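(* Let $M$ be a CR manifold enjoying property $\Psi^{we}(2)$, $\Omega$ an open subset of $M$, and $N$ a relatively open subset of $\partial\Omega$ consisting of smooth, strongly-$1$-convex, $\Theta$-non-characteristic points. If $M$ is locally CR-embeddable at all points of $N$, then there is an open neighborhood $U$ of $N$ in $M$ such that for every $f_0\in\mathcal{O}_N(N)$ there is a unique $f\in\mathcal{O}_M(U\cap\Omega)\cap C^\infty(\overline{U\cap\Omega})$ with $f=f_0$ on $N$.
   Context: A CR manifold of CR dimension $n$ is a smooth real manifold $M$ with a smooth complex subbundle $T^{0,1}M\subset\mathbb{C}TM$ of constant rank $n$, with $T^{0,1}M\cap\overline{T^{0,1}M}=0$, whose sheaf of smooth sections $\mathcal{Z}$ satisfies $[\mathcal{Z},\mathcal{Z}]\subset\mathcal{Z}$. It is locally CR-embeddable at $p$ if a neighborhood of $p$ embeds smoothly in a complex manifold $X$ so that $T^{0,1}M=\mathbb{C}TM\cap T^{0,1}X$. $\mathcal{O}_M$ is the sheaf of smooth CR functions ($Zf=0$ for all $Z\in\mathcal{Z}$). $N$, being non-characteristic, is a CR manifold with $T^{0,1}N=T^{0,1}M\cap\mathbb{C}TN$, and $\mathcal{O}_N(N)$ is the space of its smooth CR functions. $H_pM=\{\mathrm{Re}\,Z\mid Z\in T^{0,1}_pM\}$, $\pi_M:TM\to TM/HM$ is the projection. $H^{1,1}_pM$ is the convex hull of $\{Z_p\otimes\bar Z_p\mid Z_p\in T^{0,1}_pM\}$. The vector valued Levi form is the linear extension $\mathcal{L}:H^{1,1}M\to TM/HM$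 of $Z_p\otimes\bar Z_p\mapsto-\pi_M(i[Z,\bar Z]_p)$, $Z\in\mathcal{Z}$. Put $[\ker\mathcal{L}]_p=\{\tau\in H^{1,1}_pM\mid\tau\neq0,\ \mathcal{L}(\tau)=0\}$; for $U$ open, $[\ker\mathcal{L}](U)$ is the set of sections $\tau$ with $\tau_p\in[\ker\mathcal{L}]_p$ for all $p\in U$, locally of the form $\tau=\sum_{j=1}^rZ_j\otimes\bar Z_j$ with $Z_j\in\mathcal{Z}$. For such $\tau$, $\Theta(\tau)$ is the span of $Z_1,\dots,Z_r$ over smooth complex functions; $\Theta=\bigcup_\tau\Theta(\tau)$ (over local sections $\tau$). A smooth hypersurface $N$ is $\Theta$-non-characteristic at $p_0\in N$ if $T_{p_0}N+\{\mathrm{Re}\,Z_{p_0}\mid Z\in\Theta\}=T_{p_0}M$. For a distribution $\mathcal{V}\subset\mathcal{Z}$, $[\ker\mathcal{L}]_{\mathcal{V},p}$ is the set of $\tau=\sum_jZ_j\otimes\bar Z_j\in[\ker\mathcal{L}]_p$ with $Z_j\in\mathcal{V}_p$. Property $\Psi^{we}(q)$: for all $p\in M$ and all distributions $\mathcal{V}\subset\mathcal{Z}$ of rank $n-q+1$ on a neighborhood $U$ of $p$, $\bigcup_{p'\in U}[\ker\mathcal{L}]_{\mathcal{V},p'}$ is a bundle with nonempty fibers and is such that, for every sequence $\{p_\nu\}\subset M$ converging to $p$, every $\tau\in[\ker\mathcal{L}]_{\mathcal{V},p}$ is a cluster point of $\bigcup_\nu[\ker\mathcal{L}]_{\mathcal{V},p_\nu}$.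 Definition of $dd^c$: given a smooth real $\rho$, choose a smooth real $1$-form $\xi$ such that $d\rho+i\xi$ vanishes on $T^{0,1}M$. For $\tau=\sum_jZ_j\otimes\bar Z_j\in[\ker\mathcal{L}]_p$ set $dd^c\rho_p(\tau)=\tfrac i2\sum_jd\xi(Z_j,\bar Z_j)$ (independent of $\xi$), with $d\xi(X,Y)=X\xi(Y)-Y\xi(X)-\xi([X,Y])$. If $\Omega=\{\rho<0\}$ near a smooth boundary point $p_0$, $d\rho(p_0)\neq0$, then $\Omega$ (or $p_0$) is strongly-$1$-convex if there is $\tau=\sum_jZ_j\otimes\bar Z_j\in[\ker\mathcal{L}]_{p_0}$ with all $Z_j$ tangent to $\partial\Omega$ and $dd^c\rho_{p_0}(\tau)>0$.
   Formalization: The extension f is required to be smooth on the closure of U∩Ω taken relative to U, not the closure in M; with the latter the claim fails, e.g. for f_0=1/(1-z_1) on the unit sphere of C^2 minus the point (1,0). *)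

theory Defs
  imports "HOL-Analysis.Analysis" "HOL-Library.Function_Algebras"
begin

section \<open>Smooth manifolds\<close>

primrec Ck_on :: "nat \<Rightarrow> 'a::real_normed_vector set \<Rightarrow> ('a \<Rightarrow> 'b::real_normed_vector) \<Rightarrow> bool" where
  "Ck_on 0 S f \<longleftrightarrow> continuous_on S f"
| "Ck_on (Suc k) S f \<longleftrightarrow>
     (\<forall>x\<in>S. f differentiable (at x)) \<and> (\<forall>v. Ck_on k S (\<lambda>x. frechet_derivative f (at x) v))"

definition Cinf_on :: "'a::real_normed_vector set \<Rightarrow> ('a \<Rightarrow> 'b::real_normed_vector) \<Rightarrow> bool" where
  "Cinf_on S f \<longleftrightarrow> (\<forall>k. Ck_on k S f)"

text \<open>
  A complex tangent vector at a point is a complex linear derivation on the germs of smooth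
  complex valued functions at that point; it acts on globally defined functions through their
  germs. A complex vector field assigns such a derivation to every point.
\<close>

type_synonym 'p cvec = "('p \<Rightarrow> complex) \<Rightarrow> complex"

definition cscale :: "complex \<Rightarrow> 'p cvec \<Rightarrow> 'p cvec" where
  "cscale c v = (\<lambda>f. c * v f)"

definition cconj :: "'p cvec \<Rightarrow> 'p cvec" where
  "cconj v = (\<lambda>f. cnj (v (\<lambda>q. cnj (f q))))"

definition cRe :: "'p cvec \<Rightarrow> 'p cvec" where
  "cRe v = cscale (1/2) (v + cconj v)"

interpretation cvec: vector_space "cscale :: complex \<Rightarrow> 'p cvec \<Rightarrow> 'p cvec"
  by unfold_locales (auto simp: cscale_def fun_eq_iff algebra_simps)

text \<open>
  The element $v \otimes w$ of the tensor square of a complexified tangent space, as the bilinear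
  form that it induces on germs (this identification is injective, tangent spaces being finite
  dimensional).
\<close>

type_synonym 'p cten = "('p \<Rightarrow> complex) \<Rightarrow> ('p \<Rightarrow> complex) \<Rightarrow> complex"

definition tensor :: "'p cvec \<Rightarrow> 'p cvec \<Rightarrow> 'p cten" where
  "tensor v w = (\<lambda>f g. v f * w g)"

text \<open>
  The manifold is the whole type; no maximality of the atlas is required.
\<close>

locale smooth_manifold =
  fixes A :: "('p::{t2_space, second_countable_topology} set \<times> ('p \<Rightarrow> 'e::euclidean_space)) set"
  assumes chart: "(V, \<phi>) \<in> A \<Longrightarrow>
      open V \<and> open (\<phi> ` V) \<and> (\<exists>\<psi>. homeomorphism V (\<phi> ` V) \<phi> \<psi>)"
    and covering: "(\<Union>(V, \<phi>)\<in>A. V) = UNIV"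
    and compatible: "(V, \<phi>) \<in> A \<Longrightarrow> (W, \<psi>) \<in> A \<Longrightarrow>
      Cinf_on (\<psi> ` (V \<inter> W)) (\<phi> \<circ> inv_into W \<psi>)"
begin

text \<open>Only meaningful for open \<open>U\<close>.\<close>

definition smooth :: "'p set \<Rightarrow> ('p \<Rightarrow> complex) \<Rightarrow> bool" where
  "smooth U f \<longleftrightarrow> (\<forall>(V, \<phi>)\<in>A. Cinf_on (\<phi> ` (U \<inter> V)) (f \<circ> inv_into V \<phi>))"

definition smooth_near :: "'p \<Rightarrow> ('p \<Rightarrow> complex) \<Rightarrow> bool" where
  "smooth_near p f \<longleftrightarrow> (\<exists>U. open U \<and> p \<in> U \<and> smooth U f)"

text \<open>
  Smoothness on a subset which need not be open: local extendability. This is used for embedded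
  hypersurfaces and for the closed side of a hypersurface.
\<close>

definition smooth_on_subset :: "'p set \<Rightarrow> ('p \<Rightarrow> complex) \<Rightarrow> bool" where
  "smooth_on_subset S f \<longleftrightarrow>
     (\<forall>p\<in>S. \<exists>V F. open V \<and> p \<in> V \<and> smooth V F \<and> (\<forall>q\<in>V \<inter> S. F q = f q))"

text \<open>
  The fibre at \<open>p\<close> of the complexified tangent bundle. The first clause fixes the junk value off
  the germs, so that equality of tangent vectors is equality of functions.
\<close>

definition CT :: "'p \<Rightarrow> 'p cvec set" where
  "CT p = {v.
     (\<forall>f. \<not> smooth_near p f \<longrightarrow> v f = 0) \<and>
     (\<forall>f g. smooth_near p f \<longrightarrow> (\<forall>\<^sub>F q in nhds p. f q = g q) \<longrightarrow> v f = v g) \<and>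
     (\<forall>f g. smooth_near p f \<longrightarrow> smooth_near p g \<longrightarrow> v (\<lambda>q. f q + g q) = v f + v g) \<and>
     (\<forall>c f. smooth_near p f \<longrightarrow> v (\<lambda>q. c * f q) = c * v f) \<and>
     (\<forall>f g. smooth_near p f \<longrightarrow> smooth_near p g \<longrightarrow>
        v (\<lambda>q. f q * g q) = v f * g p + f p * v g)}"

definition TM :: "'p \<Rightarrow> 'p cvec set" where
  "TM p = {v \<in> CT p. cconj v = v}"

text \<open>
  Complex, resp. real, tangent space at \<open>p\<close> of an embedded submanifold \<open>S\<close>.
\<close>

definition CT_sub :: "'p set \<Rightarrow> 'p \<Rightarrow> 'p cvec set" where
  "CT_sub S p =
     {v \<in> CT p. \<forall>f. smooth_near p f \<longrightarrow> (\<forall>\<^sub>F q in nhds p. q \<in> S \<longrightarrow> f q = 0) \<longrightarrow> v f = 0}"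

definition T_sub :: "'p set \<Rightarrow> 'p \<Rightarrow> 'p cvec set" where
  "T_sub S p = CT_sub S p \<inter> TM p"

definition smooth_field :: "'p set \<Rightarrow> ('p \<Rightarrow> 'p cvec) \<Rightarrow> bool" where
  "smooth_field U Z \<longleftrightarrow>
     (\<forall>q\<in>U. Z q \<in> CT q) \<and>
     (\<forall>V f. open V \<longrightarrow> V \<subseteq> U \<longrightarrow> smooth V f \<longrightarrow> smooth V (\<lambda>q. Z q f))"

definition lie :: "('p \<Rightarrow> 'p cvec) \<Rightarrow> ('p \<Rightarrow> 'p cvec) \<Rightarrow> 'p \<Rightarrow> 'p cvec" where
  "lie X Y p =
     (\<lambda>f. if smooth_near p f then X p (\<lambda>q. Y q f) - Y p (\<lambda>q. X q f) else 0)"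

definition subbundle :: "'p set \<Rightarrow> nat \<Rightarrow> ('p \<Rightarrow> 'p cvec set) \<Rightarrow> bool" where
  "subbundle U r E \<longleftrightarrow>
     (\<forall>p\<in>U. \<exists>W Z. open W \<and> p \<in> W \<and> W \<subseteq> U \<and> (\<forall>j<r. smooth_field W (Z j)) \<and>
        (\<forall>q\<in>W. E q = cvec.span ((\<lambda>j. Z j q) ` {..<r}) \<and> cvec.dim (E q) = r))"

text \<open>A real 1-form, extended complex linearly to complex tangent vectors.\<close>

definition real_one_form :: "'p set \<Rightarrow> ('p \<Rightarrow> 'p cvec \<Rightarrow> complex) \<Rightarrow> bool" where
  "real_one_form U \<xi> \<longleftrightarrow>
     (\<forall>q\<in>U. \<forall>v\<in>CT q. \<forall>w\<in>CT q. \<xi> q (v + w) = \<xi> q v + \<xi> q w) \<and>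
     (\<forall>q\<in>U. \<forall>v\<in>CT q. \<forall>c. \<xi> q (cscale c v) = c * \<xi> q v) \<and>
     (\<forall>q\<in>U. \<forall>v\<in>CT q. \<xi> q (cconj v) = cnj (\<xi> q v)) \<and>
     (\<forall>W X. open W \<longrightarrow> W \<subseteq> U \<longrightarrow> smooth_field W X \<longrightarrow> smooth W (\<lambda>q. \<xi> q (X q)))"

definition ext_deriv ::
  "('p \<Rightarrow> 'p cvec \<Rightarrow> complex) \<Rightarrow> ('p \<Rightarrow> 'p cvec) \<Rightarrow> ('p \<Rightarrow> 'p cvec) \<Rightarrow> 'p \<Rightarrow> complex" where
  "ext_deriv \<xi> X Y p = X p (\<lambda>q. \<xi> q (Y q)) - Y p (\<lambda>q. \<xi> q (X q)) - \<xi> p (lie X Y p)"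

text \<open>\<open>\<Omega> = {\<rho> < 0}\<close> near \<open>p\<close>, with \<open>d\<rho>(p) \<noteq> 0\<close>.\<close>

definition defining_function :: "'p set \<Rightarrow> 'p \<Rightarrow> ('p \<Rightarrow> real) \<Rightarrow> bool" where
  "defining_function \<Omega> p \<rho> \<longleftrightarrow>
     (\<exists>V. open V \<and> p \<in> V \<and> smooth V (\<lambda>q. complex_of_real (\<rho> q)) \<and>
        \<Omega> \<inter> V = {q \<in> V. \<rho> q < 0} \<and> (\<exists>v\<in>TM p. v (\<lambda>q. complex_of_real (\<rho> q)) \<noteq> 0))"

definition smooth_boundary_point :: "'p set \<Rightarrow> 'p \<Rightarrow> bool" where
  "smooth_boundary_point \<Omega> p \<longleftrightarrow> p \<in> frontier \<Omega> \<and> (\<exists>\<rho>. defining_function \<Omega> p \<rho>)"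

end

section \<open>Complex manifolds\<close>

text \<open>
  The dimension is a natural number, not a type, because it has to be quantified inside a formula;
  $\mathbf C^N$ is the product space of (extensional) functions on \<open>{..<N}\<close>. For the same reason
  the manifold is an abstract topology carried by a subset of \<open>'x\<close>. A statement that assumes
  embeddability for a free type \<open>'x\<close> thereby covers all complex manifolds.
\<close>

definition Cspace :: "nat \<Rightarrow> (nat \<Rightarrow> complex) topology" where
  "Cspace N = product_topology (\<lambda>_. euclidean) {..<N}"

text \<open>Holomorphy in several variables: continuous, and holomorphic in each variable.\<close>

definition holomorphic_Cspace :: "nat \<Rightarrow> (nat \<Rightarrow> complex) set \<Rightarrow> ((nat \<Rightarrow> complex) \<Rightarrow> complex) \<Rightarrow> bool" where
  "holomorphic_Cspace N W F \<longleftrightarrow>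
     continuous_map (subtopology (Cspace N) W) euclidean F \<and>
     (\<forall>z\<in>W. \<forall>i<N. (\<lambda>t. F (z(i := t))) field_differentiable (at (z i)))"

locale complex_manifold =
  fixes X :: "'x topology" and N :: nat and B :: "('x set \<times> ('x \<Rightarrow> nat \<Rightarrow> complex)) set"
  assumes Hausdorff: "Hausdorff_space X"
    and second_countable: "second_countable X"
    and chart: "(V, \<phi>) \<in> B \<Longrightarrow> openin X V \<and> openin (Cspace N) (\<phi> ` V) \<and>
      homeomorphic_map (subtopology X V) (subtopology (Cspace N) (\<phi> ` V)) \<phi>"
    and covering: "(\<Union>(V, \<phi>)\<in>B. V) = topspace X"
    and compatible: "(V, \<phi>) \<in> B \<Longrightarrow> (W, \<psi>) \<in> B \<Longrightarrow> i < N \<Longrightarrow>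
      holomorphic_Cspace N (\<psi> ` (V \<inter> W)) (\<lambda>z. \<phi> (inv_into W \<psi> z) i)"

section \<open>CR manifolds\<close>

locale cr_manifold = smooth_manifold A
  for A :: "('p::{t2_space, second_countable_topology} set \<times> ('p \<Rightarrow> 'e::euclidean_space)) set" +
  fixes T01 :: "'p \<Rightarrow> 'p cvec set" and n :: nat
  assumes T01_subbundle: "subbundle UNIV n T01"
    and T01_Int_conj: "T01 p \<inter> cconj ` T01 p = {0}"
    and involutive: "open U \<Longrightarrow> smooth_field U Z \<Longrightarrow> smooth_field U W \<Longrightarrow>
      (\<And>q. q \<in> U \<Longrightarrow> Z q \<in> T01 q \<and> W q \<in> T01 q) \<Longrightarrow> q \<in> U \<Longrightarrow> lie Z W q \<in> T01 q"
begin

text \<open>The sections over an open set \<open>U\<close> of the sheaf $\mathcal Z$.\<close>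

definition sections :: "'p set \<Rightarrow> ('p \<Rightarrow> 'p cvec) set" where
  "sections U = {Z. smooth_field U Z \<and> (\<forall>q\<in>U. Z q \<in> T01 q)}"

definition CR_functions :: "'p set \<Rightarrow> ('p \<Rightarrow> complex) set" where
  "CR_functions W = {f. smooth W f \<and>
     (\<forall>V Z. open V \<longrightarrow> V \<subseteq> W \<longrightarrow> Z \<in> sections V \<longrightarrow> (\<forall>q\<in>V. Z q f = 0))}"

text \<open>
  CR functions on an embedded hypersurface \<open>S\<close> with the induced structure
  $T^{0,1}S = T^{0,1}M \cap \mathbf C TS$; vectors tangent to \<open>S\<close> act on a function on \<open>S\<close>
  through its smooth local extensions.
\<close>

definition CR_functions_sub :: "'p set \<Rightarrow> ('p \<Rightarrow> complex) set" where
  "CR_functions_sub S = {f. smooth_on_subset S f \<and>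
     (\<forall>p\<in>S. \<forall>Z\<in>T01 p \<inter> CT_sub S p. \<forall>F. smooth_near p F \<longrightarrow>
        (\<forall>\<^sub>F q in nhds p. q \<in> S \<longrightarrow> F q = f q) \<longrightarrow> Z F = 0)}"

definition locally_CR_embeddable :: "'x itself \<Rightarrow> 'p \<Rightarrow> bool" where
  "locally_CR_embeddable _ p \<longleftrightarrow>
     (\<exists>V (X :: 'x topology) N B \<iota>. open V \<and> p \<in> V \<and> complex_manifold X N B \<and>
        embedding_map (top_of_set V) X \<iota> \<and>
        (\<forall>(W, \<phi>)\<in>B. \<forall>i<N. smooth {q \<in> V. \<iota> q \<in> W} (\<lambda>q. \<phi> (\<iota> q) i)) \<and>
        \<comment> \<open>the differential of \<open>\<iota>\<close> is injective\<close>
        (\<forall>q\<in>V. \<forall>(W, \<phi>)\<in>B. \<iota> q \<in> W \<longrightarrow>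
           (\<forall>v\<in>TM q. (\<forall>i<N. v (\<lambda>q'. \<phi> (\<iota> q') i) = 0) \<longrightarrow> v = 0)) \<and>
        \<comment> \<open>a complex tangent vector of \<open>X\<close> is of type (0,1) iff it annihilates the holomorphic
            coordinates\<close>
        (\<forall>q\<in>V. \<forall>(W, \<phi>)\<in>B. \<iota> q \<in> W \<longrightarrow>
           T01 q = {Z \<in> CT q. \<forall>i<N. Z (\<lambda>q'. \<phi> (\<iota> q') i) = 0}))"

subsection \<open>The vector valued Levi form\<close>

definition HM :: "'p \<Rightarrow> 'p cvec set" where
  "HM p = cRe ` T01 p"

text \<open>The projection to the quotient, whose elements are cosets; the zero coset is \<open>HM p\<close>.\<close>

definition proj :: "'p \<Rightarrow> 'p cvec \<Rightarrow> 'p cvec set" where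
  "proj p v = {w \<in> TM p. w - v \<in> HM p}"

definition H11 :: "'p \<Rightarrow> 'p cten set" where
  "H11 p = {\<tau>. \<exists>(r::nat) (t :: nat \<Rightarrow> real) Z.
     (\<forall>j<r. 0 \<le> t j \<and> Z j \<in> T01 p) \<and> (\<Sum>j<r. t j) = 1 \<and>
     \<tau> = (\<Sum>j<r. (\<lambda>f g. complex_of_real (t j) * tensor (Z j) (cconj (Z j)) f g))}"

text \<open>
  The linear extension of $Z_p \otimes \bar Z_p \mapsto -\pi_M(i[Z,\bar Z]_p)$; scalars are absorbed,
  as $t\, Z \otimes \bar Z = (\sqrt t Z) \otimes \overline{(\sqrt t Z)}$ for $t \ge 0$.
\<close>

definition Levi :: "'p \<Rightarrow> 'p cten \<Rightarrow> 'p cvec set" where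
  "Levi p \<tau> = (THE c. \<exists>U (r::nat) Z. open U \<and> p \<in> U \<and> (\<forall>j<r. Z j \<in> sections U) \<and>
     \<tau> = (\<Sum>j<r. tensor (Z j p) (cconj (Z j p))) \<and>
     c = proj p (- (\<Sum>j<r. cscale \<i> (lie (Z j) (\<lambda>q. cconj (Z j q)) p))))"

definition kerL :: "'p \<Rightarrow> 'p cten set" where
  "kerL p = {\<tau> \<in> H11 p. \<tau> \<noteq> 0 \<and> Levi p \<tau> = HM p}"

definition kerL_sections :: "'p set \<Rightarrow> ('p \<Rightarrow> 'p cten) set" where
  "kerL_sections U = {\<tau>. (\<forall>p\<in>U. \<tau> p \<in> kerL p) \<and>
     (\<forall>p\<in>U. \<exists>W (r::nat) Z. open W \<and> p \<in> W \<and> W \<subseteq> U \<and> (\<forall>j<r. Z j \<in> sections W) \<and>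
        (\<forall>q\<in>W. \<tau> q = (\<Sum>j<r. tensor (Z j q) (cconj (Z j q)))))}"

definition Theta_of :: "'p set \<Rightarrow> ('p \<Rightarrow> 'p cten) \<Rightarrow> ('p \<Rightarrow> 'p cvec) set" where
  "Theta_of U \<tau> = {Y. \<exists>(r::nat) Z a. (\<forall>j<r. Z j \<in> sections U \<and> smooth U (a j)) \<and>
     (\<forall>q\<in>U. \<tau> q = (\<Sum>j<r. tensor (Z j q) (cconj (Z j q)))) \<and>
     (\<forall>q\<in>U. Y q = (\<Sum>j<r. cscale (a j q) (Z j q)))}"

definition Theta :: "'p set \<Rightarrow> ('p \<Rightarrow> 'p cvec) set" where
  "Theta U = (\<Union>\<tau>\<in>kerL_sections U. Theta_of U \<tau>)"

definition Theta_noncharacteristic :: "'p set \<Rightarrow> 'p \<Rightarrow> bool" where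
  "Theta_noncharacteristic S p \<longleftrightarrow>
     {v + cRe (Z p) | v Z. v \<in> T_sub S p \<and> (\<exists>U. open U \<and> p \<in> U \<and> Z \<in> Theta U)} = TM p"

subsection \<open>The weak concavity condition\<close>

definition distribution :: "'p set \<Rightarrow> nat \<Rightarrow> ('p \<Rightarrow> 'p cvec set) \<Rightarrow> bool" where
  "distribution U r E \<longleftrightarrow> subbundle U r E \<and> (\<forall>q\<in>U. E q \<subseteq> T01 q)"

definition kerL_in :: "('p \<Rightarrow> 'p cvec set) \<Rightarrow> 'p \<Rightarrow> 'p cten set" where
  "kerL_in E p = {\<tau> \<in> kerL p. \<exists>(r::nat) Z.
     (\<forall>j<r. Z j \<in> E p) \<and> \<tau> = (\<Sum>j<r. tensor (Z j) (cconj (Z j)))}"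

text \<open>
  The topology of the total space of $H^{1,1}M$. Evaluation at local coordinate functions yields
  the components of a tensor, and evaluation at any smooth functions is continuous, so this is the
  usual topology.
\<close>

definition H11_topology :: "('p \<times> 'p cten) topology" where
  "H11_topology = topology_generated_by
     {{(q, \<sigma>). q \<in> V \<and> \<sigma> \<in> H11 q \<and> \<sigma> f g \<in> G} | V f g G.
        open V \<and> smooth V f \<and> smooth V g \<and> open G}"

text \<open>
  ``Bundle with nonempty fibres'' is read as a family of nonempty fibres: local triviality would
  make the condition on sequences redundant. The rank is \<open>n - q + 1\<close>, written without truncated
  subtraction.
\<close>

definition Psi_we :: "nat \<Rightarrow> bool" where
  "Psi_we q \<longleftrightarrow>
     (\<forall>p U r E. open U \<longrightarrow> p \<in> U \<longrightarrow> r + q = n + 1 \<longrightarrow> distribution U r E \<longrightarrow>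
        (\<forall>p'\<in>U. kerL_in E p' \<noteq> {}) \<and>
        (\<forall>s :: nat \<Rightarrow> 'p. s \<longlonglongrightarrow> p \<longrightarrow>
           (\<forall>\<tau>\<in>kerL_in E p.
              (p, \<tau>) \<in> H11_topology derived_set_of
                (\<Union>\<nu>\<in>{\<nu>. s \<nu> \<in> U}. {s \<nu>} \<times> kerL_in E (s \<nu>)))))"

subsection \<open>Strong 1-convexity\<close>

definition ddc :: "('p \<Rightarrow> real) \<Rightarrow> 'p \<Rightarrow> 'p cten \<Rightarrow> real" where
  "ddc \<rho> p \<tau> = (THE c. \<exists>U \<xi> (r::nat) Z. open U \<and> p \<in> U \<and> real_one_form U \<xi> \<and>
     (\<forall>q\<in>U. \<forall>W\<in>T01 q. W (\<lambda>q'. complex_of_real (\<rho> q')) + \<i> * \<xi> q W = 0) \<and>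
     (\<forall>j<r. Z j \<in> sections U) \<and> \<tau> = (\<Sum>j<r. tensor (Z j p) (cconj (Z j p))) \<and>
     complex_of_real c = \<i> / 2 * (\<Sum>j<r. ext_deriv \<xi> (Z j) (\<lambda>q. cconj (Z j q)) p))"

definition strongly_1_convex :: "'p set \<Rightarrow> 'p \<Rightarrow> bool" where
  "strongly_1_convex \<Omega> p \<longleftrightarrow>
     (\<exists>\<rho>. defining_function \<Omega> p \<rho> \<and>
        (\<exists>(r::nat) Z. (\<forall>j<r. Z j \<in> T01 p \<inter> CT_sub (frontier \<Omega>) p) \<and>
           (\<Sum>j<r. tensor (Z j) (cconj (Z j))) \<in> kerL p \<and>
           ddc \<rho> p (\<Sum>j<r. tensor (Z j) (cconj (Z j))) > 0))"

end

end

theory Submission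
imports Defs
begin

text \<open>
The proof combines a maximum principle with the approximation theorem of Baouendi and Treves. Strong
1-convexity yields a tensor in the kernel of the Levi form which is tangent to the level sets of a
strictly convex modification of the defining function and on which this function is positive; by
$\Psi^{we}(2)$ such tensors persist at all nearby points, and they exclude interior maxima of \<open>|h|\<close> for CR
functions \<open>h\<close>. On small one-sided neighbourhoods \<open>h\<close> is therefore bounded by its values on \<open>N\<close>.

The embedding supplies CR coordinates \<open>Z\<close>, and as \<open>N\<close> is non-characteristic, the differential of \<open>f0\<close> along
\<open>N\<close> is a combination of the differentials of the \<open>Z i\<close>. Averages of \<open>f0\<close> against Gaussian kernels in \<open>Z\<close>
are CR on \<open>M\<close> and converge to \<open>f0\<close> on \<open>N\<close>, hence uniformly on the one-sided neighbourhood by the maximum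
principle. The coefficients of \<open>df0\<close> have the same structure, so that the convergence holds with all
derivatives, and Seeley's extension gives smoothness up to \<open>N\<close>. The maximum principle also gives
uniqueness, by which the local extensions are glued.
\<close>

section \<open>Smooth functions on Euclidean spaces\<close>

text \<open>The Levi form and \<open>ddc\<close> are defined through arbitrary extensions of vectors
  and carry first order terms. In charts whose coordinates are real parts of CR functions these
  terms depend only on the Levi vector, and on the kernel they reduce to a multiple of one vector
  \<open>cconj W\<close> with \<open>W\<close> of type (0,1). This gives the independence of the
  extensions, and it shows that kernel tensors annihilate CR functions through the bare Hessian
  contraction \<open>contr\<close>, so that the maximum principle becomes a second derivative test.
  On the part of the boundary of a one-sided neighbourhood that is off \<open>N\<close> a CR
  function has no bound by its values on \<open>N\<close>; an exponential weight makes up for it.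

  The differentials of the CR coordinates need not be independent in all directions along
  \<open>N\<close>: only the directions \<open>I\<close> carry Gaussian decay. The others are
  covered by moving the slice of integration, which costs an exponentially small term, because the
  integrated form is closed and the relevant derivatives of the cutoff live where the kernel is
  small. The integral itself always runs over the slice through the origin, so that the approximants
  are functions of the coordinates alone.\<close>

notation scaleR (infixr "*R" 75) and inner (infix "<.>" 70)

abbreviation (input) cor :: "real => complex" where "cor \<equiv> complex_of_real"

section \<open>Directional derivatives and the classes \<open>Ck_on\<close>\<close>

definition dd :: "'a::real_normed_vector => ('a => 'b::real_normed_vector) => 'a => 'b" where
"dd v f x = frechet_derivative f (at x) v"

lemma Ck_on_Suc: "Ck_on (Suc k) S f \<longleftrightarrow> (ALL x:S. f differentiable (at x)) & (ALL v. Ck_on k S (dd v f))"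
by(simp add:dd_def[abs_def])

declare Ck_on.simps(2) [simp del]

lemma dd_eq: "(f has_derivative f') (at x) ==> dd v f x = f' v"
unfolding dd_def by(metis frechet_derivative_at)

lemma has_derivative_dd: "f differentiable (at x) ==> (f has_derivative (%v. dd v f x)) (at x)"
unfolding dd_def using frechet_derivative_works by(metis (no_types, lifting) ext)

lemma bounded_linear_dd: "f differentiable (at x) ==> bounded_linear (%v. dd v f x)"
using has_derivative_dd has_derivative_bounded_linear by blast

lemma dd_scaleR_left: "f differentiable (at x) ==> dd (c *R v) f x = c *R dd v f x"
using bounded_linear.linear[OF bounded_linear_dd] linear_scale by fastforce

lemma dd_basis:
fixes f :: "'a::euclidean_space => 'b::real_normed_vector"
assumes "f differentiable (at x)"
shows "dd v f x = (SUM b:Basis. (v <.> b) *R dd b f x)"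
proof -
have l: "linear (%v. dd v f x)" using bounded_linear.linear[OF bounded_linear_dd[OF assms]] .
have "dd v f x = dd (SUM b:Basis. (v <.> b) *R b) f x" by(simp add:euclidean_representation)
also have "... = (SUM b:Basis. (v <.> b) *R dd b f x)"
 by(simp add:linear_sum[OF l] linear_scale[OF l])
finally show ?thesis .
qed

lemma dd_cong:
assumes "open S" "x:S" "!!y. y:S ==> f y = g y"
shows "dd v f x = dd v g x"
proof -
have "(f has_derivative D) (at x) \<longleftrightarrow> (g has_derivative D) (at x)" for D
 using has_derivative_transform_within_open[OF _ assms(1,2)] assms(3) by metis
thus ?thesis unfolding dd_def frechet_derivative_def by simp
qed

lemma differentiable_cong_open:
assumes "open S" "x:S" "!!y. y:S ==> f y = g y"
shows "f differentiable (at x) \<longleftrightarrow> g differentiable (at x)"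
unfolding differentiable_def
using has_derivative_transform_within_open[OF _ assms(1,2)] assms(3) by metis

lemma Ck_on_cong:
assumes "open S" "!!y. y:S ==> f y = g y"
shows "Ck_on k S f \<longleftrightarrow> Ck_on k S g"
using assms(2)
proof(induction k arbitrary: f g)
case 0 thus ?case by(auto cong: continuous_on_cong)
next
case (Suc k)
have "Ck_on k S (dd v f) \<longleftrightarrow> Ck_on k S (dd v g)" for v
 by(rule Suc.IH) (use dd_cong[OF assms(1)] Suc.prems in metis)
thus ?case unfolding Ck_on_Suc
 using differentiable_cong_open[OF assms(1)] Suc.prems by metis
qed

lemma Ck_on_subset: "Ck_on k S f ==> T <= S ==> Ck_on k T f"
proof(induction k arbitrary: f)
case 0 thus ?case using continuous_on_subset by auto
next
case (Suc k) thus ?case unfolding Ck_on_Suc by blast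
qed

lemma Ck_on_imp_continuous: "Ck_on k S f ==> continuous_on S f"
by(cases k) (auto simp:Ck_on_Suc intro!: continuous_at_imp_continuous_on differentiable_imp_continuous_within)

lemma Ck_on_SucD: "Ck_on (Suc k) S f ==> Ck_on k S f"
proof(induction k arbitrary: f)
case 0 thus ?case using Ck_on_imp_continuous by fastforce
next
case (Suc k) thus ?case using Ck_on_Suc by blast
qed

lemma Ck_on_local:
assumes "!!x. x:S ==> EX T. open T & x:T & Ck_on k T f"
shows "Ck_on k S f"
using assms
proof(induction k arbitrary: f)
case 0
have "isCont f x" if "x:S" for x
 using 0[OF that] continuous_on_eq_continuous_at by auto
thus ?case by(simp add:continuous_at_imp_continuous_on)
next
case (Suc k)
have 1: "f differentiable (at x)" if "x:S" for x
 using Suc.prems[OF that] unfolding Ck_on_Suc by auto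
have 2: "Ck_on k S (dd v f)" for v
proof(rule Suc.IH)
 fix x assume "x:S"
 from Suc.prems[OF this] show "EX T. open T & x:T & Ck_on k T (dd v f)"
 unfolding Ck_on_Suc by auto
qed
show ?case unfolding Ck_on_Suc using 1 2 by simp
qed

text \<open>Inductions on the order of smoothness go through this rule: a differentiation rule
  supplies \<open>f'\<close>, and only its values in fixed directions, built from data of lower
  order, have to be \<open>Ck_on k\<close>.\<close>

lemma Ck_on_SucI:
assumes "open S" "!!x. x:S ==> (f has_derivative f' x) (at x)" "!!v. Ck_on k S (%x. f' x v)"
shows "Ck_on (Suc k) S f"
proof -
have "Ck_on k S (dd v f)" for v
 using Ck_on_cong[OF assms(1), of "dd v f" "%x. f' x v" k] dd_eq[OF assms(2)] assms(3) by simp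
moreover have "f differentiable (at x)" if "x:S" for x
 using assms(2)[OF that] by(auto simp:differentiable_def)
ultimately show ?thesis by(simp add:Ck_on_Suc)
qed

lemma Ck_on_Suc_has_derivative:
"Ck_on (Suc k) S f ==> x:S ==> (f has_derivative (%v. dd v f x)) (at x)"
by(simp add:Ck_on_Suc has_derivative_dd)

lemma Ck_on_Suc_dd: "Ck_on (Suc k) S f ==> Ck_on k S (dd v f)"
by(simp add:Ck_on_Suc)

lemma Ck_on_const [simp]: "Ck_on k S (%x. c)"
proof(induction k arbitrary: c)
case (Suc k)
have "dd v (%x::'a. c) = (%x. 0)" for v by(auto simp:dd_eq[OF has_derivative_const])
thus ?case by(simp add:Ck_on_Suc Suc)
qed simp

lemma Ck_on_linear:
assumes "bounded_linear h" shows "Ck_on k S h"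
proof(cases k)
case 0 thus ?thesis using assms linear_continuous_on by auto
next
case (Suc j)
have "dd v h = (%x. h v)" for v
 using dd_eq[OF bounded_linear_imp_has_derivative[OF assms]] by auto
thus ?thesis unfolding Suc Ck_on_Suc
 using bounded_linear_imp_differentiable[OF assms] by auto
qed

lemma Ck_on_add:
assumes "open S" "Ck_on k S f" "Ck_on k S g" shows "Ck_on k S (%x. f x + g x)"
using assms(2,3)
proof(induction k arbitrary: f g)
case 0 thus ?case by(auto intro: continuous_on_add)
next
case (Suc k)
show ?case
 by(rule Ck_on_SucI[OF `open S` has_derivative_add])
 (rule Suc.prems[THEN Ck_on_Suc_has_derivative] Suc.IH Suc.prems[THEN Ck_on_Suc_dd] | assumption)+
qed

lemma Ck_on_bilinear:
assumes B: "bounded_bilinear B" and "open S" "Ck_on k S f" "Ck_on k S g"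
shows "Ck_on k S (%x. B (f x) (g x))"
using assms(3,4)
proof(induction k arbitrary: f g)
case 0 thus ?case by(auto intro: bounded_bilinear.continuous_on[OF B])
next
case (Suc k)
show ?case
 by(rule Ck_on_SucI[OF `open S` bounded_bilinear.FDERIV[OF B]])
 (rule Suc.prems[THEN Ck_on_Suc_has_derivative] Ck_on_add `open S` Suc.IH
  Suc.prems[THEN Ck_on_Suc_dd] Suc.prems[THEN Ck_on_SucD] | assumption)+
qed

lemmas Ck_on_mult = Ck_on_bilinear[OF bounded_bilinear_mult]
lemmas Ck_on_scaleR = Ck_on_bilinear[OF bounded_bilinear_scaleR]

lemma Ck_on_compose_linear:
assumes "bounded_linear h" "open S" "Ck_on k S f" shows "Ck_on k S (%x. h (f x))"
using assms(3)
proof(induction k arbitrary: f)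
case 0 thus ?case by(simp add:bounded_linear.continuous_on[OF assms(1)])
next
case (Suc k)
show ?case
 by(rule Ck_on_SucI[OF `open S` bounded_linear.has_derivative[OF assms(1)]])
 (rule Suc.prems[THEN Ck_on_Suc_has_derivative] Suc.IH Suc.prems[THEN Ck_on_Suc_dd] | assumption)+
qed

lemma Ck_on_sum:
assumes "open S" "!!i. i:I ==> Ck_on k S (f i)"
shows "Ck_on k S (%x. SUM i:I. f i x)"
using assms(2) by(induction I rule: infinite_finite_induct) (auto intro: Ck_on_add assms(1))

text \<open>The chain rule differentiates \<open>g\<close> in the direction \<open>dd v f x\<close>,
  which moves with \<open>x\<close>. Expanding that direction in \<open>Basis\<close> leaves
  derivatives of \<open>g\<close> in fixed directions, to which the induction hypothesis applies;
  hence the Euclidean space in the middle.\<close>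

lemma Ck_on_compose:
fixes f :: "'a::real_normed_vector => 'b::euclidean_space" and g :: "'b => 'c::real_normed_vector"
assumes "open S" "open T" "f ` S <= T" "Ck_on k S f" "Ck_on k T g"
shows "Ck_on k S (%x. g (f x))"
using assms(4,5)
proof(induction k arbitrary: g)
case 0 thus ?case
 using continuous_on_compose2[of T g S f] assms(3) by auto
next
case (Suc k)
have D: "((%x. g (f x)) has_derivative (%v. SUM b:Basis. (dd v f x <.> b) *R dd b g (f x))) (at x)"
 if "x:S" for x
proof -
 have g: "g differentiable at (f x)" using Suc.prems that assms(3) by(auto simp:Ck_on_Suc)
 have "((%x. g (f x)) has_derivative (%v. dd (dd v f x) g (f x))) (at x)"
 using diff_chain_at[OF Ck_on_Suc_has_derivative[OF Suc.prems(1) that] has_derivative_dd[OF g]]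
 by(simp add:o_def)
 thus ?thesis by(subst (asm) dd_basis[OF g])
qed
show ?case
 by(rule Ck_on_SucI[OF `open S` D])
 (rule Ck_on_sum Ck_on_scaleR Ck_on_compose_linear[OF bounded_linear_inner_left]
  Suc.IH Suc.prems[THEN Ck_on_Suc_dd] Suc.prems(1)[THEN Ck_on_SucD] `open S` | assumption)+
qed

lemma Ck_on_inverse:
fixes f :: "'a::real_normed_vector => 'b::real_normed_field"
assumes "open S" "Ck_on k S f" "!!x. x:S ==> f x ~= 0"
shows "Ck_on k S (%x. inverse (f x))"
using assms(2)
proof(induction k)
case 0 thus ?case using assms(3) by(auto intro: continuous_on_inverse)
next
case (Suc k)
have 1: "Ck_on k S (%x. inverse (f x))" using Suc Ck_on_SucD by blast
show ?case
 by(rule Ck_on_SucI[OF `open S` Deriv.has_derivative_inverse])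
 (rule Suc.prems[THEN Ck_on_Suc_has_derivative] assms(3)
  Ck_on_compose_linear[OF bounded_linear_minus[OF bounded_linear_ident]] Ck_on_mult 1 `open S`
  Suc.prems[THEN Ck_on_Suc_dd] | assumption)+
qed

section \<open>Calculus of smooth functions\<close>

lemma Cinf_dd: "Cinf_on S f ==> Cinf_on S (dd v f)"
unfolding Cinf_on_def using Ck_on_Suc by blast

lemma Cinf_differentiable: "Cinf_on S f ==> x:S ==> f differentiable (at x)"
unfolding Cinf_on_def using Ck_on_Suc by blast

lemma Cinf_deriv: "Cinf_on S f ==> x:S ==> (f has_derivative (%v. dd v f x)) (at x)"
using Cinf_differentiable has_derivative_dd by blast

lemma Cinf_cont: "Cinf_on S f ==> continuous_on S f"
unfolding Cinf_on_def using Ck_on_imp_continuous by blast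

lemma Cinf_cong: "open S ==> (!!y. y:S ==> f y = g y) ==> Cinf_on S f \<longleftrightarrow> Cinf_on S g"
unfolding Cinf_on_def using Ck_on_cong by blast

lemma Cinf_subset: "Cinf_on S f ==> T <= S ==> Cinf_on T f"
unfolding Cinf_on_def using Ck_on_subset by blast

lemma Cinf_local: "(!!x. x:S ==> EX T. open T & x:T & Cinf_on T f) ==> Cinf_on S f"
unfolding Cinf_on_def using Ck_on_local by metis

lemma Cinf_const [simp]: "Cinf_on S (%x. c)" by(simp add:Cinf_on_def)

lemma Cinf_linear: "bounded_linear h ==> Cinf_on S h" by(simp add:Cinf_on_def Ck_on_linear)

lemma Cinf_id: "Cinf_on S (%x. x)" by(intro Cinf_linear bounded_linear_ident)

lemma Cinf_compose_linear:
"bounded_linear h ==> open S ==> Cinf_on S f ==> Cinf_on S (%x. h (f x))"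
by(simp add:Cinf_on_def Ck_on_compose_linear)

lemma Cinf_add: "open S ==> Cinf_on S f ==> Cinf_on S g ==> Cinf_on S (%x. f x + g x)"
by(simp add:Cinf_on_def Ck_on_add)

lemma Cinf_minus: "open S ==> Cinf_on S f ==> Cinf_on S (%x. - f x)"
by(rule Cinf_compose_linear[OF bounded_linear_minus[OF bounded_linear_ident]])

lemma Cinf_diff: "open S ==> Cinf_on S f ==> Cinf_on S g ==> Cinf_on S (%x. f x - g x)"
using Cinf_add[of S f "%x. - g x"] Cinf_minus[of S g] by simp

lemma Cinf_mult:
fixes f g :: "'a::real_normed_vector => 'b::real_normed_algebra"
shows "open S ==> Cinf_on S f ==> Cinf_on S g ==> Cinf_on S (%x. f x*g x)"
by(simp add:Cinf_on_def Ck_on_mult)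

lemma Cinf_scaleR: "open S ==> Cinf_on S f ==> Cinf_on S g ==> Cinf_on S (%x. f x *R g x)"
by(simp add:Cinf_on_def Ck_on_scaleR)

lemma Cinf_sum: "open S ==> (!!i. i:I ==> Cinf_on S (f i)) ==> Cinf_on S (%x. SUM i:I. f i x)"
by(simp add:Cinf_on_def Ck_on_sum)

lemma Cinf_prod:
fixes f :: "'i => 'a::real_normed_vector => 'b::{real_normed_algebra,comm_ring_1}"
shows "open S ==> (!!i. i:I ==> Cinf_on S (f i)) ==> Cinf_on S (%x. PROD i:I. f i x)"
by(induction I rule: infinite_finite_induct) (auto intro: Cinf_mult)

lemma Cinf_compose:
fixes f :: "'a::real_normed_vector => 'b::euclidean_space"
shows "open S ==> open T ==> f ` S <= T ==> Cinf_on S f ==> Cinf_on T g ==> Cinf_on S (%x. g (f x))"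
by(simp add:Cinf_on_def Ck_on_compose)

lemma Cinf_inverse:
fixes f :: "'a::real_normed_vector => 'b::real_normed_field"
shows "open S ==> Cinf_on S f ==> (!!x. x:S ==> f x ~= 0) ==> Cinf_on S (%x. inverse (f x))"
by(simp add:Cinf_on_def Ck_on_inverse)

lemma Cinf_divide:
fixes f :: "'a::real_normed_vector => 'b::real_normed_field"
shows "open S ==> Cinf_on S f ==> Cinf_on S g ==> (!!x. x:S ==> g x ~= 0) ==> Cinf_on S (%x. f x/g x)"
unfolding divide_inverse by(intro Cinf_mult Cinf_inverse)

lemma Cinf_of_real:
"open S ==> Cinf_on S f ==> Cinf_on S (%x. of_real (f x) :: 'b::{real_normed_algebra_1,real_inner})"
by(rule Cinf_compose_linear[OF bounded_linear_of_real])

lemma Cinf_Re: "open S ==> Cinf_on S f ==> Cinf_on S (%x. Re (f x))"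
by(rule Cinf_compose_linear[OF bounded_linear_Re])

lemma Cinf_Im: "open S ==> Cinf_on S f ==> Cinf_on S (%x. Im (f x))"
by(rule Cinf_compose_linear[OF bounded_linear_Im])

lemma Cinf_cnj: "open S ==> Cinf_on S f ==> Cinf_on S (%x. cnj (f x))"
by(rule Cinf_compose_linear[OF bounded_linear_cnj])

lemma Cinf_inner_const: "open S ==> Cinf_on S f ==> Cinf_on S (%x. f x <.> b)"
by(rule Cinf_compose_linear[OF bounded_linear_inner_left])

section \<open>Symmetry of second derivatives\<close>

lemma dd_inner:
assumes "f differentiable (at x)" shows "dd v (%x. f x <.> b) x = dd v f x <.> b"
by(rule dd_eq[OF has_derivative_inner_left[OF has_derivative_dd[OF assms]]])

lemma has_derivative_line:
assumes "f differentiable (at (x + a *R v))"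
shows "((%a. f (x + a *R v)) has_derivative (%h. h *R dd v f (x + a *R v))) (at a)"
proof -
have "((%a. x + a *R v) has_derivative (%h. h *R v)) (at a)"
 by(auto intro!: derivative_eq_intros)
from diff_chain_at[OF this has_derivative_dd[OF assms]]
show ?thesis by(simp add:o_def dd_scaleR_left[OF assms])
qed

text \<open>The mean value theorem in the direction \<open>v\<close> and then in the direction
  \<open>w\<close>. The second difference is symmetric in \<open>v\<close> and \<open>w\<close>, so
  that letting \<open>s\<close> tend to 0 identifies the two mixed derivatives.\<close>

lemma second_difference:
fixes f :: "'a::real_normed_vector => real"
assumes s: "0 < s" and C: "Ck_on 2 S f"
 and S: "!!a b. 0 <= a ==> a <= s ==> 0 <= b ==> b <= s ==> x + a *R v + b *R w:S"
shows "EX a b. 0 <= a & a <= s & 0 <= b & b <= s &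
 f (x + s *R v + s *R w) - f (x + s *R v) - f (x + s *R w) + f x
 = s^2*dd w (dd v f) (x + a *R v + b *R w)"
proof -
have C2: "Ck_on (Suc (Suc 0)) S f" using C by(simp add:numeral_2_eq_2)
have d1: "f differentiable (at y)" if "y:S" for y using C2 that by(auto simp:Ck_on_Suc)
have d2: "dd v f differentiable (at y)" if "y:S" for y v using C2 that by(auto simp:Ck_on_Suc)
define fi where "fi t = f ((x + s *R w) + t *R v) - f (x + t *R v)" for t
define fi' where "fi' t = dd v f ((x + s *R w) + t *R v) - dd v f (x + t *R v)" for t
have in1: "x + s *R w + t *R v:S" "x + t *R v:S" if "0 <= t" "t <= s" for t
 using S[of t s] S[of t 0] that s by(auto simp:algebra_simps)
have D: "(fi has_derivative (%h. h*fi' t)) (at t)" if "0 <= t" "t <= s" for t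
 unfolding fi_def fi'_def
 using has_derivative_diff[OF has_derivative_line[OF d1[OF in1(1)[OF that]]]
  has_derivative_line[OF d1[OF in1(2)[OF that]]]]
 by(simp add:algebra_simps)
have "continuous_on {0..s} fi"
 by(intro continuous_at_imp_continuous_on) (auto intro!: has_derivative_continuous[OF D])
from mvt[OF s this] D obtain a where a: "0 < a" "a < s" "fi s - fi 0 = s*fi' a"
 by(metis (no_types, lifting) diff_zero greaterThanLessThan_iff less_le)
define ps where "ps t = dd v f ((x + a *R v) + t *R w)" for t
have in2: "x + a *R v + t *R w:S" if "0 <= t" "t <= s" for t using S[of a t] a that by auto
have D2: "(ps has_derivative (%h. h*dd w (dd v f) (x + a *R v + t *R w))) (at t)"
 if "0 <= t" "t <= s" for t
 unfolding ps_def using has_derivative_line[OF d2[OF in2[OF that]]] by simp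
have "continuous_on {0..s} ps"
 by(intro continuous_at_imp_continuous_on) (auto intro!: has_derivative_continuous[OF D2])
from mvt[OF s this] D2 obtain b where b: "0 < b" "b < s"
 "ps s - ps 0 = s*dd w (dd v f) (x + a *R v + b *R w)"
 by(metis (no_types, lifting) diff_zero greaterThanLessThan_iff less_le)
have "fi' a = ps s - ps 0" by(simp add:fi'_def ps_def algebra_simps)
hence "fi s - fi 0 = s^2*dd w (dd v f) (x + a *R v + b *R w)"
 using a(3) b(3) by(simp add:power2_eq_square)
moreover have "fi s - fi 0 = f (x + s *R v + s *R w) - f (x + s *R v) - f (x + s *R w) + f x"
 by(simp add:fi_def algebra_simps)
ultimately show ?thesis using a b by(intro exI[of _ a] exI[of _ b]) auto
qed

lemma dd_commute_real:
fixes f :: "'a::real_normed_vector => real"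
assumes "open S" "x:S" and C: "Ck_on 2 S f"
shows "dd v (dd w f) x = dd w (dd v f) x"
proof(rule ccontr)
assume ne: "dd v (dd w f) x ~= dd w (dd v f) x"
define e where "e = \<bar>dd v (dd w f) x - dd w (dd v f) x\<bar>/2"
have e: "e > 0" using ne by(simp add:e_def)
have C2: "Ck_on (Suc (Suc 0)) S f" using C by(simp add:numeral_2_eq_2)
have c: "continuous_on S (dd w (dd v f))" for v w using C2 by(auto simp:Ck_on_Suc)
have "\<forall>\<^sub>F s in at_right 0. ALL a b. 0 <= a & a <= s & 0 <= b & b <= s -->
 x + a *R v + b *R w:S & \<bar>dd w (dd v f) (x + a *R v + b *R w) - dd w (dd v f) x\<bar> < e" for v w
proof -
 obtain d0 where d0: "d0 > 0" "ball x d0 <= S" using assms(1,2) openE by blast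
 obtain d1 where d1: "d1 > 0" "!!y. y:S ==> dist y x < d1 ==> dist (dd w (dd v f) y) (dd w (dd v f) x) < e"
 using c assms(2) e unfolding continuous_on_iff by metis
 define d where "d = min d0 d1/(norm v + norm w + 1)"
 have "norm v + norm w + 1 > 0" by(metis add_nonneg_pos add_nonneg_nonneg norm_ge_zero zero_less_one)
 hence d: "d > 0" using d0 d1 by(simp add:d_def)
 show ?thesis unfolding eventually_at_right_field
 proof(intro exI[of _ d] conjI d allI impI)
 fix s a b :: real assume s: "0 < s" "s < d" and ab: "0 <= a & a <= s & 0 <= b & b <= s"
 have "norm (a *R v + b *R w) <= a*norm v + b*norm w" using ab norm_triangle_ineq[of "a *R v" "b *R w"] by simp
 also have "... <= s*norm v + s*norm w" using ab by(intro add_mono mult_right_mono) auto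
 also have "... <= s*(norm v + norm w + 1)" using s by(simp add:algebra_simps)
 also have "... < d*(norm v + norm w + 1)" using s `norm v + norm w + 1 > 0` by(intro mult_strict_right_mono) auto
 also have "... = min d0 d1" using `norm v + norm w + 1 > 0` by(simp add:d_def)
 finally have "dist (x + a *R v + b *R w) x < min d0 d1" by(simp add:dist_norm add.assoc)
 thus "x + a *R v + b *R w:S" "\<bar>dd w (dd v f) (x + a *R v + b *R w) - dd w (dd v f) x\<bar> < e"
  using d0(2) d1(2) by(auto simp:dist_commute dist_real_def subset_iff)
 qed
qed
note ev = this
have "\<forall>\<^sub>F s::real in at_right 0. False"
 using ev[of v w] ev[of w v] eventually_at_right_less[of 0]
proof eventually_elim
 case (elim s)
 obtain a b where 1: "0 <= a" "a <= s" "0 <= b" "b <= s"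
 "f (x + s *R v + s *R w) - f (x + s *R v) - f (x + s *R w) + f x
 = s^2*dd w (dd v f) (x + a *R v + b *R w)"
 using second_difference[OF elim(3) C, of x v w] elim(1) by auto
 obtain a' b' where 2: "0 <= a'" "a' <= s" "0 <= b'" "b' <= s"
 "f (x + s *R w + s *R v) - f (x + s *R w) - f (x + s *R v) + f x
 = s^2*dd v (dd w f) (x + a' *R w + b' *R v)"
 using second_difference[OF elim(3) C, of x w v] elim(2) by auto
 have "s^2*dd w (dd v f) (x + a *R v + b *R w) = s^2*dd v (dd w f) (x + a' *R w + b' *R v)"
 using 1(5) 2(5) by(simp add:algebra_simps)
 hence "dd w (dd v f) (x + a *R v + b *R w) = dd v (dd w f) (x + a' *R w + b' *R v)"
 using elim(3) by simp
 moreover have "\<bar>dd w (dd v f) (x + a *R v + b *R w) - dd w (dd v f) x\<bar> < e"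
 using elim(1) 1 by blast
 moreover have "\<bar>dd v (dd w f) (x + a' *R w + b' *R v) - dd v (dd w f) x\<bar> < e"
 using elim(2) 2 by blast
 ultimately show False unfolding e_def by(simp add:abs_if split: if_splits)
qed
thus False by simp
qed

lemma dd_commute:
fixes f :: "'a::real_normed_vector => 'b::real_inner"
assumes "open S" "x:S" and C: "Ck_on 2 S f"
shows "dd v (dd w f) x = dd w (dd v f) x"
proof -
have C2: "Ck_on (Suc (Suc 0)) S f" using C by(simp add:numeral_2_eq_2)
have 1: "dd v (dd w (%x. f x <.> b)) x = dd v (dd w f) x <.> b" for v w b
proof -
 have "dd v (dd w (%x. f x <.> b)) x = dd v (%x. dd w f x <.> b) x"
 by(rule dd_cong[OF assms(1,2)]) (use C2 in "auto simp: Ck_on_Suc intro!: dd_inner")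
 also have "... = dd v (dd w f) x <.> b"
 by(rule dd_inner) (use C2 assms(2) in "auto simp: Ck_on_Suc")
 finally show ?thesis .
qed
have "dd v (dd w f) x <.> b = dd w (dd v f) x <.> b" for b
 using dd_commute_real[OF assms(1,2) Ck_on_compose_linear[OF bounded_linear_inner_left assms(1) C]]
 by(simp add:1[symmetric])
hence "(dd v (dd w f) x - dd w (dd v f) x) <.> (dd v (dd w f) x - dd w (dd v f) x) = 0"
 unfolding inner_diff_left by simp
thus ?thesis by simp
qed

text \<open>The Leibniz rule wants the derivative as a continuous operator valued function; in
  finite dimension this follows from continuity in each direction \<open>v\<close>, which is what
  \<open>cD\<close> provides.\<close>

lemma integral_has_derivative:
fixes f :: "'a::euclidean_space => 'b::euclidean_space => 'c::banach"
assumes "open U" "x:U"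
 and D: "!!x t. x:U ==> t:cbox a b ==> ((%x. f x t) has_derivative (%v. D v x t)) (at x)"
 and cD: "!!v. continuous_on (U \<times> cbox a b) (%(x,t). D v x t)"
 and cf: "!!x. x:U ==> continuous_on (cbox a b) (f x)"
shows "((%x. integral (cbox a b) (f x)) has_derivative (%v. integral (cbox a b) (D v x))) (at x)"
proof -
obtain r where r: "r > 0" "ball x r <= U" using assms(1,2) openE by blast
define fx where "fx x t = Blinfun (%v. D v x t)" for x t
have fx: "blinfun_apply (fx x t) = (%v. D v x t)" if "x:U" "t:cbox a b" for x t
 unfolding fx_def using has_derivative_bounded_linear[OF D[OF that]] by(rule bounded_linear_Blinfun_apply)
have c: "continuous_on (ball x r \<times> cbox a b) (%(x,t). fx x t)"
proof(rule continuous_on_blinfun_componentwise)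
 fix i :: 'a
 have "continuous_on (ball x r \<times> cbox a b) (%(x,t). D i x t)"
 by(rule continuous_on_subset[OF cD]) (use r in auto)
 thus "continuous_on (ball x r \<times> cbox a b) (%xa. blinfun_apply (case xa of (x,t) => fx x t) i)"
 by(rule continuous_on_eq) (use fx r in auto)
qed
have cx: "continuous_on (cbox a b) (fx x)"
proof -
 have "continuous_on (cbox a b) (%t. (%(x,t). fx x t) (x,t))"
 by(rule continuous_on_compose2[OF c]) (use r in "auto intro!: continuous_intros")
 thus ?thesis by simp
qed
have "((%x. integral (cbox a b) (f x)) has_derivative integral (cbox a b) (fx x)) (at x within ball x r)"
proof(rule leibniz_rule[OF _ _ c])
 fix y t assume "y:ball x r" "t:cbox a b"
 hence "y:U" using r by auto
 show "((%x. f x t) has_derivative blinfun_apply (fx y t)) (at y within ball x r)"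
 unfolding fx[OF `y : U` `t : cbox a b`]
 by(rule has_derivative_at_withinI[OF D[OF `y : U` `t : cbox a b`]])
next
 fix y assume "y:ball x r"
 hence "y:U" using r by auto
 show "f y integrable_on cbox a b" by(rule integrable_continuous[OF cf[OF `y : U`]])
qed (use r in auto)
hence "((%x. integral (cbox a b) (f x)) has_derivative integral (cbox a b) (fx x)) (at x)"
 using r at_within_open[of x "ball x r"] by auto
moreover have "blinfun_apply (integral (cbox a b) (fx x)) = (%v. integral (cbox a b) (D v x))"
proof
 fix v
 have "blinfun_apply (integral (cbox a b) (fx x)) v = integral (cbox a b) (%t. blinfun_apply (fx x t) v)"
 by(rule blinfun_apply_integral) (rule integrable_continuous[OF cx])
 also have "... = integral (cbox a b) (D v x)"
 by(rule integral_cong) (use fx assms(2) in auto)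
 finally show "blinfun_apply (integral (cbox a b) (fx x)) v = integral (cbox a b) (D v x)" .
qed
ultimately show ?thesis by simp
qed

text \<open>Each differentiation in \<open>x\<close> produces one factor \<open>t\<close>; the
  weight \<open>t^j\<close> closes the induction.\<close>

lemma Ck_on_radial_integral:
fixes F :: "'a::euclidean_space => 'c::euclidean_space"
assumes "Ck_on k (ball x0 r) F"
shows "Ck_on k (ball x0 r) (%x. integral (cbox 0 1) (%t::real. t^j *R F (x0 + t *R (x - x0))))"
using assms
proof(induction k arbitrary: F j)
have img: "x0 + t *R (x - x0):ball x0 r" if "x:ball x0 r" "t:cbox 0 (1::real)" for x t
proof -
 have "t*norm (x - x0) <= norm (x - x0)" using that by(auto intro: mult_left_le_one_le)
 thus ?thesis using that by(simp add:dist_norm norm_minus_commute)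
qed
have cont: "continuous_on (ball x0 r \<times> cbox 0 1) (%(x, t::real). t^j *R F (x0 + t *R (x - x0)))"
 if "continuous_on (ball x0 r) F" for F :: "'a => 'c" and j
 unfolding case_prod_beta
 by(intro continuous_intros continuous_on_compose2[OF that]) (use img in fastforce)
{
 case 0 thus ?case using integral_continuous_on_param[OF cont] by simp
next
 case (Suc k)
 have dF: "F differentiable (at y)" if "y:ball x0 r" for y using Suc.prems that by(simp add:Ck_on_Suc)
 have D: "((%x. t^j *R F (x0 + t *R (x - x0))) has_derivative
 (%v. t^Suc j *R dd v F (x0 + t *R (x - x0)))) (at x)"
 if "x:ball x0 r" "t:cbox 0 1" for x and t :: real
 proof -
 have "((%x. x0 + t *R (x - x0)) has_derivative (%v. t *R v)) (at x)"
  by(auto intro!: derivative_eq_intros)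
 from diff_chain_at[OF this has_derivative_dd[OF dF[OF img[OF that]]]]
 have "((%x. F (x0 + t *R (x - x0))) has_derivative (%v. t *R dd v F (x0 + t *R (x - x0)))) (at x)"
  by(simp add:o_def dd_scaleR_left[OF dF[OF img[OF that]]])
 from has_derivative_scaleR_right[OF this, of "t^j"] show ?thesis by(simp add:mult.commute)
 qed
 have "((%x. integral (cbox 0 1) (%t::real. t^j *R F (x0 + t *R (x - x0)))) has_derivative
 (%v. integral (cbox 0 1) (%t::real. t^Suc j *R dd v F (x0 + t *R (x - x0))))) (at x)"
 if "x:ball x0 r" for x
 proof(rule integral_has_derivative[OF open_ball that D])
 show "continuous_on (ball x0 r \<times> cbox 0 1) (%(x, t::real). t^Suc j *R dd v F (x0 + t *R (x - x0)))" for v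
  by(rule cont[OF Ck_on_imp_continuous[OF Ck_on_Suc_dd[OF Suc.prems]]])
 show "continuous_on (cbox 0 1) (%t::real. t^j *R F (x0 + t *R (x - x0)))" if "x:ball x0 r" for x
  by(intro continuous_intros continuous_on_compose2[OF Ck_on_imp_continuous[OF Suc.prems]])
  (use img that in fastforce)
 qed auto
 from Ck_on_SucI[OF open_ball this] show ?case
 using Suc.IH[of "dd _ F" "Suc j"] Suc.prems by(auto simp:Ck_on_Suc simp del:power_Suc)
}
qed

text \<open>Integrate the derivative of \<open>F\<close> along the segment from \<open>x0\<close> to
  \<open>x\<close>; \<open>g b\<close> is the mean of the \<open>b\<close>-derivative over the
  segment. This decomposition is what determines a derivation by its values on coordinates.\<close>

lemma Hadamard:
fixes F :: "'a::euclidean_space => complex"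
assumes "Cinf_on (ball x0 r) F"
obtains g where "!!b. Cinf_on (ball x0 r) (g b)" "!!b. g b x0 = dd b F x0"
 "!!x. x:ball x0 r ==> F x = F x0 + (SUM b:Basis. ((x - x0) <.> b) *R g b x)"
proof
define g where "g b x = integral (cbox 0 1) (%t::real. dd b F (x0 + t *R (x - x0)))" for b x
show "Cinf_on (ball x0 r) (g b)" for b
 unfolding Cinf_on_def
proof
 fix k
 show "Ck_on k (ball x0 r) (g b)"
 using Ck_on_radial_integral[of k x0 r "dd b F" 0] Cinf_dd[OF assms, of b]
 by(simp add:g_def[abs_def] Cinf_on_def)
qed
show "g b x0 = dd b F x0" for b by(simp add:g_def)
fix x assume x: "x:ball x0 r"
have img: "x0 + t *R (x - x0):ball x0 r" if "0 <= t" "t <= 1" for t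
proof -
 have "t*norm (x - x0) <= norm (x - x0)" using that by(auto intro: mult_left_le_one_le)
 thus ?thesis using x that by(simp add:dist_norm norm_minus_commute)
qed
have d: "F differentiable (at (x0 + t *R (x - x0)))" if "0 <= t" "t <= 1" for t
 using Cinf_differentiable[OF assms img[OF that]] .
have cb: "continuous_on (cbox 0 1) (%t::real. dd b F (x0 + t *R (x - x0)))" for b
 by(intro continuous_intros continuous_on_compose2[OF Cinf_cont[OF Cinf_dd[OF assms]]])
 (use img in auto)
have i1: "((%t. dd (x - x0) F (x0 + t *R (x - x0))) has_integral F (x0 + 1 *R (x - x0)) - F (x0 + 0 *R (x - x0))) {0..1}"
 by(rule fundamental_theorem_of_calculus)
 (use has_derivative_line[OF d] in "auto simp: has_vector_derivative_def intro: has_derivative_at_withinI")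
have "((%t. SUM b:Basis. ((x - x0) <.> b) *R dd b F (x0 + t *R (x - x0)))
 has_integral (SUM b:Basis. ((x - x0) <.> b) *R g b x)) (cbox 0 1)"
 unfolding g_def
 by(intro has_integral_sum has_integral_cmul integrable_integral integrable_continuous cb finite_Basis)
hence i2: "((%t. dd (x - x0) F (x0 + t *R (x - x0)))
 has_integral (SUM b:Basis. ((x - x0) <.> b) *R g b x)) {0..1}"
 by(subst has_integral_cong[where g = "%t. SUM b:Basis. ((x - x0) <.> b) *R dd b F (x0 + t *R (x - x0))"])
 (auto intro!: dd_basis d)
show "F x = F x0 + (SUM b:Basis. ((x - x0) <.> b) *R g b x)"
 using has_integral_unique[OF i1 i2] by(simp add:diff_eq_eq add.commute)
qed

subsection \<open>A smooth cutoff function\<close>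

text \<open>The span of this family is closed under differentiation, so that one induction over all
  \<open>j\<close> treats the derivatives of \<open>exp (-1/t)\<close> at the critical point
  0.\<close>

definition flat_fn :: "nat => real => real" where
"flat_fn j t = (if t > 0 then (1/t)^j*exp (-(1/t)) else 0)"

lemma flat_fn_deriv: "(flat_fn j has_field_derivative flat_fn (j + 2) t - real j*flat_fn (j + 1) t) (at t)"
proof -
consider "t > 0" | "t < 0" | "t = 0" by linarith
thus ?thesis
proof cases
 case 1
 have "((%t. (1/t)^j*exp (-(1/t))) has_field_derivative flat_fn (j + 2) t - real j*flat_fn (j + 1) t) (at t)"
 proof -
 have p: "((%t. (1/t)^j) has_field_derivative - real j*(1/t)^(j+1)) (at t)"
 proof(induction j)
  case (Suc j)
  have "((%t::real. 1/t) has_field_derivative - ((1/t)^2)) (at t)"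
  using 1 by(auto intro!: derivative_eq_intros simp:field_simps power2_eq_square)
  from DERIV_mult[OF this Suc] show ?case
  using 1 by(simp add:field_simps power2_eq_square)
 qed simp
 have "((%t. exp (-(1/t))) has_field_derivative exp (-(1/t))*(1/t)^2) (at t)"
  using 1 by(auto intro!: derivative_eq_intros simp:field_simps power2_eq_square)
 from DERIV_mult[OF p this] show ?thesis
  using 1 by(simp add:flat_fn_def algebra_simps power2_eq_square power_add)
 qed
 thus ?thesis
 by(rule DERIV_cong_ev[THEN iffD1, rotated -1])
  (use 1 in \<open>auto simp:flat_fn_def intro: eventually_mono[OF eventually_nhds_in_open[of "{0<..}"]]\<close>)
next
 case 2
 have "((%t. 0) has_field_derivative flat_fn (j + 2) t - real j*flat_fn (j + 1) t) (at t)"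
 using 2 by(auto simp:flat_fn_def)
 thus ?thesis
 by(rule DERIV_cong_ev[THEN iffD1, rotated -1])
  (use 2 in \<open>auto simp:flat_fn_def intro: eventually_mono[OF eventually_nhds_in_open[of "{..<0}"]]\<close>)
next
 case 3
 \<comment> \<open>With \<open>x = 1/h\<close> the difference quotient at 0 from the right is
   \<open>x^(j+1) / exp x\<close>.\<close>
 have "((%x::real. x^(j+1)/exp x) \<longlongrightarrow> 0) at_top" by(rule tendsto_power_div_exp_0)
 from filterlim_compose[OF this filterlim_inverse_at_top_right]
 have r: "((%h::real. inverse h^(j+1)/exp (inverse h)) \<longlongrightarrow> 0) (at_right 0)" .
 have "((%h. flat_fn j h/h) \<longlongrightarrow> 0) (at_right 0)"
 by(rule Lim_transform_eventually[OF r])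
  (auto simp:eventually_at_right_field flat_fn_def exp_minus field_simps intro!: exI[of _ 1])
 moreover have "((%h. flat_fn j h/h) \<longlongrightarrow> 0) (at_left 0)"
 by(rule Lim_transform_eventually[OF tendsto_const])
  (auto simp:eventually_at_left_field flat_fn_def intro!: exI[of _ "-1"])
 ultimately have "((%h. flat_fn j h/h) \<longlongrightarrow> 0) (at 0)"
 by(simp add:filterlim_at_split)
 thus ?thesis using 3 by(simp add:DERIV_def flat_fn_def)
qed
qed

lemma Cinf_flat_fn: "Cinf_on UNIV (flat_fn j)"
unfolding Cinf_on_def
proof
fix k show "Ck_on k UNIV (flat_fn j)"
proof(induction k arbitrary: j)
 case 0 thus ?case
 using DERIV_isCont[OF flat_fn_deriv] by(simp add:continuous_at_imp_continuous_on)
next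
 case (Suc k)
 have D: "(flat_fn j has_derivative (%h. (flat_fn (j + 2) t + (- real j)*flat_fn (j + 1) t)*h)) (at t)" for t
 using flat_fn_deriv[of j t] by(simp add:has_field_derivative_def)
 show ?case
 by(rule Ck_on_SucI[OF open_UNIV D]) (intro Ck_on_mult Ck_on_add Ck_on_const open_UNIV Suc)
qed
qed

lemma smooth_cutoff:
fixes a b :: real assumes "a < b"
obtains tt :: "real => real" where "Cinf_on UNIV tt" "!!x. x <= a ==> tt x = 0" "!!x. b <= x ==> tt x = 1"
 "!!x. 0 <= tt x" "!!x. tt x <= 1"
proof
define p q where "p x = flat_fn 0 (x - a)" and "q x = flat_fn 0 (b - x)" for x
have pq: "p x >= 0" "q x >= 0" "p x + q x > 0" for x
 using assms by(auto simp:p_def q_def flat_fn_def add_pos_pos)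
have lin: "Cinf_on UNIV (%x. x - a)" "Cinf_on UNIV (%x. b - x)"
 by(intro Cinf_diff Cinf_id Cinf_const open_UNIV)+
have s: "Cinf_on UNIV p" "Cinf_on UNIV q"
 unfolding p_def[abs_def] q_def[abs_def]
 by(rule Cinf_compose[OF open_UNIV open_UNIV _ _ Cinf_flat_fn]; use lin in simp)+
show "Cinf_on UNIV (%x. p x/(p x + q x))"
 by(intro Cinf_divide Cinf_add s open_UNIV) (use pq in "auto simp: less_imp_neq[symmetric]")
show "p x/(p x + q x) = 0" if "x <= a" for x using that by(simp add:p_def flat_fn_def)
show "p x/(p x + q x) = 1" if "b <= x" for x
 using that pq(3)[of x] by(auto simp:q_def flat_fn_def)
show "0 <= p x/(p x + q x)" "p x/(p x + q x) <= 1" for x using pq[of x] by auto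
qed

section \<open>Charts and complex tangent vectors\<close>

context smooth_manifold begin

lemma chart_homeomorphism:
assumes "(V,fi):A" shows "homeomorphism V (fi ` V) fi (inv_into V fi)"
proof -
obtain ps where h: "homeomorphism V (fi ` V) fi ps" using chart[OF assms] by blast
have inj: "inj_on fi V" using h by(metis homeomorphism_def inj_on_inverseI)
have eq: "ps y = inv_into V fi y" if "y:fi ` V" for y
 using that h inj by(auto simp:homeomorphism_def)
have "continuous_on (fi ` V) (inv_into V fi)"
 using h eq by(metis (no_types, lifting) continuous_on_eq homeomorphism_def)
moreover have "inv_into V fi ` fi ` V = V" using inj by(force simp:image_iff)
ultimately show ?thesis using h inj by(auto simp:homeomorphism_def)
qed

text \<open>Charts will be restricted, translated, and have single coordinates exchanged, while the
  atlas stays fixed. The predicate keeps what makes a chart usable: a homeomorphism with its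
  inverse, in which smoothness can be read off.\<close>

definition lchart :: "'p set => ('p => 'e) => ('e => 'p) => bool" where
"lchart V ka ka' \<longleftrightarrow> open V & open (ka ` V) & homeomorphism V (ka ` V) ka ka' &
 (ALL U f. open U --> U <= V --> (smooth U f \<longleftrightarrow> Cinf_on (ka ` U) (%x. f (ka' x))))"

lemma lchart_open: "lchart V ka ka' ==> open V"
by(simp add:lchart_def)

lemma open_image_homeomorphism:
assumes "homeomorphism V T ka ka'" "open T" "open U" "U <= V" shows "open (ka ` U)"
proof -
have "openin (top_of_set V) U" using assms by(simp add:open_subset)
from homeomorphism_imp_open_map[OF assms(1) this] show ?thesis
 using assms(2) openin_open_trans by blast
qed

lemma lchart_image: "lchart V ka ka' ==> open U ==> U <= V ==> open (ka ` U)"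
unfolding lchart_def using open_image_homeomorphism by metis

lemma lchart_inv: "lchart V ka ka' ==> q:V ==> ka' (ka q) = q"
by(simp add:lchart_def homeomorphism_def)

lemma lchart_inv': "lchart V ka ka' ==> x:ka ` V ==> ka (ka' x) = x"
by(auto simp:lchart_def homeomorphism_def)

lemma lchart_continuous: "lchart V ka ka' ==> continuous_on V ka"
by(simp add:lchart_def homeomorphism_def)

lemma lchart_continuous': "lchart V ka ka' ==> continuous_on (ka ` V) ka'"
by(simp add:lchart_def homeomorphism_def)

lemma lchart_smooth_iff:
"lchart V ka ka' ==> open U ==> U <= V ==> smooth U f \<longleftrightarrow> Cinf_on (ka ` U) (%x. f (ka' x))"
by(simp add:lchart_def)

lemma lchart_vimage:
assumes "lchart V ka ka'" "open T" "T <= ka ` V"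
shows "open (V Int ka -` T)" "ka ` (V Int ka -` T) = T" "ka' ` T = V Int ka -` T"
proof -
show "open (V Int ka -` T)"
 using assms lchart_continuous[OF assms(1)] lchart_open[OF assms(1)]
 by(simp add:continuous_on_open_vimage Int_commute)
show *: "ka ` (V Int ka -` T) = T" using assms(3) by blast
have "ka' ` ka ` (V Int ka -` T) = V Int ka -` T"
 using lchart_inv[OF assms(1)] by(force simp:image_iff)
thus "ka' ` T = V Int ka -` T" by(simp only: *)
qed

lemma chart_lchart: assumes V: "(V,fi):A" shows "lchart V fi (inv_into V fi)"
unfolding lchart_def
proof(intro conjI allI impI)
show "open V" "open (fi ` V)" using chart[OF V] by auto
show h: "homeomorphism V (fi ` V) fi (inv_into V fi)" by(rule chart_homeomorphism[OF V])
fix U f assume U: "open U" "U <= V"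
show "smooth U f \<longleftrightarrow> Cinf_on (fi ` U) (%x. f (inv_into V fi x))"
proof
 assume "smooth U f"
 thus "Cinf_on (fi ` U) (%x. f (inv_into V fi x))"
 using V U unfolding smooth_def by(force simp:Int_absorb2 o_def)
next
 assume C: "Cinf_on (fi ` U) (%x. f (inv_into V fi x))"
 show "smooth U f" unfolding smooth_def
 proof clarify
 fix W ps assume W: "(W,ps):A"
 have hW: "homeomorphism W (ps ` W) ps (inv_into W ps)" by(rule chart_homeomorphism[OF W])
 have inv: "inv_into W ps (ps q) = q" if "q:W" for q using hW that by(simp add:homeomorphism_def)
 have inv': "inv_into V fi (fi q) = q" if "q:V" for q using h that by(simp add:homeomorphism_def)
 have o: "open (ps ` (U Int W))"
  using open_image_homeomorphism[OF hW] chart[OF W] U by auto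
 have "Cinf_on (ps ` (U Int W)) (%x. (%x. f (inv_into V fi x)) ((fi \<circ> inv_into W ps) x))"
 proof(rule Cinf_compose[OF o open_image_homeomorphism[OF h _ U]])
  show "open (fi ` V)" using chart[OF V] by auto
  show "(fi \<circ> inv_into W ps) ` ps ` (U Int W) <= fi ` U" using inv by auto
  show "Cinf_on (ps ` (U Int W)) (fi \<circ> inv_into W ps)"
  by(rule Cinf_subset[OF compatible[OF V W]]) (use U in auto)
 qed (rule C)
 thus "Cinf_on (ps ` (U Int W)) (f \<circ> inv_into W ps)"
  by(rule Cinf_cong[OF o, THEN iffD1, rotated]) (use inv inv' U in "auto simp: subset_iff")
 qed
qed
qed

lemma lchart_exists: "EX V ka ka'. lchart V ka ka' & p:V"
proof -
have "p:(UN (V,fi):A. V)" using covering by simp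
then obtain V fi where "(V,fi):A" "p:V" by auto
thus ?thesis using chart_lchart by metis
qed

lemma smooth_subset: assumes "smooth U f" "W <= U" shows "smooth W f"
unfolding smooth_def
proof clarify
fix V fi assume "(V,fi):A"
hence "Cinf_on (fi ` (U Int V)) (f \<circ> inv_into V fi)" using assms(1) by(auto simp:smooth_def)
thus "Cinf_on (fi ` (W Int V)) (f \<circ> inv_into V fi)"
 by(rule Cinf_subset) (use assms(2) in auto)
qed

lemma lchart_smoothD:
assumes "lchart V ka ka'" "smooth U f" "open W" "W <= U" "W <= V"
shows "Cinf_on (ka ` W) (%x. f (ka' x))"
using lchart_smooth_iff[OF assms(1,3,5)] smooth_subset[OF assms(2,4)] by metis

lemma lchart_subset:
assumes "lchart V ka ka'" "open W" "W <= V" shows "lchart W ka ka'"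
unfolding lchart_def
proof(intro conjI allI impI)
show "open (ka ` W)" by(rule lchart_image[OF assms])
show "homeomorphism W (ka ` W) ka ka'"
 using assms by(auto simp:lchart_def intro: homeomorphism_of_subsets)
fix U f assume "open U" "U <= W"
thus "smooth U f \<longleftrightarrow> Cinf_on (ka ` U) (%x. f (ka' x))"
 using assms by(simp add:lchart_smooth_iff)
qed (rule assms)

lemma smooth_local:
assumes "!!p. p:U ==> EX W. open W & p:W & smooth W f"
shows "smooth U f"
unfolding smooth_def
proof clarify
fix V fi assume V: "(V,fi):A"
show "Cinf_on (fi ` (U Int V)) (f \<circ> inv_into V fi)"
proof(rule Cinf_local)
 fix x assume "x:fi ` (U Int V)"
 then obtain p where p: "p:U" "p:V" "x = fi p" by auto
 from assms[OF p(1)] obtain W where W: "open W" "p:W" "smooth W f" by auto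
 have "open (fi ` (W Int V))" using lchart_image[OF chart_lchart[OF V]] W(1) chart[OF V] by auto
 thus "EX T. open T & x:T & Cinf_on T (f \<circ> inv_into V fi)"
 using W V p unfolding smooth_def by(intro exI[of _ "fi ` (W Int V)"]) auto
qed
qed

lemma smooth_cong:
assumes "open U" "!!q. q:U ==> f q = g q" "smooth U f" shows "smooth U g"
unfolding smooth_def
proof clarify
fix V fi assume V: "(V,fi):A"
note l = chart_lchart[OF V]
have o: "open (fi ` (U Int V))" using lchart_image[OF l] assms(1) lchart_open[OF l] by auto
have "Cinf_on (fi ` (U Int V)) (f \<circ> inv_into V fi)" using assms(3) V by(auto simp:smooth_def)
thus "Cinf_on (fi ` (U Int V)) (g \<circ> inv_into V fi)"
 by(rule Cinf_cong[OF o, THEN iffD1, rotated]) (use assms(2) lchart_inv[OF l] in auto)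
qed

lemma chart_open_image: "(V,fi):A ==> open U ==> open (fi ` (U Int V))"
using lchart_image[OF chart_lchart, of V fi "U Int V"] chart[of V fi] by auto

lemma smooth_const: "smooth U (%q. c)"
unfolding smooth_def by auto

lemma smooth_add: "open U ==> smooth U f ==> smooth U g ==> smooth U (%q. f q + g q)"
unfolding smooth_def o_def by(auto intro!: Cinf_add chart_open_image)

lemma smooth_diff: "open U ==> smooth U f ==> smooth U g ==> smooth U (%q. f q - g q)"
unfolding smooth_def o_def by(auto intro!: Cinf_diff chart_open_image)

lemma smooth_mult: "open U ==> smooth U f ==> smooth U g ==> smooth U (%q. f q*g q)"
unfolding smooth_def o_def by(auto intro!: Cinf_mult chart_open_image)

lemma smooth_minus: "open U ==> smooth U f ==> smooth U (%q. - f q)"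
using smooth_mult[OF _ smooth_const[of U "-1"]] by simp

lemma smooth_sum: "open U ==> (!!i. i:I ==> smooth U (f i)) ==> smooth U (%q. SUM i:I. f i q)"
by(induction I rule: infinite_finite_induct) (auto intro: smooth_add smooth_const)

lemma smooth_cnj: "open U ==> smooth U f ==> smooth U (%q. cnj (f q))"
unfolding smooth_def o_def by(auto intro!: Cinf_cnj chart_open_image)

lemma smooth_divide:
"open U ==> smooth U f ==> smooth U g ==> (!!q. q:U ==> g q ~= 0) ==> smooth U (%q. f q/g q)"
unfolding smooth_def o_def
by(auto intro!: Cinf_divide chart_open_image simp:lchart_inv[OF chart_lchart])

lemma smooth_of_Re: "open U ==> smooth U f ==> smooth U (%q. cor (Re (f q)))"
unfolding smooth_def o_def by(auto intro!: Cinf_of_real Cinf_Re chart_open_image)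

lemma smooth_of_Im: "open U ==> smooth U f ==> smooth U (%q. cor (Im (f q)))"
unfolding smooth_def o_def by(auto intro!: Cinf_of_real Cinf_Im chart_open_image)

lemma smooth_imp_continuous: assumes "open U" "smooth U f" shows "continuous_on U f"
proof -
have "isCont f p" if "p:U" for p
proof -
 obtain V ka ka' where l: "lchart V ka ka'" "p:V" using lchart_exists by blast
 have UV: "open (U Int V)" using assms(1) lchart_open[OF l(1)] by(rule open_Int)
 have "Cinf_on (ka ` (U Int V)) (%x. f (ka' x))"
 by(rule lchart_smoothD[OF l(1) assms(2) UV]) auto
 hence "continuous_on (U Int V) (%q. f (ka' (ka q)))"
 by(rule continuous_on_compose2[OF Cinf_cont])
  (use continuous_on_subset[OF lchart_continuous[OF l(1)]] in auto)
 hence "continuous_on (U Int V) f"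
 by(rule continuous_on_eq) (use lchart_inv[OF l(1)] in auto)
 thus ?thesis using continuous_on_eq_continuous_at[OF UV] that l(2) by auto
qed
thus ?thesis by(simp add:continuous_at_imp_continuous_on)
qed

lemma smooth_nearI: "open U ==> p:U ==> smooth U f ==> smooth_near p f"
unfolding smooth_near_def by blast

lemma smooth_near_combine:
assumes "smooth_near p f" "smooth_near p g"
obtains U where "open U" "p:U" "smooth U f" "smooth U g"
proof -
obtain U V where "open U" "p:U" "smooth U f" "open V" "p:V" "smooth V g"
 using assms unfolding smooth_near_def by blast
thus ?thesis by(intro that[of "U Int V"]) (auto elim: smooth_subset)
qed

lemma smooth_near_const [simp]: "smooth_near p (%q. c)"
by(rule smooth_nearI[OF open_UNIV UNIV_I smooth_const])

lemma smooth_near_add: "smooth_near p f ==> smooth_near p g ==> smooth_near p (%q. f q + g q)"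
by(erule smooth_near_combine, assumption, rule smooth_nearI, assumption+, rule smooth_add)

lemma smooth_near_diff: "smooth_near p f ==> smooth_near p g ==> smooth_near p (%q. f q - g q)"
by(erule smooth_near_combine, assumption, rule smooth_nearI, assumption+, rule smooth_diff)

lemma smooth_near_mult: "smooth_near p f ==> smooth_near p g ==> smooth_near p (%q. f q*g q)"
by(erule smooth_near_combine, assumption, rule smooth_nearI, assumption+, rule smooth_mult)

lemma smooth_near_sum: "(!!i. i:I ==> smooth_near p (f i)) ==> smooth_near p (%q. SUM i:I. f i q)"
by(induction I rule: infinite_finite_induct) (auto intro: smooth_near_add)

lemma smooth_near_cnj: "smooth_near p f ==> smooth_near p (%q. cnj (f q))"
by(rule smooth_near_combine[of p f f], assumption+, rule smooth_nearI, assumption+, rule smooth_cnj)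

lemma smooth_near_cnj_iff [simp]: "smooth_near p (%q. cnj (f q)) \<longleftrightarrow> smooth_near p f"
using smooth_near_cnj[of p f] smooth_near_cnj[of p "%q. cnj (f q)"] by auto

lemma smooth_near_cong:
assumes "smooth_near p f" "\<forall>\<^sub>F q in nhds p. f q = g q" shows "smooth_near p g"
proof -
obtain U where U: "open U" "p:U" "smooth U f" using assms(1) smooth_near_def by blast
obtain W where W: "open W" "p:W" "!!q. q:W ==> f q = g q" using assms(2) by(auto simp:eventually_nhds)
have "smooth (U Int W) g"
 by(rule smooth_cong[of _ f]) (use U W smooth_subset[OF U(3)] in auto)
thus ?thesis using U W by(intro smooth_nearI[of "U Int W"]) auto
qed

section \<open>Tangent vectors as derivations\<close>

lemma CT_cong: "v:CT p ==> smooth_near p f ==> (\<forall>\<^sub>F q in nhds p. f q = g q) ==> v f = v g"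
by(simp add:CT_def)

lemma CT_cong_open:
"v:CT p ==> smooth_near p f ==> open U ==> p:U ==> (!!q. q:U ==> f q = g q) ==> v f = v g"
using CT_cong[of v p f g] by(auto simp:eventually_nhds)

lemma CT_add: "v:CT p ==> smooth_near p f ==> smooth_near p g ==> v (%q. f q + g q) = v f + v g"
by(simp add:CT_def)

lemma CT_cmult: "v:CT p ==> smooth_near p f ==> v (%q. c*f q) = c * v f"
by(simp add:CT_def)

lemma CT_mult:
"v:CT p ==> smooth_near p f ==> smooth_near p g ==> v (%q. f q*g q) = v f*g p + f p * v g"
by(simp add:CT_def)

lemma CT_const: assumes "v:CT p" shows "v (%q. c) = 0"
proof -
have "v (%q. 1*1) = v (%q. 1)*1 + 1 * v (%q. 1)"
 by(rule CT_mult[OF assms smooth_near_const smooth_near_const])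
hence "v (%q. 1) = 0" by simp
thus ?thesis using CT_cmult[OF assms smooth_near_const, of c 1] by simp
qed

lemma CT_diff: "v:CT p ==> smooth_near p f ==> smooth_near p g ==> v (%q. f q - g q) = v f - v g"
using CT_add[of v p f "%q. (-1)*g q"] CT_cmult[of v p g "-1"]
 smooth_near_mult[OF smooth_near_const[of p "-1"], of g] by simp

lemma CT_sum:
assumes v: "v:CT p" and "!!i. i:I ==> smooth_near p (f i)"
shows "v (%q. SUM i:I. f i q) = (SUM i:I. v (f i))"
using assms(2)
proof(induction I rule: infinite_finite_induct)
case (insert x F)
have "smooth_near p (%q. SUM i:F. f i q)" by(intro smooth_near_sum) (use insert in auto)
thus ?case using CT_add[OF v, of "f x" "%q. SUM i:F. f i q"] insert by simp
qed (simp_all add:CT_const[OF v])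

lemma CT_zero: "0:CT p" by(simp add:CT_def)

lemma CT_I:
assumes "!!f. ~ smooth_near p f ==> v f = 0"
 "!!f g. smooth_near p f ==> \<forall>\<^sub>F q in nhds p. f q = g q ==> v f = v g"
 "!!f g. smooth_near p f ==> smooth_near p g ==> v (%q. f q + g q) = v f + v g"
 "!!c f. smooth_near p f ==> v (%q. c*f q) = c * v f"
 "!!f g. smooth_near p f ==> smooth_near p g ==> v (%q. f q*g q) = v f*g p + f p * v g"
shows "v:CT p"
unfolding CT_def using assms by(intro CollectI conjI allI impI)

lemma CT_not_smooth: "v:CT p ==> ~ smooth_near p f ==> v f = 0"
by(simp add:CT_def)

lemma CT_plus: assumes "v:CT p" "w:CT p" shows "v + w:CT p"
proof(rule CT_I)
fix f g assume "smooth_near p f" "\<forall>\<^sub>F q in nhds p. f q = g q"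
from CT_cong[OF assms(1) this] CT_cong[OF assms(2) this] show "(v + w) f = (v + w) g" by simp
qed (simp_all add:assms[THEN CT_not_smooth] assms[THEN CT_add] assms[THEN CT_cmult] assms[THEN CT_mult] algebra_simps)

lemma CT_cscale: assumes "v:CT p" shows "cscale c v:CT p"
proof(rule CT_I)
fix f g assume "smooth_near p f" "\<forall>\<^sub>F q in nhds p. f q = g q"
from CT_cong[OF assms this] show "cscale c v f = cscale c v g" by(simp add:cscale_def)
qed (simp_all add:cscale_def assms[THEN CT_not_smooth] assms[THEN CT_add] assms[THEN CT_cmult] assms[THEN CT_mult] algebra_simps)

lemma CT_subspace: "cvec.subspace (CT p)"
by(simp add:cvec.subspace_def CT_zero CT_plus CT_cscale)

lemma CT_cconj: assumes "v:CT p" shows "cconj v:CT p"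
proof -
have "cconj v f = cconj v g" if "smooth_near p f" "\<forall>\<^sub>F q in nhds p. f q = g q" for f g
proof -
 have "v (%q. cnj (f q)) = v (%q. cnj (g q))"
 by(rule CT_cong[OF assms]) (use that in "auto elim: eventually_mono")
 thus ?thesis by(simp add:cconj_def)
qed
moreover have "cconj v f = 0" if "~ smooth_near p f" for f
 using that assms by(simp add:cconj_def CT_def)
moreover have "cconj v (%q. c*f q) = c*cconj v f" if "smooth_near p f" for c f
 using CT_cmult[OF assms, of "%q. cnj (f q)" "cnj c"] that by(simp add:cconj_def)
moreover have "cconj v (%q. f q + g q) = cconj v f + cconj v g"
 and "cconj v (%q. f q*g q) = cconj v f*g p + f p*cconj v g"
 if "smooth_near p f" "smooth_near p g" for f g
 using CT_add[OF assms smooth_near_cnj[OF that(1)] smooth_near_cnj[OF that(2)]]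
 CT_mult[OF assms smooth_near_cnj[OF that(1)] smooth_near_cnj[OF that(2)]]
 by(simp_all add:cconj_def)
ultimately show ?thesis by(intro CT_I)
qed

lemma cconj_cconj [simp]: "cconj (cconj v) = v"
by(simp add:cconj_def)

definition xc :: "('p => 'e) => 'e => 'p => complex" where
"xc ka b q = cor (ka q <.> b)"

lemma smooth_pullback:
assumes l: "lchart V ka ka'" and U: "open U" "U <= V" and F: "Cinf_on (ka ` U) F"
shows "smooth U (%q. F (ka q))"
unfolding lchart_smooth_iff[OF l U]
by(rule Cinf_cong[OF lchart_image[OF l U], THEN iffD1, rotated, OF F])
 (use lchart_inv'[OF l] U in auto)

lemma smooth_xc: "lchart V ka ka' ==> open U ==> U <= V ==> smooth U (xc ka b)"
unfolding xc_def[abs_def]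
by(rule smooth_pullback[where F = "%x. cor (x <.> b)"])
 (auto intro!: Cinf_of_real Cinf_inner_const Cinf_id lchart_image)

lemma smooth_near_xc: "lchart V ka ka' ==> p:V ==> smooth_near p (xc ka b)"
using smooth_xc[of V ka ka' V] lchart_open smooth_nearI by blast

lemma smooth_near_ball:
assumes l: "lchart V ka ka'" "p:V" and f: "smooth_near p f"
obtains r where "r > 0" "ball (ka p) r <= ka ` V" "Cinf_on (ball (ka p) r) (%x. f (ka' x))"
 "smooth (V Int ka -` ball (ka p) r) f"
proof -
obtain U where U: "open U" "p:U" "smooth U f" using f smooth_near_def by blast
have UV: "open (U Int V)" "U Int V <= V" using U lchart_open[OF l(1)] by auto
have "open (ka ` (U Int V))" by(rule lchart_image[OF l(1) UV])
then obtain r where r: "r > 0" "ball (ka p) r <= ka ` (U Int V)" using U(2) l(2) openE by blast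
have C: "Cinf_on (ka ` (U Int V)) (%x. f (ka' x))"
 by(rule lchart_smoothD[OF l(1) U(3) UV(1)]) auto
have sub: "V Int ka -` ball (ka p) r <= U"
proof
 fix q assume "q:V Int ka -` ball (ka p) r"
 then obtain q' where "q':U Int V" "ka q = ka q'" "q:V" using r by auto
 thus "q:U" using lchart_inv[OF l(1)] by(metis IntD1 IntD2)
qed
show ?thesis
 by(rule that[OF r(1)]) (use r C Cinf_subset sub smooth_subset[OF U(3)] in blast)+
qed

text \<open>Hadamard's decomposition writes \<open>f - f p\<close> as a sum of products of
  coordinate differences, which vanish at \<open>p\<close>, with smooth functions; the Leibniz rule
  keeps only the terms in which the coordinates are differentiated.\<close>

lemma CT_coord:
assumes l: "lchart V ka ka'" "p:V" and v: "v:CT p" and f: "smooth_near p f"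
shows "v f = (SUM b:Basis. v (xc ka b)*dd b (%x. f (ka' x)) (ka p))"
proof -
obtain r where r: "r > 0" "ball (ka p) r <= ka ` V" "Cinf_on (ball (ka p) r) (%x. f (ka' x))"
 by(rule smooth_near_ball[OF l f])
obtain g where g: "!!b. Cinf_on (ball (ka p) r) (g b)" "!!b. g b (ka p) = dd b (%x. f (ka' x)) (ka p)"
 "!!x. x:ball (ka p) r ==> f (ka' x) = f (ka' (ka p)) + (SUM b:Basis. ((x - ka p) <.> b) *R g b x)"
 using Hadamard[OF r(3)] by blast
define W where "W = V Int ka -` ball (ka p) r"
have W: "open W" "ka ` W = ball (ka p) r" "W <= V" "p:W"
 using lchart_vimage[OF l(1) open_ball r(2)] l(2) r(1) by(auto simp:W_def)
have gs: "smooth_near p (%q. g b (ka q))" for b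
 by(rule smooth_nearI[OF W(1,4)], rule smooth_pullback[OF l(1) W(1,3)]) (simp add:W(2) g(1))
have xs: "smooth_near p (%q. xc ka b q - xc ka b p)" for b
 by(intro smooth_near_diff smooth_near_xc[OF l] smooth_near_const)
have "v f = v (%q. f p + (SUM b:Basis. (xc ka b q - xc ka b p)*g b (ka q)))"
proof(rule CT_cong_open[OF v f W(1,4)])
 fix q assume q: "q:W"
 hence "ka q:ball (ka p) r" using W(2) by blast
 from g(3)[OF this] show "f q = f p + (SUM b:Basis. (xc ka b q - xc ka b p)*g b (ka q))"
 using q W(3) l(2) by(simp add:lchart_inv[OF l(1)] subset_iff xc_def inner_diff_left scaleR_conv_of_real)
qed
also have "... = (SUM b:Basis. v (%q. (xc ka b q - xc ka b p)*g b (ka q)))"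
 by(subst CT_add[OF v], auto intro!: smooth_near_sum smooth_near_mult xs gs simp:CT_const[OF v])
 (rule CT_sum[OF v], auto intro!: smooth_near_mult xs gs)
also have "... = (SUM b:Basis. v (xc ka b)*g b (ka p))"
proof(rule sum.cong[OF refl])
 fix b
 have "v (%q. xc ka b q - xc ka b p) = v (xc ka b)"
 by(subst CT_diff[OF v smooth_near_xc[OF l]]) (auto simp:CT_const[OF v])
 thus "v (%q. (xc ka b q - xc ka b p)*g b (ka q)) = v (xc ka b)*g b (ka p)"
 by(subst CT_mult[OF v xs gs]) simp
qed
finally show ?thesis by(simp add:g(2))
qed

text \<open>The value 0 off the smooth germs is the one that \<open>CT\<close> prescribes.\<close>

definition coord_vec :: "('p => 'e) => ('e => 'p) => 'p => ('e => complex) => 'p cvec" where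
"coord_vec ka ka' p c =
 (%f. if smooth_near p f then SUM b:Basis. c b*dd b (%x. f (ka' x)) (ka p) else 0)"

lemma smooth_near_differentiable:
assumes "lchart V ka ka'" "p:V" "smooth_near p f"
shows "(%x. f (ka' x)) differentiable (at (ka p))"
using smooth_near_ball[OF assms] Cinf_differentiable by(metis centre_in_ball)

lemma dd_chart_cong:
assumes l: "lchart V ka ka'" "p:V" and e: "\<forall>\<^sub>F q in nhds p. f q = g q"
shows "dd b (%x. f (ka' x)) (ka p) = dd b (%x. g (ka' x)) (ka p)"
proof -
obtain W where W: "open W" "p:W" "!!q. q:W ==> f q = g q" using e by(auto simp:eventually_nhds)
have o: "open (ka ` (V Int W))" by(rule lchart_image[OF l(1)]) (use W lchart_open[OF l(1)] in auto)
show ?thesis by(rule dd_cong[OF o]) (use l W lchart_inv[OF l(1)] in auto)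
qed

lemma coord_vec_CT:
assumes l: "lchart V ka ka'" "p:V" shows "coord_vec ka ka' p c:CT p"
proof -
note d = has_derivative_dd[OF smooth_near_differentiable[OF l]]
have add:"dd b (%x. f (ka' x) + g (ka' x)) (ka p) = dd b (%x. f (ka' x)) (ka p) + dd b (%x. g (ka' x)) (ka p)"
 if "smooth_near p f" "smooth_near p g" for b f g
 using dd_eq[OF has_derivative_add[OF d[OF that(1)] d[OF that(2)]]] by simp
have mult: "dd b (%x. f (ka' x)*g (ka' x)) (ka p) =
 f p*dd b (%x. g (ka' x)) (ka p) + dd b (%x. f (ka' x)) (ka p)*g p"
 if "smooth_near p f" "smooth_near p g" for b f g
 using dd_eq[OF has_derivative_mult[OF d[OF that(1)] d[OF that(2)]]] by(simp add:lchart_inv[OF l])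
have cm: "dd b (%x. c*f (ka' x)) (ka p) = c*dd b (%x. f (ka' x)) (ka p)"
 if "smooth_near p f" for b c f
 using dd_eq[OF has_derivative_mult_right[OF d[OF that]]] by simp
have cong: "coord_vec ka ka' p c f = coord_vec ka ka' p c g" if "smooth_near p f" "\<forall>\<^sub>F q in nhds p. f q = g q" for f g
 using dd_chart_cong[OF l that(2)] smooth_near_cong[OF that] that(1) by(simp add:coord_vec_def)
show ?thesis
proof(rule CT_I)
 fix f g assume "smooth_near p f" "\<forall>\<^sub>F q in nhds p. f q = g q"
 thus "coord_vec ka ka' p c f = coord_vec ka ka' p c g" by(rule cong)
qed (simp_all add:coord_vec_def add mult cm smooth_near_add smooth_near_mult sum.distrib
 sum_distrib_left sum_distrib_right algebra_simps)
qed

lemma dd_xc: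
assumes l: "lchart V ka ka'" "p:V"
shows "dd v (%x. xc ka b (ka' x)) (ka p) = cor (v <.> b)"
proof -
have "dd v (%x. xc ka b (ka' x)) (ka p) = dd v (%x. cor (x <.> b)) (ka p)"
 by(rule dd_cong[of "ka ` V"]) (use l lchart_image[OF l(1) lchart_open[OF l(1)]] lchart_inv[OF l(1)] in "auto simp: xc_def")
also have "... = cor (v <.> b)"
 by(rule dd_eq) (auto intro!: derivative_eq_intros)
finally show ?thesis .
qed

lemma coord_vec_xc:
assumes l: "lchart V ka ka'" "p:V" "b:Basis" shows "coord_vec ka ka' p c (xc ka b) = c b"
proof -
have "(SUM b':Basis. c b'*cor (b' <.> b)) = (SUM b':Basis. if b' = b then c b' else 0)"
 by(rule sum.cong) (use l(3) in "auto simp: inner_Basis")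
thus ?thesis
 using smooth_near_xc[OF l(1,2)] l(3) by(simp add:coord_vec_def dd_xc[OF l(1,2)])
qed

lemma CT_eqI:
assumes l: "lchart V ka ka'" "p:V" and "v:CT p" "w:CT p" "!!b. b:Basis ==> v (xc ka b) = w (xc ka b)"
shows "v = w"
proof
fix f show "v f = w f"
proof(cases "smooth_near p f")
 case True
 thus ?thesis using CT_coord[OF l assms(3)] CT_coord[OF l assms(4)] assms(5) by simp
next
 case False
 thus ?thesis using assms(3,4) by(simp add:CT_def)
qed
qed

lemma smooth_dd:
assumes l: "lchart V ka ka'" and U: "open U" "U <= V" and f: "smooth U f"
shows "smooth U (%q. dd b (%x. f (ka' x)) (ka q))"
by(rule smooth_pullback[OF l U Cinf_dd]) (use f lchart_smooth_iff[OF l U] in auto)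

section \<open>Smooth vector fields and their brackets\<close>

lemma smooth_fieldI:
assumes l: "lchart V ka ka'" and U: "open U" "U <= V"
 and Z: "!!q. q:U ==> Z q:CT q" "!!b. b:Basis ==> smooth U (%q. Z q (xc ka b))"
shows "smooth_field U Z"
unfolding smooth_field_def
proof(intro conjI ballI allI impI)
fix W f assume W: "open W" "W <= U" "smooth W f"
have "smooth W (%q. SUM b:Basis. Z q (xc ka b)*dd b (%x. f (ka' x)) (ka q))"
 by(intro smooth_sum smooth_mult W(1) smooth_dd[OF l] W)
 (use W U Z(2) smooth_subset in "blast+")
thus "smooth W (%q. Z q f)"
 by(rule smooth_cong[OF W(1), rotated])
 (use CT_coord[OF l _ Z(1)] W U in "auto simp: subset_iff smooth_nearI[OF W(1) _ W(3)]")
qed (use Z in auto)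

lemma smooth_field_CT: "smooth_field U Z ==> q:U ==> Z q:CT q"
by(simp add:smooth_field_def)

lemma smooth_field_smooth: "smooth_field U Z ==> open W ==> W <= U ==> smooth W f ==> smooth W (%q. Z q f)"
by(simp add:smooth_field_def)

lemma smooth_field_subset: "smooth_field U Z ==> W <= U ==> smooth_field W Z"
by(simp add:smooth_field_def subset_eq)

lemma smooth_field_zero: "smooth_field U (%q. 0)"
by(simp add:smooth_field_def CT_zero smooth_const)

lemma smooth_field_add: "smooth_field U Y ==> smooth_field U Z ==> smooth_field U (%q. Y q + Z q)"
by(simp add:smooth_field_def CT_plus smooth_add)

lemma smooth_field_scale: "smooth U a ==> smooth_field U Z ==> smooth_field U (%q. cscale (a q) (Z q))"
by(simp add:smooth_field_def CT_cscale) (simp add:cscale_def smooth_mult smooth_subset[of U a])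

lemma smooth_field_sum:
"(!!i. i:I ==> smooth_field U (Z i)) ==> smooth_field U (%q. SUM i:I. Z i q)"
by(induction I rule: infinite_finite_induct) (auto intro: smooth_field_add smooth_field_zero)

lemma smooth_field_cconj: "smooth_field U Z ==> smooth_field U (%q. cconj (Z q))"
by(simp add:smooth_field_def CT_cconj) (simp add:cconj_def smooth_cnj)

lemma smooth_near_field: "smooth_field U Z ==> open U ==> p:U ==> smooth_near p f ==> smooth_near p (%q. Z q f)"
unfolding smooth_near_def
proof(elim exE conjE)
fix W assume *: "smooth_field U Z" "open U" "p:U" "open W" "p:W" "smooth W f"
show "EX W. open W & p:W & smooth W (%q. Z q f)"
 using * smooth_field_smooth[OF *(1) open_Int[OF *(2,4)] _ smooth_subset[OF *(6)]]
 by(intro exI[of _ "U Int W"]) (simp add:open_Int)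
qed

text \<open>In \<open>X (Y (f * g))\<close> the mixed products of first derivatives are symmetric in
  \<open>X\<close> and \<open>Y\<close> and cancel in the commutator. Since the outer vector acts on
  a germ, each rule for the inner field must hold at all points near \<open>p\<close>, not only at
  \<open>p\<close>.\<close>

lemma lie_CT:
assumes X: "smooth_field U X" and Y: "smooth_field U Y" and U: "open U" "p:U"
shows "lie X Y p:CT p"
proof -
have XC: "X p:CT p" and YC: "Y p:CT p" using X Y U by(auto simp:smooth_field_def)
note nX = smooth_near_field[OF X U] and nY = smooth_near_field[OF Y U]
have ev: "\<forall>\<^sub>F q in nhds p. Z q f = Z q g"
 if Z: "smooth_field U Z" and f: "smooth_near p f" and e: "\<forall>\<^sub>F q in nhds p. f q = g q" for Z f g
proof -
 obtain W where W: "open W" "p:W" "smooth W f" using f smooth_near_def by blast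
 obtain W' where W': "open W'" "p:W'" "!!q. q:W' ==> f q = g q" using e by(auto simp:eventually_nhds)
 have "Z q f = Z q g" if "q:U Int W Int W'" for q
 proof -
 have "Z q:CT q" "smooth_near q f"
  using that W `smooth_field U Z` by(auto simp:smooth_field_def intro: smooth_nearI)
 from CT_cong_open[OF this W'(1)] W'(3) that show ?thesis by simp
 qed
 thus ?thesis unfolding eventually_nhds
 by(intro exI[of _ "U Int W Int W'"]) (use U W W' in auto)
qed
have evm: "\<forall>\<^sub>F q in nhds p. Z q (%q. f q*g q) = Z q f*g q + f q*Z q g"
 and eva: "\<forall>\<^sub>F q in nhds p. Z q (%q. f q + g q) = Z q f + Z q g"
 and evc: "\<forall>\<^sub>F q in nhds p. Z q (%q. c*f q) = c*Z q f"
 if Z: "smooth_field U Z" and fg: "smooth_near p f" "smooth_near p g" for Z f g c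
proof -
 obtain W where W: "open W" "p:W" "smooth W f" "smooth W g"
 by(rule smooth_near_combine[OF fg])
 have n: "Z q:CT q" "smooth_near q f" "smooth_near q g" if "q:U Int W" for q
 using that W Z by(auto simp:smooth_field_def intro: smooth_nearI)
 have e: "\<forall>\<^sub>F q in nhds p. q:U Int W" using eventually_nhds_in_open[of "U Int W" p] U W by auto
 show "\<forall>\<^sub>F q in nhds p. Z q (%q. f q*g q) = Z q f*g q + f q*Z q g"
 using e by eventually_elim (auto intro!: CT_mult n)
 show "\<forall>\<^sub>F q in nhds p. Z q (%q. f q + g q) = Z q f + Z q g"
 using e by eventually_elim (auto intro!: CT_add n)
 show "\<forall>\<^sub>F q in nhds p. Z q (%q. c*f q) = c*Z q f"
 using e by eventually_elim (auto intro!: CT_cmult n)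
qed
have cong: "X p (%q. Y q f) - Y p (%q. X q f) = X p (%q. Y q g) - Y p (%q. X q g)"
 if f: "smooth_near p f" and e: "\<forall>\<^sub>F q in nhds p. f q = g q" for f g
 using CT_cong[OF XC nY[OF f] ev[OF Y f e]] CT_cong[OF YC nX[OF f] ev[OF X f e]] by simp
show ?thesis
proof(rule CT_I)
 fix f g assume f: "smooth_near p f" and e: "\<forall>\<^sub>F q in nhds p. f q = g q"
 show "lie X Y p f = lie X Y p g"
 using cong[OF f e] smooth_near_cong[OF f e] f by(simp add:lie_def)
next
 fix f g assume f: "smooth_near p f" and g: "smooth_near p g"
 have "X p (%q. Y q (%q. f q + g q)) = X p (%q. Y q f + Y q g)"
 by(rule CT_cong[OF XC _ eva[OF Y f g]]) (intro nY smooth_near_add f g)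
 moreover have "Y p (%q. X q (%q. f q + g q)) = Y p (%q. X q f + X q g)"
 by(rule CT_cong[OF YC _ eva[OF X f g]]) (intro nX smooth_near_add f g)
 ultimately show "lie X Y p (%q. f q + g q) = lie X Y p f + lie X Y p g"
 using f g nX[OF f] nX[OF g] nY[OF f] nY[OF g]
 by(simp add:lie_def smooth_near_add CT_add[OF XC] CT_add[OF YC])
 have "X p (%q. Y q (%q. f q*g q)) = X p (%q. Y q f*g q + f q*Y q g)"
 by(rule CT_cong[OF XC _ evm[OF Y f g]]) (intro nY smooth_near_mult f g)
 moreover have "Y p (%q. X q (%q. f q*g q)) = Y p (%q. X q f*g q + f q*X q g)"
 by(rule CT_cong[OF YC _ evm[OF X f g]]) (intro nX smooth_near_mult f g)
 ultimately show "lie X Y p (%q. f q*g q) = lie X Y p f*g p + f p*lie X Y p g"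
 using f g nX[OF f] nX[OF g] nY[OF f] nY[OF g]
 by(simp add:lie_def smooth_near_mult smooth_near_add CT_add[OF XC] CT_add[OF YC]
  CT_mult[OF XC] CT_mult[OF YC] algebra_simps)
next
 fix f :: "'p => complex" and c assume f: "smooth_near p f"
 have "X p (%q. Y q (%q. c*f q)) = X p (%q. c*Y q f)"
 by(rule CT_cong[OF XC _ evc[OF Y f f]]) (intro nY smooth_near_mult f smooth_near_const)
 moreover have "Y p (%q. X q (%q. c*f q)) = Y p (%q. c*X q f)"
 by(rule CT_cong[OF YC _ evc[OF X f f]]) (intro nX smooth_near_mult f smooth_near_const)
 ultimately show "lie X Y p (%q. c*f q) = c*lie X Y p f"
 using f nX[OF f] nY[OF f]
 by(simp add:lie_def smooth_near_mult CT_cmult[OF XC] CT_cmult[OF YC] algebra_simps)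
qed (simp add:lie_def)
qed

end

subsection \<open>Changing a single coordinate\<close>

text \<open>Only the coordinate along \<open>b\<close> is exchanged for \<open>G\<close>, so that
  the inverse of the differential of \<open>Ps\<close> is the explicit \<open>Q\<close>. The
  differential of the inverse map \<open>g\<close> at \<open>y\<close> is then
  \<open>Q (g y)\<close>, which gains one order of smoothness at each induction step.\<close>

lemma smooth_local_inverse:
fixes Ps :: "'e::euclidean_space => 'e"
assumes b: "b:Basis" and B: "open B" "x0:B" and G: "Cinf_on B G" and nz: "dd b G x0 ~= (0::real)"
 and Ps: "!!x. Ps x = x + (G x - x <.> b) *R b"
obtains U V g where "open U" "U <= B" "x0:U" "open V" "homeomorphism U V Ps g"
 "Cinf_on U Ps" "Cinf_on V g"
proof -
define B' where "B' = {x:B. dd b G x ~= 0}"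
have cG: "continuous_on B (dd v G)" for v using Cinf_cont[OF Cinf_dd[OF G]] .
have "open (B Int dd b G -` (- {0}))"
 using continuous_openin_preimage_gen[OF cG, of "- {0}"] B(1) openin_open_trans by(metis open_Compl closed_singleton)
hence B': "open B'" "x0:B'" "B' <= B" using B nz by(auto simp:B'_def vimage_def Int_def)
have PsC: "Cinf_on B Ps" unfolding Ps[abs_def]
 by(intro Cinf_add Cinf_scaleR Cinf_diff Cinf_inner_const Cinf_id Cinf_const G B(1))
define P where "P x v = v + (dd v G x - v <.> b) *R b" for x v
\<comment> \<open>The solution \<open>v\<close> of \<open>P x v = w\<close>: off \<open>b\<close>
  the components agree, \<open>w <.> b\<close> is the derivative of \<open>G\<close> along
  \<open>v\<close>, and this determines \<open>v <.> b\<close> where \<open>dd b G x\<close> is not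
  0.\<close>
define Q where "Q x w = w + (((w <.> b) - dd w G x + (w <.> b)*dd b G x)/dd b G x - w <.> b) *R b" for x w
have bb: "b <.> b = 1" using b by simp
have lin: "linear (%v. dd v G x)" if "x:B" for x
 using bounded_linear.linear[OF bounded_linear_dd[OF Cinf_differentiable[OF G that]]] .
have D: "(Ps has_derivative P x) (at x)" if "x:B" for x
 unfolding Ps[abs_def] P_def
 by(auto intro!: derivative_eq_intros Cinf_deriv[OF G that])
have blP: "bounded_linear (P x)" if "x:B" for x using D[OF that] has_derivative_bounded_linear by blast
have blQ: "bounded_linear (Q x)" if "x:B" for x
 unfolding Q_def linear_conv_bounded_linear[symmetric]
 by(rule linearI) (simp_all add:linear_add[OF lin[OF that]] linear_scale[OF lin[OF that]]
  inner_add_left algebra_simps add_divide_distrib diff_divide_distrib)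
have QP: "Q x (P x v) = v" if "x:B'" for x v
proof -
 have x: "x:B" "dd b G x ~= 0" using that by(auto simp:B'_def)
 have 1: "P x v <.> b = dd v G x" by(simp add:P_def inner_add_left bb)
 have 2: "dd (P x v) G x = dd v G x + (dd v G x - v <.> b)*dd b G x"
 by(simp add:P_def linear_add[OF lin[OF x(1)]] linear_scale[OF lin[OF x(1)]])
 have "((P x v <.> b) - dd (P x v) G x + (P x v <.> b)*dd b G x)/dd b G x = v <.> b"
 unfolding 1 2 using x(2) by(simp add:field_simps)
 hence "Q x (P x v) = P x v + (v <.> b - dd v G x) *R b" by(simp only: Q_def 1)
 also have "... = v" by(simp add:P_def algebra_simps)
 finally show ?thesis .
qed
define f' where "f' x = Blinfun (P x)" for x
have f': "blinfun_apply (f' x) = P x" if "x:B" for x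
 unfolding f'_def by(rule bounded_linear_Blinfun_apply[OF blP[OF that]])
have cf': "continuous_on B' f'"
proof(rule continuous_on_blinfun_componentwise)
 fix i :: 'e
 have "continuous_on B' (%x. P x i)" unfolding P_def
 by(intro continuous_intros continuous_on_subset[OF cG B'(3)])
 thus "continuous_on B' (%x. blinfun_apply (f' x) i)"
 by(rule continuous_on_eq) (use f' B' in auto)
qed
have inv: "Blinfun (Q x0) o\<^sub>L f' x0 = id_blinfun"
 by(rule blinfun_eqI) (simp add:bounded_linear_Blinfun_apply[OF blQ[OF B(2)]] f'[OF B(2)] QP[OF B'(2)])
have D': "(Ps has_derivative blinfun_apply (f' x)) (at x)" if "x:B'" for x
 using D[of x] f'[of x] that B' by auto
obtain U V g g' where UV: "open U" "U <= B'" "x0:U" "open V" "homeomorphism U V Ps g"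
 and g: "!!y. y:V ==> (g has_derivative (g' y)) (at y)"
 "!!y. y:V ==> g' y = inv (blinfun_apply (f' (g y)))"
 "!!y. y:V ==> bij (blinfun_apply (f' (g y)))"
 by(rule inverse_function_theorem[OF B'(1) D' cf' B'(2) inv]) (assumption | rule that)+
have gU: "g y:U" if "y:V" for y using UV(5) that by(auto simp:homeomorphism_def)
have gQ: "g' y = Q (g y)" if yV: "y:V" for y
proof
 fix w
 have gy: "g y:B'" "g y:B" using gU[OF yV] UV(2) B'(3) by auto
 obtain v where v: "w = P (g y) v" using g(3)[OF yV] f'[OF gy(2)] by(metis bij_pointE)
 have "inj (P (g y))" using g(3)[OF yV] f'[OF gy(2)] by(simp add:bij_def)
 thus "g' y w = Q (g y) w"
 using g(2)[OF yV] f'[OF gy(2)] v QP[OF gy(1)] by simp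
qed
have gc: "Cinf_on V g" unfolding Cinf_on_def
proof
 fix k show "Ck_on k V g"
 proof(induction k)
 case 0 show ?case using UV(5) by(simp add:homeomorphism_def)
 next
 case (Suc k)
 have c: "Ck_on k V (%y. dd v G (g y))" for v
  by(rule Ck_on_compose[OF UV(4) B(1) _ Suc])
  (use gU UV(2) B'(3) Cinf_dd[OF G] in "auto simp: Cinf_on_def")
 have nz: "dd b G (g y) ~= 0" if "y:V" for y using gU[OF that] UV(2) by(auto simp:B'_def)
 have Qc: "Ck_on k V (%y. Q (g y) w)" for w
  unfolding Q_def divide_inverse diff_conv_add_uminus
  by(intro Ck_on_add Ck_on_scaleR Ck_on_mult Ck_on_inverse Ck_on_const c nz UV(4)
   Ck_on_compose_linear[OF bounded_linear_minus[OF bounded_linear_ident]])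
 show ?case
 proof(rule Ck_on_SucI[OF UV(4) g(1)])
  show "Ck_on k V (%y. g' y v)" for v
  using Ck_on_cong[OF UV(4), of "%y. g' y v" "%y. Q (g y) v" k] Qc gQ by simp
 qed
 qed
qed
show ?thesis
 by(rule that[OF UV(1) order_trans[OF UV(2) B'(3)] UV(3,4,5)
  Cinf_subset[OF PsC order_trans[OF UV(2) B'(3)]] gc])
qed

context smooth_manifold begin

lemma lchart_compose:
assumes l: "lchart V ka ka'" and h: "homeomorphism (ka ` V) T Ps g" and T: "open T"
 and C: "Cinf_on (ka ` V) Ps" "Cinf_on T g"
shows "lchart V (%q. Ps (ka q)) (%x. ka' (g x))"
unfolding lchart_def
proof(intro conjI allI impI)
have im: "(%q. Ps (ka q)) ` V = T" using h by(auto simp:homeomorphism_def image_image)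
have hm: "homeomorphism V T (Ps \<circ> ka) (ka' \<circ> g)"
 by(rule homeomorphism_compose[OF _ h]) (use l in "simp add: lchart_def")
thus "homeomorphism V ((%q. Ps (ka q)) ` V) (%q. Ps (ka q)) (%x. ka' (g x))"
 by(simp add:im o_def)
show "open V" "open ((%q. Ps (ka q)) ` V)" using T lchart_open[OF l] by(auto simp:im)
fix U f assume U: "open U" "U <= V"
have o1: "open (ka ` U)" by(rule lchart_image[OF l U])
have o2: "open ((%q. Ps (ka q)) ` U)"
 using open_image_homeomorphism[OF hm T U] by simp
have gi: "g (Ps x) = x" if "x:ka ` V" for x using h that by(auto simp:homeomorphism_def)
have sub: "(%q. Ps (ka q)) ` U <= T" using im U by auto
show "smooth U f \<longleftrightarrow> Cinf_on ((%q. Ps (ka q)) ` U) (%x. f (ka' (g x)))"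
proof
 assume "smooth U f"
 hence *: "Cinf_on (ka ` U) (%x. f (ka' x))" using lchart_smooth_iff[OF l U] by simp
 show "Cinf_on ((%q. Ps (ka q)) ` U) (%x. f (ka' (g x)))"
 by(rule Cinf_compose[OF o2 o1 _ Cinf_subset[OF C(2) sub] *]) (use gi U in auto)
next
 assume *: "Cinf_on ((%q. Ps (ka q)) ` U) (%x. f (ka' (g x)))"
 have "Cinf_on (ka ` U) (%x. f (ka' (g (Ps x))))"
 by(rule Cinf_compose[OF o1 o2 _ Cinf_subset[OF C(1) image_mono[OF U(2)]] *]) auto
 hence "Cinf_on (ka ` U) (%x. f (ka' x))"
 by(rule Cinf_cong[OF o1, THEN iffD1, rotated]) (use gi U in auto)
 thus "smooth U f" using lchart_smooth_iff[OF l U] by simp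
qed
qed

lemma lchart_translate:
assumes l: "lchart V ka ka'" shows "lchart V (%q. ka q - c) (%x. ka' (x + c))"
proof(rule lchart_compose[OF l, where T = "(%x. x - c) ` ka ` V"])
have "open (ka ` V)" using l by(simp add:lchart_def)
thus o: "open ((%x. x - c) ` ka ` V)" using open_translation_subtract by blast
show "homeomorphism (ka ` V) ((%x. x - c) ` ka ` V) (%x. x - c) (%x. x + c)"
 by(auto simp:homeomorphism_def image_image intro!: continuous_intros)
show "Cinf_on (ka ` V) (%x. x - c)" "Cinf_on ((%x. x - c) ` ka ` V) (%x. x + c)"
 using o \<open>open (ka ` V)\<close> by(intro Cinf_diff Cinf_add Cinf_id Cinf_const; simp)+
qed

text \<open>Serves twice: to turn coordinates into real parts of CR functions, and to turn a
  defining function into a coordinate.\<close>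

lemma lchart_replace:
assumes l: "lchart V ka ka'" "p:V" and b: "b:Basis"
 and g: "smooth_near p (%q. cor (g q))"
 and nz: "dd b (%x. cor (g (ka' x))) (ka p) ~= 0"
obtains V1 ka1 ka1' where "lchart V1 ka1 ka1'" "p:V1" "V1 <= V"
 "!!q. q:V1 ==> ka1 q = ka q + (g q - ka q <.> b) *R b"
proof -
obtain r where r: "r > 0" "ball (ka p) r <= ka ` V"
 "Cinf_on (ball (ka p) r) (%x. cor (g (ka' x)))"
 by(rule smooth_near_ball[OF l g])
define G where "G x = g (ka' x)" for x
have G: "Cinf_on (ball (ka p) r) G"
 using Cinf_Re[OF open_ball r(3)] by(simp add:G_def[abs_def])
have "((%x. cor (G x)) has_derivative (%v. cor (dd v G (ka p)))) (at (ka p))"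
 by(rule has_derivative_of_real) (use r(1) Cinf_deriv[OF G] in auto)
from dd_eq[OF this, of b]
have "dd b (%x. cor (g (ka' x))) (ka p) = cor (dd b G (ka p))"
 by(simp add:G_def)
with nz have nz': "dd b G (ka p) ~= 0" by auto
obtain U T h where U: "open U" "U <= ball (ka p) r" "ka p:U" "open T"
 "homeomorphism U T (%x. x + (G x - x <.> b) *R b) h"
 "Cinf_on U (%x. x + (G x - x <.> b) *R b)" "Cinf_on T h"
 using smooth_local_inverse[OF b open_ball _ G nz', of "%x. x + (G x - x <.> b) *R b"] r(1) by auto
define V1 where "V1 = V Int ka -` U"
have V1: "open V1" "ka ` V1 = U" "V1 <= V" "p:V1"
 using lchart_vimage[OF l(1) U(1)] U(2,3) r(2) l(2) by(auto simp:V1_def)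
have l1: "lchart V1 ka ka'" by(rule lchart_subset[OF l(1) V1(1,3)])
have "lchart V1 (%q. ka q + (G (ka q) - ka q <.> b) *R b) (%x. ka' (h x))"
 using lchart_compose[OF l1, unfolded V1(2), OF U(5,4,6,7)] .
thus ?thesis
 by(rule that[OF _ V1(4,3)]) (simp add:G_def lchart_inv[OF l1])
qed

end

section \<open>Charts by real parts of CR functions\<close>

lemma sum_fun_apply: "(SUM i:I. F i) x = (SUM i:I. F i x)"
by(induction I rule: infinite_finite_induct) auto

lemma cconj_sum: "cconj (SUM i:I. F i) = (SUM i:I. cconj (F i))"
by(rule ext) (simp add:cconj_def sum_fun_apply)

lemma cconj_real: "(!!q. cnj (f q) = f q) ==> cconj v f = cnj (v f)"
by(simp add:cconj_def)

context smooth_manifold begin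

lemma cconj_xc: "cconj v (xc ka b) = cnj (v (xc ka b))"
by(rule cconj_real) (simp add:xc_def)

lemma CT_split:
assumes v: "v:CT p" and f: "smooth_near p f"
shows "v f = v (%q. cor (Re (f q))) + \<i> * v (%q. cor (Im (f q)))"
proof -
obtain U where U: "open U" "p:U" "smooth U f" using f smooth_near_def by blast
have s: "smooth_near p (%q. cor (Re (f q)))" "smooth_near p (%q. cor (Im (f q)))"
 using smooth_of_Re[OF U(1,3)] smooth_of_Im[OF U(1,3)] U smooth_nearI by auto
have "v (%q. cor (Re (f q)) + \<i>*cor (Im (f q)))
 = v (%q. cor (Re (f q))) + v (%q. \<i>*cor (Im (f q)))"
 by(rule CT_add[OF v s(1) smooth_near_mult[OF smooth_near_const s(2)]])
thus ?thesis using CT_cmult[OF v s(2), of \<i>] by(simp flip: complex_eq)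
qed

lemma coord_vec_TM:
assumes l: "lchart V ka ka'" "p:V" and "!!b. b:Basis ==> cnj (c b) = c b"
shows "coord_vec ka ka' p c:TM p"
using CT_eqI[OF l CT_cconj[OF coord_vec_CT[OF l]] coord_vec_CT[OF l]] coord_vec_CT[OF l] assms(3)
by(simp add:TM_def cconj_xc coord_vec_xc[OF l])

end

context cr_manifold begin

section \<open>Frames and sections of \<open>T01\<close>, and CR coordinates\<close>

lemma T01_frame:
obtains U E where "open U" "p:U" "ALL j<n. smooth_field U (E j)"
 "ALL q:U. T01 q = cvec.span ((%j. E j q) ` {..<n}) & cvec.dim (T01 q) = n"
using bspec[OF T01_subbundle[unfolded subbundle_def] UNIV_I, of p] by(elim exE conjE) (rule that)

lemma T01_subset_CT: "T01 q <= CT q"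
proof -
obtain U E where U: "open U" "q:U" "ALL j<n. smooth_field U (E j)"
 "ALL q:U. T01 q = cvec.span ((%j. E j q) ` {..<n}) & cvec.dim (T01 q) = n"
 by(rule T01_frame)
have "(%j. E j q) ` {..<n} <= CT q" using U(2,3) smooth_field_CT by auto
thus ?thesis using bspec[OF U(4) U(2), THEN conjunct1] cvec.span_minimal[OF _ CT_subspace] by simp
qed

lemma T01_CT: "Z:T01 q ==> Z:CT q" using T01_subset_CT by auto

lemma T01_subspace: "cvec.subspace (T01 q)"
proof -
obtain U E where U: "open U" "q:U" "ALL j<n. smooth_field U (E j)"
 "ALL q:U. T01 q = cvec.span ((%j. E j q) ` {..<n}) & cvec.dim (T01 q) = n"
 by(rule T01_frame)
show ?thesis using bspec[OF U(4) U(2), THEN conjunct1] by simp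
qed

lemma T01_add: "Y:T01 q ==> Z:T01 q ==> Y + Z:T01 q"
using T01_subspace cvec.subspace_add by blast

lemma T01_cscale: "Z:T01 q ==> cscale c Z:T01 q"
using T01_subspace cvec.subspace_scale by blast

lemma T01_zero: "0:T01 q"
using T01_subspace cvec.subspace_0 by blast

lemma T01_sum: "(!!i. i:I ==> F i:T01 q) ==> (SUM i:I. F i):T01 q"
by(rule cvec.subspace_sum[OF T01_subspace])

lemma span_finite_family:
fixes E :: "nat => 'p cvec"
assumes "W:cvec.span (E ` {..<k})" shows "EX c. W = (SUM j<k. cscale (c j) (E j))"
using assms
proof(induction k arbitrary: W)
case (Suc k)
have "W:cvec.span (insert (E k) (E ` {..<k}))"
 using Suc.prems by(simp add:lessThan_Suc)
then obtain a where "W - cscale a (E k):cvec.span (E ` {..<k})" using cvec.span_breakdown_eq by blast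
from Suc.IH[OF this] obtain c where c: "W - cscale a (E k) = (SUM j<k. cscale (c j) (E j))" by blast
have "W = (SUM j<Suc k. cscale ((c(k := a)) j) (E j))"
 using c by(simp add:algebra_simps)
thus ?case by blast
qed simp

text \<open>Extension with constant coefficients in a local frame; hence one neighbourhood serves
  all vectors at \<open>p\<close>, in particular every finite family.\<close>

lemma T01_extend:
obtains U where "open U" "p:U" "ALL W:T01 p. EX Z:sections U. Z p = W"
proof -
obtain U E where U: "open U" "p:U" "ALL j<n. smooth_field U (E j)"
 "ALL q:U. T01 q = cvec.span ((%j. E j q) ` {..<n}) & cvec.dim (T01 q) = n"
 by(rule T01_frame)
have "EX Z:sections U. Z p = W" if "W:T01 p" for W
proof -
 from that bspec[OF U(4) U(2), THEN conjunct1] have "W:cvec.span ((%j. E j p) ` {..<n})" by simp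
 from span_finite_family[OF this] obtain c where c: "W = (SUM j<n. cscale (c j) (E j p))" by blast
 have "smooth_field U (%q. SUM j<n. cscale (c j) (E j q))"
 by(intro smooth_field_sum smooth_field_scale smooth_const) (simp add:U(3))
 moreover have "(SUM j<n. cscale (c j) (E j q)):T01 q" if "q:U" for q
 by(rule T01_sum, rule T01_cscale) (use bspec[OF U(4) that, THEN conjunct1] in "auto intro: cvec.span_base")
 ultimately show ?thesis using c by(intro bexI[of _ "%q. SUM j<n. cscale (c j) (E j q)"]) (auto simp:sections_def)
qed
thus ?thesis by(intro that[OF U(1,2)] ballI)
qed

lemma sections_smooth_field: "Z:sections U ==> smooth_field U Z" by(simp add:sections_def)
lemma sections_T01: "Z:sections U ==> q:U ==> Z q:T01 q" by(simp add:sections_def)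
lemma sections_subset: "Z:sections U ==> W <= U ==> Z:sections W"
by(auto simp:sections_def intro: smooth_field_subset)

text \<open>What remains of a local embedding: the holomorphic coordinates of the ambient manifold,
  pulled back to \<open>U\<close>.\<close>

definition CR_coords :: "'p set => nat => (nat => 'p => complex) => bool" where
"CR_coords U m z \<longleftrightarrow> open U & (ALL i<m. smooth U (z i)) &
 (ALL q:U. T01 q = {Z:CT q. ALL i<m. Z (z i) = 0}) &
 (ALL q:U. ALL v:TM q. (ALL i<m. v (z i) = 0) --> v = 0)"

lemma CR_coords_open: "CR_coords U m z ==> open U" by(simp add:CR_coords_def)

lemma CR_coords_smooth: "CR_coords U m z ==> i < m ==> smooth U (z i)" by(simp add:CR_coords_def)

lemma CR_coords_T01: "CR_coords U m z ==> q:U ==> T01 q = {Z:CT q. ALL i<m. Z (z i) = 0}"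
unfolding CR_coords_def by(elim conjE) (rule bspec)

lemma CR_coords_inj:
"CR_coords U m z ==> q:U ==> v:TM q ==> ALL i<m. v (z i) = 0 ==> v = 0"
unfolding CR_coords_def by(elim conjE) (drule(1) bspec, drule(1) bspec, drule(1) bspec, drule(1) mp)

lemma CR_coords_subset:
assumes c: "CR_coords U m z" and W: "open W" "W <= U" shows "CR_coords W m z"
unfolding CR_coords_def
proof(intro conjI allI impI ballI W(1))
show "smooth W (z i)" if "i < m" for i by(rule smooth_subset[OF CR_coords_smooth[OF c that] W(2)])
show "T01 q = {Z:CT q. ALL i<m. Z (z i) = 0}" if "q:W" for q
 by(rule CR_coords_T01[OF c subsetD[OF W(2) that]])
show "v = 0" if "q:W" "v:TM q" "ALL i<m. v (z i) = 0" for q v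
 by(rule CR_coords_inj[OF c subsetD[OF W(2) that(1)] that(2,3)])
qed

lemma embeddable_CR_coords:
assumes "locally_CR_embeddable TYPE('x) p"
obtains U m z where "CR_coords U m z" "p:U"
proof -
obtain V and X :: "'x topology" and N B io where
 V: "open V" "p:V" and X: "complex_manifold X N B" and e: "embedding_map (top_of_set V) X io"
 and s: "ALL (W,fi):B. ALL i<N. smooth {q:V. io q:W} (%q. fi (io q) i)"
 and inj: "ALL q:V. ALL (W,fi):B. io q:W --> (ALL v:TM q. (ALL i<N. v (%q'. fi (io q') i) = 0) --> v = 0)"
 and T: "ALL q:V. ALL (W,fi):B. io q:W --> T01 q = {Z:CT q. ALL i<N. Z (%q'. fi (io q') i) = 0}"
 using assms unfolding locally_CR_embeddable_def by(elim exE conjE) (rule that)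
interpret X: complex_manifold X N B by(rule X)
have c: "continuous_map (top_of_set V) X io"
 using e embedding_map_def homeomorphic_imp_continuous_map continuous_map_in_subtopology by metis
have "io p:topspace X" using continuous_map_image_subset_topspace[OF c] V by auto
hence "io p:(UN (V,fi):B. V)" using X.covering by simp
then obtain W fi where W: "(W,fi):B" "io p:W" by auto
have oW: "openin X W" using X.chart[OF W(1)] by blast
have "openin (top_of_set V) {q:topspace (top_of_set V). io q:W}"
 by(rule openin_continuous_map_preimage[OF c oW])
hence o: "open {q:V. io q:W}" using V(1) openin_open_trans by fastforce
have "CR_coords {q:V. io q:W} N (%i q. fi (io q) i)"
 unfolding CR_coords_def
proof(intro conjI ballI allI impI o)
 fix i assume "i < N" thus "smooth {q:V. io q:W} (%q. fi (io q) i)" using s W(1) by auto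
next
 fix q assume q: "q:{q:V. io q:W}"
 show "T01 q = {Z:CT q. ALL i<N. Z (%q. fi (io q) i) = 0}" using T q W(1) by fast
 fix v assume "v:TM q" "ALL i<N. v (%q. fi (io q) i) = 0"
 thus "v = 0" using inj q W(1) by fast
qed
thus ?thesis using that W(2) V(2) by blast
qed

text \<open>The functions \<open>ze b\<close> are CR and their real parts are the coordinates. A
  vector of type (0,1) annihilates \<open>ze b\<close>, so that its values on a coordinate and on
  the conjugate of \<open>ze b\<close> are proportional.\<close>

definition ph_chart ::
"nat => (nat => 'p => complex) => 'p set => ('p => 'e) => ('e => 'p) => ('e => 'p => complex) => bool" where
"ph_chart m z V ka ka' ze \<longleftrightarrow> lchart V ka ka' & CR_coords V m z &
 (ALL b:Basis. smooth V (ze b) & (ALL q:V. ALL Z:T01 q. Z (ze b) = 0) & (ALL q:V. Re (ze b q) = ka q <.> b))"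

text \<open>Exchange the coordinates one at a time. Some \<open>z i\<close> has nonzero derivative
  along the coordinate vector of \<open>b\<close>, as no nonzero real vector is annihilated by all
  of them; if that derivative comes from the imaginary part, \<open>- \<i> * z i\<close> is used,
  which is again CR.\<close>

lemma ph_chart_exists:
assumes cc: "CR_coords U m z" "p:U"
obtains V ka ka' ze where "ph_chart m z V ka ka' ze" "p:V" "V <= U"
proof -
have oU: "open U" using cc by(simp add:CR_coords_def)
have "EX V ka ka' ze. lchart V ka ka' & p:V & V <= U &
 (ALL b:S. smooth U (ze b) & (ALL q:U. ALL Z:T01 q. Z (ze b) = 0) & (ALL q:V. Re (ze b q) = ka q <.> b))"
 if "S <= Basis" for S :: "'e set"
 using finite_subset[OF that finite_Basis] that
proof(induction S rule: finite_induct)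
 case empty
 obtain V ka ka' where l: "lchart V ka ka'" "p:V" using lchart_exists by blast
 have "lchart (V Int U) ka ka'" by(rule lchart_subset[OF l(1)]) (use lchart_open[OF l(1)] oU in auto)
 thus ?case using l cc by auto
next
 case (insert b S)
 then obtain V ka ka' ze where IH: "lchart V ka ka'" "p:V" "V <= U"
 "ALL b:S. smooth U (ze b) & (ALL q:U. ALL Z:T01 q. Z (ze b) = 0) & (ALL q:V. Re (ze b q) = ka q <.> b)"
 by auto
 have b: "b:Basis" using insert by auto
 define v where "v = coord_vec ka ka' p (%b'. if b' = b then 1 else 0)"
 have vx: "v (xc ka b) = 1" using coord_vec_xc[OF IH(1,2) b] by(simp add:v_def)
 have vT: "v:TM p" unfolding v_def by(rule coord_vec_TM[OF IH(1,2)]) simp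
 hence vC: "v:CT p" by(simp add:TM_def)
 have vd: "v f = dd b (%x. f (ka' x)) (ka p)" if "smooth_near p f" for f
 proof -
 have "(SUM b':Basis. (if b' = b then 1 else 0)*dd b' (%x. f (ka' x)) (ka p))
  = (SUM b':Basis. if b' = b then dd b' (%x. f (ka' x)) (ka p) else 0)"
  by(rule sum.cong) auto
 thus ?thesis using that b by(simp add:v_def coord_vec_def)
 qed
 have "v ~= 0" using vx by auto
 then obtain i where i: "i < m" "v (z i) ~= 0" using CR_coords_inj[OF cc vT] by blast
 have zs: "smooth U (z i)" and zT: "ALL q:U. ALL Z:T01 q. Z (z i) = 0" 
 using CR_coords_smooth[OF cc(1) i(1)] CR_coords_T01[OF cc(1)] i(1) by auto
 have sz: "smooth_near p (z i)" by(rule smooth_nearI[OF oU cc(2) zs])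
 have "v (%q. cor (Re (z i q))) ~= 0 | v (%q. cor (Im (z i q))) ~= 0"
 using CT_split[OF vC sz] i(2) by auto
 then obtain ze0 where ze0: "smooth U ze0" "ALL q:U. ALL Z:T01 q. Z ze0 = 0"
 "v (%q. cor (Re (ze0 q))) ~= 0"
 proof
 assume "v (%q. cor (Re (z i q))) ~= 0"
 with that[of "z i"] zs zT show thesis by blast
 next
 assume *: "v (%q. cor (Im (z i q))) ~= 0"
 have "Z (%q. (- \<i>)*z i q) = 0" if "q:U" "Z:T01 q" for q Z
  using CT_cmult[OF T01_CT[OF that(2)] smooth_nearI[OF oU that(1) zs], of "- \<i>"] zT that by auto
 moreover have "v (%q. cor (Re ((- \<i>)*z i q))) ~= 0" using * by simp
 ultimately show thesis using that[OF smooth_mult[OF oU smooth_const[of U "- \<i>"] zs]] by blast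
 qed
 have s0: "smooth_near p (%q. cor (Re (ze0 q)))"
 by(rule smooth_nearI[OF oU cc(2) smooth_of_Re[OF oU ze0(1)]])
 obtain V1 ka1 ka1' where l1: "lchart V1 ka1 ka1'" "p:V1" "V1 <= V"
 "!!q. q:V1 ==> ka1 q = ka q + (Re (ze0 q) - ka q <.> b) *R b"
 using lchart_replace[OF IH(1,2) b s0] ze0(3) vd[OF s0] by metis
 have "ALL b':insert b S. smooth U ((ze(b := ze0)) b') & (ALL q:U. ALL Z:T01 q. Z ((ze(b := ze0)) b') = 0) &
 (ALL q:V1. Re ((ze(b := ze0)) b' q) = ka1 q <.> b')"
 proof
 fix b' assume b': "b':insert b S"
 have ib: "b <.> b' = (if b' = b then 1 else 0)" using b' insert.prems by(auto simp:inner_Basis)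
 show "smooth U ((ze(b := ze0)) b') & (ALL q:U. ALL Z:T01 q. Z ((ze(b := ze0)) b') = 0) &
 (ALL q:V1. Re ((ze(b := ze0)) b' q) = ka1 q <.> b')"
  using b' ze0 IH(4) l1(3,4) ib by(cases "b' = b") (auto simp:inner_add_left)
 qed
 thus ?case using l1 IH(3) by(intro exI[of _ V1] exI[of _ ka1] exI[of _ ka1'] exI[of _ "ze(b := ze0)"]) auto
qed
from this[OF order_refl] obtain V ka ka' ze where *: "lchart V ka ka'" "p:V" "V <= U"
 "ALL b:Basis. smooth U (ze b) & (ALL q:U. ALL Z:T01 q. Z (ze b) = 0) & (ALL q:V. Re (ze b q) = ka q <.> b)"
 by blast
have "ph_chart m z V ka ka' ze"
 unfolding ph_chart_def
 using * CR_coords_subset[OF cc(1) lchart_open[OF *(1)] *(3)] smooth_subset[OF _ *(3)] by auto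
thus ?thesis using that * by blast
qed

end

section \<open>The Levi form in a chart of real parts of CR functions\<close>

context smooth_manifold begin

definition pd :: "('p => 'e) => ('e => 'p) => 'e => ('p => complex) => 'p => complex" where
"pd ka ka' b h q = dd b (%x. h (ka' x)) (ka q)"

text \<open>For \<open>s\<close> the components of a sum of tensors
  \<open>tensor (Z j) (cconj (Z j))\<close> this is the second order part of the sum of the
  \<open>Z j (cconj (Z j) h)\<close>.\<close>

definition contr :: "('p => 'e) => ('e => 'p) => 'p => ('e => 'e => complex) => ('p => complex) => complex" where
"contr ka ka' q s h = (SUM a:Basis. SUM b:Basis. s a b*pd ka ka' a (pd ka ka' b h) q)"

lemma CT_pd:
"lchart V ka ka' ==> q:V ==> v:CT q ==> smooth_near q f ==> v f = (SUM b:Basis. v (xc ka b)*pd ka ka' b f q)"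
unfolding pd_def by(rule CT_coord)

lemma smooth_pd: "lchart V ka ka' ==> open U ==> U <= V ==> smooth U f ==> smooth U (pd ka ka' b f)"
unfolding pd_def[abs_def] by(rule smooth_dd)

lemma smooth_near_pd:
assumes "lchart V ka ka'" "q:V" "smooth_near q f" shows "smooth_near q (pd ka ka' b f)"
proof -
obtain U where "open U" "q:U" "smooth U f" using assms(3) smooth_near_def by blast
hence "open (U Int V)" "q:U Int V" "smooth (U Int V) f"
 using assms(2) lchart_open[OF assms(1)] by(auto intro: smooth_subset)
thus ?thesis using smooth_nearI smooth_pd[OF assms(1)] Int_lower2 by metis
qed

lemma pd_pd:
assumes l: "lchart V ka ka'" "q:V"
shows "pd ka ka' a (pd ka ka' b h) q = dd a (dd b (%x. h (ka' x))) (ka q)"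
unfolding pd_def
by(rule dd_cong[OF lchart_image[OF l(1) lchart_open[OF l(1)] order_refl]])
 (use l lchart_inv[OF l(1)] in auto)

lemma pd_commute:
assumes l: "lchart V ka ka'" "q:V" and h: "smooth_near q h"
shows "pd ka ka' a (pd ka ka' b h) q = pd ka ka' b (pd ka ka' a h) q"
proof -
obtain r where r: "r > 0" "ball (ka q) r <= ka ` V" "Cinf_on (ball (ka q) r) (%x. h (ka' x))"
 by(rule smooth_near_ball[OF l h])
show ?thesis unfolding pd_pd[OF l]
 by(rule dd_commute[OF open_ball]) (use r in "auto simp: Cinf_on_def")
qed

text \<open>The coordinate vectors as elements of \<open>TM\<close>; the rules for \<open>pd\<close>
  become instances of those for derivations.\<close>

definition pdv :: "('p => 'e) => ('e => 'p) => 'e => 'p => 'p cvec" where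
"pdv ka ka' b q = coord_vec ka ka' q (%b'. if b' = b then 1 else 0)"

lemma pdv_TM: "lchart V ka ka' ==> q:V ==> pdv ka ka' b q:TM q"
unfolding pdv_def by(rule coord_vec_TM) auto

lemma pdv_CT: "lchart V ka ka' ==> q:V ==> pdv ka ka' b q:CT q"
using pdv_TM by(auto simp:TM_def)

lemma pdv_eq:
assumes "b:Basis" "smooth_near q f" shows "pdv ka ka' b q f = pd ka ka' b f q"
proof -
have "(SUM b':Basis. (if b' = b then 1 else 0)*dd b' (%x. f (ka' x)) (ka q))
 = (SUM b':Basis. if b' = b then dd b' (%x. f (ka' x)) (ka q) else 0)"
 by(rule sum.cong) auto
thus ?thesis using assms by(simp add:pdv_def coord_vec_def pd_def)
qed

lemma pd_mult:
assumes l: "lchart V ka ka'" "q:V" and b: "b:Basis" and f: "smooth_near q f" and g: "smooth_near q g"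
shows "pd ka ka' b (%q. f q*g q) q = pd ka ka' b f q*g q + f q*pd ka ka' b g q"
using CT_mult[OF pdv_CT[OF l] f g, of b]
by(simp add:pdv_eq[OF b f] pdv_eq[OF b g] pdv_eq[OF b smooth_near_mult[OF f g]])

lemma pd_add:
assumes l: "lchart V ka ka'" "q:V" and b: "b:Basis" and f: "smooth_near q f" and g: "smooth_near q g"
shows "pd ka ka' b (%q. f q + g q) q = pd ka ka' b f q + pd ka ka' b g q"
using CT_add[OF pdv_CT[OF l] f g, of b]
by(simp add:pdv_eq[OF b f] pdv_eq[OF b g] pdv_eq[OF b smooth_near_add[OF f g]])

lemma pd_cmult:
assumes l: "lchart V ka ka'" "q:V" and b: "b:Basis" and f: "smooth_near q f"
shows "pd ka ka' b (%q. c*f q) q = c*pd ka ka' b f q"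
using CT_cmult[OF pdv_CT[OF l] f, of b c]
by(simp add:pdv_eq[OF b f] pdv_eq[OF b smooth_near_mult[OF smooth_near_const f]])

lemma pd_cnj:
assumes l: "lchart V ka ka'" "q:V" and b: "b:Basis" and f: "smooth_near q f"
shows "pd ka ka' b (%q. cnj (f q)) q = cnj (pd ka ka' b f q)"
proof -
have "cconj (pdv ka ka' b q) = pdv ka ka' b q" using pdv_TM[OF l] by(simp add:TM_def)
hence "pdv ka ka' b q (%q. cnj (f q)) = cnj (pdv ka ka' b q f)"
 using fun_cong[of "cconj (pdv ka ka' b q)" _ "%q. cnj (f q)"] by(simp add:cconj_def)
thus ?thesis using f by(simp add:pdv_eq[OF b])
qed

lemma pd_cong:
"lchart V ka ka' ==> q:V ==> open U ==> q:U ==> (!!q'. q':U ==> f q' = g q') ==> pd ka ka' b f q = pd ka ka' b g q"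
unfolding pd_def by(rule dd_chart_cong) (auto simp:eventually_nhds)

end

context cr_manifold begin

definition levi_vec :: "nat => (nat => 'p => 'p cvec) => 'p => 'p cvec" where
"levi_vec r Z q = (SUM j<r. lie (Z j) (%q. cconj (Z j q)) q)"

lemma levi_vec_CT:
assumes "open U" "q:U" "!!j. j < r ==> Z j:sections U" shows "levi_vec r Z q:CT q"
unfolding levi_vec_def
by(rule cvec.subspace_sum[OF CT_subspace], rule lie_CT[where U = U])
 (use assms in "auto intro: sections_smooth_field smooth_field_cconj")

lemma cconj_levi_vec: "cconj (levi_vec r Z q) = - levi_vec r Z q"
proof -
have "cconj (lie Y (%q. cconj (Y q)) q) f = - lie Y (%q. cconj (Y q)) q f" for Y f
 by(auto simp:cconj_def lie_def)
thus ?thesis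
 unfolding levi_vec_def cconj_sum by(intro ext) (simp add:sum_fun_apply sum_negf)
qed

lemma HM_add: "v:HM q ==> w:HM q ==> v + w:HM q"
proof -
assume "v:HM q" "w:HM q"
then obtain Y Z where "Y:T01 q" "Z:T01 q" "v = cRe Y" "w = cRe Z" by(auto simp:HM_def)
hence "v + w = cRe (Y + Z)" by(auto simp:cRe_def cconj_def cscale_def fun_eq_iff algebra_simps)
thus ?thesis using T01_add[OF `Y : T01 q` `Z : T01 q`] by(auto simp:HM_def)
qed

lemma HM_uminus: "v:HM q ==> - v:HM q"
proof -
assume "v:HM q"
then obtain Y where Y: "Y:T01 q" "v = cRe Y" by(auto simp:HM_def)
hence e: "- v = cRe (cscale (-1) Y)" by(auto simp:cRe_def cconj_def cscale_def fun_eq_iff algebra_simps)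
show ?thesis unfolding HM_def e by(rule imageI[OF T01_cscale[OF Y(1)]])
qed

lemma proj_eqI: assumes "v - w:HM q" shows "proj q v = proj q w"
proof -
have "u - v:HM q \<longleftrightarrow> u - w:HM q" for u
 using HM_add[OF _ assms, of "u - v"] HM_add[OF _ HM_uminus[OF assms], of "u - w"] by auto
thus ?thesis by(auto simp:proj_def)
qed

lemma zero_HM: "0:HM q"
unfolding HM_def using T01_zero by(force simp:cRe_def cconj_def cscale_def fun_eq_iff)

lemma section_zero_derivative:
assumes "open U" "q:U" "v:CT q" "!!q'. q':U ==> f q' = c"
shows "v f = 0"
proof -
have "v (%q. c) = v f"
 by(rule CT_cong_open[OF assms(3) smooth_near_const assms(1,2)]) (use assms(4) in simp)
thus ?thesis using CT_const[OF assms(3), of c] by simp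
qed

lemma second_order:
assumes l: "lchart V ka ka'" and U: "open U" "U <= V" "q:U" and Z: "smooth_field U Z" and h: "smooth_near q h"
shows "Z q (%q'. cconj (Z q') h) =
 (SUM a:Basis. SUM b:Basis. Z q (xc ka a)*cnj (Z q (xc ka b))*pd ka ka' a (pd ka ka' b h) q) +
 (SUM b:Basis. Z q (%q'. cnj (Z q' (xc ka b)))*pd ka ka' b h q)"
proof -
have qV: "q:V" using U by auto
have ZC: "Z q:CT q" using Z U by(simp add:smooth_field_CT)
obtain W where W: "open W" "q:W" "smooth W h" using h smooth_near_def by blast
have sx: "smooth_near q (%q'. cnj (Z q' (xc ka b)))" for b
 by(intro smooth_near_cnj smooth_near_field[OF Z U(1,3)] smooth_near_xc[OF l qV])
note sp = smooth_near_pd[OF l qV h]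
have "Z q (%q'. SUM b:Basis. cnj (Z q' (xc ka b))*pd ka ka' b h q') = Z q (%q'. cconj (Z q') h)"
proof(rule CT_cong_open[OF ZC _ open_Int[OF U(1) W(1)]])
 show "smooth_near q (%q'. SUM b:Basis. cnj (Z q' (xc ka b))*pd ka ka' b h q')"
 by(intro smooth_near_sum smooth_near_mult sx sp)
 fix q' assume q': "q':U Int W"
 hence "cconj (Z q'):CT q'" "smooth_near q' h" "q':V"
 using Z U W by(auto simp:smooth_field_CT CT_cconj intro: smooth_nearI)
 from CT_pd[OF l this(3,1,2)]
 show "(SUM b:Basis. cnj (Z q' (xc ka b))*pd ka ka' b h q') = cconj (Z q') h" by(simp add:cconj_xc)
qed (use U W in auto)
also have "Z q (%q'. SUM b:Basis. cnj (Z q' (xc ka b))*pd ka ka' b h q') =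
 (SUM b:Basis. Z q (%q'. cnj (Z q' (xc ka b))*pd ka ka' b h q'))"
 by(rule CT_sum[OF ZC]) (intro smooth_near_mult sx sp)
also have "... = (SUM b:Basis. Z q (%q'. cnj (Z q' (xc ka b)))*pd ka ka' b h q +
 cnj (Z q (xc ka b))*(SUM a:Basis. Z q (xc ka a)*pd ka ka' a (pd ka ka' b h) q))"
 by(rule sum.cong[OF refl]) (simp add:CT_mult[OF ZC sx sp] CT_pd[OF l qV ZC sp])
also have "... = (SUM b:Basis. Z q (%q'. cnj (Z q' (xc ka b)))*pd ka ka' b h q) +
 (SUM b:Basis. SUM a:Basis. Z q (xc ka a)*cnj (Z q (xc ka b))*pd ka ka' a (pd ka ka' b h) q)"
 by(simp add:sum.distrib sum_distrib_left mult_ac)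
finally show ?thesis
 using sum.swap[of "%b a. Z q (xc ka a)*cnj (Z q (xc ka b))*pd ka ka' a (pd ka ka' b h) q" Basis Basis]
 by(simp add:add.commute)
qed

context
fixes m z V ka ka' ze
assumes ph: "ph_chart m z V ka ka' ze"
begin

lemma ph_lchart: "lchart V ka ka'" using ph by(simp add:ph_chart_def)
lemma ph_open: "open V" using lchart_open[OF ph_lchart] .
lemma ph_coords: "CR_coords V m z" using ph by(simp add:ph_chart_def)
lemma ph_zeta_smooth: "b:Basis ==> smooth V (ze b)" using ph by(simp add:ph_chart_def)
lemma ph_zeta_T01: "b:Basis ==> q:V ==> Z:T01 q ==> Z (ze b) = 0" using ph by(simp add:ph_chart_def)
lemma ph_zeta_Re: "b:Basis ==> q:V ==> Re (ze b q) = ka q <.> b" using ph by(simp add:ph_chart_def)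

lemma CT_zeta:
assumes b: "b:Basis" and q: "q:V" and v: "v:CT q"
shows "v (xc ka b) = (v (ze b) + v (%q. cnj (ze b q)))/2"
proof -
have s: "smooth_near q (ze b)" by(rule smooth_nearI[OF ph_open q ph_zeta_smooth[OF b]])
have "v (%q. (1/2)*(ze b q + cnj (ze b q))) = v (xc ka b)"
proof(rule CT_cong_open[OF v _ ph_open q])
 show "smooth_near q (%q. (1/2)*(ze b q + cnj (ze b q)))"
 by(intro smooth_near_mult smooth_near_add s smooth_near_cnj smooth_near_const)
qed (simp add:xc_def complex_add_cnj ph_zeta_Re[OF b])
moreover have "v (%q. (1/2)*(ze b q + cnj (ze b q))) = (1/2) * v (%q. ze b q + cnj (ze b q))"
 by(rule CT_cmult[OF v]) (intro smooth_near_add s smooth_near_cnj)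
moreover have "v (%q. ze b q + cnj (ze b q)) = v (ze b) + v (%q. cnj (ze b q))"
 by(rule CT_add[OF v s smooth_near_cnj[OF s]])
ultimately show ?thesis by simp
qed

lemma cconj_zeta:
assumes "b:Basis" "q:V" "Z:T01 q" shows "cconj Z (ze b) = 2*cconj Z (xc ka b)"
using CT_zeta[OF assms(1,2) CT_cconj[OF T01_CT[OF assms(3)]]] ph_zeta_T01[OF assms]
by(simp add:cconj_def mult.commute[of _ "2::complex"])

lemma lie_CR:
assumes U: "open U" "U <= V" "q:U" and Z: "Z:sections U" and h: "smooth_near q h"
 and h0: "!!q'. q':U ==> Z q' h = 0"
shows "lie Z (%q. cconj (Z q)) q h = Z q (%q'. cconj (Z q') h)"
proof -
have "cconj (Z q) (%q'. Z q' h) = 0"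
 by(rule section_zero_derivative[OF U(1,3) CT_cconj[OF T01_CT[OF sections_T01[OF Z U(3)]]]]) (rule h0)
thus ?thesis using h by(simp add:lie_def)
qed

text \<open>As \<open>ze b\<close> is CR, the bracket acts on it as
  \<open>Z (cconj Z (ze b))\<close>, and \<open>cconj Z (ze b)\<close> is twice the conjugate of
  \<open>Z (xc ka b)\<close>. So the first order coefficients in \<open>second_order\<close> are
  values of the bracket.\<close>

lemma transport_coeff:
assumes U: "open U" "U <= V" "q:U" and Z: "Z:sections U" and b: "b:Basis"
shows "Z q (%q'. cnj (Z q' (xc ka b))) = lie Z (%q. cconj (Z q)) q (ze b)/2"
proof -
have ZC: "Z q:CT q" by(rule T01_CT[OF sections_T01[OF Z U(3)]])
have s: "smooth_near q (ze b)" by(rule smooth_nearI[OF ph_open _ ph_zeta_smooth[OF b]]) (use U in auto)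
have s': "smooth_near q (%q'. cconj (Z q') (ze b))"
 by(rule smooth_near_field[OF smooth_field_cconj[OF sections_smooth_field[OF Z]] U(1,3) s])
have "lie Z (%q. cconj (Z q)) q (ze b) = Z q (%q'. cconj (Z q') (ze b))"
 by(rule lie_CR[OF U Z s]) (use ph_zeta_T01[OF b] sections_T01[OF Z] U in auto)
moreover have "Z q (%q'. (1/2)*cconj (Z q') (ze b)) = Z q (%q'. cnj (Z q' (xc ka b)))"
proof(rule CT_cong_open[OF ZC smooth_near_mult[OF smooth_near_const s'] U(1,3)])
 fix q' assume "q':U"
 thus "(1/2)*cconj (Z q') (ze b) = cnj (Z q' (xc ka b))"
 using cconj_zeta[OF b _ sections_T01[OF Z]] U by(auto simp:cconj_xc)
qed
ultimately show ?thesis using CT_cmult[OF ZC s', of "1/2"] by simp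
qed

text \<open>The second order part sees only the tensor, the first order part only the Levi vector:
  in this chart no other trace of the extensions \<open>Z j\<close> is left.\<close>

lemma sum_second_order:
assumes U: "open U" "U <= V" "q:U" and Z: "!!j. j < r ==> Z j:sections U" and h: "smooth_near q h"
shows "(SUM j<r. Z j q (%q'. cconj (Z j q') h)) =
 contr ka ka' q (%a b. (SUM j<r. tensor (Z j q) (cconj (Z j q))) (xc ka a) (xc ka b)) h +
 (SUM b:Basis. levi_vec r Z q (ze b)/2*pd ka ka' b h q)"
proof -
have "(SUM j<r. Z j q (%q'. cconj (Z j q') h)) =
 (SUM j<r. (SUM a:Basis. SUM b:Basis. Z j q (xc ka a)*cnj (Z j q (xc ka b))*pd ka ka' a (pd ka ka' b h) q) +
 (SUM b:Basis. lie (Z j) (%q. cconj (Z j q)) q (ze b)/2*pd ka ka' b h q))"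
 by(rule sum.cong[OF refl])
 (simp add:second_order[OF ph_lchart U sections_smooth_field[OF Z] h] transport_coeff[OF U Z] cong: sum.cong)
also have "... = (SUM j<r. SUM a:Basis. SUM b:Basis. Z j q (xc ka a)*cnj (Z j q (xc ka b))*pd ka ka' a (pd ka ka' b h) q)
 + (SUM j<r. SUM b:Basis. lie (Z j) (%q. cconj (Z j q)) q (ze b)/2*pd ka ka' b h q)"
 by(rule sum.distrib)
also have "(SUM j<r. SUM b:Basis. lie (Z j) (%q. cconj (Z j q)) q (ze b)/2*pd ka ka' b h q)
 = (SUM b:Basis. levi_vec r Z q (ze b)/2*pd ka ka' b h q)"
 by(subst sum.swap) (simp add:levi_vec_def sum_fun_apply sum_distrib_right sum_divide_distrib)
also have "(SUM j<r. SUM a:Basis. SUM b:Basis. Z j q (xc ka a)*cnj (Z j q (xc ka b))*pd ka ka' a (pd ka ka' b h) q)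
 = (SUM a:Basis. SUM b:Basis. (SUM j<r. Z j q (xc ka a)*cnj (Z j q (xc ka b)))*pd ka ka' a (pd ka ka' b h) q)"
 by(subst sum.swap, rule sum.cong[OF refl], subst sum.swap) (simp add:sum_distrib_right)
finally show ?thesis by(simp add:contr_def sum_fun_apply tensor_def cconj_xc)
qed

lemma levi_vec_CR:
assumes U: "open U" "U <= V" "q:U" and Z: "!!j. j < r ==> Z j:sections U" and h: "smooth_near q h"
 and h0: "!!q' j. q':U ==> j < r ==> Z j q' h = 0"
shows "levi_vec r Z q h =
 contr ka ka' q (%a b. (SUM j<r. tensor (Z j q) (cconj (Z j q))) (xc ka a) (xc ka b)) h +
 (SUM b:Basis. levi_vec r Z q (ze b)/2*pd ka ka' b h q)"
proof -
have "levi_vec r Z q h = (SUM j<r. Z j q (%q'. cconj (Z j q') h))"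
 unfolding levi_vec_def sum_fun_apply
 by(rule sum.cong[OF refl], rule lie_CR[OF U Z h h0]) auto
thus ?thesis using sum_second_order[OF U Z h] by simp
qed

text \<open>
A vector \<open>D\<close> which is determined by its values on the \<open>ze b\<close> in this way, and which is imaginary,
is of the form \<open>P - cconj P\<close> with \<open>P\<close> of type (0,1).
\<close>

lemma imaginary_split:
assumes q: "q:V" and D: "D:CT q" "cconj D = - D"
 and z: "!!i. i < m ==> D (z i) = (SUM b:Basis. D (ze b)/2*pd ka ka' b (z i) q)"
shows "EX P:T01 q. D = P - cconj P"
proof -
note l = ph_lchart q
define Y where "Y = coord_vec ka ka' q (%b. D (ze b)/2)"
have Y: "Y:CT q" unfolding Y_def by(rule coord_vec_CT[OF l])
have Yx: "Y (xc ka b) = D (ze b)/2" if "b:Basis" for b unfolding Y_def by(rule coord_vec_xc[OF l that])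
define P where "P = D + cscale (-1) Y"
have P: "P:CT q" unfolding P_def by(intro CT_plus CT_cscale D Y)
have "P (z i) = 0" if "i < m" for i
proof -
 have "smooth_near q (z i)" by(rule smooth_nearI[OF ph_open q CR_coords_smooth[OF ph_coords that]])
 from CT_pd[OF l Y this] Yx z[OF that] show ?thesis by(simp add:P_def cscale_def)
qed
hence PT: "P:T01 q" using CR_coords_T01[OF ph_coords q] P by simp
have "D = P + cscale (-1) (cconj P)"
proof(rule CT_eqI[OF l D(1) CT_plus[OF P CT_cscale[OF CT_cconj[OF P]]]])
 fix b :: 'e assume b: "b:Basis"
 have 1: "D (xc ka b) = (D (ze b) + D (%q. cnj (ze b q)))/2" by(rule CT_zeta[OF b q D(1)])
 hence 2: "P (xc ka b) = D (%q. cnj (ze b q))/2" by(simp add:P_def cscale_def Yx[OF b] field_simps)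
 have "cnj (D (%q. cnj (ze b q))) = cconj D (ze b)" by(simp add:cconj_def)
 hence c: "cnj (D (%q. cnj (ze b q))) = - D (ze b)" using D(2) by simp
 have "cnj (P (xc ka b)) = - D (ze b)/2" unfolding 2 complex_cnj_divide c by simp
 thus "D (xc ka b) = (P + cscale (-1) (cconj P)) (xc ka b)"
 by(simp add:cscale_def cconj_xc 1 2 field_simps)
qed
hence "D = P - cconj P" by simp
thus ?thesis using PT by blast
qed

text \<open>Independence of the extension: on the CR functions \<open>z i\<close> two Levi vectors
  of the same tensor have the same second order part, so their difference satisfies the hypothesis
  of \<open>imaginary_split\<close> and, multiplied by \<open>\<i>\<close>, lies in
  \<open>HM q\<close>.\<close>

lemma Levi_eq:
assumes U: "open U" "q:U" and q: "q:V" and Z: "!!j. j < r ==> Z j:sections U"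
 and si: "si = (SUM j<r. tensor (Z j q) (cconj (Z j q)))"
shows "Levi q si = proj q (- cscale \<i> (levi_vec r Z q))"
unfolding Levi_def
proof(rule the_equality)
have eq: "(SUM j<r. cscale \<i> (lie (Z j) (%q. cconj (Z j q)) q)) = cscale \<i> (levi_vec r Z q)" for r Z q
 by(rule ext) (simp add:levi_vec_def cscale_def sum_fun_apply sum_distrib_left)
show "EX U' (r'::nat) Z'. open U' & q:U' & (ALL j<r'. Z' j:sections U') & si = (SUM j<r'. tensor (Z' j q) (cconj (Z' j q))) &
 proj q (- cscale \<i> (levi_vec r Z q)) = proj q (- (SUM j<r'. cscale \<i> (lie (Z' j) (%q. cconj (Z' j q)) q)))"
 using U Z si by(intro exI[of _ U] exI[of _ r] exI[of _ Z]) (simp only: eq; blast)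
fix c assume "EX U (r::nat) Z. open U & q:U & (ALL j<r. Z j:sections U) & si = (SUM j<r. tensor (Z j q) (cconj (Z j q))) &
 c = proj q (- (SUM j<r. cscale \<i> (lie (Z j) (%q. cconj (Z j q)) q)))"
then obtain U' r' Z' where U': "open U'" "q:U'" and Z': "ALL j<r'. Z' j:sections U'"
 and si': "si = (SUM j<r'. tensor (Z' j q) (cconj (Z' j q)))"
 and c: "c = proj q (- cscale \<i> (levi_vec r' Z' q))"
 by(elim exE conjE) (rule that, auto simp only: eq)
let ?U = "U Int V" and ?U' = "U' Int V"
have o: "open ?U" "?U <= V" "q:?U" "open ?U'" "?U' <= V" "q:?U'" using U U' q ph_open by auto
have s: "Z j:sections ?U" if "j < r" for j using sections_subset[OF Z[OF that]] by auto
have s': "Z' j:sections ?U'" if "j < r'" for j using sections_subset[of "Z' j" U'] Z' that by auto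
define D where "D = levi_vec r' Z' q - levi_vec r Z q"
have dC: "levi_vec r Z q:CT q" "levi_vec r' Z' q:CT q"
 using levi_vec_CT[OF o(1,3) s] levi_vec_CT[OF o(4,6) s'] by auto
have "D:CT q" unfolding D_def by(rule cvec.subspace_diff[OF CT_subspace dC(2,1)])
moreover have "cconj D = - D"
proof -
 have "cconj D = cconj (levi_vec r' Z' q) - cconj (levi_vec r Z q)" by(simp add:D_def cconj_def fun_eq_iff)
 thus ?thesis by(simp only: cconj_levi_vec D_def) simp
qed
moreover have "D (z i) = (SUM b:Basis. D (ze b)/2*pd ka ka' b (z i) q)" if "i < m" for i
proof -
 have h: "smooth_near q (z i)" by(rule smooth_nearI[OF ph_open q CR_coords_smooth[OF ph_coords that]])
 have z0: "Y (z i) = 0" if "q':V" "Y:T01 q'" for q' Y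
 using CR_coords_T01[OF ph_coords that(1)] that(2) `i < m` by auto
 have 1: "levi_vec r Z q (z i) = contr ka ka' q (%a b. si (xc ka a) (xc ka b)) (z i) +
 (SUM b:Basis. levi_vec r Z q (ze b)/2*pd ka ka' b (z i) q)"
 unfolding si by(rule levi_vec_CR[OF o(1,2,3) s h]) (use z0 sections_T01[OF s] in auto)
 have 2: "levi_vec r' Z' q (z i) = contr ka ka' q (%a b. si (xc ka a) (xc ka b)) (z i) +
 (SUM b:Basis. levi_vec r' Z' q (ze b)/2*pd ka ka' b (z i) q)"
 unfolding si' by(rule levi_vec_CR[OF o(4,5,6) s' h]) (use z0 sections_T01[OF s'] in auto)
 show ?thesis unfolding D_def using 1 2
 by(simp add:diff_divide_distrib left_diff_distrib sum_subtractf)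
qed
ultimately obtain P where P: "P:T01 q" "D = P - cconj P" using imaginary_split[OF q] by blast
have "- cscale \<i> (levi_vec r' Z' q) - - cscale \<i> (levi_vec r Z q) = - cscale \<i> D"
 by(simp add:D_def cscale_def fun_eq_iff algebra_simps)
also have "... = cRe (cscale (-2*\<i>) P)"
 by(simp add:P(2) cRe_def cscale_def cconj_def fun_eq_iff algebra_simps)
also have "...:HM q" unfolding HM_def by(rule imageI[OF T01_cscale[OF P(1)]])
finally show "c = proj q (- cscale \<i> (levi_vec r Z q))" unfolding c by(rule proj_eqI)
qed

lemma kerL_levi_vec:
assumes U: "open U" "q:U" and q: "q:V" and Z: "!!j. j < r ==> Z j:sections U"
 and si: "(SUM j<r. tensor (Z j q) (cconj (Z j q))):kerL q"
shows "EX W:T01 q. levi_vec r Z q = cscale (- \<i>/2) (W + cconj W)"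
proof -
have "proj q (- cscale \<i> (levi_vec r Z q)) = HM q"
 using Levi_eq[OF U q Z refl] si by(simp add:kerL_def)
hence "0:proj q (- cscale \<i> (levi_vec r Z q))" using zero_HM by simp
hence "cscale \<i> (levi_vec r Z q):HM q" by(simp add:proj_def)
then obtain W where W: "W:T01 q" "cscale \<i> (levi_vec r Z q) = cRe W" by(auto simp:HM_def)
have "levi_vec r Z q = cscale (- \<i>) (cscale \<i> (levi_vec r Z q))" by simp
also have "... = cscale (- \<i>/2) (W + cconj W)" unfolding W(2) by(simp add:cRe_def cscale_def fun_eq_iff)
finally show ?thesis using W(1) by blast
qed

text \<open>On the kernel the first order part of \<open>sum_second_order\<close> is that of the
  single vector \<open>cconj W\<close>, because \<open>W\<close> annihilates the
  \<open>ze b\<close>.\<close>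

lemma levi_vec_zeta:
assumes q: "q:V" and W: "W:T01 q" and D: "D = cscale (- \<i>/2) (W + cconj W)" and h: "smooth_near q h"
shows "(SUM b:Basis. D (ze b)/2*pd ka ka' b h q) = - \<i>/2*cconj W h"
proof -
have "D (ze b)/2 = - \<i>/2*cconj W (xc ka b)" if "b:Basis" for b
 using ph_zeta_T01[OF that q W] cconj_zeta[OF that q W] by(simp add:D cscale_def)
hence "(SUM b:Basis. D (ze b)/2*pd ka ka' b h q) = - \<i>/2*(SUM b:Basis. cconj W (xc ka b)*pd ka ka' b h q)"
 by(simp add:sum_distrib_left mult.assoc cong: sum.cong)
thus ?thesis using CT_pd[OF ph_lchart q CT_cconj[OF T01_CT[OF W]] h] by simp
qed

lemma T01_repr_sections:
fixes Z0 :: "nat => 'p cvec"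
assumes q: "q:V" and Z0: "!!j. j < r ==> Z0 j:T01 q"
obtains U Z where "open U" "U <= V" "q:U" "ALL j<r. Z j:sections U" "ALL j<r. Z j q = Z0 j"
proof -
obtain U where U: "open U" "q:U" "ALL W:T01 q. EX Z:sections U. Z q = W"
 by(rule T01_extend)
have "ALL j. EX Z. j < r --> Z:sections U & Z q = Z0 j" using U(3) Z0 by blast
then obtain Z where Z: "!!j. j < r ==> Z j:sections U & Z j q = Z0 j" by metis
show ?thesis
 by(rule that[of "U Int V" Z])
 (use U q ph_open Z sections_subset[of _ U "U Int V"] in "auto intro: open_Int")
qed

lemma kerL_repr:
assumes "si:kerL q"
obtains r :: nat and Z0 :: "nat => 'p cvec" where "ALL j<r. Z0 j:T01 q" "si = (SUM j<r. tensor (Z0 j) (cconj (Z0 j)))"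
proof -
have "si:H11 q" using assms by(simp add:kerL_def)
then obtain r :: nat and t :: "nat => real" and Z where Z: "ALL j<r. 0 <= t j & Z j:T01 q"
 "si = (SUM j<r. (%f g. cor (t j)*tensor (Z j) (cconj (Z j)) f g))"
 unfolding H11_def by auto
have "(%f g. cor (t j)*tensor (Z j) (cconj (Z j)) f g) =
 tensor (cscale (cor (sqrt (t j))) (Z j)) (cconj (cscale (cor (sqrt (t j))) (Z j)))"
 if "j < r" for j
proof -
 have "cor (t j) = cor (sqrt (t j))*cor (sqrt (t j))"
 using Z(1) that by(simp flip: of_real_mult)
 thus ?thesis by(simp add:tensor_def cscale_def cconj_def fun_eq_iff)
qed
hence 1: "si = (SUM j<r. tensor (cscale (cor (sqrt (t j))) (Z j)) (cconj (cscale (cor (sqrt (t j))) (Z j))))"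
 unfolding Z(2) by(intro sum.cong) auto
have 2: "ALL j<r. cscale (cor (sqrt (t j))) (Z j):T01 q" using Z(1) T01_cscale by simp
show ?thesis by(rule that[OF 2 1])
qed

text \<open>The Levi vector at \<open>h\<close> is evaluated in two ways: by
  \<open>levi_vec_CR\<close> as the contraction plus a multiple of \<open>cconj Y h\<close>, and by
  its form on the kernel as the same multiple of \<open>Y h + cconj Y h\<close>. As
  \<open>Y h = 0\<close>, the contraction vanishes.\<close>

lemma kerL_CR:
assumes si: "si:kerL q" and q: "q:V" and U: "open U" "q:U" and h: "h:CR_functions U"
shows "contr ka ka' q (%a b. si (xc ka a) (xc ka b)) h = 0"
proof -
obtain r :: nat and Z0 where Z0: "ALL j<r. Z0 j:T01 q" "si = (SUM j<r. tensor (Z0 j) (cconj (Z0 j)))"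
 by(rule kerL_repr[OF si])
obtain W Z where W: "open W" "W <= V" "q:W" "ALL j<r. Z j:sections W" "ALL j<r. Z j q = Z0 j"
 by(rule T01_repr_sections[OF q, of r Z0]) (use Z0(1) in auto)
have si': "si = (SUM j<r. tensor (Z j q) (cconj (Z j q)))" using Z0(2) W(5) by simp
let ?W = "W Int U"
have o: "open ?W" "?W <= V" "q:?W" using W U by auto
have s: "Z j:sections ?W" if "j < r" for j using sections_subset[of "Z j" W ?W] W(4) that by auto
have hU: "smooth U h" "!!V Z q. open V ==> V <= U ==> Z:sections V ==> q:V ==> Z q h = 0"
 using h by(auto simp:CR_functions_def)
have sh: "smooth_near q h" by(rule smooth_nearI[OF U hU(1)])
obtain Y where Y: "Y:T01 q" "levi_vec r Z q = cscale (- \<i>/2) (Y + cconj Y)"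
 using kerL_levi_vec[where Z = Z and r = r, OF o(1,3) q s] si unfolding si' by blast
have "levi_vec r Z q h = contr ka ka' q (%a b. si (xc ka a) (xc ka b)) h - \<i>/2*cconj Y h"
 unfolding si' using levi_vec_CR[where Z = Z and r = r, OF o s sh] hU(2)[OF o(1) _ s] levi_vec_zeta[OF q Y sh] by simp
moreover have "Y h = 0"
proof -
 obtain V' where V': "open V'" "q:V'" "ALL W:T01 q. EX Z:sections V'. Z q = W"
 by(rule T01_extend)
 obtain Y' where Y': "Y':sections V'" "Y' q = Y" using bspec[OF V'(3) Y(1)] by blast
 have "Y' q h = 0"
 by(rule hU(2)[of "V' Int U"]) (use V' U sections_subset[OF Y'(1)] in auto)
 thus ?thesis using Y' by simp
qed
ultimately show ?thesis by(simp add:Y(2) cscale_def)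
qed

end

end

section \<open>The maximum principle\<close>

lemma second_derivative_max:
fixes om :: "'e::real_normed_vector => real"
assumes S: "open S" "x:S" and C: "Ck_on 2 S om" and max: "!!y. y:S ==> om y <= om x"
shows "dd u (dd u om) x <= 0"
proof(rule ccontr)
assume pos: "~ dd u (dd u om) x <= 0"
have C2: "Ck_on (Suc (Suc 0)) S om" using C by(simp add:numeral_2_eq_2)
have d1: "om differentiable (at y)" "dd u om differentiable (at y)" if "y:S" for y
 using C2 that by(auto simp:Ck_on_Suc)
have D1: "((%t. om (x + t *R u)) has_field_derivative dd u om (x + t *R u)) (at t)" if "x + t *R u:S" for t
 using has_derivative_line[OF d1(1)[OF that]] by(simp add:has_field_derivative_def mult_commute_abs)
have D2: "((%t. dd u om (x + t *R u)) has_field_derivative dd u (dd u om) x) (at 0)"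
 using has_derivative_line[of "dd u om" x 0 u] d1(2)[OF S(2)]
 by(simp add:has_field_derivative_def mult_commute_abs)
have o: "open ((%t. x + t *R u) -` S)" by(rule open_vimage[OF S(1)]) (intro continuous_intros)
have z0: "0:(%t. x + t *R u) -` S" using S(2) by simp
obtain d where d: "d > 0" "ball 0 d <= (%t. x + t *R u) -` S" by(rule openE[OF o z0])
have inS: "x + t *R u:S" if "\<bar>t\<bar> < d" for t using d(2) that by auto
have "((%t. om (x + t *R u)) has_field_derivative dd u om x) (at 0)" using D1[of 0] S(2) by simp
from DERIV_local_max[OF this d(1)] have z: "dd u om x = 0" using max inS by simp
obtain e where e: "e > 0" "!!h. 0 < h ==> h < e ==> dd u om (x + (0 + h) *R u) > dd u om (x + 0 *R u)"
 using DERIV_pos_inc_right[OF D2] pos by auto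
define t where "t = min d e/2"
have t: "0 < t" "t < d" "t < e" using d(1) e(1) by(auto simp:t_def)
have "EX c. 0 < c & c < t & om (x + t *R u) - om (x + 0 *R u) = (t - 0)*dd u om (x + c *R u)"
 by(rule MVT2[OF t(1)]) (rule D1[OF inS], use t in auto)
then obtain c where c: "0 < c" "c < t" "om (x + t *R u) - om x = t*dd u om (x + c *R u)" by auto
have "dd u om (x + c *R u) > 0" using e(2)[of c] c t z by simp
hence "om (x + t *R u) > om x" using c(3) t(1) by(metis diff_gt_0_iff_gt mult_pos_pos)
thus False using max[OF inS[of t]] t by simp
qed

lemma dd_of_real:
assumes "f differentiable (at x)" shows "dd v (%x. cor (f x)) x = cor (dd v f x)"
by(rule dd_eq[OF has_derivative_of_real[OF has_derivative_dd[OF assms]]])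

lemma dd_dd_basis:
fixes om :: "'e::euclidean_space => real"
assumes S: "open S" "x:S" and C: "Ck_on 2 S om"
shows "dd u (dd u om) x = (SUM a:Basis. SUM b:Basis. (u <.> a)*(u <.> b)*dd a (dd b om) x)"
proof -
have C2: "Ck_on (Suc (Suc 0)) S om" using C by(simp add:numeral_2_eq_2)
have d1: "om differentiable (at y)" "dd v om differentiable (at y)" if "y:S" for y v
 using C2 that by(auto simp:Ck_on_Suc)
have "dd a (dd u om) x = (SUM b:Basis. (u <.> b)*dd a (dd b om) x)" for a
proof -
 have "dd a (dd u om) x = dd a (%y. SUM b:Basis. (u <.> b) *R dd b om y) x"
 by(rule dd_cong[OF S]) (rule dd_basis[OF d1(1)])
 also have "... = (SUM b:Basis. (u <.> b) *R dd a (dd b om) x)"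
 by(rule dd_eq, intro has_derivative_sum has_derivative_scaleR_right has_derivative_dd d1(2) S(2))
 finally show ?thesis by simp
qed
thus ?thesis using dd_basis[OF d1(2)[OF S(2)], of u u] by(simp add:sum_distrib_left mult.assoc)
qed

context smooth_manifold begin

text \<open>The real part of a real Hessian contracted with \<open>Z\<close> and its conjugate is
  its value on the real part of \<open>Z\<close> plus that on the imaginary part; at a maximum both
  are nonpositive.\<close>

lemma contr_max_nonpos:
fixes r :: nat and w :: "'p => real"
assumes l: "lchart V ka ka'" "q:V" and w: "smooth_near q (%q. cor (w q))"
 and D: "open D" "q:D" and max: "!!q'. q':D ==> w q' <= w q"
shows "Re (contr ka ka' q (%a b. (SUM j<r. tensor (Z j) (cconj (Z j))) (xc ka a) (xc ka b)) (%q. cor (w q))) <= 0"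
proof -
obtain r0 where r0: "r0 > 0" "ball (ka q) r0 <= ka ` V" "Cinf_on (ball (ka q) r0) (%x. cor (w (ka' x)))"
 by(rule smooth_near_ball[OF l w])
define S where "S = ball (ka q) r0 Int ka ` (V Int D)"
have S: "open S" "ka q:S"
 using lchart_image[OF l(1), of "V Int D"] lchart_open[OF l(1)] D l(2) r0(1) by(auto simp:S_def intro!: open_Int)
define om where "om x = w (ka' x)" for x
have C: "Cinf_on S om"
 using Cinf_subset[OF Cinf_Re[OF open_ball r0(3)], of S] by(simp add:om_def[abs_def] S_def)
hence C2: "Ck_on 2 S om" by(simp add:Cinf_on_def)
have mx: "om y <= om (ka q)" if "y:S" for y
 using that max by(auto simp:om_def S_def lchart_inv[OF l(1)] l(2))
have pd: "pd ka ka' a (pd ka ka' b (%q. cor (w q))) q = cor (dd a (dd b om) (ka q))" for a b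
proof -
 have "pd ka ka' a (pd ka ka' b (%q. cor (w q))) q = dd a (dd b (%x. cor (om x))) (ka q)"
 unfolding pd_pd[OF l] om_def ..
 also have "... = dd a (%x. cor (dd b om x)) (ka q)"
 by(rule dd_cong[OF S]) (rule dd_of_real[OF Cinf_differentiable[OF C]])
 also have "... = cor (dd a (dd b om) (ka q))"
 by(rule dd_of_real[OF Cinf_differentiable[OF Cinf_dd[OF C] S(2)]])
 finally show ?thesis .
qed
define X where "X j = (SUM a:Basis. Re (Z j (xc ka a)) *R a)" for j
define Y where "Y j = (SUM a:Basis. Im (Z j (xc ka a)) *R a)" for j
have XY: "X j <.> a = Re (Z j (xc ka a))" "Y j <.> a = Im (Z j (xc ka a))" if "a:Basis" for a j
 using that by(simp_all add:X_def Y_def)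
have "Re (contr ka ka' q (%a b. (SUM j<r. tensor (Z j) (cconj (Z j))) (xc ka a) (xc ka b)) (%q. cor (w q))) =
 (SUM a:Basis. SUM b:Basis. SUM j<r. ((X j <.> a)*(X j <.> b) + (Y j <.> a)*(Y j <.> b))*dd a (dd b om) (ka q))"
 unfolding contr_def pd by(simp add:sum_fun_apply tensor_def cconj_xc XY sum_distrib_right cong: sum.cong)
also have "... = (SUM j<r. SUM a:Basis. SUM b:Basis. ((X j <.> a)*(X j <.> b) + (Y j <.> a)*(Y j <.> b))*dd a (dd b om) (ka q))"
 by(subst (2) sum.swap, subst sum.swap) (rule refl)
also have "... = (SUM j<r. dd (X j) (dd (X j) om) (ka q) + dd (Y j) (dd (Y j) om) (ka q))"
 by(simp add:dd_dd_basis[OF S C2] distrib_right sum.distrib)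
also have "... <= 0"
 by(rule sum_nonpos) (intro add_nonpos_nonpos second_derivative_max[OF S C2 mx])
finally show ?thesis .
qed

lemma contr_add:
assumes l: "lchart V ka ka'" "q:V" and f: "smooth_near q f" and g: "smooth_near q g"
shows "contr ka ka' q s (%q. f q + g q) = contr ka ka' q s f + contr ka ka' q s g"
proof -
obtain U where U: "open U" "q:U" "smooth U f" "smooth U g" by(rule smooth_near_combine[OF f g])
have "pd ka ka' a (pd ka ka' b (%q. f q + g q)) q = pd ka ka' a (pd ka ka' b f) q + pd ka ka' a (pd ka ka' b g) q"
 if ab: "a:Basis" "b:Basis" for a b
proof -
 have "pd ka ka' a (pd ka ka' b (%q. f q + g q)) q = pd ka ka' a (%q. pd ka ka' b f q + pd ka ka' b g q) q"
 by(rule pd_cong[OF l, of "U Int V"])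
  (use U l lchart_open[OF l(1)] in "auto intro!: pd_add[OF l(1) _ ab(2)] smooth_nearI[OF U(1)]")
 also have "... = pd ka ka' a (pd ka ka' b f) q + pd ka ka' a (pd ka ka' b g) q"
 by(rule pd_add[OF l ab(1) smooth_near_pd[OF l f] smooth_near_pd[OF l g]])
 finally show ?thesis .
qed
thus ?thesis by(simp add:contr_def sum.distrib distrib_left cong: sum.cong)
qed

lemma contr_cmult:
assumes l: "lchart V ka ka'" "q:V" and f: "smooth_near q f"
shows "contr ka ka' q s (%q. c*f q) = c*contr ka ka' q s f"
proof -
obtain U where U: "open U" "q:U" "smooth U f" using f smooth_near_def by blast
have "pd ka ka' a (pd ka ka' b (%q. c*f q)) q = c*pd ka ka' a (pd ka ka' b f) q"
 if ab: "a:Basis" "b:Basis" for a b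
proof -
 have "pd ka ka' a (pd ka ka' b (%q. c*f q)) q = pd ka ka' a (%q. c*pd ka ka' b f q) q"
 by(rule pd_cong[OF l, of "U Int V"])
  (use U l lchart_open[OF l(1)] in "auto intro!: pd_cmult[OF l(1) _ ab(2)] smooth_nearI[OF U(1)]")
 also have "... = c*pd ka ka' a (pd ka ka' b f) q"
 by(rule pd_cmult[OF l ab(1) smooth_near_pd[OF l f]])
 finally show ?thesis .
qed
thus ?thesis by(simp add:contr_def sum_distrib_left mult_ac cong: sum.cong)
qed

lemma contr_mult:
assumes l: "lchart V ka ka'" "q:V" and f: "smooth_near q f" and g: "smooth_near q g"
shows "contr ka ka' q s (%q. f q*g q) = contr ka ka' q s f*g q + f q*contr ka ka' q s g +
 (SUM a:Basis. SUM b:Basis. s a b*(pd ka ka' a f q*pd ka ka' b g q + pd ka ka' b f q*pd ka ka' a g q))"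
proof -
obtain U where U: "open U" "q:U" "smooth U f" "smooth U g" by(rule smooth_near_combine[OF f g])
have "pd ka ka' a (pd ka ka' b (%q. f q*g q)) q =
 pd ka ka' a (pd ka ka' b f) q*g q + f q*pd ka ka' a (pd ka ka' b g) q +
 (pd ka ka' a f q*pd ka ka' b g q + pd ka ka' b f q*pd ka ka' a g q)"
 if ab: "a:Basis" "b:Basis" for a b
proof -
 note sf = smooth_near_pd[OF l f] and sg = smooth_near_pd[OF l g]
 have "pd ka ka' a (pd ka ka' b (%q. f q*g q)) q =
 pd ka ka' a (%q. pd ka ka' b f q*g q + f q*pd ka ka' b g q) q"
 by(rule pd_cong[OF l, of "U Int V"])
  (use U l lchart_open[OF l(1)] in "auto intro!: pd_mult[OF l(1) _ ab(2)] smooth_nearI[OF U(1)]")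
 also have "... = pd ka ka' a (%q. pd ka ka' b f q*g q) q + pd ka ka' a (%q. f q*pd ka ka' b g q) q"
 by(rule pd_add[OF l ab(1)]) (intro smooth_near_mult sf sg f g)+
 also have "pd ka ka' a (%q. pd ka ka' b f q*g q) q = pd ka ka' a (pd ka ka' b f) q*g q + pd ka ka' b f q*pd ka ka' a g q"
 by(rule pd_mult[OF l ab(1) sf g])
 also have "pd ka ka' a (%q. f q*pd ka ka' b g q) q = pd ka ka' a f q*pd ka ka' b g q + f q*pd ka ka' a (pd ka ka' b g) q"
 by(rule pd_mult[OF l ab(1) f sg])
 finally show ?thesis by simp
qed
thus ?thesis
 by(simp add:contr_def sum.distrib distrib_left sum_distrib_left sum_distrib_right mult_ac cong: sum.cong)
qed

text \<open>The first order part of \<open>contr_mult\<close> for \<open>s\<close> the components of a sum of tensors.\<close>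

lemma tensor_first_order:
fixes r :: nat
assumes l: "lchart V ka ka'" "q:V" and f: "smooth_near q f" and g: "smooth_near q g"
 and Z: "!!j. j < r ==> Z j:CT q"
shows "(SUM a:Basis. SUM b:Basis. (SUM j<r. tensor (Z j) (cconj (Z j))) (xc ka a) (xc ka b)*(pd ka ka' a f q*pd ka ka' b g q))
 = (SUM j<r. Z j f*cconj (Z j) g)"
proof -
have "(SUM j<r. Z j f*cconj (Z j) g) =
 (SUM j<r. (SUM a:Basis. Z j (xc ka a)*pd ka ka' a f q)*(SUM b:Basis. cconj (Z j) (xc ka b)*pd ka ka' b g q))"
 by(rule sum.cong[OF refl]) (use CT_pd[OF l Z f] CT_pd[OF l CT_cconj[OF Z] g] in auto)
also have "... = (SUM j<r. SUM a:Basis. SUM b:Basis. Z j (xc ka a)*cconj (Z j) (xc ka b)*(pd ka ka' a f q*pd ka ka' b g q))"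
 by(simp add:sum_product mult_ac)
also have "... = (SUM a:Basis. SUM b:Basis. SUM j<r. Z j (xc ka a)*cconj (Z j) (xc ka b)*(pd ka ka' a f q*pd ka ka' b g q))"
 by(subst sum.swap, rule sum.cong[OF refl], subst sum.swap) (rule refl)
finally show ?thesis by(simp add:sum_fun_apply tensor_def sum_distrib_right)
qed

lemma tensor_sum_hermitian:
fixes r :: nat
shows "cnj ((SUM j<r. tensor (Z j) (cconj (Z j))) (xc ka a) (xc ka b)) = (SUM j<r. tensor (Z j) (cconj (Z j))) (xc ka b) (xc ka a)"
by(simp add:sum_fun_apply tensor_def cconj_xc mult.commute)

lemma contr_cnj:
fixes r :: nat and Z :: "nat => 'p cvec"
assumes l: "lchart V ka ka'" "q:V" and f: "smooth_near q f"
defines "s \<equiv> %a b. (SUM j<r. tensor (Z j) (cconj (Z j))) (xc ka a) (xc ka b)"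
shows "contr ka ka' q s (%q. cnj (f q)) = cnj (contr ka ka' q s f)"
proof -
obtain U where U: "open U" "q:U" "smooth U f" using f smooth_near_def by blast
have "pd ka ka' a (pd ka ka' b (%q. cnj (f q))) q = cnj (pd ka ka' b (pd ka ka' a f) q)"
 if ab: "a:Basis" "b:Basis" for a b
proof -
 have "pd ka ka' a (pd ka ka' b (%q. cnj (f q))) q = pd ka ka' a (%q. cnj (pd ka ka' b f q)) q"
 by(rule pd_cong[OF l, of "U Int V"])
  (use U l lchart_open[OF l(1)] in "auto intro!: pd_cnj[OF l(1) _ ab(2)] smooth_nearI[OF U(1)]")
 also have "... = cnj (pd ka ka' a (pd ka ka' b f) q)"
 by(rule pd_cnj[OF l ab(1) smooth_near_pd[OF l f]])
 also have "pd ka ka' a (pd ka ka' b f) q = pd ka ka' b (pd ka ka' a f) q" by(rule pd_commute[OF l f])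
 finally show ?thesis .
qed
hence "contr ka ka' q s (%q. cnj (f q)) = cnj (SUM a:Basis. SUM b:Basis. s b a*pd ka ka' b (pd ka ka' a f) q)"
 by(simp add:contr_def s_def tensor_sum_hermitian cong: sum.cong)
also have "(SUM a:Basis. SUM b:Basis. s b a*pd ka ka' b (pd ka ka' a f) q) = contr ka ka' q s f"
 unfolding contr_def by(rule sum.swap)
finally show ?thesis .
qed

text \<open>\<open>F\<close> behaves like the exponential of \<open>c * fi\<close>. The quadratic
  first order term of the chain rule is a multiple of the sum of the
  \<open>Z j fi * cconj (Z j) fi\<close>, which vanishes for vectors tangent to the level set; so
  the sign of the result is under control for every real \<open>c\<close>.\<close>

lemma contr_exp:
fixes r :: nat and fi :: "'p => real"
assumes l: "lchart V ka ka'" "q:V" and U: "open U" "q:U" and fi: "smooth U (%q. cor (fi q))"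
 and Z: "!!j. j < r ==> Z j:CT q" "!!j. j < r ==> Z j (%q. cor (fi q)) = 0"
 and F: "smooth U F" "!!q b. q:U ==> q:V ==> b:Basis ==> pd ka ka' b F q = c*F q*pd ka ka' b (%q. cor (fi q)) q"
defines "s \<equiv> %a b. (SUM j<r. tensor (Z j) (cconj (Z j))) (xc ka a) (xc ka b)"
shows "contr ka ka' q s F = c*F q*contr ka ka' q s (%q. cor (fi q))"
proof -
let ?fi = "%q. cor (fi q)"
have sF: "smooth_near q F" and sfi: "smooth_near q ?fi" using smooth_nearI[OF U] F fi by auto
have "pd ka ka' a (pd ka ka' b F) q = c*F q*pd ka ka' a (pd ka ka' b ?fi) q + c^2*F q*(pd ka ka' a ?fi q*pd ka ka' b ?fi q)"
 if ab: "a:Basis" "b:Basis" for a b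
proof -
 have "pd ka ka' a (pd ka ka' b F) q = pd ka ka' a (%q. (c*F q)*pd ka ka' b ?fi q) q"
 by(rule pd_cong[OF l, of "U Int V"]) (use U l F(2) ab lchart_open[OF l(1)] in auto)
 also have "... = pd ka ka' a (%q. c*F q) q*pd ka ka' b ?fi q + (c*F q)*pd ka ka' a (pd ka ka' b ?fi) q"
 by(rule pd_mult[OF l ab(1)]) (intro smooth_near_mult smooth_near_const sF smooth_near_pd[OF l sfi])+
 also have "pd ka ka' a (%q. c*F q) q = c*(c*F q*pd ka ka' a ?fi q)"
 using pd_cmult[OF l ab(1) sF] F(2)[OF U(2) l(2) ab(1)] by simp
 finally show ?thesis by(simp add:power2_eq_square algebra_simps)
qed
hence "contr ka ka' q s F = c*F q*contr ka ka' q s ?fi +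
 c^2*F q*(SUM a:Basis. SUM b:Basis. s a b*(pd ka ka' a ?fi q*pd ka ka' b ?fi q))"
 by(simp add:contr_def sum.distrib distrib_left sum_distrib_left mult_ac cong: sum.cong)
also have "(SUM a:Basis. SUM b:Basis. s a b*(pd ka ka' a ?fi q*pd ka ka' b ?fi q)) = (SUM j<r. Z j ?fi*cconj (Z j) ?fi)"
 unfolding s_def by(rule tensor_first_order[OF l sfi sfi Z(1)])
also have "... = 0" using Z(2) by simp
finally show ?thesis by simp
qed

lemma smooth_exp_of_real:
fixes fi :: "'p => real" and k d :: real
assumes l: "lchart V ka ka'" and U: "open U" "U <= V" and fi: "smooth U (%q. cor (fi q))"
defines "F \<equiv> %q. cor (exp (k*fi q + d))"
shows "smooth U F" "q:U ==> pd ka ka' b F q = cor k*F q*pd ka ka' b (%q. cor (fi q)) q"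
proof -
have o: "open (ka ` U)" by(rule lchart_image[OF l U])
have C: "Cinf_on (ka ` U) (%x. fi (ka' x))"
 using Cinf_Re[OF o lchart_smoothD[OF l fi U(1) order_refl U(2)]] by simp
have E: "Cinf_on UNIV (%t::real. exp (k*t + d))"
 unfolding Cinf_on_def
proof
 fix i
 have D: "((%t::real. exp (k*t + d)) has_derivative (%h. exp (k*t + d)*(k*h))) (at t)" for t
 by(auto intro!: derivative_eq_intros)
 show "Ck_on i UNIV (%t::real. exp (k*t + d))"
 proof(induction i)
 case 0 show ?case by(auto intro!: continuous_intros)
 next
 case (Suc i) show ?case
  by(rule Ck_on_SucI[OF open_UNIV D]) (intro Ck_on_mult Suc Ck_on_const open_UNIV)
 qed
qed
have "Cinf_on (ka ` U) (%x. exp (k*fi (ka' x) + d))"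
 by(rule Cinf_compose[OF o open_UNIV _ C E]) simp
thus "smooth U F" unfolding lchart_smooth_iff[OF l U] F_def by(rule Cinf_of_real[OF o])
assume q: "q:U"
have fid: "((%x. fi (ka' x)) has_derivative (%v. dd v (%x. fi (ka' x)) (ka q))) (at (ka q))"
 using Cinf_deriv[OF C] q by auto
have "((%x. cor (exp (k*fi (ka' x) + d))) has_derivative
 (%v. cor (exp (k*fi (ka' (ka q)) + d)*(k*dd v (%x. fi (ka' x)) (ka q))))) (at (ka q))"
 by(auto intro!: derivative_eq_intros fid simp del:of_real_mult)
from dd_eq[OF this, of b] dd_of_real[OF Cinf_differentiable[OF C imageI[OF q]], of b]
show "pd ka ka' b F q = cor k*F q*pd ka ka' b (%q. cor (fi q)) q"
 using q U(2) by(simp add:pd_def F_def lchart_inv[OF l] subset_iff)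
qed

end

context cr_manifold begin

text \<open>The vectors are tangent to the level set of \<open>fi\<close> through \<open>q\<close>.
  By \<open>ddc_eq\<close> the positive quantity is \<open>ddc fi q\<close> when the coordinates are
  real parts of CR functions.\<close>

definition convex_at :: "('p => 'e) => ('e => 'p) => ('p => real) => 'p => bool" where
"convex_at ka ka' fi q \<longleftrightarrow> (EX (r::nat) Z. (ALL j<r. Z j:T01 q & Z j (%q. cor (fi q)) = 0) &
 (SUM j<r. tensor (Z j) (cconj (Z j))):kerL q &
 Re (contr ka ka' q (%a b. (SUM j<r. tensor (Z j) (cconj (Z j))) (xc ka a) (xc ka b)) (%q. cor (fi q))) > 0)"

lemma CR_functions_T01:
assumes "h:CR_functions U" "open U" "q:U" "Z:T01 q" shows "Z h = 0"
proof -
obtain V where V: "open V" "q:V" "ALL W:T01 q. EX Z:sections V. Z q = W" by(rule T01_extend)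
obtain Z' where Z': "Z':sections V" "Z' q = Z" using bspec[OF V(3) assms(4)] by blast
have "Z':sections (V Int U)" using sections_subset[OF Z'(1)] by simp
moreover have "open (V Int U)" "V Int U <= U" "q:V Int U" using V assms by auto
ultimately have "Z' q h = 0" using assms(1) unfolding CR_functions_def by blast
thus ?thesis using Z' by simp
qed

text \<open>
Near the level \<open>- c\<close> of \<open>fi\<close> nothing is assumed about \<open>h\<close>. The function \<open>|h|\<^sup>2 - exp (- k (fi - s0))\<close>
cannot have an interior maximum, and for large \<open>k\<close> it is negative on that level, so that
its maximum lies where \<open>|h| \<le> M\<close>.
\<close>

lemma maximum_principle:
assumes ph: "ph_chart m z V ka ka' ze"
 and K: "compact K" "K <= V" "continuous_on K h" "continuous_on K fi"
 and fi: "smooth V (%q. cor (fi q))" and conv: "!!q. q:K ==> convex_at ka ka' fi q"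
 and D: "open D" "D <= K" "h:CR_functions D" and M: "0 <= M"
 and K': "!!q. q:K ==> q:D | norm (h q) <= M | fi q <= - c"
 and q0: "q0:K" "fi q0 > - c"
shows "norm (h q0) <= M"
proof(rule ccontr)
assume "~ norm (h q0) <= M"
hence hM: "(norm (h q0))^2 > M^2" using M by(simp add:power_strict_mono)
note l = ph_lchart[OF ph]
obtain B where B: "!!q. q:K ==> norm (h q) <= B"
 using compact_imp_bounded[OF compact_continuous_image[OF K(3,1)]] by(auto simp:bounded_iff)
\<comment> \<open>Strictly between the level \<open>- c\<close> and the value at \<open>q0\<close>,
  so that increasing \<open>k\<close> makes the weight small at \<open>q0\<close> and large where
  \<open>fi <= - c\<close>.\<close>
define s0 where "s0 = (fi q0 - c)/2"
have s0: "- c < s0" "s0 < fi q0" using q0(2) by(auto simp:s0_def field_simps)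
define ey where "ey = (norm (h q0))^2 - M^2"
have ey: "ey > 0" using hM by(simp add:ey_def)
\<comment> \<open>The two thresholds put the weight at \<open>q0\<close> below the excess
  \<open>ey\<close>, and above \<open>B^2\<close> where \<open>fi <= - c\<close>. The first keeps
  the maximum of \<open>w\<close> above \<open>M^2\<close>, the second keeps its position off that
  level.\<close>
define k where "k = 1 + max 0 (max (- ln ey/(fi q0 - s0)) (ln (B^2 + 1)/(s0 + c)))"
have k0: "k > - ln ey/(fi q0 - s0)" "k > ln (B^2 + 1)/(s0 + c)" "k > 0" by(auto simp:k_def)
have k: "exp (- k*(fi q0 - s0)) < ey" "B^2 < exp (k*(s0 + c))"
proof -
 have "- k*(fi q0 - s0) < ln ey" using k0(1) s0 by(simp add:field_simps)
 thus "exp (- k*(fi q0 - s0)) < ey" using ey by(metis exp_less_mono exp_ln)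
 have "ln (B^2 + 1) < k*(s0 + c)" using k0(2) s0 by(simp add:field_simps)
 hence "B^2 + 1 < exp (k*(s0 + c))" using ey
 by(metis add_nonneg_pos exp_less_mono exp_ln zero_le_power2 zero_less_one)
 thus "B^2 < exp (k*(s0 + c))" by simp
qed
define E where "E q = exp (- k*fi q + k * s0)" for q
define w where "w q = (norm (h q))^2 - E q" for q
have "continuous_on K w" unfolding w_def E_def by(intro continuous_intros K)
then obtain q1 where q1: "q1:K" "!!q. q:K ==> w q <= w q1"
 using continuous_attains_sup[OF K(1)] q0(1) by(metis empty_iff)
have E0: "E q0 = exp (- k*(fi q0 - s0))" by(simp add:E_def algebra_simps)
have w1: "w q1 > M^2" using q1(2)[OF q0(1)] k(1) by(simp add:w_def E0 ey_def)
have "~ norm (h q1) <= M"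
proof
 assume "norm (h q1) <= M"
 hence "(norm (h q1))^2 <= M^2" by(simp add:power_mono)
 moreover have "E q1 > 0" by(simp add:E_def)
 ultimately show False using w1 by(simp add:w_def)
qed
moreover have "~ fi q1 <= - c"
proof
 assume "fi q1 <= - c"
 hence "k*fi q1 <= k*(- c)" using k0(3) by(intro mult_left_mono) auto
 hence "exp (k*(s0 + c)) <= E q1" by(simp add:E_def algebra_simps)
 hence "E q1 > B^2" using k(2) by linarith
 moreover have "(norm (h q1))^2 <= B^2" using B[OF q1(1)] by(simp add:power_mono)
 moreover have "M^2 >= 0" by simp
 ultimately show False using w1 unfolding w_def by linarith
qed
ultimately have q1D: "q1:D" using K'[OF q1(1)] by blast
have q1V: "q1:V" using q1 K by auto
obtain r :: nat and Z where Z: "ALL j<r. Z j:T01 q1 & Z j (%q. cor (fi q)) = 0"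
 "(SUM j<r. tensor (Z j) (cconj (Z j))):kerL q1"
 "Re (contr ka ka' q1 (%a b. (SUM j<r. tensor (Z j) (cconj (Z j))) (xc ka a) (xc ka b)) (%q. cor (fi q))) > 0"
 using conv[OF q1(1)] unfolding convex_at_def by blast
define s where "s a b = (SUM j<r. tensor (Z j) (cconj (Z j))) (xc ka a) (xc ka b)" for a b
have ZC: "Z j:CT q1" if "j < r" for j using Z(1) that T01_CT by blast
have DV: "D <= V" using D K by auto
have hD: "smooth D h" using D(3) by(simp add:CR_functions_def)
note sh = smooth_nearI[OF D(1) q1D hD]
have fiD: "smooth D (%q. cor (fi q))" by(rule smooth_subset[OF fi DV])
note ex = smooth_exp_of_real[OF l D(1) DV fiD, where k = "- k" and d = "k * s0"]
have sE: "smooth_near q1 (%q. cor (E q))" unfolding E_def by(rule smooth_nearI[OF D(1) q1D ex(1)])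
have c1: "contr ka ka' q1 s h = 0" unfolding s_def by(rule kerL_CR[OF ph Z(2) q1V D(1) q1D D(3)])
have c2: "contr ka ka' q1 s (%q. cnj (h q)) = 0"
 using contr_cnj[OF l q1V sh, where r = r and Z = Z] c1 by(simp add:s_def[abs_def])
have Zh: "Z j h = 0" if "j < r" for j using CR_functions_T01[OF D(3) D(1) q1D] Z(1) that by blast
have f1: "(SUM a:Basis. SUM b:Basis. s a b*(pd ka ka' a h q1*pd ka ka' b (%q. cnj (h q)) q1)) = 0"
 unfolding s_def by(subst tensor_first_order[OF l q1V sh smooth_near_cnj[OF sh] ZC]) (auto simp:Zh)
have f2: "(SUM a:Basis. SUM b:Basis. s a b*(pd ka ka' a (%q. cnj (h q)) q1*pd ka ka' b h q1)) =
 cor (SUM j<r. (norm (cconj (Z j) h))^2)"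
 unfolding s_def
 by(subst tensor_first_order[OF l q1V smooth_near_cnj[OF sh] sh ZC])
 (auto simp:cconj_def complex_norm_square intro!: sum.cong simp del:of_real_power)
have c3: "contr ka ka' q1 s (%q. h q*cnj (h q)) = cor (SUM j<r. (norm (cconj (Z j) h))^2)"
 using contr_mult[OF l q1V sh smooth_near_cnj[OF sh], of s] f1 f2 c1 c2
 by(simp add:distrib_left sum.distrib mult_ac)
have c4: "contr ka ka' q1 s (%q. cor (E q)) =
 cor (- k)*cor (E q1)*contr ka ka' q1 s (%q. cor (fi q))"
 unfolding s_def E_def
 by(rule contr_exp[OF l q1V D(1) q1D fiD ZC _ ex]) (use Z(1) in auto)
have ww: "(%q. cor (w q)) = (%q. h q*cnj (h q) + (-1)*cor (E q))"
 by(rule ext) (simp add:w_def complex_norm_square[symmetric])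
have sw: "smooth_near q1 (%q. cor (w q))"
 unfolding ww by(intro smooth_near_add smooth_near_mult sh smooth_near_cnj smooth_near_const sE)
have "contr ka ka' q1 s (%q. cor (w q)) =
 contr ka ka' q1 s (%q. h q*cnj (h q)) + (-1)*contr ka ka' q1 s (%q. cor (E q))"
proof -
 have 1: "smooth_near q1 (%q. h q*cnj (h q))" by(intro smooth_near_mult sh smooth_near_cnj)
 have 2: "smooth_near q1 (%q. (-1)*cor (E q))" by(intro smooth_near_mult sE smooth_near_const)
 show ?thesis unfolding ww contr_add[OF l q1V 1 2] contr_cmult[OF l q1V sE] ..
qed
\<comment> \<open>Both terms have a sign: a sum of squares from the square of
  \<open>norm (h q)\<close>, and a positive multiple of the convexity of \<open>fi\<close> from the
  weight.\<close>
hence "Re (contr ka ka' q1 s (%q. cor (w q))) =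
 (SUM j<r. (norm (cconj (Z j) h))^2) + k*E q1 * Re (contr ka ka' q1 s (%q. cor (fi q)))"
 by(simp add:c3 c4)
moreover have "k*E q1 * Re (contr ka ka' q1 s (%q. cor (fi q))) > 0"
 using Z(3) k0(3) by(simp add:s_def[abs_def] E_def)
moreover have "(SUM j<r. (norm (cconj (Z j) h))^2) >= 0" by(simp add:sum_nonneg)
moreover have "Re (contr ka ka' q1 s (%q. cor (w q))) <= 0"
 unfolding s_def by(rule contr_max_nonpos[OF l q1V sw D(1) q1D]) (use q1(2) D(2) in auto)
ultimately show False by linarith
qed

end

section \<open>The operator \<open>ddc\<close> in charts by real parts of CR functions\<close>

context cr_manifold begin

lemma ph_chart_subset:
assumes ph: "ph_chart m z V ka ka' ze" and W: "open W" "W <= V" shows "ph_chart m z W ka ka' ze"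
unfolding ph_chart_def
proof(intro conjI ballI)
show "lchart W ka ka'" by(rule lchart_subset[OF ph_lchart[OF ph] W])
show "CR_coords W m z" by(rule CR_coords_subset[OF ph_coords[OF ph] W])
fix b :: 'e assume b: "b:Basis"
show "smooth W (ze b)" by(rule smooth_subset[OF ph_zeta_smooth[OF ph b] W(2)])
fix q assume "q:W"
hence q: "q:V" using W by auto
show "Re (ze b q) = ka q <.> b" by(rule ph_zeta_Re[OF ph b q])
fix Z assume "Z:T01 q" thus "Z (ze b) = 0" by(rule ph_zeta_T01[OF ph b q])
qed

lemma real_one_form_add:
assumes "real_one_form U xi" "q:U" "v:CT q" "w:CT q" shows "xi q (v + w) = xi q v + xi q w"
using assms(1)[unfolded real_one_form_def, THEN conjunct1] assms(2-4) by(simp only:)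

lemma real_one_form_cscale:
assumes "real_one_form U xi" "q:U" "v:CT q" shows "xi q (cscale c v) = c*xi q v"
using assms(1)[unfolded real_one_form_def, THEN conjunct2, THEN conjunct1] assms(2-3) by(simp only:)

lemma real_one_form_cconj:
assumes "real_one_form U xi" "q:U" "v:CT q" shows "xi q (cconj v) = cnj (xi q v)"
using assms(1)[unfolded real_one_form_def, THEN conjunct2, THEN conjunct2, THEN conjunct1] assms(2-3) by(simp only:)

lemma real_one_form_sum:
assumes "real_one_form U xi" "q:U" "!!j. j < (r::nat) ==> F j:CT q"
shows "xi q (SUM j<r. F j) = (SUM j<r. xi q (F j))"
using assms(3)
proof(induction r)
case 0
have "xi q (cscale 0 0) = 0*xi q 0" by(rule real_one_form_cscale[OF assms(1,2) CT_zero])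
moreover have "cscale 0 0 = (0 :: 'p cvec)" by simp
ultimately show ?case by(simp only: lessThan_0 sum.empty mult_zero_left)
next
case (Suc r)
have "(SUM j<r. F j):CT q" by(rule cvec.subspace_sum[OF CT_subspace]) (use Suc.prems in auto)
moreover have "F r:CT q" using Suc.prems by auto
ultimately have "xi q ((SUM j<r. F j) + F r) = xi q (SUM j<r. F j) + xi q (F r)"
 by(rule real_one_form_add[OF assms(1,2)])
moreover have "xi q (SUM j<r. F j) = (SUM j<r. xi q (F j))" by(rule Suc.IH) (use Suc.prems in auto)
ultimately show ?case by(simp only: sum.lessThan_Suc)
qed

text \<open>The condition on \<open>xi\<close> expresses \<open>xi\<close> on \<open>Z j\<close> and
  its conjugate by derivatives of \<open>rh\<close>, so that only second derivatives of
  \<open>rh\<close> and the values of \<open>rh\<close> and \<open>xi\<close> on the Levi vector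
  remain. On the kernel the Levi vector is \<open>- \<i>/2\<close> times \<open>Y + cconj Y\<close>,
  and with it all first order terms cancel.\<close>

lemma ext_deriv_contr:
fixes r :: nat and rh :: "'p => real"
assumes ph: "ph_chart m z V ka ka' ze" and q: "q:V" and U: "open U" "q:U"
 and rh: "smooth_near q (%q. cor (rh q))" and xi: "real_one_form U xi"
 and d: "!!q W. q:U ==> W:T01 q ==> W (%q'. cor (rh q')) + \<i>*xi q W = 0"
 and Z: "!!j. j < r ==> Z j:sections U"
 and si: "(SUM j<r. tensor (Z j q) (cconj (Z j q))):kerL q"
shows "\<i>/2*(SUM j<r. ext_deriv xi (Z j) (%q. cconj (Z j q)) q) =
 contr ka ka' q (%a b. (SUM j<r. tensor (Z j q) (cconj (Z j q))) (xc ka a) (xc ka b)) (%q. cor (rh q))"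
proof -
let ?rh = "%q. cor (rh q)"
obtain U1 where U1: "open U1" "q:U1" "smooth U1 ?rh" using rh smooth_near_def by blast
define W where "W = U Int V Int U1"
have W: "open W" "W <= V" "q:W" "W <= U" "W <= U1"
 using U U1 q ph_open[OF ph] by(auto simp:W_def)
have ZW: "Z j:sections W" if "j < r" for j by(rule sections_subset[OF Z[OF that] W(4)])
have ZC: "Z j q:CT q" "cconj (Z j q):CT q" if "j < r" for j
 using T01_CT[OF sections_T01[OF ZW[OF that] W(3)]] CT_cconj by auto
have xiZ: "xi q' Y = \<i>*Y ?rh" if "q':U" "Y:T01 q'" for q' Y
proof -
 have "\<i>*(Y ?rh + \<i>*xi q' Y) = 0" using d[OF that] by simp
 thus ?thesis by(simp add:distrib_left)
qed
have xiZc: "xi q' (cconj Y) = - \<i>*cconj Y ?rh" if "q':U" "Y:T01 q'" for q' Y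
proof -
 have "xi q' (cconj Y) = cnj (xi q' Y)" by(rule real_one_form_cconj[OF xi that(1) T01_CT[OF that(2)]])
 moreover have "cconj Y ?rh = cnj (Y ?rh)" by(rule cconj_real) simp
 ultimately show ?thesis using xiZ[OF that] by simp
qed
define A where "A j = Z j q (%q'. cconj (Z j q') ?rh)" for j
define B where "B j = cconj (Z j q) (%q'. Z j q' ?rh)" for j
have s1: "smooth_near q (%q'. cconj (Z j q') ?rh)" "smooth_near q (%q'. Z j q' ?rh)" if "j < r" for j
 using smooth_near_field[OF _ W(1,3) rh] sections_smooth_field[OF ZW[OF that]] smooth_field_cconj by auto
have a1: "Z j q (%q'. xi q' (cconj (Z j q'))) = - \<i>*A j" if "j < r" for j
proof -
 have "Z j q (%q'. (- \<i>)*cconj (Z j q') ?rh) = Z j q (%q'. xi q' (cconj (Z j q')))"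
 by(rule CT_cong_open[OF ZC(1)[OF that] smooth_near_mult[OF smooth_near_const s1(1)[OF that]] W(1,3)])
  (use xiZc sections_T01[OF ZW[OF that]] W(4) in auto)
 thus ?thesis using CT_cmult[OF ZC(1)[OF that] s1(1)[OF that], of "- \<i>"] by(simp add:A_def)
qed
have b1: "cconj (Z j q) (%q'. xi q' (Z j q')) = \<i>*B j" if "j < r" for j
proof -
 have "cconj (Z j q) (%q'. \<i>*Z j q' ?rh) = cconj (Z j q) (%q'. xi q' (Z j q'))"
 by(rule CT_cong_open[OF ZC(2)[OF that] smooth_near_mult[OF smooth_near_const s1(2)[OF that]] W(1,3)])
  (use xiZ sections_T01[OF ZW[OF that]] W(4) in auto)
 thus ?thesis using CT_cmult[OF ZC(2)[OF that] s1(2)[OF that], of "\<i>"] by(simp add:B_def)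
qed
have lC: "lie (Z j) (%q. cconj (Z j q)) q:CT q" if "j < r" for j
 using sections_smooth_field[OF ZW[OF that]] by(intro lie_CT[OF _ smooth_field_cconj W(1,3)])
have S1: "(SUM j<r. ext_deriv xi (Z j) (%q. cconj (Z j q)) q) = - \<i>*(SUM j<r. A j) - \<i>*(SUM j<r. B j) - xi q (levi_vec r Z q)"
proof -
 have "(SUM j<r. ext_deriv xi (Z j) (%q. cconj (Z j q)) q) =
 (SUM j<r. - \<i>*A j - \<i>*B j - xi q (lie (Z j) (%q. cconj (Z j q)) q))"
 by(rule sum.cong[OF refl]) (simp add:ext_deriv_def a1 b1)
 moreover have "xi q (levi_vec r Z q) = (SUM j<r. xi q (lie (Z j) (%q. cconj (Z j q)) q))"
 unfolding levi_vec_def by(rule real_one_form_sum[OF xi U(2) lC])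
 ultimately show ?thesis by(simp add:sum_subtractf sum_distrib_left sum_negf)
qed
have S2: "levi_vec r Z q ?rh = (SUM j<r. A j) - (SUM j<r. B j)"
 unfolding levi_vec_def sum_fun_apply using rh by(simp add:lie_def A_def B_def sum_subtractf)
obtain Y where Y: "Y:T01 q" "levi_vec r Z q = cscale (- \<i>/2) (Y + cconj Y)"
 using kerL_levi_vec[where Z = Z and r = r, OF ph W(1,3) q ZW si] by blast
have S3: "xi q (levi_vec r Z q) = - \<i>/2*(\<i>*Y ?rh - \<i>*cconj Y ?rh)"
proof -
 have C: "Y:CT q" "cconj Y:CT q" using T01_CT[OF Y(1)] CT_cconj by auto
 have "xi q (levi_vec r Z q) = - \<i>/2*(xi q Y + xi q (cconj Y))"
 by(simp only: Y(2) real_one_form_cscale[OF xi U(2) CT_plus[OF C]] real_one_form_add[OF xi U(2) C])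
 thus ?thesis using xiZ[OF U(2) Y(1)] xiZc[OF U(2) Y(1)] by simp
qed
have S4: "levi_vec r Z q ?rh = - \<i>/2*(Y ?rh + cconj Y ?rh)" by(simp add:Y(2) cscale_def)
have S5: "(SUM j<r. A j) = contr ka ka' q (%a b. (SUM j<r. tensor (Z j q) (cconj (Z j q))) (xc ka a) (xc ka b)) ?rh - \<i>/2*cconj Y ?rh"
 unfolding A_def using sum_second_order[where Z = Z and r = r, OF ph W(1,2,3) ZW rh] levi_vec_zeta[OF ph q Y rh] by simp
have B: "(SUM j<r. B j) = (SUM j<r. A j) - levi_vec r Z q ?rh" using S2 by simp
show ?thesis unfolding S1 B S3 unfolding S4 S5 by(simp add:algebra_simps)
qed

lemma contr_real:
fixes r :: nat and Z :: "nat => 'p cvec" and rh :: "'p => real"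
assumes l: "lchart V ka ka'" "q:V" and rh: "smooth_near q (%q. cor (rh q))"
defines "s \<equiv> %a b. (SUM j<r. tensor (Z j) (cconj (Z j))) (xc ka a) (xc ka b)"
shows "cor (Re (contr ka ka' q s (%q. cor (rh q)))) = contr ka ka' q s (%q. cor (rh q))"
proof -
have "cnj (contr ka ka' q s (%q. cor (rh q))) = contr ka ka' q s (%q. cor (rh q))"
 using contr_cnj[OF l rh, where r = r and Z = Z] by(simp add:s_def)
thus ?thesis by(metis Reals_cnj_iff of_real_Re)
qed

text \<open>By \<open>ext_deriv_contr\<close> every admissible \<open>xi\<close> and every
  representation of the tensor give the same number; it remains to exhibit one
  \<open>xi\<close>.\<close>

lemma ddc_eq:
fixes rh :: "'p => real"
assumes ph: "ph_chart m z V ka ka' ze" and q: "q:V" and si: "si:kerL q"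
 and rh: "smooth_near q (%q. cor (rh q))"
shows "ddc rh q si = Re (contr ka ka' q (%a b. si (xc ka a) (xc ka b)) (%q. cor (rh q)))"
 (is "_ = Re ?c")
proof -
let ?rh = "%q. cor (rh q)"
note l = ph_lchart[OF ph]
obtain U1 where U1: "open U1" "q:U1" "smooth U1 ?rh" using rh smooth_near_def by blast
obtain r :: nat and Z0 where Z0: "ALL j<r. Z0 j:T01 q" "si = (SUM j<r. tensor (Z0 j) (cconj (Z0 j)))"
 by(rule kerL_repr[OF ph si])
obtain U2 Z where Z: "open U2" "U2 <= V" "q:U2" "ALL j<r. Z j:sections U2" "ALL j<r. Z j q = Z0 j"
 by(rule T01_repr_sections[OF ph q, of r Z0]) (use Z0(1) in auto)
have real: "cor (Re ?c) = ?c"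
 unfolding Z0(2) by(rule contr_real[OF l q rh])
define U where "U = U1 Int U2"
have U: "open U" "q:U" "U <= U1" "U <= V" "U <= U2" using U1 Z by(auto simp:U_def)
define I where "I b = (%q. cor (Im (ze b q)))" for b
have sI: "smooth U (I b)" if "b:Basis" for b
 unfolding I_def by(rule smooth_of_Im[OF U(1) smooth_subset[OF ph_zeta_smooth[OF ph that] U(4)]])
\<comment> \<open>A vector \<open>W\<close> of type (0,1) annihilates \<open>ze b\<close>, so its
  value on the coordinate is \<open>- \<i>\<close> times that on \<open>I b\<close>. The required
  form therefore arises from the differential of \<open>rh\<close> by replacing each coordinate
  differential by that of \<open>Im (ze b)\<close>.\<close>
define xi where "xi q v = (SUM b:Basis. pd ka ka' b ?rh q * v (I b))" for q and v :: "'p cvec"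
have srh: "smooth U ?rh" by(rule smooth_subset[OF U1(3) U(3)])
have xi: "real_one_form U xi"
 unfolding real_one_form_def
proof(intro conjI ballI allI impI)
 fix q v assume q: "q:U" and v: "v:CT q"
 show "xi q (v + w) = xi q v + xi q w" for w by(simp add:xi_def distrib_left sum.distrib)
 show "xi q (cscale c v) = c*xi q v" for c by(simp add:xi_def cscale_def sum_distrib_left mult_ac)
 show "xi q (cconj v) = cnj (xi q v)"
 proof -
 have "cnj (pd ka ka' b ?rh q) = pd ka ka' b ?rh q" if "b:Basis" for b
  using pd_cnj[OF l _ that smooth_nearI[OF U(1) q srh]] q U by auto
 moreover have "cconj v (I b) = cnj (v (I b))" for b by(rule cconj_real) (simp add:I_def)
 ultimately show ?thesis by(simp add:xi_def cong: sum.cong)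
 qed
next
 fix W X assume W: "open W" "W <= U" "smooth_field W X"
 show "smooth W (%q. xi q (X q))" unfolding xi_def
 by(intro smooth_sum smooth_mult W(1) smooth_pd[OF l] smooth_field_smooth[OF W(3) W(1) order_refl])
  (use W U smooth_subset[OF srh] smooth_subset[OF sI] in auto)
qed
have dxi: "W ?rh + \<i>*xi q' W = 0" if q': "q':U" and W: "W:T01 q'" for q' W
proof -
 have q'V: "q':V" using q' U by auto
 note WC = T01_CT[OF W]
 have "W (xc ka b) + \<i>*W (I b) = 0" if b: "b:Basis" for b
 proof -
 have s: "smooth_near q' (ze b)" by(rule smooth_nearI[OF ph_open[OF ph] q'V ph_zeta_smooth[OF ph b]])
 have "W (xc ka b) = W (%q. cor (Re (ze b q)))"
  by(rule CT_cong_open[OF WC smooth_near_xc[OF l q'V] ph_open[OF ph] q'V])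
  (simp add:xc_def ph_zeta_Re[OF ph b])
 thus ?thesis using CT_split[OF WC s] ph_zeta_T01[OF ph b q'V W] by(simp add:I_def)
 qed
 hence "(SUM b:Basis. (W (xc ka b) + \<i>*W (I b))*pd ka ka' b ?rh q') = 0" by simp
 moreover have "(SUM b:Basis. (W (xc ka b) + \<i>*W (I b))*pd ka ka' b ?rh q') =
 (SUM b:Basis. W (xc ka b)*pd ka ka' b ?rh q') + \<i>*xi q' W"
 by(simp add:xi_def algebra_simps sum.distrib sum_distrib_left)
 ultimately show ?thesis
 using CT_pd[OF l q'V WC smooth_nearI[OF U(1) q' srh]] by simp
qed
have ZU: "Z j:sections U" if "j < r" for j using sections_subset[of "Z j" U2 U] Z(4) that U(5) by auto
have siZ: "si = (SUM j<r. tensor (Z j q) (cconj (Z j q)))" using Z0(2) Z(5) by simp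
show ?thesis unfolding ddc_def
proof(rule the_equality)
 have "cor (Re ?c) = \<i>/2*(SUM j<r. ext_deriv xi (Z j) (%q. cconj (Z j q)) q)"
 unfolding real unfolding siZ
 by(rule ext_deriv_contr[symmetric, OF ph q U(1,2) rh xi dxi ZU]) (use si in "auto simp: siZ[symmetric]")
 thus "EX U xi (r::nat) Z. open U & q:U & real_one_form U xi &
 (ALL q:U. ALL W:T01 q. W ?rh + \<i>*xi q W = 0) &
 (ALL j<r. Z j:sections U) & si = (SUM j<r. tensor (Z j q) (cconj (Z j q))) &
 cor (Re ?c) = \<i>/2*(SUM j<r. ext_deriv xi (Z j) (%q. cconj (Z j q)) q)"
 using U(1,2) xi dxi ZU siZ
 by(intro exI[of _ U] exI[of _ xi] exI[of _ r] exI[of _ Z]) blast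
next
 fix c :: real assume "EX U xi (r::nat) Z. open U & q:U & real_one_form U xi &
 (ALL q:U. ALL W:T01 q. W ?rh + \<i>*xi q W = 0) &
 (ALL j<r. Z j:sections U) & si = (SUM j<r. tensor (Z j q) (cconj (Z j q))) &
 cor c = \<i>/2*(SUM j<r. ext_deriv xi (Z j) (%q. cconj (Z j q)) q)"
 then obtain U xi and r :: nat and Z where *: "open U" "q:U" "real_one_form U xi"
 "ALL q:U. ALL W:T01 q. W ?rh + \<i>*xi q W = 0"
 "ALL j<r. Z j:sections U" "si = (SUM j<r. tensor (Z j q) (cconj (Z j q)))"
 "cor c = \<i>/2*(SUM j<r. ext_deriv xi (Z j) (%q. cconj (Z j q)) q)"
 by(elim exE conjE) (rule that)
 have "cor c = ?c" unfolding *(7) unfolding *(6)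
 by(rule ext_deriv_contr[OF ph q *(1,2) rh *(3)]) (use *(4,5) si in "auto simp: *(6)[symmetric]")
 thus "c = Re ?c" by(metis Re_complex_of_real)
qed
qed

section \<open>Tangential distributions and weak concavity\<close>

text \<open>Near \<open>p\<close> some frame vector \<open>E k\<close> does not annihilate
  \<open>fi\<close>; subtracting multiples of it from the others gives a frame of the vectors that
  do. The rank \<open>n - 1\<close> is that of the distributions in \<open>Psi_we 2\<close>.\<close>

lemma tangent_distribution:
fixes fi :: "'p => complex"
assumes fi: "smooth_near p fi" and Y: "Y:T01 p" "Y fi ~= 0"
obtains U where "open U" "p:U" "n >= 1" "distribution U (n - 1) (%q. {Z:T01 q. Z fi = 0})"
proof -
obtain U0 E where U0: "open U0" "p:U0" "ALL j<n. smooth_field U0 (E j)"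
 "ALL q:U0. T01 q = cvec.span ((%j. E j q) ` {..<n}) & cvec.dim (T01 q) = n"
 by(rule T01_frame[of p])
obtain U1 where U1: "open U1" "p:U1" "smooth U1 fi" using fi smooth_near_def by blast
let ?U2 = "U0 Int U1"
have T: "T01 q = cvec.span ((%j. E j q) ` {..<n})" "cvec.dim (T01 q) = n" if "q:U0" for q
 by(rule conjunct1[OF bspec[OF U0(4) that]], rule conjunct2[OF bspec[OF U0(4) that]])
have sE: "smooth ?U2 (%q. E j q fi)" if "j < n" for j
 by(rule smooth_field_smooth[of U0]) (use U0 U1 that smooth_subset[OF U1(3)] in auto)
obtain c where c: "Y = (SUM j<n. cscale (c j) (E j p))"
 using span_finite_family[of Y "%j. E j p" n] Y(1) T(1)[OF U0(2)] by auto
have "Y fi = (SUM j<n. c j*E j p fi)" by(simp add:c sum_fun_apply cscale_def)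
then obtain k where k: "k < n" "E k p fi ~= 0" using Y(2) by(metis (no_types, lifting) lessThan_iff mult_zero_right sum.neutral)
define U where "U = {q:?U2. E k q fi ~= 0}"
have "open (?U2 Int (%q. E k q fi) -` (- {0}))"
 using smooth_imp_continuous[OF _ sE[OF k(1)]] U0 U1 by(intro continuous_open_preimage) auto
hence U: "open U" "p:U" "U <= ?U2" using U0 U1 k by(auto simp:U_def vimage_def Int_def)
define F where "F j q = E j q + cscale (- (E j q fi/E k q fi)) (E k q)" for j q
\<comment> \<open>Enumerates the indices other than \<open>k\<close> by
  \<open>{..<n - 1}\<close>.\<close>
define ix where "ix j = (if j < k then j else Suc j)" for j
have ix: "ix j < n" "ix j ~= k" if "j < n - 1" for j using that k(1) by(auto simp:ix_def)
have ixs: "EX i<n - 1. ix i = j" if "j < n" "j ~= k" for j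
proof(cases "j < k")
 case True thus ?thesis using k(1) by(intro exI[of _ j]) (auto simp:ix_def)
next
 case False thus ?thesis using that by(intro exI[of _ "j - 1"]) (auto simp:ix_def)
qed
have sF: "smooth_field U (F j)" if "j < n" for j
proof -
 have "smooth U (%q. - (E j q fi/E k q fi))"
 by(intro smooth_minus smooth_divide U(1) smooth_subset[OF sE[OF that] U(3)] smooth_subset[OF sE[OF k(1)] U(3)])
  (simp add:U_def)
 thus ?thesis unfolding F_def
 by(intro smooth_field_add smooth_field_scale)
  (use U0(3) U(3) that k(1) smooth_field_subset in "meson le_inf_iff")+
qed
have main: "{Z:T01 q. Z fi = 0} = cvec.span ((%j. F (ix j) q) ` {..<n - 1}) &
 cvec.dim {Z:T01 q. Z fi = 0} = n - 1" if q: "q:U" for q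
proof -
 have q0: "q:U0" and nz: "E k q fi ~= 0" using q U by(auto simp:U_def)
 let ?K = "{Z:T01 q. Z fi = 0}" and ?S = "(%j. F (ix j) q) ` {..<n - 1}"
 have ET: "E j q:T01 q" if "j < n" for j using T(1)[OF q0] that by(auto intro: cvec.span_base)
 have FK: "F j q:?K" if "j < n" for j
 proof -
 have "F j q:T01 q" unfolding F_def by(intro T01_add T01_cscale ET that k(1))
 moreover have "F j q fi = 0" using nz by(simp add:F_def cscale_def)
 ultimately show ?thesis by simp
 qed
 have sub: "cvec.subspace ?K"
 unfolding cvec.subspace_def using T01_zero T01_add T01_cscale by(auto simp:cscale_def)
 have EF: "E j q = F j q + cscale (E j q fi/E k q fi) (E k q)" for j
 by(simp add:F_def cscale_def fun_eq_iff)
 have Fsp: "F j q:cvec.span ?S" if "j < n" "j ~= k" for j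
 using ixs[OF that] by(auto intro!: cvec.span_base)
 have decomp: "EX P:cvec.span ?S. EX a. Z = P + cscale a (E k q)" if "Z:T01 q" for Z
 proof -
 obtain c where c: "Z = (SUM j<n. cscale (c j) (E j q))"
  using span_finite_family[of Z "%j. E j q" n] `Z : T01 q` T(1)[OF q0] by auto
 have "Z = (SUM j:{..<n} - {k}. cscale (c j) (E j q)) + cscale (c k) (E k q)"
  unfolding c using k(1) by(subst sum.remove[of "{..<n}" k]) (auto simp:add.commute)
 also have "(SUM j:{..<n} - {k}. cscale (c j) (E j q)) =
  (SUM j:{..<n} - {k}. cscale (c j) (F j q)) + cscale (SUM j:{..<n} - {k}. c j*(E j q fi/E k q fi)) (E k q)"
  by(rule ext) (simp add:sum_fun_apply cscale_def F_def algebra_simps sum.distrib sum_subtractf sum_distrib_left sum_distrib_right)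
 finally have "Z = (SUM j:{..<n} - {k}. cscale (c j) (F j q)) +
  cscale ((SUM j:{..<n} - {k}. c j*(E j q fi/E k q fi)) + c k) (E k q)"
  by(simp add:cscale_def fun_eq_iff algebra_simps)
 moreover have "(SUM j:{..<n} - {k}. cscale (c j) (F j q)):cvec.span ?S"
  by(intro cvec.span_sum cvec.span_scale Fsp) auto
 ultimately show ?thesis by blast
 qed
 have SK: "cvec.span ?S <= ?K" by(rule cvec.span_minimal[OF _ sub]) (use FK ix in auto)
 have "?K <= cvec.span ?S"
 proof
 fix Z assume Z: "Z:?K"
 then obtain P a where P: "P:cvec.span ?S" "Z = P + cscale a (E k q)" using decomp by blast
 have "P fi = 0" using SK P(1) by auto
 hence "a = 0" using Z P(2) nz by(simp add:cscale_def)
 hence "Z = P" using P(2) by simp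
 thus "Z:cvec.span ?S" using P(1) by simp
 qed
 hence KS: "?K = cvec.span ?S" using SK by auto
 have fS: "finite ?S" by simp
 have "cvec.dim ?K <= card ?S" unfolding KS by(rule cvec.dim_le_card[OF order_refl fS])
 also have "... <= n - 1" using card_image_le[of "{..<n - 1}"] by simp
 finally have le: "cvec.dim ?K <= n - 1" .
 obtain B where B: "B <= ?K" "cvec.independent B" "?K <= cvec.span B" "card B = cvec.dim ?K"
 by(rule cvec.basis_exists)
 have fB: "finite B" using cvec.independent_span_bound[OF fS B(2)] B(1) KS by auto
 have "T01 q <= cvec.span (insert (E k q) B)"
 proof
 fix Z assume "Z:T01 q"
 then obtain P a where P: "P:cvec.span ?S" "Z = P + cscale a (E k q)" using decomp by blast
 have "P:cvec.span (insert (E k q) B)" using P(1) KS B(3) cvec.span_mono[of B "insert (E k q) B"] by auto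
 thus "Z:cvec.span (insert (E k q) B)" unfolding P(2)
  by(intro cvec.span_add cvec.span_scale) (auto intro: cvec.span_base)
 qed
 hence "cvec.dim (T01 q) <= card (insert (E k q) B)" using fB by(intro cvec.dim_le_card) auto
 hence "n <= cvec.dim ?K + 1" using T(2)[OF q0] B(4) card_insert_le_m1[of "card B + 1"] fB
 by(metis add.commute card_insert_if le_SucI plus_1_eq_Suc order_refl le_trans)
 thus ?thesis using le KS by auto
qed
have "distribution U (n - 1) (%q. {Z:T01 q. Z fi = 0})"
 unfolding distribution_def subbundle_def
proof(intro conjI ballI)
 fix q assume "q:U"
 show "EX W Z. open W & q:W & W <= U & (ALL j<n - 1. smooth_field W (Z j)) &
 (ALL q:W. {Z:T01 q. Z fi = 0} = cvec.span ((%j. Z j q) ` {..<n - 1}) & cvec.dim {Z:T01 q. Z fi = 0} = n - 1)"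
 proof(intro exI[of _ U] exI[of _ "%j. F (ix j)"] conjI allI impI ballI)
 show "smooth_field U (F (ix j))" if "j < n - 1" for j by(rule sF) (use ix that in auto)
 show "{Z:T01 q. Z fi = 0} = cvec.span ((%j. F (ix j) q) ` {..<n - 1})"
  "cvec.dim {Z:T01 q. Z fi = 0} = n - 1" if "q:U" for q
  using main[OF that] by(rule conjunct1, rule conjunct2)
 qed (use U `q : U` in auto)
qed auto
thus ?thesis using that U k(1) by auto
qed

end

context cr_manifold begin

lemma openin_H11_box:
assumes V: "open V" and f: "!!a. a:B ==> smooth V (f a)" and B: "finite B" "B ~= {}" and G: "!!a b. open (G a b)"
shows "openin H11_topology {(q,si). q:V & si:H11 q & (ALL a:B. ALL b:B. si (f a) (f b):G a b)}"
proof -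
have 1: "openin H11_topology {(q,si). q:V & si:H11 q & si (f a) (f b):G a b}" if "a:B" "b:B" for a b
 unfolding H11_topology_def
 by(rule topology_generated_by_Basis) (use that V f G in blast)
have "openin H11_topology (INT ab:B \<times> B. {(q,si). q:V & si:H11 q & si (f (fst ab)) (f (snd ab)):G (fst ab) (snd ab)})"
 by(rule openin_INT2) (use B 1 in auto)
also have "(INT ab:B \<times> B. {(q,si). q:V & si:H11 q & si (f (fst ab)) (f (snd ab)):G (fst ab) (snd ab)}) =
 {(q,si). q:V & si:H11 q & (ALL a:B. ALL b:B. si (f a) (f b):G a b)}"
 using B(2) by auto
finally show ?thesis .
qed

text \<open>Tensors tangent to the level sets of \<open>fi\<close> are those of a distribution of
  rank \<open>n - 1\<close>. If convexity failed along a sequence tending to \<open>p\<close>,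
  \<open>Psi_we 2\<close> would approximate the positive tensor at \<open>p\<close> by such tensors
  at points of the sequence, and their contraction with the Hessian would be positive by
  continuity.\<close>

lemma convex_at_nbhd:
fixes fi :: "'p => real"
assumes psi: "Psi_we 2" and l: "lchart V ka ka'" and p: "p:V"
 and fi: "smooth V (%q. cor (fi q))"
 and Y: "Y:T01 p" "Y (%q. cor (fi q)) ~= 0" and conv: "convex_at ka ka' fi p"
obtains G where "open G" "p:G" "ALL q:G. convex_at ka ka' fi q"
proof -
let ?fi = "%q. cor (fi q)"
have sfi: "smooth_near p ?fi" by(rule smooth_nearI[OF lchart_open[OF l] p fi])
obtain U where U: "open U" "p:U" "n >= 1" "distribution U (n - 1) (%q. {Z:T01 q. Z ?fi = 0})"
 by(rule tangent_distribution[OF sfi Y])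
define E where "E = (%q. {Z:T01 q. Z ?fi = 0})"
have psi': "ALL s :: nat => 'p. s \<longlonglongrightarrow> p --> (ALL ta:kerL_in E p.
 (p,ta):H11_topology derived_set_of (UN nu:{nu. s nu:U}. {s nu} \<times> kerL_in E (s nu)))"
proof -
 have d: "distribution U (n - 1) E" using U(4) by(simp only: E_def)
 have e: "n - 1 + 2 = n + 1" using U(3) by simp
 show ?thesis
 by(rule psi[unfolded Psi_we_def, THEN spec[of _ p], THEN spec[of _ U], THEN spec[of _ "n - 1"], THEN spec[of _ E],
  THEN mp, OF U(1), THEN mp, OF U(2), THEN mp, OF e, THEN mp, OF d, THEN conjunct2])
qed
define H where "H a b = pd ka ka' a (pd ka ka' b ?fi)" for a b
have cH: "isCont (H a b) p" for a b
proof -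
 have "smooth V (H a b)" unfolding H_def
 by(intro smooth_pd[OF l lchart_open[OF l] order_refl] fi)
 from smooth_imp_continuous[OF lchart_open[OF l] this] show ?thesis
 using continuous_on_eq_continuous_at[OF lchart_open[OF l]] p by auto
qed
have conv_iff: "convex_at ka ka' fi q \<longleftrightarrow> (EX si:kerL_in E q. Re (SUM a:Basis. SUM b:Basis. si (xc ka a) (xc ka b)*H a b q) > 0)" for q
 unfolding convex_at_def kerL_in_def E_def contr_def H_def by auto
obtain ta where ta: "ta:kerL_in E p" "Re (SUM a:Basis. SUM b:Basis. ta (xc ka a) (xc ka b)*H a b p) > 0"
 using conv conv_iff by blast
have "EX G. open G & p:G & (ALL q:G. convex_at ka ka' fi q)"
proof(rule ccontr)
 assume no: "\<nexists>G. open G & p:G & (ALL q:G. convex_at ka ka' fi q)"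
 obtain A :: "nat => 'p set" where A: "!!i. open (A i)" "!!i. p:A i"
 "!!F. (ALL n. F n:A n) ==> F \<longlonglongrightarrow> p"
 by(rule first_countable_topology_class.countable_basis[of p]) blast
 have "EX q. q:A i & ~ convex_at ka ka' fi q" for i
 proof(rule ccontr)
 assume "\<nexists>q. q:A i & ~ convex_at ka ka' fi q"
 hence "open (A i) & p:A i & (ALL q:A i. convex_at ka ka' fi q)" using A(1,2) by simp
 thus False using no by(elim notE) (rule exI)
 qed
 hence "EX s. ALL i. s i:A i & ~ convex_at ka ka' fi (s i)" by(intro choice allI)
 then obtain s where s: "!!i. s i:A i" "!!i. ~ convex_at ka ka' fi (s i)" by auto
 have "s \<longlonglongrightarrow> p" by(rule A(3)) (simp add:s(1))
 hence der: "(p,ta):H11_topology derived_set_of (UN nu:{nu. s nu:U}. {s nu} \<times> kerL_in E (s nu))"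
 by(rule psi'[THEN spec, THEN mp, THEN bspec, OF _ ta(1)])
 define T where "T k = {(q,si). q:A k Int V & si:H11 q &
 (ALL a:Basis. ALL b:Basis. si (xc ka a) (xc ka b):ball (ta (xc ka a) (xc ka b)) (1/real (Suc k)))}" for k
 have T1: "openin H11_topology (T k)" for k unfolding T_def
 by(rule openin_H11_box) (auto intro: A lchart_open[OF l] smooth_xc[OF l])
 have T2: "(p,ta):T k" for k
 using A p ta(1) by(auto simp:T_def kerL_in_def kerL_def)
 note d = conjunct2[OF der[unfolded in_derived_set_of]]
 have "EX y. y:(UN nu:{nu. s nu:U}. {s nu} \<times> kerL_in E (s nu)) & y:T k" for k
 using mp[OF spec[OF d, of "T k"] conjI[OF T2 T1]] by(elim exE conjE) (rule exI, rule conjI)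
 hence "EX y. ALL k. y k:(UN nu:{nu. s nu:U}. {s nu} \<times> kerL_in E (s nu)) & y k:T k"
 by(intro choice allI)
 then obtain y where y: "!!k. y k:(UN nu:{nu. s nu:U}. {s nu} \<times> kerL_in E (s nu))" "!!k. y k:T k" by auto
 define Q where "Q k = fst (y k)" for k
 define S where "S k = snd (y k)" for k
 have QA: "Q k:A k" for k using y(2)[of k] by(auto simp:T_def Q_def)
 have "Q \<longlonglongrightarrow> p" by(rule A(3)) (simp add:QA)
 hence tH: "(%k. H a b (Q k)) \<longlonglongrightarrow> H a b p" for a b
 by(rule isCont_tendsto_compose[OF cH])
 have tS: "(%k. S k (xc ka a) (xc ka b)) \<longlonglongrightarrow> ta (xc ka a) (xc ka b)" if "a:Basis" "b:Basis" for a b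
 proof(rule metric_tendsto_imp_tendsto[OF LIMSEQ_Suc[OF lim_1_over_n[where 'a = real]]])
 show "\<forall>\<^sub>F k in sequentially. dist (S k (xc ka a) (xc ka b)) (ta (xc ka a) (xc ka b)) <= dist (1/real (Suc k)) 0"
  using y(2) that by(auto simp:T_def S_def dist_commute case_prod_beta less_imp_le intro!: always_eventually)
 qed
 have "(%k. Re (SUM a:Basis. SUM b:Basis. S k (xc ka a) (xc ka b)*H a b (Q k))) \<longlonglongrightarrow>
 Re (SUM a:Basis. SUM b:Basis. ta (xc ka a) (xc ka b)*H a b p)"
 by(intro tendsto_Re tendsto_sum tendsto_mult tH tS)
 from order_tendstoD(1)[OF this ta(2)]
 obtain k where k: "Re (SUM a:Basis. SUM b:Basis. S k (xc ka a) (xc ka b)*H a b (Q k)) > 0"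
 by(auto dest: eventually_happens)
 obtain nu where "Q k = s nu" "S k:kerL_in E (s nu)" using y(1)[of k] by(auto simp:Q_def S_def)
 hence "convex_at ka ka' fi (s nu)" using k conv_iff by auto
 thus False using s(2) by blast
qed
thus ?thesis using that by blast
qed

text \<open>The bound is required only on the part of the frontier of \<open>Om\<close> inside
  \<open>G\<close>; nothing is asked at the other boundary points of
  \<open>G Int Om\<close>.\<close>

definition MP :: "'p set => 'p set => bool" where
"MP Om G \<longleftrightarrow> (ALL h M. h:CR_functions (G Int Om) --> continuous_on (G Int closure Om) h --> 0 <= M -->
 (ALL q:G Int frontier Om. norm (h q) <= M) --> (ALL q:G Int Om. norm (h q) <= M))"

lemma CR_functions_subset: "h:CR_functions U ==> W <= U ==> h:CR_functions W"
unfolding CR_functions_def by(auto intro: smooth_subset)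

lemma defining_function_frontier:
assumes "open V" "smooth V (%q. cor (rh q))" "open Om" "Om Int V = {q:V. rh q < 0}"
shows "q:V ==> q:closure Om ==> rh q <= 0" "q:V ==> q:frontier Om ==> rh q = 0"
proof -
have c: "continuous_on V rh"
 using continuous_on_Re[OF smooth_imp_continuous[OF assms(1,2)]] by simp
show 1: "rh q <= 0" if q: "q:V" "q:closure Om" for q
proof(rule ccontr)
 assume "~ rh q <= 0"
 moreover have "open (V Int rh -` {0<..})" by(rule continuous_open_preimage[OF c assms(1)]) simp
 ultimately have "(V Int rh -` {0<..}) Int Om ~= {}"
 using q open_Int_closure_eq_empty[of "V Int rh -` {0<..}" Om] by auto
 then obtain q' where "q':Om Int V" "rh q' > 0" by auto
 thus False unfolding assms(4) by simp
qed
assume q: "q:V" "q:frontier Om"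
have nq: "q~:Om" using q(2) assms(3) by(simp add:frontier_def interior_open)
have "rh q <= 0" by(rule 1[OF q(1)]) (use q(2) in "simp add: frontier_def")
moreover have "~ rh q < 0"
proof
 assume "rh q < 0"
 hence "q:{q:V. rh q < 0}" using q(1) by simp
 hence "q:Om Int V" by(simp only: assms(4))
 thus False using nq by simp
qed
ultimately show "rh q = 0" by simp
qed

lemma T_sub_vanish:
assumes V: "open V" "p:V" "smooth V (%q. cor (rh q))" and 0: "!!q. q:V ==> q:S ==> rh q = (0::real)"
 and v: "v:CT_sub S p"
shows "v (%q. cor (rh q)) = 0"
proof -
have "\<forall>\<^sub>F q in nhds p. q:S --> cor (rh q) = 0"
 using V 0 by(auto simp:eventually_nhds)
thus ?thesis using v smooth_nearI[OF V] by(auto simp:CT_sub_def)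
qed

lemma cRe_real: "v:CT p ==> cRe v (%q. cor (rh q)) = cor (Re (v (%q. cor (rh q))))"
by(simp add:cRe_def cscale_def cconj_def complex_add_cnj)

text \<open>A vector transversal to \<open>N\<close> is a tangent vector of \<open>N\<close> plus
  \<open>cRe (Z p)\<close>, so the latter is transversal; since \<open>rh\<close> is real,
  \<open>Z p\<close> itself does not annihilate \<open>rh\<close>.\<close>

lemma Theta_noncharacteristic_T01:
assumes nc: "Theta_noncharacteristic N p" and V: "open V" "p:V" "smooth V (%q. cor (rh q))"
 and 0: "!!q. q:V ==> q:N ==> rh q = 0" and v: "v:TM p" "v (%q. cor (rh q)) ~= 0"
obtains Y where "Y:T01 p" "Y (%q. cor (rh q)) ~= 0"
proof -
obtain v' Z U where Z: "v = v' + cRe (Z p)" "v':T_sub N p" "open U" "p:U" "Z:Theta U"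
 using nc v(1) unfolding Theta_noncharacteristic_def by blast
obtain r :: nat and W a where W: "ALL j<r. W j:sections U & smooth U (a j)" "ALL q:U. Z q = (SUM j<r. cscale (a j q) (W j q))"
 using Z(5) unfolding Theta_def Theta_of_def by auto
have ZT: "Z p:T01 p"
 using W Z(4) by(auto intro!: T01_sum T01_cscale sections_T01)
have "v' (%q. cor (rh q)) = 0"
 by(rule T_sub_vanish[OF V 0]) (use Z(2) in "auto simp: T_sub_def")
hence "cRe (Z p) (%q. cor (rh q)) ~= 0" using v(2) Z(1) by simp
hence "Z p (%q. cor (rh q)) ~= 0" by(auto simp:cRe_real[OF T01_CT[OF ZT]])
thus ?thesis using that ZT by blast
qed

text \<open>Subtracting a small multiple of the squared distance to \<open>p\<close> from
  \<open>rh\<close> changes neither the differential at \<open>p\<close> nor the sign of the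
  convexity there, but makes \<open>fi\<close> negative on the closed side away from
  \<open>p\<close>. Hence \<open>fi > - c\<close> cuts a small neighbourhood of \<open>p\<close> out
  of the closed side, and what bounds it off the frontier is a level of \<open>fi\<close>.\<close>

lemma local_maximum_principle:
assumes psi: "Psi_we 2" and Om: "open Om" and p: "strongly_1_convex Om p" and nc: "Theta_noncharacteristic N p"
 and N: "N <= frontier Om" and pN: "p:N" and cc: "CR_coords U0 m z" "p:U0" and W0: "open W0" "p:W0"
obtains G where "open G" "p:G" "G <= W0" "MP Om G"
proof -
obtain rh and r :: nat and Z0 where rh: "defining_function Om p rh"
 and Z0: "ALL j<r. Z0 j:T01 p Int CT_sub (frontier Om) p"
 and ker: "(SUM j<r. tensor (Z0 j) (cconj (Z0 j))):kerL p"
 and pos: "ddc rh p (SUM j<r. tensor (Z0 j) (cconj (Z0 j))) > 0"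
 using p unfolding strongly_1_convex_def by blast
obtain V1 v where V1: "open V1" "p:V1" "smooth V1 (%q. cor (rh q))"
 "Om Int V1 = {q:V1. rh q < 0}" "v:TM p" "v (%q. cor (rh q)) ~= 0"
 using rh unfolding defining_function_def by blast
note fr = defining_function_frontier[OF V1(1,3) Om V1(4)]
obtain Y where Y: "Y:T01 p" "Y (%q. cor (rh q)) ~= 0"
 by(rule Theta_noncharacteristic_T01[OF nc V1(1-3) _ V1(5,6)]) (use fr(2) N in blast)
obtain V2 ka ka' ze where ph2: "ph_chart m z V2 ka ka' ze" "p:V2" "V2 <= U0"
 by(rule ph_chart_exists[OF cc])
define V where "V = V2 Int V1 Int W0"
have V: "open V" "p:V" "V <= V1" "V <= V2" "V <= W0" using ph2 V1 W0 ph_open[OF ph2(1)] by(auto simp:V_def)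
have ph: "ph_chart m z V ka ka' ze" by(rule ph_chart_subset[OF ph2(1) V(1,4)])
note l = ph_lchart[OF ph]
let ?rh = "%q. cor (rh q)"
have srh: "smooth V ?rh" by(rule smooth_subset[OF V1(3) V(3)])
define u where "u b = (%q. xc ka b q - xc ka b p)" for b
have su: "smooth V (u b)" for b unfolding u_def
 by(intro smooth_diff V(1) smooth_xc[OF l V(1) order_refl] smooth_const)
define Sq where "Sq = (%q. SUM b:Basis. u b q*u b q)"
have sSq: "smooth V Sq" unfolding Sq_def by(intro smooth_sum smooth_mult V(1) su)
have Sqn: "Sq q = cor ((norm (ka q - ka p))^2)" for q
proof -
 have "(norm (ka q - ka p))^2 = (SUM b:Basis. ((ka q - ka p) <.> b)*((ka q - ka p) <.> b))"
 by(subst power2_norm_eq_inner) (rule euclidean_inner)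
 thus ?thesis by(simp add:Sq_def u_def xc_def inner_diff_left)
qed
define s where "s = (%a b. (SUM j<r. tensor (Z0 j) (cconj (Z0 j))) (xc ka a) (xc ka b))"
define d where "d = Re (contr ka ka' p s ?rh)"
have d: "d > 0" using pos ddc_eq[OF ph V(2) ker smooth_nearI[OF V(1,2) srh]] by(simp add:d_def s_def)
define C where "C = Re (contr ka ka' p s Sq)"
\<comment> \<open>Small enough that the Hessian of the squared distance takes away at most half of
  \<open>d\<close>.\<close>
define ep where "ep = d/(2*(\<bar>C\<bar> + 1))"
have ep: "ep > 0" using d by(simp add:ep_def)
have "ep*C <= ep*(\<bar>C\<bar> + 1)" using ep by(intro mult_left_mono) auto
also have "... = d/2"
proof -
 have "d/(2*x)*x = d/2" if "x > 0" for x :: real using that by simp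
 from this[of "\<bar>C\<bar> + 1"] show ?thesis unfolding ep_def by linarith
qed
finally have epC: "ep*C < d" using d by linarith
define fi where "fi q = rh q - ep*(norm (ka q - ka p))^2" for q
let ?fi = "%q. cor (fi q)"
have fieq: "?fi = (%q. ?rh q + cor (- ep)*Sq q)" by(rule ext) (simp add:fi_def Sqn)
have sfi: "smooth V ?fi" unfolding fieq by(intro smooth_add smooth_mult smooth_const srh sSq V(1))
note near = smooth_nearI[OF V(1,2)]
have ZSq: "X Sq = 0" if X: "X:CT p" for X
proof -
 have "X Sq = (SUM b:Basis. X (%q. u b q*u b q))" unfolding Sq_def
 by(rule CT_sum[OF X]) (intro smooth_near_mult near su)
 also have "... = 0"
 proof(rule sum.neutral, rule ballI)
 show "X (%q. u b q*u b q) = 0" for b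
  using CT_mult[OF X near[OF su] near[OF su], of b b] by(simp add:u_def)
 qed
 finally show ?thesis .
qed
have Zfi: "X ?fi = X ?rh" if X: "X:CT p" for X
 unfolding fieq using CT_add[OF X near[OF srh] smooth_near_mult[OF smooth_near_const near[OF sSq]], of "cor (- ep)"]
 CT_cmult[OF X near[OF sSq], of "cor (- ep)"] ZSq[OF X] by simp
have "convex_at ka ka' fi p"
 unfolding convex_at_def
proof(intro exI[of _ r] exI[of _ Z0] conjI allI impI ker)
 fix j assume "j < r"
 hence j: "Z0 j:T01 p" "Z0 j:CT_sub (frontier Om) p" using Z0 by auto
 show "Z0 j:T01 p" by fact
 show "Z0 j ?fi = 0"
 using T_sub_vanish[OF V1(1-3) fr(2) j(2)] Zfi[OF T01_CT[OF j(1)]] by simp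
next
 have "contr ka ka' p s ?fi = contr ka ka' p s ?rh + cor (- ep)*contr ka ka' p s Sq"
 unfolding fieq contr_add[OF l V(2) near[OF srh] smooth_near_mult[OF smooth_near_const near[OF sSq]]]
  contr_cmult[OF l V(2) near[OF sSq]] ..
 hence "Re (contr ka ka' p s ?fi) = d - ep*C" by(simp add:d_def C_def)
 thus "Re (contr ka ka' p (%a b. (SUM j<r. tensor (Z0 j) (cconj (Z0 j))) (xc ka a) (xc ka b)) ?fi) > 0"
 using epC by(simp add:s_def)
qed
then obtain G0 where G0: "open G0" "p:G0" "ALL q:G0. convex_at ka ka' fi q"
 using convex_at_nbhd[OF psi l V(2) sfi Y(1)] Y(2) Zfi[OF T01_CT[OF Y(1)]] by metis
have "open (ka ` (V Int G0))" by(rule lchart_image[OF l]) (use V G0 in auto)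
then obtain R where R: "R > 0" "cball (ka p) R <= ka ` (V Int G0)" using V(2) G0(2) open_contains_cball by blast
define B where "B = V Int ka -` ball (ka p) R"
have Rb: "ball (ka p) R <= ka ` V" using R(2) ball_subset_cball by fast
have B: "open B" "p:B" "B <= V" using lchart_vimage[OF l open_ball Rb] V(2) R(1) by(auto simp:B_def)
define Kb where "Kb = ka' ` cball (ka p) R"
have Kb: "compact Kb" unfolding Kb_def
 by(rule compact_continuous_image[OF continuous_on_subset[OF lchart_continuous'[OF l]]]) (use R in auto)
have KbG: "q:V" "q:G0" "ka q:cball (ka p) R" if "q:Kb" for q
 using that R(2) lchart_inv[OF l] by(auto simp:Kb_def subset_iff image_iff)
have KbI: "q:Kb" if "q:V" "ka q:cball (ka p) R" for q
 using that lchart_inv[OF l that(1)] unfolding Kb_def by(metis imageI)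
have cfi: "continuous_on V fi" using continuous_on_Re[OF smooth_imp_continuous[OF V(1) sfi]] by simp
\<comment> \<open>On the closed side \<open>rh <= 0\<close>, so that \<open>fi >= - c\<close> forces
  \<open>norm (ka q - ka p) < R\<close>.\<close>
define c where "c = ep * R^2/2"
have c: "c > 0" using ep R(1) by(simp add:c_def)
define G where "G = B Int fi -` {- c<..}"
have G: "open G" "G <= B"
 unfolding G_def by(auto intro!: continuous_open_preimage continuous_on_subset[OF cfi B(3)] B(1))
have "p:frontier Om" using pN N by auto
hence pG: "p:G" using B(2) c fr(2)[OF V1(2)] by(simp add:G_def fi_def)
have "MP Om G" unfolding MP_def
proof(intro allI impI ballI)
 fix h M q0
 assume h: "h:CR_functions (G Int Om)" "continuous_on (G Int closure Om) h" and M: "0 <= M"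
 and bd: "ALL q:G Int frontier Om. norm (h q) <= M" and q0: "q0:G Int Om"
 \<comment> \<open>The level \<open>- c'\<close> is strictly between \<open>- c\<close> and the
   value at \<open>q0\<close>: the part of the closed side in \<open>Kb\<close> where
   \<open>fi >= - c'\<close> is compact and still inside \<open>G\<close>.\<close>
 define c' where "c' = (c - fi q0)/2"
 have c': "c' < c" "fi q0 > - c'" using q0 by(auto simp:c'_def G_def field_simps)
 define K where "K = Kb Int closure Om Int {q:Kb. fi q >= - c'}"
 have KbV: "Kb <= V" using KbG by auto
 have "closed Kb" using Kb by(rule compact_imp_closed)
 hence "closed (Kb Int fi -` {- c'..})"
 by(intro continuous_closed_preimage continuous_on_subset[OF cfi KbV]) auto
 moreover have "{q:Kb. fi q >= - c'} = Kb Int fi -` {- c'..}" by auto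
 ultimately have K: "compact K" unfolding K_def
 by(auto intro!: compact_Int_closed Kb)
 have KG: "q:G" if "q:K" for q
 proof -
 have q: "q:V" "q:closure Om" "fi q >= - c'" using that KbG by(auto simp:K_def)
 have "rh q <= 0" using fr(1) q V(3) by auto
 hence "ep*(norm (ka q - ka p))^2 < ep * R^2" using q(3) c'(1) c by(simp add:fi_def c_def)
 hence "norm (ka q - ka p) < R" using ep R(1) power_less_imp_less_base[of _ 2 R] by auto
 thus ?thesis using q c' by(simp add:G_def B_def dist_norm norm_minus_commute)
 qed
 have KV: "K <= V" using KG G B by auto
 have KGc: "K <= G Int closure Om" using KG by(auto simp:K_def)
 show "norm (h q0) <= M"
 proof(rule maximum_principle[OF ph K KV continuous_on_subset[OF h(2) KGc] continuous_on_subset[OF cfi KV] sfi])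
 show "convex_at ka ka' fi q" if "q:K" for q using G0(3) KbG that by(auto simp:K_def)
 let ?D = "G Int Om Int (B Int fi -` {- c'<..})"
 have oD: "open (B Int fi -` {- c'<..})" by(intro continuous_open_preimage continuous_on_subset[OF cfi B(3)] B(1)) auto
 show "open ?D" by(rule open_Int[OF open_Int[OF G(1) Om] oD])
 show "?D <= K"
 proof
  fix q assume q: "q:?D"
  hence "q:V" "ka q:cball (ka p) R" by(auto simp:B_def)
  from KbI[OF this] show "q:K" using q closure_subset by(auto simp:K_def)
 qed
 show "h:CR_functions ?D" by(rule CR_functions_subset[OF h(1)]) auto
 show "q:?D | norm (h q) <= M | fi q <= - c'" if q: "q:K" for q
 proof(cases "q:Om")
  case True
  thus ?thesis using KG[OF q] G by auto
 next
  case False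
  hence "q:frontier Om" using q Om by(simp add:K_def frontier_def interior_open)
  thus ?thesis using bd KG[OF q] by auto
 qed
 have "q0:V" "ka q0:cball (ka p) R" using q0 by(auto simp:G_def B_def)
 from KbI[OF this] show "q0:K" using q0 c' closure_subset by(auto simp:K_def)
 qed (rule M, rule c'(2))
qed
thus ?thesis using that[OF G(1) pG] G B V by auto
qed

end

section \<open>Jacobian determinants of complex valued maps\<close>

text \<open>Determinants are indexed by finite types; this one has the vectors of
  \<open>Basis\<close> as its elements.\<close>

typedef (overloaded) 'e bix = "Basis :: 'e::euclidean_space set"
using nonempty_Basis by blast

instance bix :: (euclidean_space) finite
proof
have "UNIV = Abs_bix ` (Basis :: 'a set)"
 by(metis type_definition.Abs_image type_definition_bix)
thus "finite (UNIV :: 'a bix set)" using finite_imageI[OF finite_Basis, of "Abs_bix :: 'a => _"] by simp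
qed

lemma bij_Rep_bix: "bij_betw Rep_bix UNIV (Basis :: 'e::euclidean_space set)"
unfolding bij_betw_def using type_definition.Rep_range[OF type_definition_bix] Rep_bix_inject by(auto simp:inj_on_def)

lemma sum_bix: "(SUM k:UNIV. f (Rep_bix k)) = (SUM b:(Basis :: 'e::euclidean_space set). f b)"
by(rule sum.reindex_bij_betw[OF bij_Rep_bix])

lemma Rep_Abs_bix: "b:Basis ==> Rep_bix (Abs_bix b) = b"
by(rule Abs_bix_inverse)

definition row_replace :: "'n => 'a^'n => 'a^'n^'n => 'a^'n^'n::finite" where
"row_replace i v A = (\<chi> r. if r = i then v else A $ r)"

lemma det_row_expand:
fixes A :: "'a::comm_ring_1^'n^'n"
shows "det (row_replace i v A) = (SUM k:UNIV. v $ k*det (row_replace i (axis k 1) A))"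
proof -
have "det (row_replace i v A) = det (\<chi> r. if r = i then (SUM k:UNIV. v $ k *s axis k 1) else A $ r)"
 by(simp only: row_replace_def basis_expansion)
also have "... = (SUM k:UNIV. det (\<chi> r. if r = i then v $ k *s axis k 1 else A $ r))"
 by(rule det_linear_row_sum) simp
also have "... = (SUM k:UNIV. v $ k*det (row_replace i (axis k 1) A))"
 by(simp add:det_row_mul row_replace_def)
finally show ?thesis .
qed

lemma det_row_other:
fixes A :: "'a::comm_ring_1^'n^'n"
assumes "i ~= l" shows "det (row_replace i (A $ l) A) = 0"
by(rule det_identical_rows[OF assms]) (use assms in "auto simp: row_replace_def row_def vec_eq_iff")

lemma row_replace_self [simp]: "row_replace i (A $ i) A = A"
by(simp add:row_replace_def vec_eq_iff)

text \<open>Polarisation: a bilinear form that vanishes on the diagonal is antisymmetric.\<close>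

lemma det_two_rows_swap:
fixes A :: "complex^'n^'n"
assumes "i ~= l"
shows "det (row_replace l v (row_replace i u A)) = - det (row_replace l u (row_replace i v A))"
proof -
let ?D = "%u v. det (row_replace l v (row_replace i u A))"
have add1: "?D u (v + w) = ?D u v + ?D u w" for u v w
 unfolding row_replace_def by(rule det_row_add)
have "row_replace l v (row_replace i u A) = row_replace i u (row_replace l v A)" for u v
 using assms by(simp add:row_replace_def vec_eq_iff)
hence add2: "?D (u + w) v = ?D u v + ?D w v" for u v w
 unfolding row_replace_def using det_row_add[of i "%_. u" "%_. w" "%r. if r = l then v else A $ r"] by(simp cong: if_cong)
have 0: "?D u u = 0" for u
 by(rule det_identical_rows[OF assms]) (use assms in "auto simp: row_replace_def row_def vec_eq_iff")
have "?D (u + v) (u + v) = ?D u u + ?D u v + (?D v u + ?D v v)" by(simp only: add1 add2)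
thus ?thesis using 0 by(simp add:add_eq_0_iff2)
qed

lemma has_derivative_det:
fixes A :: "'a::real_normed_vector => complex^'n^'n"
assumes "!!i j. ((%x. A x $ i $ j) has_derivative A' i j) (at x)"
shows "((%x. det (A x)) has_derivative (%h. SUM i:UNIV. det (row_replace i (\<chi> j. A' i j h) (A x)))) (at x)"
proof -
have "((%x. det (A x)) has_derivative (%h. SUM p:{p. p permutes UNIV}. of_int (sign p) *
 (SUM i:UNIV. A' i (p i) h*(PROD j:UNIV - {i}. A x $ j $ p j)))) (at x)"
 unfolding det_def
 by(intro has_derivative_sum has_derivative_mult_right has_derivative_prod assms)
also have "(%h. SUM p:{p. p permutes UNIV}. of_int (sign p) *
 (SUM i:UNIV. A' i (p i) h*(PROD j:UNIV - {i}. A x $ j $ p j))) =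
 (%h. SUM i:UNIV. det (row_replace i (\<chi> j. A' i j h) (A x)))"
proof
 fix h
 have "(PROD r:UNIV. row_replace i (\<chi> j. A' i j h) (A x) $ r $ p r) = A' i (p i) h*(PROD j:UNIV - {i}. A x $ j $ p j)" for i p
 by(subst prod.remove[of UNIV i]) (auto simp:row_replace_def intro!: arg_cong2[where f = "(*)"] prod.cong)
 hence "det (row_replace i (\<chi> j. A' i j h) (A x)) = (SUM p:{p. p permutes UNIV}. of_int (sign p) *
 (A' i (p i) h*(PROD j:UNIV - {i}. A x $ j $ p j)))" for i
 by(simp add:det_def)
 thus "(SUM p:{p. p permutes UNIV}. of_int (sign p) *
 (SUM i:UNIV. A' i (p i) h*(PROD j:UNIV - {i}. A x $ j $ p j))) =
 (SUM i:UNIV. det (row_replace i (\<chi> j. A' i j h) (A x)))"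
 by(simp add:sum_distrib_left) (rule sum.swap)
qed
finally show ?thesis .
qed

definition jmat :: "('e::euclidean_space => 'e => complex) => complex^('e bix)^('e bix)" where
"jmat tt = (\<chi> i j. tt (Rep_bix i) (Rep_bix j))"

definition jac :: "('e::euclidean_space => 'e => complex) => complex" where
"jac tt = det (jmat tt)"

text \<open>The cofactor, written as a determinant of full size so that
  \<open>has_derivative_det\<close> can differentiate it again.\<close>

definition cof :: "('e::euclidean_space => 'e => complex) => 'e => 'e => complex" where
"cof tt i k = det (row_replace (Abs_bix i) (axis (Abs_bix k) 1) (jmat tt))"

lemma jac_row_expand:
assumes "i:Basis"
shows "(SUM k:Basis. cof tt i k*c k) = det (row_replace (Abs_bix i) (\<chi> k. c (Rep_bix k)) (jmat tt))"
proof -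
have "det (row_replace (Abs_bix i) (\<chi> k. c (Rep_bix k)) (jmat tt)) =
 (SUM k:UNIV. c (Rep_bix k)*det (row_replace (Abs_bix i) (axis k 1) (jmat tt)))"
 by(subst det_row_expand) simp
also have "... = (SUM k:UNIV. cof tt i (Rep_bix k)*c (Rep_bix k))"
 by(simp add:cof_def Rep_bix_inverse mult.commute)
also have "... = (SUM k:Basis. cof tt i k*c k)" by(rule sum_bix)
finally show ?thesis by simp
qed

lemma cof_row:
fixes tt :: "'e::euclidean_space => 'e => complex"
assumes "i:Basis" "l:Basis"
shows "(SUM k:Basis. cof tt i k*tt l k) = (if l = i then jac tt else 0)"
proof -
have e: "(\<chi> k. tt l (Rep_bix k)) = jmat tt $ Abs_bix l" using assms by(simp add:jmat_def Rep_Abs_bix)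
show ?thesis
proof(cases "l = i")
 case True thus ?thesis unfolding jac_row_expand[OF assms(1)] e by(simp add:jac_def)
next
 case False
 hence "Abs_bix i ~= Abs_bix l" using assms by(simp add:Abs_bix_inject)
 thus ?thesis unfolding jac_row_expand[OF assms(1)] e using False by(simp add:det_row_other)
qed
qed

text \<open>After the replacement the rows \<open>i\<close> and \<open>k\<close> are both the unit
  vector of \<open>k\<close>.\<close>

lemma cof_unit_row:
fixes tt :: "'e::euclidean_space => 'e => complex"
assumes "i:Basis" "k:Basis" "k ~= i" and u: "!!j. j:Basis ==> tt k j = (if j = k then 1 else 0)"
shows "cof tt i k = 0"
proof -
have e: "Rep_bix j = k \<longleftrightarrow> j = Abs_bix k" for j
 by(metis Rep_Abs_bix[OF assms(2)] Rep_bix_inverse)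
have "axis (Abs_bix k) 1 = jmat tt $ Abs_bix k"
 by(simp add:vec_eq_iff axis_def jmat_def Rep_Abs_bix[OF assms(2)] u[OF Rep_bix] e)
moreover have "Abs_bix i ~= Abs_bix k" using assms by(simp add:Abs_bix_inject)
ultimately show ?thesis unfolding cof_def by(simp add:det_row_other)
qed

lemma jac_unit:
fixes tt :: "'e::euclidean_space => 'e => complex"
assumes "!!i j. i:Basis ==> j:Basis ==> tt i j = (if j = i then 1 else 0)"
shows "jac tt = 1"
proof -
have "jmat tt = mat 1"
 by(simp add:jmat_def mat_def vec_eq_iff assms[OF Rep_bix Rep_bix] Rep_bix_inject)
thus ?thesis by(simp add:jac_def)
qed

lemma has_derivative_jac:
fixes tt :: "'a::real_normed_vector => 'e::euclidean_space => 'e => complex"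
assumes "!!i j. i:Basis ==> j:Basis ==> ((%x. tt x i j) has_derivative tt' i j) (at x)"
shows "((%x. jac (tt x)) has_derivative (%h. SUM i:Basis. SUM k:Basis. cof (tt x) i k*tt' i k h)) (at x)"
proof -
have "((%x. det (jmat (tt x))) has_derivative
 (%h. SUM i:UNIV. det (row_replace i (\<chi> j. tt' (Rep_bix i) (Rep_bix j) h) (jmat (tt x))))) (at x)"
 by(rule has_derivative_det) (simp add:jmat_def assms Rep_bix)
moreover have "(SUM i:UNIV. det (row_replace i (\<chi> j. tt' (Rep_bix i) (Rep_bix j) h) (jmat (tt x)))) =
 (SUM i:Basis. SUM k:Basis. cof (tt x) i k*tt' i k h)" for h
 by(subst sum_bix[symmetric], rule sum.cong[OF refl]) (simp add:jac_row_expand Rep_bix Rep_bix_inverse)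
ultimately show ?thesis by(simp add:jac_def)
qed

text \<open>
Piola's identity: in the divergence of a row of cofactors the second derivatives of the map are
symmetric, and the minors which they multiply are antisymmetric.
\<close>

lemma Piola:
fixes tt :: "'e::euclidean_space => 'e => 'e => complex"
assumes D: "!!i j. i:Basis ==> j:Basis ==> ((%x. tt x i j) has_derivative tt' i j) (at x)"
 and sym: "!!i j k. i:Basis ==> j:Basis ==> k:Basis ==> tt' i j k = tt' i k j"
 and i: "i:Basis"
obtains C' where "!!k. ((%x. cof (tt x) i k) has_derivative C' k) (at x)" "(SUM k:Basis. C' k k) = 0"
proof
let ?i = "Abs_bix i"
let ?A = "%k l j. row_replace l (axis j 1) (row_replace ?i (axis (Abs_bix k) 1) (jmat (tt x)))"
define C' where "C' k h = (SUM l:UNIV. if l = ?i then 0 else SUM j:UNIV. tt' (Rep_bix l) (Rep_bix j) h*det (?A k l j))" for k h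
show "((%x. cof (tt x) i k) has_derivative C' k) (at x)" for k
proof -
 let ?M = "%x. row_replace ?i (axis (Abs_bix k) 1) (jmat (tt x))"
 let ?M' = "%l j h. if l = ?i then 0 else tt' (Rep_bix l) (Rep_bix j) h"
 have "((%x. det (?M x)) has_derivative (%h. SUM l:UNIV. det (row_replace l (\<chi> j. ?M' l j h) (?M x)))) (at x)"
 proof(rule has_derivative_det)
 show "((%x. ?M x $ l $ j) has_derivative ?M' l j) (at x)" for l j
  by(cases "l = ?i") (simp_all add:row_replace_def jmat_def D Rep_bix)
 qed
 moreover have "det (row_replace l (\<chi> j. ?M' l j h) (?M x)) =
  (if l = ?i then 0 else SUM j:UNIV. tt' (Rep_bix l) (Rep_bix j) h*det (?A k l j))" for l h
 by(subst det_row_expand) simp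
 ultimately show ?thesis unfolding cof_def C'_def by simp
qed
have z: "(SUM k:UNIV. SUM j:UNIV. tt' (Rep_bix l) (Rep_bix j) (Rep_bix k)*det (?A (Rep_bix k) l j)) = 0" (is "?S = 0")
 if "l ~= ?i" for l
proof -
 have a: "det (?A (Rep_bix k) l j) = - det (?A (Rep_bix j) l k)" for j k
 unfolding Rep_bix_inverse by(rule det_two_rows_swap) (use that in auto)
 have s: "tt' (Rep_bix l) (Rep_bix j) (Rep_bix k) = tt' (Rep_bix l) (Rep_bix k) (Rep_bix j)" for j k
 by(rule sym[OF Rep_bix Rep_bix Rep_bix])
 have "?S = (SUM j:UNIV. SUM k:UNIV. tt' (Rep_bix l) (Rep_bix j) (Rep_bix k)*det (?A (Rep_bix k) l j))"
 by(rule sum.swap)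
 also have "... = (SUM j:UNIV. SUM k:UNIV. - (tt' (Rep_bix l) (Rep_bix k) (Rep_bix j)*det (?A (Rep_bix j) l k)))"
 by(intro sum.cong refl, subst a, subst s) simp
 also have "... = - ?S" by(simp add:sum_negf)
 finally show ?thesis by simp
qed
have "(SUM k:Basis. C' k k) = (SUM k:UNIV. C' (Rep_bix k) (Rep_bix k))" by(rule sum_bix[symmetric])
also have "... = (SUM l:UNIV. SUM k:UNIV. if l = ?i then 0 else SUM j:UNIV. tt' (Rep_bix l) (Rep_bix j) (Rep_bix k)*det (?A (Rep_bix k) l j))"
 unfolding C'_def by(rule sum.swap)
also have "... = 0"
proof(rule sum.neutral, rule ballI)
 fix l
 show "(SUM k:UNIV. if l = ?i then 0 else SUM j:UNIV. tt' (Rep_bix l) (Rep_bix j) (Rep_bix k)*det (?A (Rep_bix k) l j)) = 0"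
 using z[of l] by(cases "l = ?i") simp_all
qed
finally show "(SUM k:Basis. C' k k) = 0" .
qed

lemma continuous_on_jac:
fixes tt :: "'a::topological_space => 'e::euclidean_space => 'e => complex"
assumes "!!i j. i:Basis ==> j:Basis ==> continuous_on S (%x. tt x i j)"
shows "continuous_on S (%x. jac (tt x))"
unfolding jac_def det_def jmat_def
by(intro continuous_intros) (simp add:assms Rep_bix)

lemma continuous_on_cof:
fixes tt :: "'a::topological_space => 'e::euclidean_space => 'e => complex"
assumes "!!i j. i:Basis ==> j:Basis ==> continuous_on S (%x. tt x i j)"
shows "continuous_on S (%x. cof (tt x) i k)"
proof -
have "continuous_on S (%x. row_replace (Abs_bix i) (axis (Abs_bix k) 1) (jmat (tt x)) $ l $ m)" for l m
 by(cases "l = Abs_bix i") (simp_all add:row_replace_def jmat_def assms Rep_bix)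
note c = this
show ?thesis unfolding cof_def det_def
 by(intro continuous_on_sum continuous_on_mult continuous_on_const continuous_on_prod c)
qed

section \<open>Deformation of oscillatory integrals\<close>

lemma continuous_on_zero_extend:
fixes H :: "'a::topological_space => 'b::real_normed_vector"
assumes "open S" "continuous_on S H" "closed K" "!!x. x~:K ==> H x = 0" "K <= S"
shows "continuous_on UNIV H"
proof -
have "continuous_on (- K) H" by(rule continuous_on_eq[OF continuous_on_const[of _ 0]]) (use assms in auto)
hence "continuous_on (S Un - K) H" using assms by(intro continuous_on_open_Un) auto
thus ?thesis by(rule continuous_on_subset) (use assms(5) in auto)
qed

text \<open>The integral of \<open>H\<close> over a large box does not change under small
  translations along \<open>k\<close>; differentiate it at the translation 0.\<close>

lemma integral_dd_zero:
fixes H :: "'e::euclidean_space => complex"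
assumes D: "!!q. H differentiable (at q)" and C: "continuous_on UNIV (dd k H)"
 and z: "!!q. q~:cbox a b ==> H q = 0" "!!q. q~:cbox a b ==> dd k H q = 0"
shows "integral (cbox a b) (dd k H) = 0"
proof -
obtain A where A: "A > 0" "cbox a b <= ball 0 A" using bounded_subset_ballD[OF bounded_cbox] by blast
obtain c :: 'e where c: "ball 0 (A + norm k) <= cbox (- c) c"
 using bounded_subset_cbox_symmetric[OF bounded_ball] by blast
have cH: "continuous_on UNIV H"
 using D by(intro continuous_at_imp_continuous_on) (auto intro: differentiable_imp_continuous_within)
have big: "cbox a b <= cbox (- c) c"
 using order_trans[OF A(2) order_trans[OF subset_ball[of A "A + norm k"] c]] by simp
have const: "integral (cbox (- c) c) (%q. H (q + t *R k)) = integral (cbox a b) H" if "t:ball 0 1" for t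
proof -
 have "(H has_integral integral (cbox a b) H) (cbox a b)"
 by(intro integrable_integral integrable_continuous continuous_on_subset[OF cH]) auto
 from has_integral_affinity[OF this, of 1 "t *R k"]
 have "((%q. H (q + t *R k)) has_integral integral (cbox a b) H) ((%q. q - t *R k) ` cbox a b)" by simp
 hence "((%q. H (q + t *R k)) has_integral integral (cbox a b) H) (cbox (- c) c)"
 proof(rule has_integral_on_superset)
 fix q assume q: "q~:(%q. q - t *R k) ` cbox a b"
 have "q + t *R k~:cbox a b"
 proof
  assume "q + t *R k:cbox a b"
  hence "(q + t *R k) - t *R k:(%q. q - t *R k) ` cbox a b" by(rule imageI)
  thus False using q by simp
 qed
 thus "H (q + t *R k) = 0" by(rule z(1))
 next
 have "q - t *R k:ball 0 (A + norm k)" if "q:cbox a b" for q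
 proof -
  have "norm (q - t *R k) <= norm q + \<bar>t\<bar>*norm k" using norm_triangle_ineq4[of q "t *R k"] by simp
  also have "... < A + norm k"
  using A(2) that `t : ball 0 1` mult_right_mono[of "\<bar>t\<bar>" 1 "norm k"] by auto
  finally show ?thesis by simp
 qed
 thus "(%q. q - t *R k) ` cbox a b <= cbox (- c) c" using c by auto
 qed
 thus ?thesis by(rule integral_unique)
qed
have "((%t. integral (cbox (- c) c) (%q. H (q + t *R k))) has_derivative
 (%h. integral (cbox (- c) c) (%q. h *R dd k H (q + 0 *R k)))) (at 0)"
proof(rule integral_has_derivative[where U = "ball 0 1" and D = "%h t q. h *R dd k H (q + t *R k)"])
 show "((%t. H (q + t *R k)) has_derivative (%h. h *R dd k H (q + t *R k))) (at t)" for q and t :: real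
 by(rule has_derivative_line[OF D])
 show "continuous_on (ball 0 1 \<times> cbox (- c) c) (%(t,q). h *R dd k H (q + t *R k))" for h :: real
 unfolding case_prod_beta by(intro continuous_intros continuous_on_compose2[OF C]) auto
 show "continuous_on (cbox (- c) c) (%q. H (q + t *R k))" for t :: real
 by(intro continuous_on_compose2[OF cH] continuous_intros) auto
qed auto
moreover have "((%t. integral (cbox (- c) c) (%q. H (q + t *R k))) has_derivative (%h. 0)) (at (0::real))"
proof(rule has_derivative_transform_within_open[OF has_derivative_const open_ball])
 show "integral (cbox a b) H = integral (cbox (- c) c) (%q. H (q + t *R k))" if "t:ball 0 1" for t
 using const[OF that] by simp
qed simp
ultimately have "(%h::real. integral (cbox (- c) c) (%q. h *R dd k H (q + 0 *R k))) = (%h. 0)"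
 by(rule has_derivative_unique)
from fun_cong[OF this, of 1] have 0: "integral (cbox (- c) c) (dd k H) = 0" by simp
have "(dd k H has_integral integral (cbox a b) (dd k H)) (cbox a b)"
 by(intro integrable_integral integrable_continuous continuous_on_subset[OF C]) auto
hence "(dd k H has_integral integral (cbox a b) (dd k H)) (cbox (- c) c)"
 by(rule has_integral_on_superset) (use z big in auto)
thus ?thesis using 0 by(simp add:integral_unique)
qed

lemma Cinf_exp_UNIV: "Cinf_on UNIV (exp :: complex => complex)"
unfolding Cinf_on_def
proof
fix k
have D: "((exp :: complex => complex) has_derivative (%h. exp x*h)) (at x)" for x
 using DERIV_exp[of x] by(simp add:has_field_derivative_def)
show "Ck_on k UNIV (exp :: complex => complex)"
proof(induction k)
 case (Suc k)
 show ?case by(rule Ck_on_SucI[OF open_UNIV D]) (intro Ck_on_mult Suc Ck_on_const open_UNIV)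
qed (simp add:continuous_on_exp)
qed

lemma Cinf_exp: "open S ==> Cinf_on S f ==> Cinf_on S (%x. exp (f x :: complex))"
by(rule Cinf_compose[OF _ open_UNIV _ _ Cinf_exp_UNIV]) auto

lemma Cinf_det:
fixes A :: "'a::real_normed_vector => complex^'n^'n"
assumes "open S" "!!l m. Cinf_on S (%x. A x $ l $ m)"
shows "Cinf_on S (%x. det (A x))"
unfolding det_def by(intro Cinf_sum Cinf_mult Cinf_const Cinf_prod assms)

lemma Cinf_jac:
assumes "open S" "!!i j. i:Basis ==> j:Basis ==> Cinf_on S (%x. tt x i j)"
shows "Cinf_on S (%x. jac (tt x))"
unfolding jac_def by(rule Cinf_det) (simp_all add:assms jmat_def Rep_bix)

lemma Cinf_cof:
assumes "open S" "!!i j. i:Basis ==> j:Basis ==> Cinf_on S (%x. tt x i j)"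
shows "Cinf_on S (%x. cof (tt x) i k)"
unfolding cof_def
proof(rule Cinf_det[OF assms(1)])
show "Cinf_on S (%x. row_replace (Abs_bix i) (axis (Abs_bix k) 1) (jmat (tt x)) $ l $ m)" for l m
 by(cases "l = Abs_bix i") (simp_all add:row_replace_def jmat_def assms Rep_bix Cinf_const)
qed

lemma Cinf_slice: "open S ==> Cinf_on S (%q. (s,q))"
using Cinf_add[OF _ Cinf_const[of S "(s,0)"] Cinf_linear[of "%q. (0,q)" S]]
by(simp add:bounded_linear_Pair[OF bounded_linear_zero bounded_linear_ident])

lemma dd_fst_slice:
assumes "f differentiable (at (s,q))"
shows "((%q. f (s,q)) has_derivative (%h. dd (0,h) f (s,q))) (at q)"
 "((%s. f (s,q)) has_derivative (%h. dd (h,0) f (s,q))) (at s)"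
proof -
note d = has_derivative_dd[OF assms]
have 1: "((%q. (s,q)) has_derivative (%h. (0,h))) (at q)" by(auto intro!: derivative_eq_intros)
have 2: "((%s. (s,q)) has_derivative (%h. (h,0))) (at s)" by(auto intro!: derivative_eq_intros)
show "((%q. f (s,q)) has_derivative (%h. dd (0,h) f (s,q))) (at q)"
 using diff_chain_at[OF 1] d by(simp add:o_def)
show "((%s. f (s,q)) has_derivative (%h. dd (h,0) f (s,q))) (at s)"
 using diff_chain_at[OF 2] d by(simp add:o_def)
qed

lemma integral_dd_zero_compact:
fixes H :: "'e::euclidean_space => complex"
assumes S: "open S" "Cinf_on S H" and K: "closed K" "K <= S" "K <= cbox a b" and z: "!!q. q~:K ==> H q = 0"
shows "integral (cbox a b) (dd k H) = 0"
proof -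
have E0: "H differentiable (at q) & dd k H q = 0" if "q~:K" for q
proof -
 have o: "open (- K)" "q:- K" using K(1) that by auto
 have "H differentiable (at q)" by(rule differentiable_cong_open[OF o, of H "%_. 0", THEN iffD2]) (use z in auto)
 moreover have "dd k H q = dd k (%_. 0) q" by(rule dd_cong[OF o]) (use z in auto)
 moreover have "dd k (%_. 0 :: complex) q = 0" by(rule dd_eq) simp
 ultimately show ?thesis by simp
qed
show ?thesis
proof(rule integral_dd_zero)
 show "H differentiable (at q)" for q using E0[of q] Cinf_differentiable[OF S(2), of q] K(2) by blast
 show "continuous_on UNIV (dd k H)"
 by(rule continuous_on_zero_extend[OF S(1) Cinf_cont[OF Cinf_dd[OF S(2)]] K(1) _ K(2)]) (use E0 in blast)
 fix q assume "q~:cbox a b"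
 hence "q~:K" using K(3) by auto
 thus "H q = 0" "dd k H q = 0" using E0 z by auto
qed
qed

text \<open>
The integral of \<open>ey G dW\<^sub>1 \<and> \<dots> \<and> dW\<^sub>d\<close> over the slice \<open>s\<close>. Since \<open>dG\<close> is a combination of the
\<open>dW\<^sub>i\<close>, the form \<open>G dW\<^sub>1 \<and> \<dots> \<and> dW\<^sub>d\<close> is closed, so that the integral changes with \<open>s\<close>
only through the derivatives of the cutoff \<open>ey\<close>.
\<close>

definition slice_integral ::
"'e => 'e => ('e => complex) => ('e => real \<times> 'e => complex) => (real \<times> 'e::euclidean_space => complex) => real => complex" where
"slice_integral a b ey W G s =
 integral (cbox a b) (%q. ey q*G (s,q)*jac (%i k. dd (0,k) (W i) (s,q)))"

lemma deformation:
fixes W :: "'e::euclidean_space => real \<times> 'e => complex" and G :: "real \<times> 'e => complex" and ey :: "'e => complex"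
assumes oU: "open U" and U01: "{0..1} <= U" and oS: "open S" and abS: "cbox a b <= S"
 and W: "!!i. i:Basis ==> Cinf_on (U \<times> S) (W i)" and G: "Cinf_on (U \<times> S) G"
 and Gi: "!!i. i:Basis ==> continuous_on (U \<times> S) (Gi i)"
 and dG: "!!x v. x:U \<times> S ==> dd v G x = (SUM i:Basis. Gi i x*dd v (W i) x)"
 and ey: "Cinf_on UNIV ey" and K: "closed K" "K <= cbox a b" "!!q. q~:K ==> ey q = 0"
 and M0: "0 <= M" and M: "!!s q. 0 <= s ==> s <= 1 ==> q:cbox a b ==>
 norm (SUM i:Basis. SUM k:Basis. dd (1,0) (W i) (s,q)*cof (%i k. dd (0,k) (W i) (s,q)) i k*G (s,q)*dd k ey q) <= M"
shows "norm (slice_integral a b ey W G 1 - slice_integral a b ey W G 0) <= M*measure lborel (cbox a b)"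
proof -
define tt where "tt x i k = dd (0,k) (W i) x" for x i k
have tte: "tt x = (%i k. dd (0,k) (W i) x)" for x by(simp add:fun_eq_iff tt_def)
have W1: "Cinf_on (U \<times> S) (dd v (W i))" if "i:Basis" for v i by(rule Cinf_dd[OF W[OF that]])
have cW1: "continuous_on (U \<times> S) (dd v (W i))" if "i:Basis" for v i by(rule Cinf_cont[OF W1[OF that]])
have cW2: "continuous_on (U \<times> S) (dd u (dd v (W i)))" if "i:Basis" for u v i
 by(rule Cinf_cont[OF Cinf_dd[OF W1[OF that]]])
have cJ: "continuous_on (U \<times> S) (%x. jac (tt x))" unfolding tt_def by(rule continuous_on_jac) (rule cW1)
have cC: "continuous_on (U \<times> S) (%x. cof (tt x) i k)" for i k unfolding tt_def by(rule continuous_on_cof) (rule cW1)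
have cG: "continuous_on (U \<times> S) G" by(rule Cinf_cont[OF G])
have cey: "continuous_on S ey" "continuous_on S (dd v ey)" for S v
 using Cinf_cont[OF ey] Cinf_cont[OF Cinf_dd[OF ey]] continuous_on_subset by blast+
define F where "F x = ey (snd x)*G x*jac (tt x)" for x
define F' where "F' x = ey (snd x)*((SUM i:Basis. Gi i x*dd (1,0) (W i) x)*jac (tt x) +
 G x*(SUM i:Basis. SUM k:Basis. cof (tt x) i k*dd (1,0) (dd (0,k) (W i)) x))" for x
define B where "B x = (SUM i:Basis. SUM k:Basis. dd (1,0) (W i) x*cof (tt x) i k*G x*dd k ey (snd x))" for x
have cF: "continuous_on (U \<times> S) F" unfolding F_def
 by(intro continuous_intros cG cJ continuous_on_compose2[OF cey(1)[of UNIV]]) auto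
have cF': "continuous_on (U \<times> S) F'" unfolding F'_def
 by(intro continuous_intros cG cJ cC cW1 cW2 Gi continuous_on_compose2[OF cey(1)[of UNIV]]) auto
have cB: "continuous_on (U \<times> S) B" unfolding B_def
 by(intro continuous_intros cG cC cW1 continuous_on_compose2[OF cey(2)[of UNIV]]) auto
have oP: "open (U \<times> S)" by(rule open_Times[OF oU oS])
have sl: "continuous_on (cbox a b) (%q. f (s,q))" if "s:U" "continuous_on (U \<times> S) f" for s and f :: "real \<times> 'e => complex"
 by(rule continuous_on_compose2[OF that(2)]) (use that(1) abS in "auto intro!: continuous_intros")
have DF: "((%s. F (s,q)) has_derivative (%h. h *R F' (s,q))) (at s)" if "s:U" "q:cbox a b" for s q
proof -
 have x: "(s,q):U \<times> S" using that abS by auto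
 have g: "((%s. G (s,q)) has_derivative (%h. dd (h,0) G (s,q))) (at s)"
 by(rule dd_fst_slice(2)[OF Cinf_differentiable[OF G x]])
 have j: "((%s. jac (tt (s,q))) has_derivative
 (%h. SUM i:Basis. SUM k:Basis. cof (tt (s,q)) i k*dd (h,0) (dd (0,k) (W i)) (s,q))) (at s)"
 unfolding tt_def by(rule has_derivative_jac, rule dd_fst_slice(2)[OF Cinf_differentiable[OF W1 x]])
 have h0: "dd (h,0) f (s,q) = h *R dd (1,0) f (s,q)" if "f differentiable (at (s,q))" for f :: "real \<times> 'e => complex" and h :: real
 using dd_scaleR_left[OF that, of h "(1,0)"] by simp
 have hG: "dd (h,0) G (s,q) = h *R (SUM i:Basis. Gi i (s,q)*dd (1,0) (W i) (s,q))" for h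
 unfolding h0[OF Cinf_differentiable[OF G x], of h] by(simp only: dG[OF x])
 have hW: "dd (h,0) (dd (0,k) (W i)) (s,q) = h *R dd (1,0) (dd (0,k) (W i)) (s,q)" if "i:Basis" for h i k
 by(rule h0[OF Cinf_differentiable[OF W1[OF that] x]])
 have "((%s. ey q*G (s,q)*jac (tt (s,q))) has_derivative
 (%h. ey q*G (s,q)*(SUM i:Basis. SUM k:Basis. cof (tt (s,q)) i k*dd (h,0) (dd (0,k) (W i)) (s,q)) +
  ey q*dd (h,0) G (s,q)*jac (tt (s,q)))) (at s)"
 by(rule has_derivative_mult[OF has_derivative_mult_right[OF g] j])
 moreover have "ey q*G (s,q)*(SUM i:Basis. SUM k:Basis. cof (tt (s,q)) i k*dd (h,0) (dd (0,k) (W i)) (s,q)) +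
  ey q*dd (h,0) G (s,q)*jac (tt (s,q)) = h *R F' (s,q)" for h
 proof -
 have a: "(SUM i:Basis. SUM k:Basis. cof (tt (s,q)) i k*dd (h,0) (dd (0,k) (W i)) (s,q)) =
  h *R (SUM i:Basis. SUM k:Basis. cof (tt (s,q)) i k*dd (1,0) (dd (0,k) (W i)) (s,q))"
  unfolding scaleR_sum_right by(intro sum.cong refl, subst hW, assumption, simp)
 show ?thesis unfolding a hG[of h] F'_def by(simp add:scaleR_conv_of_real algebra_simps)
 qed
 ultimately show ?thesis by(simp only: F_def snd_conv)
qed
have DPh: "((%s. integral (cbox a b) (%q. F (s,q))) has_derivative (%h. integral (cbox a b) (%q. h *R F' (s,q)))) (at s)"
 if "s:U" for s
proof(rule integral_has_derivative[OF oU that DF])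
 have "U \<times> cbox a b <= U \<times> S" using abS by auto
 thus "continuous_on (U \<times> cbox a b) (%(s,q). h *R F' (s,q))" for h :: real
 using continuous_on_subset[OF cF'] by(auto simp:case_prod_beta intro!: continuous_intros)
qed (use sl cF in auto)
\<comment> \<open>\<open>F' + B\<close> is the divergence of the compactly supported fields
  \<open>E i k\<close>: Piola's identity removes the derivatives of the cofactors,
  \<open>cof_row\<close> turns the coefficients \<open>Gi\<close> into those of \<open>F'\<close>,
  and the derivatives of the cutoff make up \<open>B\<close>.\<close>
have key: "integral (cbox a b) (%q. F' (s,q)) = - integral (cbox a b) (%q. B (s,q))" if s: "s:U" for s
proof -
 define C where "C i k q = cof (tt (s,q)) i k" for i k q
 have S: "K <= S" using abS K(2) by auto
 have xS: "(s,q):U \<times> S" if "q:S" for q using that s by simp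
 define E where "E i k q = ey q*(G (s,q)*(C i k q*dd (1,0) (W i) (s,q)))" for i k q
 have "EX C'. ALL q:S. (ALL k. (C i k has_derivative C' q k) (at q)) & (SUM k:Basis. C' q k k) = 0" if i: "i:Basis" for i
 proof -
 have "EX C'. (ALL k. (C i k has_derivative C' k) (at q)) & (SUM k:Basis. C' k k) = 0" if q: "q:S" for q
 proof -
  show ?thesis
  proof(rule Piola[where tt = "%q. tt (s,q)" and x = q, OF _ _ i])
  show "((%q. tt (s,q) i j) has_derivative (%h. dd (0,h) (dd (0,j) (W i)) (s,q))) (at q)"
   if "i:Basis" "j:Basis" for i j unfolding tt_def
   by(rule dd_fst_slice(1)[OF Cinf_differentiable[OF W1[OF that(1)] xS[OF q]]])
  show "dd (0,k) (dd (0,j) (W i)) (s,q) = dd (0,j) (dd (0,k) (W i)) (s,q)" if "i:Basis" for i j k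
   by(rule dd_commute[OF oP xS[OF q]]) (use W[OF that] in "simp add: Cinf_on_def")
  fix C' assume C': "!!k. ((%q. cof (tt (s,q)) i k) has_derivative C' k) (at q)" "(SUM k:Basis. C' k k) = 0"
  show "EX C'. (ALL k. (C i k has_derivative C' k) (at q)) & (SUM k:Basis. C' k k) = 0"
   unfolding C_def by(rule exI[of _ C']) (simp add:C')
  qed
 qed
 thus ?thesis by metis
 qed
 then obtain C' where C': "!!i q k. i:Basis ==> q:S ==> (C i k has_derivative C' i q k) (at q)"
 "!!i q. i:Basis ==> q:S ==> (SUM k:Basis. C' i q k k) = 0" by metis
 define E' where "E' i k q = dd k ey q*(G (s,q)*(C i k q*dd (1,0) (W i) (s,q))) +
 ey q*((SUM l:Basis. Gi l (s,q)*dd (0,k) (W l) (s,q))*(C i k q*dd (1,0) (W i) (s,q)) +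
 G (s,q)*(C' i q k k*dd (1,0) (W i) (s,q) + C i k q*dd (1,0) (dd (0,k) (W i)) (s,q)))" for i k q
 have E1: "dd k (E i k) q = E' i k q" if i: "i:Basis" and q: "q:S" for i k q
 proof -
 note x = xS[OF q]
 have g: "((%q. G (s,q)) has_derivative (%h. dd (0,h) G (s,q))) (at q)"
  by(rule dd_fst_slice(1)[OF Cinf_differentiable[OF G x]])
 have w: "((%q. dd (1,0) (W i) (s,q)) has_derivative (%h. dd (0,h) (dd (1,0) (W i)) (s,q))) (at q)"
  by(rule dd_fst_slice(1)[OF Cinf_differentiable[OF W1[OF i] x]])
 have dey: "(ey has_derivative (%h. dd h ey q)) (at q)" using Cinf_deriv[OF ey] by simp
 have D: "(E i k has_derivative (%h. ey q*(G (s,q)*(C i k q*dd (0,h) (dd (1,0) (W i)) (s,q) +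
  C' i q k h*dd (1,0) (W i) (s,q)) + dd (0,h) G (s,q)*(C i k q*dd (1,0) (W i) (s,q))) +
  dd h ey q*(G (s,q)*(C i k q*dd (1,0) (W i) (s,q))))) (at q)"
  unfolding E_def by(rule has_derivative_mult[OF dey has_derivative_mult[OF g has_derivative_mult[OF C'(1)[OF i q] w]]])
 have sw: "dd (0,k) (dd (1,0) (W i)) (s,q) = dd (1,0) (dd (0,k) (W i)) (s,q)"
  by(rule dd_commute[OF oP x]) (use W[OF i] in "simp add: Cinf_on_def")
 show "dd k (E i k) q = E' i k q"
  unfolding dd_eq[OF D] E'_def sw dG[OF x] by simp
 qed
 have CE: "Cinf_on S (E i k)" if i: "i:Basis" for i k
 proof -
 have sl': "Cinf_on S (%q. f (s,q))" if "Cinf_on (U \<times> S) f" for f :: "real \<times> 'e => complex"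
  by(rule Cinf_compose[OF oS oP _ _ that]) (use s in "auto intro!: Cinf_slice[OF oS]")
 show ?thesis unfolding E_def C_def tt_def
  by(intro Cinf_mult Cinf_cof oS sl' W1 i G Cinf_subset[OF ey]) auto
 qed
 have cE: "continuous_on (cbox a b) (dd k (E i k))" if "i:Basis" for i k
 by(rule continuous_on_subset[OF Cinf_cont[OF Cinf_dd[OF CE[OF that]]] abS])
 have zero: "integral (cbox a b) (dd k (E i k)) = 0" if "i:Basis" for i k
 by(rule integral_dd_zero_compact[OF oS CE[OF that] K(1) S K(2)]) (simp add:E_def K(3))
 have "F' (s,q) + B (s,q) = (SUM i:Basis. SUM k:Basis. dd k (E i k) q)" if q: "q:cbox a b" for q
 proof -
 have qS: "q:S" using q abS by auto
 have "(SUM i:Basis. SUM k:Basis. dd k (E i k) q) = (SUM i:Basis. SUM k:Basis. E' i k q)"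
  using E1[OF _ qS] by simp
 also have "... = B (s,q) + (SUM i:Basis. ey q*dd (1,0) (W i) (s,q) *
  (SUM l:Basis. Gi l (s,q)*(SUM k:Basis. cof (tt (s,q)) i k*tt (s,q) l k))) +
  (SUM i:Basis. ey q*G (s,q)*dd (1,0) (W i) (s,q)*(SUM k:Basis. C' i q k k)) +
  ey q*G (s,q)*(SUM i:Basis. SUM k:Basis. cof (tt (s,q)) i k*dd (1,0) (dd (0,k) (W i)) (s,q))"
  unfolding E'_def B_def
 by(simp add:sum.distrib distrib_left distrib_right sum_distrib_left sum_distrib_right C_def mult_ac,
  rule sum.cong[OF refl], subst sum.swap, simp add:tt_def mult_ac)
 also have "(SUM i:Basis. ey q*dd (1,0) (W i) (s,q) *
  (SUM l:Basis. Gi l (s,q)*(SUM k:Basis. cof (tt (s,q)) i k*tt (s,q) l k))) =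
  (SUM i:Basis. ey q*dd (1,0) (W i) (s,q)*(Gi i (s,q)*jac (tt (s,q))))"
  by(rule sum.cong[OF refl]) (simp add:cof_row if_distrib[of "%x. _*x"] cong: if_cong sum.cong)
 also have "(SUM i:Basis. ey q*G (s,q)*dd (1,0) (W i) (s,q)*(SUM k:Basis. C' i q k k)) = 0"
  by(rule sum.neutral) (use C'(2)[OF _ qS] in simp)
 finally show ?thesis by(simp add:F'_def algebra_simps sum_distrib_left sum_distrib_right)
 qed
 hence "integral (cbox a b) (%q. F' (s,q) + B (s,q)) = integral (cbox a b) (%q. SUM i:Basis. SUM k:Basis. dd k (E i k) q)"
 by(rule integral_cong)
 also have "... = (SUM i:Basis. SUM k:Basis. integral (cbox a b) (dd k (E i k)))"
 by(simp add:integral_sum integrable_sum integrable_continuous cE)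
 also have "... = 0" by(simp add:zero)
 finally show ?thesis
 using integral_add[OF integrable_continuous[OF sl[OF s cF']] integrable_continuous[OF sl[OF s cB]]]
 by(simp add:add_eq_0_iff2)
qed
have bound: "norm (integral (cbox a b) (%q. F (1,q)) - integral (cbox a b) (%q. F (0,q))) <= M*measure lborel (cbox a b)*norm (1 - 0 :: real)"
proof(rule differentiable_bound[of "{0..1}"])
 show "((%s. integral (cbox a b) (%q. F (s,q))) has_derivative (%h. integral (cbox a b) (%q. h *R F' (s,q)))) (at s within {0..1})"
 if "s:{0..1}" for s by(rule has_derivative_at_withinI[OF DPh]) (use that U01 in blast)
 fix s :: real assume s: "s:{0..1}"
 hence sU: "s:U" using U01 by auto
 have M': "norm (integral (cbox a b) (%q. B (s,q))) <= M*measure lborel (cbox a b)"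
 proof(rule integrable_bound[of M "%q. B (s,q)" a b])
 show "norm (B (s,q)) <= M" if "q:cbox a b" for q
  using M[of s q] s that by(simp add:B_def tte)
 show "0 <= M" by(rule M0)
 show "(%q. B (s,q)) integrable_on cbox a b" by(rule integrable_continuous[OF sl[OF sU cB]])
 qed
 have "integral (cbox a b) (%q. h *R F' (s,q)) = h *R (- integral (cbox a b) (%q. B (s,q)))" for h
 unfolding key[OF sU, symmetric] by(rule integral_cmul)
 thus "onorm (%h. integral (cbox a b) (%q. h *R F' (s,q))) <= M*measure lborel (cbox a b)"
 using M' by(intro onorm_le) (auto simp:mult.commute[of "\<bar>_\<bar>"] intro: mult_right_mono)
qed auto
thus ?thesis by(simp add:slice_integral_def F_def tte)
qed

section \<open>Approximation of CR functions by entire functions of CR coordinates\<close>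

lemma dd_chain:
assumes "(f has_derivative f') (at x)" "g differentiable (at (f x))"
shows "dd v (%x. g (f x)) x = dd (f' v) g (f x)"
using dd_eq[OF diff_chain_at[OF assms(1) has_derivative_dd[OF assms(2)]], of v] by(simp add:o_def)

lemma onorm_scaleR_le: "norm c <= B ==> onorm (%s::real. s *R c) <= B"
by(rule onorm_le) (simp add:mult.commute[of "norm c"] mult.commute[of B] mult_left_mono)

definition cube :: "real => 'e::euclidean_space set" where
"cube r = {q. ALL b:Basis. \<bar>q <.> b\<bar> < r}"

definition ccube :: "real => 'e::euclidean_space set" where
"ccube r = cbox (- r *R One) (r *R One)"

lemma mem_ccube: "q:ccube r \<longleftrightarrow> (ALL b:Basis. \<bar>q <.> b\<bar> <= r)"
by(auto simp:ccube_def mem_box abs_le_iff)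

lemma open_cube: "open (cube r :: 'e::euclidean_space set)"
proof -
have "cube r = box (- r *R One) (r *R One :: 'e)" by(force simp:cube_def mem_box abs_less_iff)
thus ?thesis by(simp add:open_box)
qed

lemma compact_ccube: "compact (ccube r)" unfolding ccube_def by simp

lemma ccube_subset_cube: "s < r ==> ccube s <= cube r"
by(force simp:mem_ccube cube_def)

text \<open>The Jacobian matrix, along a slice, of the map with components \<open>Z i\<close> for
  \<open>i\<close> in \<open>I\<close> and the coordinates otherwise. The entries 0 arise because a
  slice is parametrised through \<open>pr\<close>, so that moving in a direction outside
  \<open>I\<close> does not change the \<open>Z i\<close>.\<close>

definition tmat :: "'e set => ('e => 'e => complex) => 'e => 'e => 'e::euclidean_space => complex" where
"tmat I Z q i k = (if i:I then dd (if k:I then k else 0) (Z i) q else if k = i then 1 else 0)"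

text \<open>
The functions \<open>Z i\<close> are coordinates transversally to the directions in \<open>Basis - I\<close>, along which
\<open>f\<close> is approximated on every slice by integrals over the slice through the origin.
\<close>

locale slice_coordinates =
fixes I :: "'e::euclidean_space set" and r :: real and Z :: "'e => 'e => complex" and ey :: "real => real"
assumes I: "I <= Basis" and r: "0 < r"
 and Z: "i:I ==> Cinf_on (cube (2*r)) (Z i)"
 and dZ: "i:I ==> j:I ==> q:cube (2*r) ==>
 cmod (dd j (Z i) q - (if j = i then 1 else 0)) <= 1/(8*real DIM('e)^2)"
 and jac0: "q:cube (2*r) ==> jac (tmat I Z q) ~= 0"
 and ey: "Cinf_on UNIV ey" "0 <= ey t" "ey t <= 1" "\<bar>t\<bar> <= r/2 ==> ey t = 1" "\<bar>t\<bar> >= 3*r/4 ==> ey t = 0"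
begin

lemma finI: "finite I" using I finite_Basis finite_subset by blast

lemma cardI: "real (card I) <= real DIM('e)" using card_mono[OF finite_Basis I] by simp

lemma d1: "1 <= real DIM('e)" using DIM_positive[where 'a = 'e] by linarith

definition pr :: "'e => 'e" where "pr q = (SUM i:I. (q <.> i) *R i)"

lemma pr_inner: "b:Basis ==> pr q <.> b = (if b:I then q <.> b else 0)"
proof -
assume b: "b:Basis"
have "pr q <.> b = (SUM i:I. if i = b then q <.> i else 0)"
 unfolding pr_def inner_sum_left by(rule sum.cong[OF refl]) (use I b in "auto simp: inner_Basis")
thus ?thesis by(simp add:finI)
qed

lemma bounded_linear_pr: "bounded_linear pr"
unfolding pr_def by(intro bounded_linear_sum bounded_linear_scaleR_left[THEN bounded_linear_compose] bounded_linear_inner_left)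

interpretation pr: bounded_linear pr by(rule bounded_linear_pr)

lemma pr_pr: "pr (pr q) = pr q" by(rule euclidean_eqI) (simp add:pr_inner)

lemma norm_pr_sq: "norm (pr q)^2 = (SUM i:I. (q <.> i)^2)"
proof -
have "norm (pr q)^2 = (SUM b:Basis. (pr q <.> b)^2)"
 by(subst power2_norm_eq_inner, subst euclidean_inner) (simp add:power2_eq_square)
also have "... = (SUM b:Basis. if b:I then (q <.> b)^2 else 0)" by(rule sum.cong[OF refl]) (simp add:pr_inner)
also have "... = (SUM i:I. (q <.> i)^2)" using I by(simp add:sum.inter_restrict[symmetric] Int_absorb1)
finally show ?thesis .
qed

lemma inner_le_pr: "i:I ==> \<bar>q <.> i\<bar> <= norm (pr q)"
using Basis_le_norm[of i "pr q"] pr_inner[of i q] I by auto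

lemma pr_Basis: "b:Basis ==> pr b = (if b:I then b else 0)"
by(rule euclidean_eqI) (auto simp:pr_inner inner_Basis)

lemma norm_pr_le: "norm (pr q) <= norm q"
proof -
have "norm q^2 = (SUM b:Basis. (q <.> b)^2)"
 by(subst power2_norm_eq_inner, subst euclidean_inner) (simp add:power2_eq_square)
hence "norm (pr q)^2 <= norm q^2"
 unfolding norm_pr_sq using I by(auto intro!: sum_mono2)
thus ?thesis by(rule power2_le_imp_le) simp
qed

lemma tmat_alt: "k:Basis ==> tmat I Z q i k = (if i:I then dd (pr k) (Z i) q else if k = i then 1 else 0)"
by(simp add:tmat_def pr_Basis)

lemma dd_combination:
assumes "f differentiable (at q)"
shows "dd v f q = (SUM b:Basis. of_real (v <.> b)*(dd b f q :: complex))"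
using dd_basis[OF assms, of v] by(simp add:scaleR_conv_of_real)

text \<open>Along the segment from \<open>b\<close> to \<open>a\<close> the bounds
  \<open>dZ\<close>, summed over the basis directions, give the Lipschitz constant
  \<open>1/(8*DIM('e))\<close> for the difference of \<open>Z i\<close> and the coordinate; by
  \<open>ab\<close> the segment moves only in the directions \<open>I\<close>.\<close>

lemma Z_increment:
assumes i: "i:I" and a: "a:cube (2*r)" and b: "b:cube (2*r)" and ab: "pr (a - b) = a - b"
shows "cmod (Z i a - Z i b - of_real ((a - b) <.> i)) <= norm (a - b)/(8*real DIM('e))"
proof -
define h where "h t = Z i (b + t *R (a - b)) - of_real (t*((a - b) <.> i))" for t
have in_cube: "b + t *R (a - b):cube (2*r)" if "t:{0..1}" for t
proof -
 have "\<bar>(b + t *R (a - b)) <.> c\<bar> < 2*r" if c: "c:Basis" for c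
 proof -
 have "(b + t *R (a - b)) <.> c = (1 - t)*(b <.> c) + t*(a <.> c)" by(simp add:algebra_simps)
 moreover have "\<bar>(1 - t)*(b <.> c) + t*(a <.> c)\<bar> < 2*r"
  by(rule convex_bound_lt[of "\<bar>b <.> c\<bar>" _ "\<bar>a <.> c\<bar>" "1 - t" t, THEN le_less_trans[rotated]])
  (use a b c that `t : {0..1}` abs_triangle_ineq[of "(1 - t)*(b <.> c)" "t*(a <.> c)"] in "auto simp: cube_def abs_mult")
 ultimately show ?thesis by simp
 qed
 thus ?thesis by(simp add:cube_def)
qed
have "norm (h 1 - h 0) <= norm (a - b)/(8*real DIM('e))*norm (1 - 0 :: real)"
proof(rule differentiable_bound[of "{0..1}"])
 fix t :: real assume t: "t:{0..1}"
 let ?q = "b + t *R (a - b)"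
 have dz: "Z i differentiable (at ?q)" by(rule Cinf_differentiable[OF Z[OF i] in_cube[OF t]])
 have "(h has_derivative (%s. s *R dd (a - b) (Z i) ?q - of_real (s*((a - b) <.> i)))) (at t)"
 unfolding h_def by(intro has_derivative_diff has_derivative_line[OF dz] derivative_eq_intros) auto
 also have "(%s. s *R dd (a - b) (Z i) ?q - of_real (s*((a - b) <.> i))) =
 (%s. s *R (dd (a - b) (Z i) ?q - of_real ((a - b) <.> i)))"
 by(simp add:fun_eq_iff right_diff_distrib scaleR_conv_of_real)
 finally show "(h has_derivative (%s. s *R (dd (a - b) (Z i) ?q - of_real ((a - b) <.> i)))) (at t within {0..1})"
 by(rule has_derivative_at_withinI)
 have "dd (a - b) (Z i) ?q - of_real ((a - b) <.> i) =
 (SUM j:Basis. of_real ((a - b) <.> j)*(dd j (Z i) ?q - (if j = i then 1 else 0)))"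
 using i I by(subst dd_combination[OF dz]) (auto simp:right_diff_distrib sum_subtractf if_distrib[of "%x. _*x"] cong: if_cong)
 also have "cmod ... <= (SUM j:(Basis :: 'e set). norm (a - b)*(1/(8*real DIM('e)^2)))"
 proof(rule sum_norm_le)
 fix j :: 'e assume j: "j:Basis"
 show "cmod (of_real ((a - b) <.> j)*(dd j (Z i) ?q - (if j = i then 1 else 0))) <= norm (a - b)*(1/(8*real DIM('e)^2))"
 proof(cases "j:I")
  case True
  show ?thesis unfolding norm_mult norm_of_real
  by(rule mult_mono[OF Basis_le_norm[OF j] dZ[OF i True in_cube[OF t]]]) auto
 next
  case False
  hence "(a - b) <.> j = 0" using pr_inner[OF j, of "a - b"] ab by simp
  thus ?thesis by simp
 qed
 qed
 also have "... = norm (a - b)/(8*real DIM('e))" using d1 by(simp add:power2_eq_square)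
 finally show "onorm (%s. s *R (dd (a - b) (Z i) ?q - of_real ((a - b) <.> i))) <= norm (a - b)/(8*real DIM('e))"
 by(rule onorm_scaleR_le)
qed auto
moreover have "h 1 - h 0 = Z i a - Z i b - of_real ((a - b) <.> i)" by(simp add:h_def)
ultimately show ?thesis by(simp only: diff_zero norm_one mult_1_right)
qed

definition kern :: "nat => ('e => complex) => ('e => complex) => complex" where
"kern nu z w = exp (- of_nat nu*(SUM i:I. (z i - w i)^2))"

text \<open>The vector \<open>w - z\<close> differs little from the real vector \<open>a\<close>, so
  that the real part of the sum of its squares is comparable to
  \<open>norm (pr a)^2\<close>.\<close>

lemma kern_bound:
assumes "!!i. i:I ==> cmod (z i - w i + of_real (a <.> i)) <= norm (pr a)/(4*real DIM('e))"
shows "cmod (kern nu z w) <= exp (- real nu*(norm (pr a)^2/4))"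
proof -
define g where "g i = z i - w i + of_real (a <.> i)" for i
define N where "N = norm (pr a)"
have g: "cmod (g i) <= N/(4*real DIM('e))" if "i:I" for i using assms[OF that] by(simp add:g_def N_def)
\<comment> \<open>Each coordinate loses at most \<open>9/16 * N^2 / DIM('e)\<close>:
  \<open>8/16\<close> from the mixed term and \<open>1/16\<close> from the square of the imaginary
  part. With at most \<open>DIM('e)\<close> coordinates, \<open>7/16 * N^2\<close> remains, which
  exceeds the claimed quarter.\<close>
have le: "(a <.> i)^2 - 9/16*N^2/real DIM('e) <= Re ((z i - w i)^2)" if i: "i:I" for i
proof -
 let ?d = "real DIM('e)"
 have N0: "0 <= N" by(simp add:N_def)
 have e: "z i - w i = g i - of_real (a <.> i)" by(simp add:g_def)
 have "Re ((z i - w i)^2) = (Re (g i))^2 - (Im (g i))^2 - 2*(a <.> i) * Re (g i) + (a <.> i)^2"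
 unfolding e by(simp add:power2_eq_square algebra_simps)
 moreover have "\<bar>2*(a <.> i) * Re (g i)\<bar> <= 2*N*(N/(4*?d))"
 unfolding abs_mult by(intro mult_mono order_trans[OF abs_Re_le_cmod g[OF i]]) (use inner_le_pr[OF i] N0 in "auto simp: N_def")
 moreover have "(Im (g i))^2 <= (N/(4*?d))^2"
 by(rule abs_le_square_iff[THEN iffD1]) (use order_trans[OF abs_Im_le_cmod g[OF i]] in linarith)
 moreover have "(N/(4*?d))^2 <= N^2/(16*?d)"
 proof -
 have "(N/(4*?d))^2 = N^2/(16*?d)*(1/?d)" by(simp add:power2_eq_square)
 also have "... <= N^2/(16*?d)*1" using d1 by(intro mult_left_mono) auto
 finally show ?thesis by simp
 qed
 moreover have "2*N*(N/(4*?d)) = 8/16*N^2/?d" by(simp add:power2_eq_square)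
 moreover have "9/16*N^2/?d = 8/16*N^2/?d + N^2/(16*?d)" using d1 by simp
 ultimately show ?thesis using zero_le_power2[of "Re (g i)"] by linarith
qed
have "norm (pr a)^2/4 <= Re (SUM i:I. (z i - w i)^2)"
proof -
 have "real (card I)*(9/16*N^2/real DIM('e)) <= real DIM('e)*(9/16*N^2/real DIM('e))"
 by(intro mult_right_mono cardI) simp
 also have "... = 9/16*N^2" using d1 by simp
 finally have "(SUM i:I. (a <.> i)^2 - 9/16*N^2/real DIM('e)) >= N^2 - 9/16*N^2"
 by(simp add:sum_subtractf norm_pr_sq N_def)
 moreover have "0 <= N^2" by simp
 moreover have "(SUM i:I. (a <.> i)^2 - 9/16*N^2/real DIM('e)) <= (SUM i:I. Re ((z i - w i)^2))"
 by(rule sum_mono[OF le])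
 ultimately show ?thesis unfolding Re_sum N_def[symmetric] by linarith
qed
hence "- real nu * Re (SUM i:I. (z i - w i)^2) <= - real nu*(norm (pr a)^2/4)"
 by(intro mult_left_mono_neg) auto
thus ?thesis unfolding kern_def norm_exp_eq_Re exp_le_cancel_iff by simp
qed

definition fi :: "'e => real" where "fi q = (PROD b:Basis. ey (q <.> b))"

lemma fi_range: "0 <= fi q" "fi q <= 1"
unfolding fi_def using ey(2,3) by(auto intro: prod_nonneg prod_le_1)

lemma fi_1: "q:ccube (r/2) ==> fi q = 1"
unfolding fi_def mem_ccube by(rule prod.neutral) (simp add:ey(4))

lemma fi_0: "q~:ccube (3*r/4) ==> fi q = 0"
unfolding fi_def mem_ccube using ey(5) by(intro prod_zero) (auto simp:not_le intro: less_imp_le)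

lemma Cinf_fi: "Cinf_on UNIV fi"
unfolding fi_def by(intro Cinf_prod open_UNIV Cinf_compose[OF open_UNIV open_UNIV _ _ ey(1)] Cinf_linear bounded_linear_inner_left) auto

abbreviation "fic \<equiv> (%q. cor (fi q))"

abbreviation (input) "slint \<equiv> slice_integral (- r *R One) (r *R One) fic"

text \<open>The bound of \<open>kern_bound\<close> at \<open>norm (pr a) = r/2\<close>, the distance
  at which the cutoff may begin to vary.\<close>

abbreviation (input) tail :: "nat => real" where "tail nu \<equiv> exp (- real nu*(r^2/16))"

text \<open>The second clause concerns the straight homotopy from the affine functions
  \<open>z i + q <.> i\<close> to the \<open>Z i\<close>, along which the normalising integral is
  computed.\<close>

abbreviation (input) "kern_small nu z T q \<equiv> cmod (kern nu z (%i. Z i (pr q + T))) <= tail nu &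
(ALL s:{0..1}. cmod (kern nu z (%i. (1 - of_real s)*(z i + of_real (q <.> i)) + of_real s*Z i (pr q + T))) <= tail nu)"

lemma Cinf_fic: "Cinf_on UNIV fic" by(intro Cinf_of_real open_UNIV Cinf_fi)

lemma continuous_fi: "continuous_on S fi" using Cinf_cont[OF Cinf_fi] continuous_on_subset by blast

lemma dd_fi_0:
assumes k: "k:I" and q: "norm (pr q) < r/2"
shows "dd k fic q = 0"
proof -
have kB: "k:Basis" using k I by blast
have lin: "\<bar>q <.> k\<bar> < r/2" using inner_le_pr[OF k, of q] q by linarith
have "((%t. fic (q + t *R k)) has_derivative (%h. h *R dd k fic (q + 0 *R k))) (at 0)"
 by(rule has_derivative_line) (rule Cinf_differentiable[OF Cinf_fic], simp)
moreover have "((%t. fic (q + t *R k)) has_derivative (%h. 0)) (at 0)"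
proof(rule has_derivative_transform_within_open[OF has_derivative_const[of "fic q"]])
 show "open (ball 0 (r/2 - \<bar>q <.> k\<bar>))" "(0::real):ball 0 (r/2 - \<bar>q <.> k\<bar>)" using lin by auto
 fix t :: real assume "t:ball 0 (r/2 - \<bar>q <.> k\<bar>)"
 hence t: "\<bar>q <.> k + t\<bar> <= r/2" using abs_triangle_ineq[of "q <.> k" t] by auto
 have "ey (q <.> b) = ey ((q + t *R k) <.> b)" if "b:Basis" for b
 using t lin kB that by(cases "b = k") (auto simp:inner_add_left inner_Basis ey(4))
 thus "fic q = fic (q + t *R k)" by(simp add:fi_def)
qed
ultimately have "(%h::real. h *R dd k fic (q + 0 *R k)) = (%h. 0)" by(rule has_derivative_unique)
from fun_cong[OF this, of 1] show ?thesis by simp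
qed

text \<open>The integral of the kernel over a flat model slice. It serves as the normalisation
  itself, so that comparisons with it replace its asymptotics in \<open>nu\<close>.\<close>

definition cn :: "nat => real" where
"cn nu = integral (ccube r) (%q. fi q*exp (- real nu*norm (pr q)^2))"

lemma integrable_ccube: "continuous_on (ccube s) f ==> f integrable_on (ccube s :: 'e set)"
for f :: "'e => 'b::banach"
unfolding ccube_def by(rule integrable_continuous)

lemma continuous_pr: "continuous_on S pr" by(rule pr.continuous_on[OF continuous_on_id])

lemma ccube_mono: "s <= t ==> ccube s <= ccube t"
by(force simp:mem_ccube)

lemma cn_ge:
assumes "0 <= s" "s <= r/2"
shows "integral (ccube s) (%q. exp (- real nu*norm (pr q)^2)) <= cn nu"
proof -
have c: "continuous_on T (%q. exp (- real nu*norm (pr q)^2))" for T by(intro continuous_intros continuous_pr)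
have "integral (ccube s) (%q. exp (- real nu*norm (pr q)^2)) = integral (ccube s) (%q. fi q*exp (- real nu*norm (pr q)^2))"
 by(rule integral_cong) (use ccube_mono[OF assms(2)] fi_1 in auto)
also have "... <= cn nu" unfolding cn_def
 by(rule integral_subset_le) (use assms r in "auto intro!: ccube_mono integrable_ccube continuous_intros continuous_fi continuous_pr mult_nonneg_nonneg fi_range")
finally show ?thesis .
qed

text \<open>On a cube so small that \<open>norm (pr q)^2 <= ka\<close> the integrand is at least
  \<open>exp (- nu * ka)\<close>. So \<open>cn\<close> decays more slowly than any exponential, and
  exponentially small errors stay small after normalisation.\<close>

lemma cn_lower:
assumes "0 < ka"
obtains C where "0 < C" "!!nu. C*exp (- real nu*ka) <= cn nu"
proof
define t where "t = min (r/2) (sqrt ka/real DIM('e))"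
have t: "0 < t" "t <= r/2" "real DIM('e)*t <= sqrt ka"
 using r assms d1 by(auto simp:t_def min_def field_simps)
define C where "C = Henstock_Kurzweil_Integration.content (ccube t :: 'e set)"
have "box (- t *R One) (t *R One :: 'e) ~= {}" using t by(auto simp:box_ne_empty)
thus "0 < C" unfolding C_def ccube_def content_pos_lt_eq by(simp add:box_ne_empty)
fix nu
have "C*exp (- real nu*ka) = integral (ccube t :: 'e set) (%q. exp (- real nu*ka))"
 unfolding C_def ccube_def by simp
also have "... <= integral (ccube t) (%q. exp (- real nu*norm (pr q)^2))"
proof(rule integral_le)
 fix q :: 'e assume q: "q:ccube t"
 have "norm q <= (SUM b:Basis. \<bar>q <.> b\<bar>)" by(rule norm_le_l1)
 also have "... <= (SUM b:(Basis :: 'e set). t)" by(rule sum_mono) (use q in "auto simp: mem_ccube")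
 also have "... <= sqrt ka" using t by simp
 finally have "norm (pr q)^2 <= (sqrt ka)^2" using norm_pr_le[of q] by(intro power_mono) auto
 thus "exp (- real nu*ka) <= exp (- real nu*norm (pr q)^2)" using assms by(simp add:mult_left_mono)
qed (auto intro!: integrable_ccube continuous_intros continuous_pr)
also have "... <= cn nu" using t by(intro cn_ge) auto
finally show "C*exp (- real nu*ka) <= cn nu" .
qed

lemma cn_pos: "0 < cn nu"
proof -
obtain C where "0 < C" "!!nu. C*exp (- real nu*1) <= cn nu" using cn_lower[of 1] by auto
thus ?thesis by(metis exp_gt_zero less_le_trans mult_pos_pos)
qed

lemma exp_over_cn:
assumes "0 < ka"
shows "(%nu. exp (- real nu*ka)/cn nu) \<longlonglongrightarrow> 0"
proof -
obtain C where C: "0 < C" "!!nu. C*exp (- real nu*(ka/2)) <= cn nu" using cn_lower[of "ka/2"] assms by auto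
have "(%nu. 1/C*(exp (- (ka/2)))^nu) \<longlonglongrightarrow> 1/C*0"
 by(intro tendsto_mult_left LIMSEQ_realpow_zero) (use assms in auto)
hence lim: "(%nu. 1/C*(exp (- (ka/2)))^nu) \<longlonglongrightarrow> 0" by simp
have le: "exp (- real nu*ka)/cn nu <= 1/C*(exp (- (ka/2)))^nu" for nu
proof -
 have "exp (- real nu*ka)/cn nu <= exp (- real nu*ka)/(C*exp (- real nu*(ka/2)))"
 using C by(intro divide_left_mono) (auto intro!: mult_pos_pos cn_pos)
 also have "... = 1/C*exp (- real nu*(ka/2))"
 using C(1) by(simp add:field_simps flip: exp_add)
 also have "exp (- real nu*(ka/2)) = (exp (- (ka/2)))^nu" by(simp flip: exp_of_nat_mult)
 finally show ?thesis .
qed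
show ?thesis
 by(rule tendsto_sandwich[OF _ _ tendsto_const lim]) (use le cn_pos in "auto intro!: always_eventually simp: less_imp_le")
qed

text \<open>Substitute \<open>q = 4 *R u + x\<close>: the exponent becomes
  \<open>4 * norm (pr u)^2\<close>, the volume changes by \<open>4^DIM('e)\<close>, and the image of
  the cube of size \<open>r/2\<close> covers the cube of size \<open>r\<close> because
  \<open>norm x <= r\<close>.\<close>

lemma gaussian_le_cn:
assumes x: "norm x <= r"
shows "integral (ccube r) (%q. exp (- real nu*(norm (pr (q - x))^2/4))) <= 4^DIM('e)*cn nu"
proof -
define g where "g q = exp (- real nu*(norm (pr (q - x))^2/4))" for q
define D where "D = (%u. 4 *R u + x) ` (ccube (r/2) :: 'e set)"
have c: "continuous_on T (%u. exp (- real nu*(4*norm (pr u)^2)))" for T by(intro continuous_intros continuous_pr)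
have "((%u. exp (- real nu*(4*norm (pr u)^2))) has_integral
 integral (ccube (r/2)) (%u. exp (- real nu*(4*norm (pr u)^2)))) (cbox (- (r/2) *R One) ((r/2) *R One :: 'e))"
 using integrable_integral[OF integrable_ccube[OF c]] by(simp add:ccube_def)
from has_integral_affinity[OF this, of "1/4" "- (1/4) *R x"]
have "((%q. exp (- real nu*(4*norm (pr ((1/4) *R q + - (1/4) *R x))^2))) has_integral
 4^DIM('e)*integral (ccube (r/2)) (%u. exp (- real nu*(4*norm (pr u)^2)))) D"
 by(simp add:D_def ccube_def power_divide)
moreover have "exp (- real nu*(4*norm (pr ((1/4) *R q + - (1/4) *R x))^2)) = g q" for q
proof -
 have "(1/4) *R q + - (1/4) *R x = (1/4) *R (q - x)" by(simp add:scaleR_diff_right)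
 thus ?thesis by(simp only: pr.scaleR g_def norm_scaleR) (simp add:power_divide)
qed
ultimately have I1: "(g has_integral 4^DIM('e)*integral (ccube (r/2)) (%u. exp (- real nu*(4*norm (pr u)^2)))) D"
 by simp
have sub: "ccube r <= D"
proof
 fix q :: 'e assume q: "q:ccube r"
 have "(1/4) *R (q - x):ccube (r/2)" unfolding mem_ccube
 proof
 fix b :: 'e assume b: "b:Basis"
 have "\<bar>(q - x) <.> b\<bar> <= 2*r"
  using q b x Basis_le_norm[OF b, of x] by(fastforce simp:mem_ccube inner_diff_left)
 thus "\<bar>((1/4) *R (q - x)) <.> b\<bar> <= r/2" by simp
 qed
 hence "4 *R ((1/4) *R (q - x)) + x:D" unfolding D_def by(rule imageI)
 thus "q:D" by simp
qed
have "integral (ccube r) g <= integral D g"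
 by(rule integral_subset_le[OF sub]) (use I1 in "auto simp: g_def intro!: integrable_ccube continuous_intros continuous_on_compose2[OF continuous_pr[of UNIV]]")
also have "... = 4^DIM('e)*integral (ccube (r/2)) (%u. exp (- real nu*(4*norm (pr u)^2)))"
 by(rule integral_unique[OF I1])
also have "... <= 4^DIM('e)*integral (ccube (r/2)) (%u. exp (- real nu*norm (pr u)^2))"
 by(intro mult_left_mono integral_le integrable_ccube c) (auto intro!: continuous_intros continuous_pr mult_left_mono)
also have "... <= 4^DIM('e)*cn nu" using r by(intro mult_left_mono cn_ge) auto
finally show ?thesis unfolding g_def .
qed

end

lemma jac_cong: "(!!i k. i:Basis ==> k:Basis ==> tt i k = tt' i k) ==> jac tt = jac tt'"
unfolding jac_def jmat_def by(simp add:Rep_bix)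

lemma cof_cong:
fixes tt :: "'e::euclidean_space => 'e => complex"
assumes "!!i k. i:Basis ==> k:Basis ==> tt i k = tt' i k"
shows "cof tt i k = cof tt' i k"
proof -
have "jmat tt = jmat tt'" unfolding jmat_def by(simp add:assms Rep_bix)
thus ?thesis by(simp add:cof_def)
qed

lemma has_derivative_cexp:
fixes f :: "'a::real_normed_vector => complex"
assumes "(f has_derivative f') (at x)"
shows "((%x. exp (f x)) has_derivative (%h. exp (f x)*f' h)) (at x)"
using diff_chain_at[OF assms, of exp "%h. exp (f x)*h"] DERIV_exp[of "f x"]
by(simp add:o_def has_field_derivative_def)

lemma finite_family_bound:
assumes "finite A" "compact K" "!!a. a:A ==> continuous_on K (g a)"
obtains C :: real where "0 <= C" "ALL a:A. ALL x:K. norm (g a x :: 'b::real_normed_vector) <= C"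
proof -
have "EX C. ALL x:K. norm (g a x) <= C" if "a:A" for a
 using compact_imp_bounded[OF compact_continuous_image[OF assms(3)[OF that] assms(2)]] by(auto simp:bounded_iff)
then obtain C where C: "!!a x. a:A ==> x:K ==> norm (g a x) <= C a" by metis
have "norm (g a x) <= (SUM a:A. \<bar>C a\<bar>)" if "a:A" "x:K" for a x
 using C[OF that] member_le_sum[of a A "%a. \<bar>C a\<bar>"] that assms(1) by fastforce
thus ?thesis by(intro that[of "SUM a:A. \<bar>C a\<bar>"]) (auto intro: sum_nonneg)
qed

section \<open>Moving the slice of integration\<close>

context slice_coordinates
begin

interpretation pr: bounded_linear pr by(rule bounded_linear_pr)

abbreviation "J q \<equiv> jac (tmat I Z q)"

lemma shift_cube:
assumes T: "pr T = 0" "norm T < r/2" and q: "q:cube (2*r)" and s: "-1 < s" "s < 2"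
shows "pr q + s *R T:cube (2*r)"
proof -
have "\<bar>(pr q + s *R T) <.> b\<bar> < 2*r" if b: "b:Basis" for b
proof(cases "b:I")
 case True
 thus ?thesis using q b T pr_inner[OF b, of T] by(simp add:cube_def pr_inner[OF b] inner_add_left)
next
 case False
 have "\<bar>s\<bar>*\<bar>T <.> b\<bar> <= 2*(r/2)" using s T Basis_le_norm[OF b, of T] by(intro mult_mono) auto
 thus ?thesis using False r by(simp add:pr_inner[OF b] inner_add_left abs_mult)
qed
thus ?thesis by(simp add:cube_def)
qed

lemma shift_ccube:
assumes T: "pr T = 0" "norm T < r/2" and q: "q:ccube r" and s: "0 <= s" "s <= 1"
shows "pr q + s *R T:ccube (3*r/2)"
proof -
have "\<bar>(pr q + s *R T) <.> b\<bar> <= 3*r/2" if b: "b:Basis" for b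
proof(cases "b:I")
 case True
 hence "T <.> b = 0" using T(1) pr_inner[OF b, of T] by simp
 thus ?thesis using q b True r by(force simp:mem_ccube pr_inner[OF b] inner_add_left)
next
 case False
 have "\<bar>s\<bar>*\<bar>T <.> b\<bar> <= 1*(r/2)" using s T Basis_le_norm[OF b, of T] by(intro mult_mono) auto
 thus ?thesis using False r by(simp add:pr_inner[OF b] inner_add_left abs_mult)
qed
thus ?thesis by(simp add:mem_ccube)
qed

lemma ccube_cube: "ccube (3*r/2) <= cube (2*r)" "ccube r <= cube (2*r)"
using r by(auto intro!: ccube_subset_cube)

text \<open>For \<open>norm (pr q)\<close> at least \<open>r/2\<close> the distance of
  \<open>z\<close> from the values at 0 and the shift \<open>T\<close> are negligible against
  \<open>pr q\<close>, so that \<open>kern_bound\<close> applies; along the homotopy the deviation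
  from the affine functions is only scaled by \<open>s\<close>.\<close>

lemma kern_far:
obtains de where "0 < de" "de <= r/4" "!!nu z T q. norm T < de ==> pr T = 0 ==> (ALL i:I. cmod (z i - Z i 0) < de) ==>
 q:ccube r ==> r/2 <= norm (pr q) ==> kern_small nu z T q"
proof -
\<comment> \<open>Two errors of size \<open>e\<close>, from \<open>z\<close> and from
  \<open>T\<close>, must fit into \<open>norm (pr q)/(8*DIM('e))\<close>, which is at least
  \<open>r/(16*DIM('e))\<close>.\<close>
define e where "e = r/(32*real DIM('e))"
have e: "0 < e" using r d1 by(simp add:e_def)
have r0: "0:cube (2*r)" using r by(simp add:cube_def)
have "EX d>0. ALL T. norm T < d --> cmod (Z i T - Z i 0) < e" if "i:I" for i
proof -
 have "continuous (at 0) (Z i)"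
 using Cinf_cont[OF Z[OF that]] continuous_on_eq_continuous_at[OF open_cube] r0 by blast
 hence "EX d>0. ALL T. dist T 0 < d --> dist (Z i T) (Z i 0) < e" using e unfolding continuous_at_eps_delta by blast
 thus ?thesis by(simp add:dist_norm)
qed
then obtain d where d: "!!i. i:I ==> 0 < d i" "!!i T. i:I ==> norm T < d i ==> cmod (Z i T - Z i 0) < e" by metis
define de where "de = Min (insert e (insert (r/4) (d ` I)))"
have de: "de <= e" "de <= r/4" "!!i. i:I ==> de <= d i" "0 < de"
proof -
 have f: "finite (insert e (insert (r/4) (d ` I)))" using finI by simp
 show "de <= e" "de <= r/4" "!!i. i:I ==> de <= d i" unfolding de_def by(rule Min_le[OF f], simp)+
 show "0 < de" unfolding de_def Min_gr_iff[OF f insert_not_empty] using e r d(1) by auto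
qed
show ?thesis
proof(rule that[OF de(4,2)])
 fix nu and z :: "'e => complex" and T q :: 'e
 assume T: "norm T < de" "pr T = 0" and z: "ALL i:I. cmod (z i - Z i 0) < de" and q: "q:ccube r" "r/2 <= norm (pr q)"
 have Tr: "norm T < r/2" using T(1) de(2) r by linarith
 have main: "cmod (z i - Z i (pr q + T) + of_real (q <.> i)) <= norm (pr q)/(4*real DIM('e))" if i: "i:I" for i
 proof -
 have qT: "pr q + T:cube (2*r)" using shift_ccube[OF T(2) Tr q(1), of 1] ccube_cube by auto
 have T': "T:cube (2*r)" using shift_ccube[OF T(2) Tr, of 0 1] ccube_cube r by(auto simp:mem_ccube pr.zero)
 have "cmod (Z i (pr q + T) - Z i T - of_real ((pr q + T - T) <.> i)) <= norm (pr q + T - T)/(8*real DIM('e))"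
  by(rule Z_increment[OF i qT T']) (simp add:pr_pr)
 hence "cmod (Z i (pr q + T) - Z i T - of_real (q <.> i)) <= norm (pr q)/(8*real DIM('e))"
  using pr_inner[of i q] i I by auto
 moreover have "cmod (Z i T - Z i 0) < e" using d(2)[OF i] T(1) de(3)[OF i] by simp
 moreover have "cmod (z i - Z i 0) < e" using z i de(1) by force
 moreover have "2*e <= norm (pr q)/(8*real DIM('e))" using q(2) d1 by(simp add:e_def field_simps)
 moreover have e2: "z i - Z i (pr q + T) + of_real (q <.> i) =
  (z i - Z i 0) - (Z i T - Z i 0) - (Z i (pr q + T) - Z i T - of_real (q <.> i))" by simp
 ultimately have "cmod (z i - Z i (pr q + T) + of_real (q <.> i)) <= 2*(norm (pr q)/(8*real DIM('e)))"
  using norm_triangle_ineq4[of "z i - Z i 0" "Z i T - Z i 0"]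
  norm_triangle_ineq4[of "(z i - Z i 0) - (Z i T - Z i 0)" "Z i (pr q + T) - Z i T - of_real (q <.> i)"]
  unfolding e2 by linarith
 thus ?thesis by simp
 qed
 have le: "exp (- real nu*(norm (pr q)^2/4)) <= tail nu"
 proof -
 have "r^2/16 <= norm (pr q)^2/4" using power_mono[OF q(2), of 2] r by(simp add:power_divide)
 thus ?thesis unfolding exp_le_cancel_iff by(intro mult_left_mono_neg) auto
 qed
 have "cmod (kern nu z (%i. (1 - of_real s)*(z i + of_real (q <.> i)) + of_real s*Z i (pr q + T))) <= exp (- real nu*(norm (pr q)^2/4))"
 if s: "s:{0..1}" for s
 proof(rule kern_bound)
 fix i assume i: "i:I"
 have "z i - ((1 - of_real s)*(z i + of_real (q <.> i)) + of_real s*Z i (pr q + T)) + of_real (q <.> i) =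
  of_real s*(z i - Z i (pr q + T) + of_real (q <.> i))" by(simp add:algebra_simps)
 thus "cmod (z i - ((1 - of_real s)*(z i + of_real (q <.> i)) + of_real s*Z i (pr q + T)) + of_real (q <.> i))
  <= norm (pr q)/(4*real DIM('e))"
  using s mult_mono[OF _ main[OF i], of s 1] by(simp add:norm_mult)
 qed
 thus "kern_small nu z T q"
 using order_trans[OF kern_bound[OF main] le] le by(meson order_trans)
qed
qed

lemma kern_near:
assumes "pr q + T:cube (2*r)" "p:cube (2*r)" "T = p - pr p"
shows "cmod (kern nu (%i. Z i p) (%i. Z i (pr q + T))) <= exp (- real nu*(norm (pr (q - p))^2/4))"
proof(rule kern_bound)
fix i assume i: "i:I"
have e: "pr q + T - p = pr (q - p)" using assms(3) by(simp add:pr.diff)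
have "cmod (Z i (pr q + T) - Z i p - of_real ((pr q + T - p) <.> i)) <= norm (pr q + T - p)/(8*real DIM('e))"
 by(rule Z_increment[OF i assms(1,2)]) (simp add:e pr_pr)
hence "cmod (- (Z i p - Z i (pr q + T) + of_real ((q - p) <.> i))) <= norm (pr (q - p))/(8*real DIM('e))"
 unfolding norm_minus_cancel e using pr_inner[of i "q - p"] i I
 norm_minus_cancel[of "Z i p - Z i (pr q + T) + of_real ((q - p) <.> i)"] by auto
also have "... <= norm (pr (q - p))/(4*real DIM('e))" using d1 by(simp add:field_simps)
finally show "cmod (Z i p - Z i (pr q + T) + of_real ((q - p) <.> i)) <= norm (pr (q - p))/(4*real DIM('e))"
 by(simp only: norm_minus_cancel)
qed

lemma has_derivative_kern:
assumes "!!i. i:I ==> ((%x. z i x - w i x) has_derivative D i) (at x)"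
shows "((%x. kern nu (%i. z i x) (%i. w i x)) has_derivative
 (%h. kern nu (%i. z i x) (%i. w i x)*(SUM i:I. - (2 * of_nat nu)*(z i x - w i x)*D i h))) (at x)"
proof -
have "((%x. - of_nat nu*(SUM i:I. (z i x - w i x)*(z i x - w i x))) has_derivative
 (%h. - of_nat nu*(SUM i:I. (z i x - w i x)*D i h + D i h*(z i x - w i x)))) (at x)"
 by(intro has_derivative_mult_right has_derivative_sum has_derivative_mult assms)
from has_derivative_cexp[OF this] show ?thesis
 unfolding kern_def power2_eq_square by(simp add:sum_distrib_left algebra_simps)
qed

lemma Cinf_kern:
assumes "open S" "!!i. i:I ==> Cinf_on S (z i)" "!!i. i:I ==> Cinf_on S (w i)"
shows "Cinf_on S (%x. kern nu (%i. z i x) (%i. w i x))"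
unfolding kern_def power2_eq_square
by(intro Cinf_exp Cinf_mult Cinf_sum Cinf_diff Cinf_const assms)

text \<open>The boundary term of \<open>deformation\<close> is localised: for \<open>i\<close>
  outside \<open>I\<close> the function \<open>W i\<close> does not depend on \<open>s\<close>; for
  \<open>i\<close> in \<open>I\<close> and \<open>k\<close> outside, the cofactor vanishes; and for
  \<open>k\<close> in \<open>I\<close> the derivative of the cutoff vanishes where
  \<open>norm (pr q) < r/2\<close>. What is left lies where the kernel is small.\<close>

lemma slice_deform:
fixes W :: "'e => real \<times> 'e => complex"
assumes C: "0 <= C" "!!k q. k:Basis ==> q:ccube r ==> cmod (dd k fic q) <= C"
 and W: "!!i. i:I ==> Cinf_on ({-1<..<2} \<times> cube (2*r)) (W i)" and G: "Cinf_on ({-1<..<2} \<times> cube (2*r)) G"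
 and Wb: "!!b. b:Basis ==> b~:I ==> W b = (%x. of_real (snd x <.> b))"
 and Gi: "!!i. i:I ==> continuous_on ({-1<..<2} \<times> cube (2*r)) (Gi i)"
 and dG: "!!x v. x:{-1<..<2} \<times> cube (2*r) ==> dd v G x = (SUM i:I. Gi i x*dd v (W i) x)"
 and B: "0 <= B" "!!s q i k. 0 <= s ==> s <= 1 ==> q:ccube r ==> r/2 <= norm (pr q) ==> i:I ==> k:I ==>
 cmod (dd (1,0) (W i) (s,q)*cof (%i k. dd (0,k) (W i) (s,q)) i k*G (s,q)) <= B"
shows "cmod (slint W G 1 - slint W G 0)
 <= real DIM('e)^2*(B*C)*measure lborel (ccube r :: 'e set)"
unfolding ccube_def
proof(rule deformation[where U = "{-1<..<2}" and S = "cube (2*r)" and K = "ccube (3*r/4)" and Gi = "%i. if i:I then Gi i else (%_. 0)"])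
let ?U = "{-1<..<2} \<times> cube (2*r) :: (real \<times> 'e) set"
have oU: "open ?U" by(intro open_Times open_cube) auto
have Wb': "dd v (W b) x = of_real (snd v <.> b)" if "b:Basis" "b~:I" for b v x
 unfolding Wb[OF that] by(rule dd_eq) (auto intro!: derivative_eq_intros)
show "Cinf_on ?U (W i)" if "i:Basis" for i
 using W[of i] Wb[OF that]
 by(cases "i:I") (auto intro!: Cinf_linear bounded_linear_compose[OF bounded_linear_of_real
 bounded_linear_compose[OF bounded_linear_inner_left bounded_linear_snd]])
show "continuous_on ?U (if i:I then Gi i else (%_. 0))" for i using Gi by auto
show "dd v G x = (SUM i:Basis. (if i:I then Gi i else (%_. 0)) x*dd v (W i) x)" if "x:?U" for x v
 unfolding dG[OF that] using I by(intro sum.mono_neutral_cong_left) auto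
fix s :: real and q assume s: "0 <= s" "s <= 1" and "q:cbox (- r *R One) (r *R One :: 'e)"
hence q: "q:ccube r" by(simp add:ccube_def)
have "cmod (dd (1,0) (W i) (s,q)*cof (%i k. dd (0,k) (W i) (s,q)) i k*G (s,q)*dd k fic q) <= B*C"
 if ik: "i:Basis" "k:Basis" for i k
proof -
 have "i~:I | (i:I & k~:I) | (k:I & norm (pr q) < r/2) | (i:I & k:I & r/2 <= norm (pr q))" by linarith
 thus ?thesis
 proof(elim disjE)
 assume "i:I & k~:I"
 hence "cof (%i k. dd (0,k) (W i) (s,q)) i k = 0"
  by(intro cof_unit_row) (use ik in "auto simp: Wb' inner_Basis")
 thus ?thesis using B(1) C(1) by simp
 next
 assume "i:I & k:I & r/2 <= norm (pr q)"
 thus ?thesis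
  by(subst norm_mult, intro mult_mono B(2)[OF s q] C(2)[OF ik(2) q]) (use B(1) in auto)
 qed (use B(1) C(1) Wb' ik dd_fi_0 in auto)
qed
hence "cmod (SUM i:Basis. SUM k:Basis. dd (1,0) (W i) (s,q)*cof (%i k. dd (0,k) (W i) (s,q)) i k*G (s,q)*dd k fic q)
 <= (SUM i:(Basis::'e set). SUM k:(Basis::'e set). B*C)"
 by(intro sum_norm_le)
thus "cmod (SUM i:Basis. SUM k:Basis. dd (1,0) (W i) (s,q)*cof (%i k. dd (0,k) (W i) (s,q)) i k*G (s,q)*dd k fic q)
 <= real DIM('e)^2*(B*C)" by(simp add:power2_eq_square)
next
show "closed (ccube (3*r/4) :: 'e set)" by(rule compact_imp_closed[OF compact_ccube])
show "ccube (3*r/4) <= cbox (- r *R One) (r *R One :: 'e)"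
 unfolding ccube_def[symmetric] using r by(intro ccube_mono) auto
show "cbox (- r *R One) (r *R One :: 'e) <= cube (2*r)"
 unfolding ccube_def[symmetric] by(rule ccube_cube)
qed (use G B(1) C(1) fi_0 in "auto intro: open_cube Cinf_fic")

end

section \<open>Solutions, their coefficients and their approximants\<close>

context slice_coordinates
begin

interpretation pr: bounded_linear pr by(rule bounded_linear_pr)

text \<open>Cramer's rule for the coefficients of the differential of \<open>f\<close> with respect
  to the differentials of the \<open>Z i\<close>.\<close>

definition grad :: "'e => ('e => complex) => 'e => complex" where
"grad i f q = (SUM k:Basis. cof (tmat I Z q) i k*dd (if k:I then k else 0) f q)/J q"

text \<open>The equation is imposed in every direction, including those outside \<open>I\<close>.
  This is how the tangential Cauchy-Riemann equations enter the approximation.\<close>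

definition sol :: "('e => complex) => bool" where
"sol f \<longleftrightarrow> Cinf_on (cube (2*r)) f & (ALL q:cube (2*r). ALL v. dd v f q = (SUM i:I. grad i f q*dd v (Z i) q))"

definition kint :: "nat => ('e => complex) => ('e => complex) => complex" where
"kint nu u z = integral (ccube r) (%q. u q*kern nu z (%i. Z i (pr q)))"

text \<open>Only the slice through the origin enters, so that this is one entire function of the
  values \<open>z\<close>, whatever the point at which these are taken.\<close>

definition approx :: "nat => ('e => complex) => ('e => complex) => complex" where
"approx nu f z = kint nu (%q. fic q*(f (pr q)*J (pr q))) z/of_real (cn nu)"

lemma Cinf_tmat: "Cinf_on (cube (2*r)) (%q. tmat I Z q i k)"
by(cases "i:I") (auto simp:tmat_def intro!: Cinf_dd Z)

lemma Cinf_J: "Cinf_on (cube (2*r)) (%q. J q)" by(intro Cinf_jac open_cube Cinf_tmat)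

lemma Cinf_grad: "Cinf_on (cube (2*r)) f ==> Cinf_on (cube (2*r)) (grad i f)"
unfolding grad_def using jac0
by(intro Cinf_divide Cinf_sum Cinf_mult Cinf_cof Cinf_dd Cinf_J Cinf_tmat open_cube) auto

lemma grad_Z:
assumes "i:I" "l:I" "q:cube (2*r)"
shows "grad i (Z l) q = (if l = i then 1 else 0)"
proof -
have "(SUM k:Basis. cof (tmat I Z q) i k*dd (if k:I then k else 0) (Z l) q) = (SUM k:Basis. cof (tmat I Z q) i k*tmat I Z q l k)"
 using assms by(simp add:tmat_def)
also have "... = (if l = i then J q else 0)" by(rule cof_row) (use assms I in auto)
finally show ?thesis using jac0[OF assms(3)] by(simp add:grad_def)
qed

text \<open>Differentiating \<open>df = \<Sum> f\<^sub>i dZ\<^sub>i\<close> once more gives \<open>\<Sum> df\<^sub>i \<and> dZ\<^sub>i = 0\<close>, so that each \<open>df\<^sub>i\<close> is again a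
combination of the \<open>dZ\<^sub>i\<close>.\<close>

lemma sol_grad:
assumes f: "sol f" and l: "l:I"
shows "sol (grad l f)"
proof -
have S: "Cinf_on (cube (2*r)) f" and df: "!!q v. q:cube (2*r) ==> dd v f q = (SUM i:I. grad i f q*dd v (Z i) q)"
 using f by(auto simp:sol_def)
note G = Cinf_grad[OF S]
have "dd v (grad l f) q = (SUM i:I. grad i (grad l f) q*dd v (Z i) q)" if q: "q:cube (2*r)" for q v
proof -
 define m where "m k = cof (tmat I Z q) l k/J q" for k
 define e :: "'e => 'e" where "e k = (if k:I then k else 0)" for k
 have grad_m: "grad l g q = (SUM k:Basis. m k*dd (e k) g q)" for g
 by(simp add:grad_def m_def e_def sum_divide_distrib)
 have dd2: "dd u (dd v f) q = (SUM i:I. grad i f q*dd u (dd v (Z i)) q + dd u (grad i f) q*dd v (Z i) q)" for u v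
 proof -
 have "dd u (dd v f) q = dd u (%q. SUM i:I. grad i f q*dd v (Z i) q) q"
  by(rule dd_cong[OF open_cube q df])
 also have "... = (SUM i:I. grad i f q*dd u (dd v (Z i)) q + dd u (grad i f) q*dd v (Z i) q)"
  by(rule dd_eq) (intro has_derivative_sum has_derivative_mult Cinf_deriv[OF G q]
  Cinf_deriv[OF Cinf_dd[OF Z] q], assumption)
 finally show ?thesis .
 qed
 have sym: "dd u (dd v g) q = dd v (dd u g) q" if "Cinf_on (cube (2*r)) g" for u v and g :: "'e => complex"
 by(rule dd_commute[OF open_cube q]) (use that in "simp add: Cinf_on_def")
 have swap: "(SUM i:I. dd u (grad i f) q*dd v (Z i) q) = (SUM i:I. dd v (grad i f) q*dd u (Z i) q)" for u v
 using dd2[of u v] dd2[of v u] sym[OF S, of u v] by(simp add:sum.distrib sym[OF Z] cong: sum.cong)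
 have A: "dd v (grad l f) q = (SUM i:I. grad l (grad i f) q*dd v (Z i) q)" for v
 proof -
 have "(SUM k:Basis. m k*(SUM i:I. dd (e k) (grad i f) q*dd v (Z i) q)) =
 (SUM k:Basis. m k*(SUM i:I. dd v (grad i f) q*dd (e k) (Z i) q))" by(simp only: swap)
 moreover have "(SUM k:Basis. m k*(SUM i:I. dd (e k) (grad i f) q*dd v (Z i) q)) = (SUM i:I. grad l (grad i f) q*dd v (Z i) q)"
 unfolding sum_distrib_left grad_m sum_distrib_right by(subst sum.swap) (simp add:mult_ac)
 moreover have "(SUM k:Basis. m k*(SUM i:I. dd v (grad i f) q*dd (e k) (Z i) q)) = (SUM i:I. dd v (grad i f) q*grad l (Z i) q)"
 unfolding sum_distrib_left grad_m by(subst sum.swap) (simp add:mult_ac)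
 moreover have "(SUM i:I. dd v (grad i f) q*grad l (Z i) q) = dd v (grad l f) q"
 using l finI by(simp add:grad_Z[OF l _ q] if_distrib[of "%x. _*x"] cong: if_cong sum.cong)
 ultimately show ?thesis by simp
 qed
 have "grad i (grad l f) q = grad l (grad i f) q" if i: "i:I" for i
 proof -
 have "grad i (grad l f) q = (SUM j:I. grad l (grad j f) q*grad i (Z j) q)"
  unfolding grad_def[of i] A sum_divide_distrib[symmetric] sum_distrib_left times_divide_eq_right
  by(subst sum.swap) (simp add:sum_distrib_left mult_ac)
 thus ?thesis using i finI by(simp add:grad_Z[OF i _ q] if_distrib[of "%x. _*x"] cong: if_cong sum.cong)
 qed
 thus ?thesis using A by simp
qed
thus ?thesis using G by(simp add:sol_def)
qed

lemma continuous_pr_comp: "continuous_on (cube (2*r)) g ==> continuous_on (ccube r) (%q. g (pr q))"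
using shift_ccube[of 0 _ 0] ccube_cube r
by(intro continuous_on_compose2[OF _ continuous_pr]) (auto simp:pr.zero image_subset_iff)

lemma cof_I: "i:I ==> k:Basis ==> k~:I ==> cof (tmat I Z q) i k = 0"
by(rule cof_unit_row) (use I in "auto simp: tmat_def")

lemma dd_W:
assumes "g differentiable (at (pr (snd x) + fst x *R T))"
shows "dd v (%x. g (pr (snd x) + fst x *R T)) x = dd (pr (snd v) + fst v *R T) g (pr (snd x) + fst x *R T)"
by(rule dd_chain[where f = "%x. pr (snd x) + fst x *R T" and f' = "%v. pr (snd v) + fst v *R T", OF _ assms])
 (auto intro!: derivative_eq_intros pr.has_derivative)

lemma Cinf_W:
assumes "pr T = 0" "norm T < r/2" "Cinf_on (cube (2*r)) g"
shows "Cinf_on ({-1<..<2} \<times> cube (2*r)) (%x. g (pr (snd x) + fst x *R T))"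
proof(rule Cinf_compose[OF _ open_cube _ _ assms(3)])
show "(%x. pr (snd x) + fst x *R T) ` ({-1<..<2} \<times> cube (2*r)) <= cube (2*r)"
 using shift_cube[OF assms(1,2)] by auto
have "bounded_linear (%x::real \<times> 'e. pr (snd x) + fst x *R T)"
 by(intro bounded_linear_add bounded_linear_compose[OF bounded_linear_pr bounded_linear_snd]
 bounded_linear_compose[OF bounded_linear_scaleR_left bounded_linear_fst])
thus "Cinf_on ({-1<..<2} \<times> cube (2*r)) (%x. pr (snd x) + fst x *R T)" by(rule Cinf_linear)
qed (auto intro: open_Times open_cube)

lemma dd_kern:
assumes "!!i. i:I ==> w i differentiable (at x)"
shows "dd v (%x. kern nu z (%i. w i x)) x = (SUM i:I. kern nu z (%i. w i x)*(2 * of_nat nu*(z i - w i x))*dd v (w i) x)"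
proof -
have "((%x. kern nu z (%i. w i x)) has_derivative
 (%h. kern nu z (%i. w i x)*(SUM i:I. - (2 * of_nat nu)*(z i - w i x)*(0 - dd h (w i) x)))) (at x)"
 by(rule has_derivative_kern[where z = "%i x. z i"]) (intro has_derivative_diff has_derivative_const has_derivative_dd assms)
from dd_eq[OF this, of v] show ?thesis by(simp add:sum_distrib_left mult_ac)
qed

text \<open>One radius serves all solutions \<open>f\<close>: derivatives of all orders lead to
  iterated \<open>grad\<close>s, whose approximants must converge on the same ball. The bound
  \<open>de0/2\<close> accounts for \<open>norm (p - pr p) <= 2 * norm p\<close>.\<close>

definition radius :: "real => bool" where
"radius de \<longleftrightarrow> 0 < de & (EX de0. de <= de0/2 & 0 < de0 & de0 <= r/4 &
 (ALL i:I. ALL p. norm p < de --> cmod (Z i p - Z i 0) < de0) &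
 (ALL nu z T q. norm T < de0 --> pr T = 0 --> (ALL i:I. cmod (z i - Z i 0) < de0) -->
 q:ccube r --> r/2 <= norm (pr q) --> kern_small nu z T q))"

lemma radius_exists: "EX de. radius de"
proof -
obtain de0 where de0: "0 < de0" "de0 <= r/4" and far: "!!nu z T q. norm T < de0 ==> pr T = 0 ==> (ALL i:I. cmod (z i - Z i 0) < de0) ==>
 q:ccube r ==> r/2 <= norm (pr q) ==> kern_small nu z T q"
 by(rule kern_far) blast
obtain de where de: "0 < de" "de <= de0/2" "!!i p. i:I ==> norm p < de ==> cmod (Z i p - Z i 0) < de0"
proof -
 have "EX d>0. ALL p. norm p < d --> cmod (Z i p - Z i 0) < de0" if "i:I" for i
 proof -
 have "0:cube (2*r)" using r by(simp add:cube_def)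
 hence "continuous (at 0) (Z i)"
  using Cinf_cont[OF Z[OF that]] continuous_on_eq_continuous_at[OF open_cube] by blast
 hence "EX d>0. ALL p. dist p 0 < d --> dist (Z i p) (Z i 0) < de0" using de0 unfolding continuous_at_eps_delta by blast
 thus ?thesis by(simp add:dist_norm)
 qed
 then obtain d where d: "!!i. i:I ==> 0 < d i" "!!i p. i:I ==> norm p < d i ==> cmod (Z i p - Z i 0) < de0" by metis
 have fin: "finite (insert (de0/2) (d ` I))" using finI by simp
 show ?thesis
 proof(rule that[of "Min (insert (de0/2) (d ` I))"])
 show "0 < Min (insert (de0/2) (d ` I))" unfolding Min_gr_iff[OF fin insert_not_empty] using de0 d(1) by auto
 show "Min (insert (de0/2) (d ` I)) <= de0/2" by(rule Min_le[OF fin]) simp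
 fix i p :: 'e assume i: "i:I" and p: "norm p < Min (insert (de0/2) (d ` I))"
 have "Min (insert (de0/2) (d ` I)) <= d i" by(rule Min_le[OF fin]) (use i in simp)
 thus "cmod (Z i p - Z i 0) < de0" using p d(2)[OF i, of p] by linarith
 qed
qed
have "radius de" unfolding radius_def using de de0 far by(intro conjI exI[of _ de0]) auto
thus ?thesis ..
qed

text \<open>Two deformations of slices. One moves the slice through the origin to that through
  \<open>p\<close>, with \<open>f\<close> times the kernel as amplitude; the other joins a flat
  model slice to the slice through \<open>p\<close>, with the kernel alone, and yields the
  normalisation. Both cost a multiple of \<open>tail nu\<close> that does not depend on
  \<open>p\<close>.\<close>

lemma approx_bound:
assumes f: "sol f" and rad: "radius de"
shows "EX A. de <= r/4 & 0 <= A & (ALL p. norm p < de --> (ALL nu.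
 cmod (kint nu (%q. fic q*(f (pr q)*J (pr q))) (%i. Z i p) -
  integral (ccube r) (%q. fic q*(f (pr q + (p - pr p))*kern nu (%i. Z i p) (%i. Z i (pr q + (p - pr p))))*J (pr q + (p - pr p))))
 <= A*tail nu &
 cmod (integral (ccube r) (%q. fic q*kern nu (%i. Z i p) (%i. Z i (pr q + (p - pr p)))*J (pr q + (p - pr p))) - of_real (cn nu))
 <= A*tail nu))"
proof -
have S: "Cinf_on (cube (2*r)) f" and df: "!!q v. q:cube (2*r) ==> dd v f q = (SUM i:I. grad i f q*dd v (Z i) q)"
 using f by(auto simp:sol_def)
let ?K = "ccube (3*r/2) :: 'e set" and ?U = "{-1<..<2} \<times> cube (2*r) :: (real \<times> 'e) set"
define tt where "tt x i k = (if i:I then (1 - of_real (fst x)) * of_real (k <.> i) + of_real (fst x)*tmat I Z (snd x) i k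
 else tmat I Z (snd x) i k)" for x and i k :: 'e
have cK: "continuous_on ?K g" if "Cinf_on (cube (2*r)) g" for g :: "'e => complex"
 using continuous_on_subset[OF Cinf_cont[OF that] ccube_cube(1)] .
have cfi: "continuous_on (ccube r) (dd k fic)" for k
 using continuous_on_subset[OF Cinf_cont[OF Cinf_dd[OF Cinf_fic]]] by blast
have ct: "continuous_on ({0..1} \<times> ?K) (%x. tmat I Z (snd x) i k)" for i k
 by(rule continuous_on_compose2[OF cK[OF Cinf_tmat]]) (auto intro!: continuous_intros)
have ctt: "continuous_on ({0..1} \<times> ?K) (%x. cof (tt x) (fst ik) (snd ik))" for ik
proof(rule continuous_on_cof)
 show "continuous_on ({0..1} \<times> ?K) (%x. tt x i j)" for i j
 unfolding tt_def by(cases "i:I") (simp_all add:continuous_intros ct)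
qed
obtain C1 where C1: "0 <= C1" "ALL k:Basis. ALL q:ccube r. cmod (dd k fic q) <= C1"
 by(rule finite_family_bound[OF finite_Basis compact_ccube cfi])
obtain C2 where C2: "0 <= C2" "ALL i:I. ALL q:?K. cmod (Z i q) <= C2"
 by(rule finite_family_bound[OF finI compact_ccube cK[OF Z]])
obtain C3 where C3: "0 <= C3" "ALL ib:I \<times> Basis. ALL q:?K. cmod (dd (snd ib) (Z (fst ib)) q) <= C3"
proof(rule finite_family_bound[of "I \<times> Basis" "?K" "%ib. dd (snd ib) (Z (fst ib))"])
 show "continuous_on ?K (dd (snd ib) (Z (fst ib)))" if "ib:I \<times> Basis" for ib
 by(rule cK[OF Cinf_dd[OF Z]]) (use that in auto)
qed (use finI compact_ccube in auto)
obtain C4 where C4: "0 <= C4" "ALL ik:I \<times> I. ALL x:{0..1} \<times> ?K. cmod (cof (tt x) (fst ik) (snd ik)) <= C4"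
 by(rule finite_family_bound[of "I \<times> I", OF finite_cartesian_product[OF finI finI] compact_Times[OF compact_Icc compact_ccube] ctt])
obtain C5 where C5: "0 <= C5" "ALL i:{0::nat}. ALL q:?K. cmod (f q) <= C5"
 by(rule finite_family_bound[of "{0::nat}", OF _ compact_ccube cK[OF S]]) auto
obtain de0 where de0: "0 < de0" "de0 <= r/4" and de: "0 < de" "de <= de0/2" "!!i p. i:I ==> norm p < de ==> cmod (Z i p - Z i 0) < de0"
 and far: "!!nu z T q. norm T < de0 ==> pr T = 0 ==> (ALL i:I. cmod (z i - Z i 0) < de0) ==>
 q:ccube r ==> r/2 <= norm (pr q) ==> kern_small nu z T q"
 using rad unfolding radius_def by(elim conjE exE) blast
define V where "V = real DIM('e)^2*measure lborel (ccube r :: 'e set)*C1"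
define A where "A = V*(real DIM('e)*r*C3*C4*C5) + V*((2*C2 + r)*C4)"
have V0: "0 <= V" unfolding V_def using C1(1) by simp
have A12: "V*(real DIM('e)*r*C3*C4*C5) <= A" "V*((2*C2 + r)*C4) <= A" "0 <= A"
 unfolding A_def using V0 C2(1) C3(1) C4(1) C5(1) r by(auto intro!: add_nonneg_nonneg mult_nonneg_nonneg)
show ?thesis
proof(rule exI[of _ A], intro conjI allI impI)
 show "0 <= A" by(rule A12(3))
 show "de <= r/4" using de(1,2) de0 by linarith
 fix p :: 'e and nu assume p: "norm p < de"
 define T z E where "T = p - pr p" and "z = (%i. Z i p)" and "E = tail nu"
 have "norm T <= norm p + norm (pr p)" unfolding T_def by(rule norm_triangle_ineq4)
 hence T: "norm T < de0" "pr T = 0" "norm T < r/2" using p de(2) de0 norm_pr_le[of p] r by(auto simp:T_def pr.diff pr_pr)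
 have z: "ALL i:I. cmod (z i - Z i 0) < de0" using de(3) p by(auto simp:z_def)
 have pK: "p:?K" unfolding mem_ccube
 proof
 fix b :: 'e assume "b:Basis"
 thus "\<bar>p <.> b\<bar> <= 3*r/2" using Basis_le_norm[of b p] p de de0 r by linarith
 qed
 have zC: "cmod (z i) <= C2" if "i:I" for i using C2(2) that pK by(simp add:z_def)
 have inK: "pr q + s *R T:?K" if "q:ccube r" "0 <= s" "s <= 1" for s q by(rule shift_ccube[OF T(2,3) that])
 have inK1: "pr q + T:?K" if "q:ccube r" for q using inK[OF that, of 1] by simp
 have inU: "pr q + s *R T:cube (2*r)" if "(s,q):?U" for s q using shift_cube[OF T(2,3)] that by auto
 have inU1: "pr q + T:cube (2*r)" if "(s,q):?U" for s q using shift_cube[OF T(2,3), of q 1] that by auto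
 have dZd: "Z i differentiable (at q)" if "i:I" "q:cube (2*r)" for i q by(rule Cinf_differentiable[OF Z[OF that(1)] that(2)])
 have oU: "open ?U" by(intro open_Times open_cube) auto
 have ccr: "ccube r <= cube (2*r)" by(rule ccube_cube)
 show "cmod (kint nu (%q. fic q*(f (pr q)*J (pr q))) (%i. Z i p) -
  integral (ccube r) (%q. fic q*(f (pr q + (p - pr p))*kern nu (%i. Z i p) (%i. Z i (pr q + (p - pr p))))*J (pr q + (p - pr p))))
 <= A*tail nu"
 proof -
 \<comment> \<open>At \<open>s = 0\<close> the slice through the origin, at \<open>s = 1\<close> the
   slice through \<open>p\<close>, since \<open>pr p + T = p\<close>.\<close>
 define W where "W i x = (if i:I then Z i (pr (snd x) + fst x *R T) else of_real (snd x <.> i))" for i x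
 define g where "g q = f q*kern nu z (%i. Z i q)" for q
 define G where "G x = g (pr (snd x) + fst x *R T)" for x
 define gi where "gi i q = grad i f q*kern nu z (%i. Z i q) + f q*(kern nu z (%i. Z i q)*(2 * of_nat nu*(z i - Z i q)))" for i q
 have g: "Cinf_on (cube (2*r)) g" unfolding g_def
  by(intro Cinf_mult S open_cube Cinf_kern Z Cinf_const)
 have gi: "Cinf_on (cube (2*r)) (gi i)" if "i:I" for i unfolding gi_def
  by(intro Cinf_add Cinf_mult S open_cube Cinf_kern Z Cinf_const Cinf_grad Cinf_diff that)
 have WI: "W i = (%x. Z i (pr (snd x) + fst x *R T))" if "i:I" for i using that by(simp add:W_def fun_eq_iff)
 have ddW: "dd v (W i) x = dd (pr (snd v) + fst v *R T) (Z i) (pr (snd x) + fst x *R T)" if "i:I" "x:?U" for i x v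
  unfolding WI[OF that(1)] by(rule dd_W[OF dZd[OF that(1)]]) (use inU[of "fst x" "snd x"] that in simp)
 have ttW: "dd (0,k) (W i) (s,q) = tmat I Z (pr q + s *R T) i k"
  if "i:Basis" "k:Basis" "(s,q):?U" for i k s q
 proof(cases "i:I")
  case True thus ?thesis using ddW[OF True that(3)] by(simp add:tmat_alt that)
 next
  case False
  hence "W i = (%x. of_real (snd x <.> i))" by(simp add:W_def fun_eq_iff)
  moreover have "dd (0,k) (%x::real \<times> 'e. cor (snd x <.> i)) (s,q) = of_real (k <.> i)"
  by(rule dd_eq[where f' = "%v. of_real (snd v <.> i)", THEN trans]) (auto intro!: derivative_eq_intros)
  ultimately show ?thesis using False that by(simp add:tmat_def inner_Basis)
 qed
 have "cmod (slint W G 1 - slint W G 0)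
  <= real DIM('e)^2*((real DIM('e)*r*C3*C4*(C5*E))*C1)*measure lborel (ccube r :: 'e set)"
 proof(rule slice_deform[where Gi = "%i x. gi i (pr (snd x) + fst x *R T)"])
  show "Cinf_on ?U (W i)" if "i:I" for i unfolding WI[OF that] by(rule Cinf_W[OF T(2,3) Z[OF that]])
  show "Cinf_on ?U G" unfolding G_def by(rule Cinf_W[OF T(2,3) g])
  show "W b = (%x. of_real (snd x <.> b))" if "b~:I" for b using that by(simp add:W_def fun_eq_iff)
  show "continuous_on ?U (%x. gi i (pr (snd x) + fst x *R T))" if "i:I" for i
  by(rule Cinf_cont[OF Cinf_W[OF T(2,3) gi[OF that]]])
  show "dd v G x = (SUM i:I. gi i (pr (snd x) + fst x *R T)*dd v (W i) x)" if x: "x:?U" for x v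
  proof -
  let ?q = "pr (snd x) + fst x *R T" and ?v = "pr (snd v) + fst v *R T"
  have q: "?q:cube (2*r)" using inU[of "fst x" "snd x"] x by simp
  have "dd v G x = dd ?v g ?q" unfolding G_def by(rule dd_W[OF Cinf_differentiable[OF g q]])
  also have "... = f ?q*dd ?v (%q. kern nu z (%i. Z i q)) ?q + dd ?v f ?q*kern nu z (%i. Z i ?q)"
   unfolding g_def by(rule dd_eq) (intro has_derivative_mult Cinf_deriv[OF S q]
   Cinf_deriv[OF Cinf_kern[OF open_cube Cinf_const Z] q])
  also have "dd ?v (%q. kern nu z (%i. Z i q)) ?q =
   (SUM i:I. kern nu z (%i. Z i ?q)*(2 * of_nat nu*(z i - Z i ?q))*dd ?v (Z i) ?q)"
   by(rule dd_kern[where w = Z, OF dZd[OF _ q]])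
  also have "f ?q*... + dd ?v f ?q*kern nu z (%i. Z i ?q) = (SUM i:I. gi i ?q*dd ?v (Z i) ?q)"
   unfolding df[OF q] gi_def sum_distrib_left sum_distrib_right sum.distrib[symmetric]
   by(rule sum.cong[OF refl]) (simp add:algebra_simps)
  finally show ?thesis using ddW[OF _ x] by simp
  qed
  show "0 <= real DIM('e)*r*C3*C4*(C5*E)" using C3(1) C4(1) C5(1) r by(simp add:E_def)
  fix s :: real and q i k :: 'e assume s: "0 <= s" "s <= 1" and q: "q:ccube r" "r/2 <= norm (pr q)" and ik: "i:I" "k:I"
  let ?q = "pr q + s *R T"
  have x: "(s,q):?U" using s q ccr by auto
  have qK: "?q:?K" by(rule inK[OF q(1) s])
  have qc: "?q:cube (2*r)" by(rule inU[OF x])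
  have "cmod (dd T (Z i) ?q) <= (SUM b:(Basis :: 'e set). r*C3)"
  unfolding dd_combination[OF dZd[OF ik(1) qc], of T]
  proof(rule sum_norm_le)
  fix b :: 'e assume b: "b:Basis"
  have "\<bar>T <.> b\<bar> <= r" using Basis_le_norm[OF b, of T] T(3) r by linarith
  thus "cmod (of_real (T <.> b)*dd b (Z i) ?q) <= r*C3"
   unfolding norm_mult norm_of_real using C3(2) ik b qK r by(intro mult_mono) auto
  qed
  hence 1: "cmod (dd (1,0) (W i) (s,q)) <= real DIM('e)*r*C3"
  using ddW[OF ik(1) x, of "(1,0)"] by(simp add:pr.zero)
  have "cof (%i k. dd (0,k) (W i) (s,q)) i k = cof (tt (1, ?q)) i k"
  by(rule cof_cong) (simp add:ttW[OF _ _ x] tt_def)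
  hence 2: "cmod (cof (%i k. dd (0,k) (W i) (s,q)) i k) <= C4"
  using C4(2) ik qK by fastforce
  have "norm (s *R T) <= norm T" using s mult_right_mono[of s 1 "norm T"] by simp
  hence "cmod (kern nu z (%i. Z i ?q)) <= E"
  using far[of "s *R T" z q nu] T z q by(simp add:pr.scaleR E_def)
  hence 3: "cmod (G (s,q)) <= C5*E"
  unfolding G_def g_def norm_mult using C5 qK by(intro mult_mono) auto
  show "cmod (dd (1,0) (W i) (s,q)*cof (%i k. dd (0,k) (W i) (s,q)) i k*G (s,q)) <= real DIM('e)*r*C3*C4*(C5*E)"
  unfolding norm_mult by(intro mult_mono 1 2 3 mult_nonneg_nonneg) (use C3(1) C4(1) r in auto)
 qed (use C1 in auto)
 moreover have "slint W G s =
  integral (ccube r) (%q. fic q*(f (pr q + s *R T)*kern nu z (%i. Z i (pr q + s *R T)))*J (pr q + s *R T))"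
  if "0 <= s" "s <= 1" for s
  unfolding slice_integral_def ccube_def[symmetric]
 proof(rule integral_cong)
  fix q :: 'e assume q: "q:ccube r"
  have xU: "(s,q):?U" using that q ccr by auto
  have "jac (%i k. dd (0,k) (W i) (s,q)) = J (pr q + s *R T)"
  by(rule jac_cong) (rule ttW[OF _ _ xU])
  thus "fic q*G (s,q)*jac (%i k. dd (0,k) (W i) (s,q)) =
  fic q*(f (pr q + s *R T)*kern nu z (%i. Z i (pr q + s *R T)))*J (pr q + s *R T)"
  by(simp add:G_def g_def)
 qed
 ultimately have "cmod (integral (ccube r) (%q. fic q*(f (pr q + T)*kern nu z (%i. Z i (pr q + T)))*J (pr q + T)) -
  kint nu (%q. fic q*(f (pr q)*J (pr q))) z) <= V*(real DIM('e)*r*C3*C4*C5)*E"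
  by(simp add:kint_def V_def mult_ac)
 also have "... <= A*E" by(rule mult_right_mono[OF A12(1)]) (simp add:E_def)
 finally show ?thesis by(simp add:norm_minus_commute T_def z_def E_def)
 qed
 show "cmod (integral (ccube r) (%q. fic q*kern nu (%i. Z i p) (%i. Z i (pr q + (p - pr p)))*J (pr q + (p - pr p))) - of_real (cn nu))
 <= A*tail nu"
 proof -
 \<comment> \<open>At \<open>s = 0\<close> an affine slice, on which the kernel is the real Gaussian
   \<open>exp (- nu * norm (pr q)^2)\<close> and the Jacobian is 1, so that the integral is
   \<open>cn nu\<close>.\<close>
 define W where "W i x = (if i:I then (1 - of_real (fst x))*(z i + of_real (snd x <.> i)) + of_real (fst x)*Z i (pr (snd x) + T)
  else of_real (snd x <.> i))" for i x
 define G where "G x = kern nu z (%i. W i x)" for x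
 have WI: "W i = (%x. (1 - of_real (fst x))*(z i + of_real (snd x <.> i)) + of_real (fst x)*Z i (pr (snd x) + T))" if "i:I" for i
  using that by(simp add:W_def fun_eq_iff)
 have ZT: "Cinf_on ?U (%x. Z i (pr (snd x) + T))" if "i:I" for i
 proof(rule Cinf_compose[OF oU open_cube _ _ Z[OF that]])
  show "Cinf_on ?U (%x. pr (snd x) + T)"
  by(intro Cinf_add oU Cinf_const Cinf_linear bounded_linear_compose[OF bounded_linear_pr bounded_linear_snd])
 qed (use inU1 in auto)
 have W: "Cinf_on ?U (W i)" if "i:I" for i
  unfolding WI[OF that]
  by(intro Cinf_add Cinf_mult Cinf_diff Cinf_const Cinf_of_real ZT that oU
  Cinf_linear bounded_linear_fst bounded_linear_compose[OF bounded_linear_inner_left bounded_linear_snd])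
 have ddW: "dd v (W i) x = (1 - of_real (fst x)) * of_real (snd v <.> i) + of_real (fst x)*dd (pr (snd v)) (Z i) (pr (snd x) + T)
  + of_real (fst v)*(Z i (pr (snd x) + T) - (z i + of_real (snd x <.> i)))" if i: "i:I" and x: "x:?U" for i x v
 proof -
  have q: "pr (snd x) + T:cube (2*r)" using inU1[of "fst x" "snd x"] x by simp
  have "((%x. Z i (pr (snd x) + T)) has_derivative (%v. dd (pr (snd v)) (Z i) (pr (snd x) + T))) (at x)"
  proof -
  have "((%x. pr (snd x) + T) has_derivative (%v. pr (snd v))) (at x)"
   by(auto intro!: derivative_eq_intros pr.has_derivative)
  from diff_chain_at[OF this has_derivative_dd[OF dZd[OF i q]]] show ?thesis by(simp add:o_def)
  qed
  hence "(W i has_derivative (%v. ((1 - of_real (fst x)) * of_real (snd v <.> i) + (0 - of_real (fst v))*(z i + of_real (snd x <.> i))) +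
  (of_real (fst x)*dd (pr (snd v)) (Z i) (pr (snd x) + T) + of_real (fst v)*Z i (pr (snd x) + T)))) (at x)"
  unfolding WI[OF i]
  by(intro has_derivative_add has_derivative_mult) (auto intro!: derivative_eq_intros)
  from dd_eq[OF this, of v] show ?thesis by(simp add:algebra_simps)
 qed
 have ttW: "dd (0,k) (W i) (s,q) = tt (s, pr q + T) i k"
  if "i:Basis" "k:Basis" "(s,q):?U" for i k s q
 proof(cases "i:I")
  case True thus ?thesis using ddW[OF True that(3)] by(simp add:tt_def tmat_alt that)
 next
  case False
  hence "W i = (%x. of_real (snd x <.> i))" by(simp add:W_def fun_eq_iff)
  moreover have "dd (0,k) (%x::real \<times> 'e. cor (snd x <.> i)) (s,q) = of_real (k <.> i)"
  by(rule dd_eq[where f' = "%v. of_real (snd v <.> i)", THEN trans]) (auto intro!: derivative_eq_intros)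
  ultimately show ?thesis using False that by(simp add:tt_def tmat_def inner_Basis)
 qed
 have "cmod (slint W G 1 - slint W G 0)
  <= real DIM('e)^2*(((2*C2 + r)*C4*E)*C1)*measure lborel (ccube r :: 'e set)"
 proof(rule slice_deform[where Gi = "%i x. kern nu z (%i. W i x)*(2 * of_nat nu*(z i - W i x))"])
  show "W b = (%x. of_real (snd x <.> b))" if "b~:I" for b using that by(simp add:W_def fun_eq_iff)
  show "Cinf_on ?U G" unfolding G_def by(intro Cinf_kern oU W Cinf_const)
  show "continuous_on ?U (%x. kern nu z (%i. W i x)*(2 * of_nat nu*(z i - W i x)))" if "i:I" for i
  by(rule Cinf_cont) (intro Cinf_mult Cinf_kern oU W Cinf_const Cinf_diff that)
  show "dd v G x = (SUM i:I. kern nu z (%i. W i x)*(2 * of_nat nu*(z i - W i x))*dd v (W i) x)" if "x:?U" for x v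
  unfolding G_def by(rule dd_kern[OF Cinf_differentiable[OF W that]])
  show "0 <= (2*C2 + r)*C4*E" using C2(1) C4(1) r by(simp add:E_def)
  fix s :: real and q i k :: 'e assume s: "0 <= s" "s <= 1" and q: "q:ccube r" "r/2 <= norm (pr q)" and ik: "i:I" "k:I"
  have x: "(s,q):?U" using s q ccr by auto
  have "cmod (Z i (pr q + T)) <= C2" using C2(2) ik inK1[OF q(1)] by blast
  moreover have "\<bar>q <.> i\<bar> <= r" using q(1) ik I by(auto simp:mem_ccube)
  moreover have "cmod (Z i (pr q + T) - (z i + of_real (q <.> i))) <= cmod (Z i (pr q + T)) + (cmod (z i) + \<bar>q <.> i\<bar>)"
  using norm_triangle_ineq4[of "Z i (pr q + T)" "z i + of_real (q <.> i)"] norm_triangle_ineq[of "z i" "of_real (q <.> i)"] by simp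
  ultimately have 1: "cmod (dd (1,0) (W i) (s,q)) <= 2*C2 + r"
  using ddW[OF ik(1) x, of "(1,0)"] zC[OF ik(1)] dZd[OF ik(1) inU1[OF x]]
  by(simp add:pr.zero dd_combination[of _ _ 0])
  have "cof (%i k. dd (0,k) (W i) (s,q)) i k = cof (tt (s, pr q + T)) i k"
  by(rule cof_cong) (rule ttW[OF _ _ x])
  hence 2: "cmod (cof (%i k. dd (0,k) (W i) (s,q)) i k) <= C4"
  using C4(2) ik inK1[OF q(1)] s by fastforce
  have "kern nu z (%i. W i (s,q)) = kern nu z (%i. (1 - of_real s)*(z i + of_real (q <.> i)) + of_real s*Z i (pr q + T))"
  unfolding kern_def by(simp add:WI)
  hence 3: "cmod (G (s,q)) <= E"
  using far[OF T(1,2) z q, of nu] s by(auto simp:G_def E_def)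
  show "cmod (dd (1,0) (W i) (s,q)*cof (%i k. dd (0,k) (W i) (s,q)) i k*G (s,q)) <= (2*C2 + r)*C4*E"
  unfolding norm_mult by(intro mult_mono 1 2 3 mult_nonneg_nonneg) (use C2(1) C4(1) r in auto)
 qed (use C1 W in auto)
 moreover have "slint W G 1 =
  integral (ccube r) (%q. fic q*kern nu z (%i. Z i (pr q + T))*J (pr q + T))"
  unfolding slice_integral_def ccube_def[symmetric]
 proof(rule integral_cong)
  fix q :: 'e assume q: "q:ccube r"
  have xU: "(1,q):?U" using q ccr by auto
  have "jac (%i k. dd (0,k) (W i) (1,q)) = J (pr q + T)"
  by(rule jac_cong) (simp add:ttW[OF _ _ xU] tt_def)
  moreover have "G (1,q) = kern nu z (%i. Z i (pr q + T))" unfolding G_def kern_def by(simp add:WI)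
  ultimately show "fic q*G (1,q)*jac (%i k. dd (0,k) (W i) (1,q)) = fic q*kern nu z (%i. Z i (pr q + T))*J (pr q + T)"
  by simp
 qed
 moreover have "slint W G 0 = of_real (cn nu)"
 proof -
  have "slint W G 0 =
  integral (ccube r) (%q. of_real (fi q*exp (- real nu*norm (pr q)^2)))"
  unfolding slice_integral_def ccube_def[symmetric]
  proof(rule integral_cong)
  fix q :: 'e assume q: "q:ccube r"
  have xU: "(0,q):?U" using q ccr by auto
  have "jac (%i k. dd (0,k) (W i) (0,q)) = 1"
   by(rule jac_unit) (simp add:ttW[OF _ _ xU] tt_def tmat_def inner_Basis)
  moreover have "G (0,q) = of_real (exp (- real nu*norm (pr q)^2))"
   unfolding G_def kern_def norm_pr_sq by(simp add:WI exp_of_real[symmetric] sum_distrib_left)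
  ultimately show "fic q*G (0,q)*jac (%i k. dd (0,k) (W i) (0,q)) = of_real (fi q*exp (- real nu*norm (pr q)^2))"
   by simp
  qed
  also have "... = of_real (cn nu)" unfolding cn_def
  by(rule integral_linear[OF _ bounded_linear_of_real, unfolded o_def])
   (auto intro!: integrable_ccube continuous_intros continuous_fi continuous_pr)
  finally show ?thesis .
 qed
 ultimately have "cmod (integral (ccube r) (%q. fic q*kern nu z (%i. Z i (pr q + T))*J (pr q + T)) - of_real (cn nu))
  <= V*((2*C2 + r)*C4)*E"
  by(simp add:V_def mult_ac)
 also have "... <= A*E" by(rule mult_right_mono[OF A12(2)]) (simp add:E_def)
 finally show ?thesis by(simp add:T_def z_def E_def)
 qed
qed
qed

text \<open>After \<open>approx_bound\<close> there remains the integral of \<open>f - f p\<close>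
  against the kernel on the slice through \<open>p\<close>. Where
  \<open>norm (pr (q - p)) < h\<close> the difference is small and the Gaussian mass is at most a
  multiple of \<open>cn nu\<close>; elsewhere the kernel is exponentially small against
  \<open>cn nu\<close>.\<close>

lemma approx_converges:
assumes f: "sol f" and rad: "radius de" and ep: "0 < ep"
shows "\<forall>\<^sub>F nu in sequentially. ALL p. norm p < de --> cmod (approx nu f (%i. Z i p) - f p) < ep"
proof -
have A1: "0 < de" using rad by(simp add:radius_def)
obtain A where A0: "de <= r/4" "0 <= A" and bd: "ALL p. norm p < de --> (ALL nu.
 cmod (kint nu (%q. fic q*(f (pr q)*J (pr q))) (%i. Z i p) -
  integral (ccube r) (%q. fic q*(f (pr q + (p - pr p))*kern nu (%i. Z i p) (%i. Z i (pr q + (p - pr p))))*J (pr q + (p - pr p))))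
 <= A*tail nu &
 cmod (integral (ccube r) (%q. fic q*kern nu (%i. Z i p) (%i. Z i (pr q + (p - pr p)))*J (pr q + (p - pr p))) - of_real (cn nu))
 <= A*tail nu)"
 using approx_bound[OF f rad] by blast
note A = A1 A0
have S: "Cinf_on (cube (2*r)) f" using f by(simp add:sol_def)
let ?K = "ccube (3*r/2) :: 'e set"
have cK: "continuous_on ?K g" if "Cinf_on (cube (2*r)) g" for g :: "'e => complex"
 using continuous_on_subset[OF Cinf_cont[OF that] ccube_cube(1)] .
obtain Cf where Cf: "0 <= Cf" "ALL i:{0::nat}. ALL q:?K. cmod (f q) <= Cf"
 by(rule finite_family_bound[of "{0::nat}", OF _ compact_ccube cK[OF S]]) auto
obtain CJ where CJ: "0 <= CJ" "ALL i:{0::nat}. ALL q:?K. cmod (J q) <= CJ"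
 by(rule finite_family_bound[of "{0::nat}", OF _ compact_ccube cK[OF Cinf_J]]) auto
\<comment> \<open>Makes the main term \<open>CJ * ep' * 4^DIM('e)\<close> at most
  \<open>ep/2\<close>; the power of 4 is that of \<open>gaussian_le_cn\<close>.\<close>
define ep' where "ep' = ep/(2*((CJ + 1)*4^DIM('e)))"
have ep': "0 < ep'" using ep CJ(1) by(simp add:ep'_def)
obtain h where h: "0 < h" "!!x y. x:?K ==> y:?K ==> dist y x < h ==> dist (f y) (f x) < ep'"
 using compact_uniformly_continuous[OF cK[OF S] compact_ccube] ep' unfolding uniformly_continuous_on_def by metis
define Vq where "Vq = measure lborel (ccube r :: 'e set)"
define B where "B nu = (A*(1 + Cf))*(tail nu/cn nu) + (CJ*(2*Cf)*Vq)*(exp (- real nu*(h^2/4))/cn nu)" for nu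
have "B \<longlonglongrightarrow> (A*(1 + Cf))*0 + (CJ*(2*Cf)*Vq)*0"
 unfolding B_def by(intro tendsto_add tendsto_mult_left exp_over_cn) (use r h in auto)
hence "\<forall>\<^sub>F nu in sequentially. B nu < ep/2" using ep by(intro order_tendstoD(2)[of B 0]) auto
thus "\<forall>\<^sub>F nu in sequentially. ALL p. norm p < de --> cmod (approx nu f (%i. Z i p) - f p) < ep"
proof(rule eventually_mono, intro allI impI)
 fix nu and p :: 'e assume B: "B nu < ep/2" and p: "norm p < de"
 define T z where "T = p - pr p" and "z = (%i. Z i p)"
 define X Y E where "X = integral (ccube r) (%q. fic q*(f (pr q + T)*kern nu z (%i. Z i (pr q + T)))*J (pr q + T))"
 and "Y = integral (ccube r) (%q. fic q*kern nu z (%i. Z i (pr q + T))*J (pr q + T))"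
 and "E = tail nu"
 define S0 where "S0 = kint nu (%q. fic q*(f (pr q)*J (pr q))) z"
 have b1: "cmod (S0 - X) <= A*E" and b2: "cmod (Y - of_real (cn nu)) <= A*E"
 using bd p by(auto simp:S0_def X_def Y_def E_def T_def z_def)
 have "norm T <= norm p + norm (pr p)" unfolding T_def by(rule norm_triangle_ineq4)
 hence T: "pr T = 0" "norm T < r/2" using p A(2) norm_pr_le[of p] by(auto simp:T_def pr.diff pr_pr)
 have pK: "p:?K" unfolding mem_ccube
 proof
 fix b :: 'e assume "b:Basis"
 thus "\<bar>p <.> b\<bar> <= 3*r/2" using Basis_le_norm[of b p] p A r by linarith
 qed
 have inK: "pr q + T:?K" if "q:ccube r" for q using shift_ccube[OF T that, of 1] by simp
 have cc: "continuous_on (ccube r) (%q. g (pr q + T))" if "Cinf_on (cube (2*r)) g" for g :: "'e => complex"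
 by(rule continuous_on_compose2[OF cK[OF that]]) (use inK in "auto intro!: continuous_intros continuous_pr")
 have ck: "continuous_on (ccube r) (%q. kern nu z (%i. Z i (pr q + T)))"
 by(rule cc) (intro Cinf_kern open_cube Z Cinf_const)
 have cfi: "continuous_on (ccube r) fic" by(intro continuous_intros continuous_fi)
 have XY: "X - f p*Y = integral (ccube r) (%q. fic q*(f (pr q + T)*kern nu z (%i. Z i (pr q + T)))*J (pr q + T) -
  f p*(fic q*kern nu z (%i. Z i (pr q + T))*J (pr q + T)))"
 unfolding X_def Y_def integral_mult_right[symmetric]
 by(rule integral_diff[symmetric]; intro integrable_ccube continuous_intros cfi cc[OF S] cc[OF Cinf_J] ck)
 have "cmod (X - f p*Y) <= integral (ccube r) (%q. CJ*ep'*exp (- real nu*(norm (pr (q - p))^2/4)) + CJ*(2*Cf)*exp (- real nu*(h^2/4)))"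
 unfolding XY
 proof(rule integral_norm_bound_integral)
 fix q :: 'e assume q: "q:ccube r"
 have near: "cmod (kern nu z (%i. Z i (pr q + T))) <= exp (- real nu*(norm (pr (q - p))^2/4))"
  unfolding z_def by(rule kern_near[OF _ _ T_def]) (use inK[OF q] pK ccube_cube in auto)
 have key: "cmod (f (pr q + T) - f p)*cmod (kern nu z (%i. Z i (pr q + T))) <=
  ep'*exp (- real nu*(norm (pr (q - p))^2/4)) + (2*Cf)*exp (- real nu*(h^2/4))"
 proof(cases "norm (pr (q - p)) < h")
  case True
  have "pr q + T - p = pr (q - p)" by(simp add:T_def pr.diff)
  hence "cmod (f (pr q + T) - f p) < ep'" using h(2)[OF pK inK[OF q]] True by(simp add:dist_norm)
  hence "cmod (f (pr q + T) - f p)*cmod (kern nu z (%i. Z i (pr q + T))) <= ep'*exp (- real nu*(norm (pr (q - p))^2/4))"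
  by(intro mult_mono near) (use ep' in auto)
  moreover have "0 <= (2*Cf)*exp (- real nu*(h^2/4))" using Cf by simp
  ultimately show ?thesis by linarith
 next
  case False
  hence "h^2/4 <= norm (pr (q - p))^2/4" using h(1) by simp
  hence "exp (- real nu*(norm (pr (q - p))^2/4)) <= exp (- real nu*(h^2/4))"
  unfolding exp_le_cancel_iff by(intro mult_left_mono_neg) auto
  hence near': "cmod (kern nu z (%i. Z i (pr q + T))) <= exp (- real nu*(h^2/4))"
  using near by(rule order_trans[rotated])
  have "cmod (f (pr q + T)) <= Cf" "cmod (f p) <= Cf" using Cf(2) inK[OF q] pK by auto
  hence "cmod (f (pr q + T) - f p) <= 2*Cf" using norm_triangle_ineq4[of "f (pr q + T)" "f p"] by linarith
  hence "cmod (f (pr q + T) - f p)*cmod (kern nu z (%i. Z i (pr q + T))) <= (2*Cf)*exp (- real nu*(h^2/4))"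
  using Cf(1) by(intro mult_mono near') auto
  moreover have "0 <= ep'*exp (- real nu*(norm (pr (q - p))^2/4))" using ep' by simp
  ultimately show ?thesis by linarith
 qed
 have "cmod (fic q*(f (pr q + T)*kern nu z (%i. Z i (pr q + T)))*J (pr q + T) -
  f p*(fic q*kern nu z (%i. Z i (pr q + T))*J (pr q + T))) =
  cmod (fic q*((f (pr q + T) - f p)*kern nu z (%i. Z i (pr q + T)))*J (pr q + T))"
  by(simp add:algebra_simps)
 also have "... <= 1*(ep'*exp (- real nu*(norm (pr (q - p))^2/4)) + (2*Cf)*exp (- real nu*(h^2/4)))*CJ"
  unfolding norm_mult using key fi_range[of q] CJ inK[OF q] ep' Cf(1)
  by(intro mult_mono) auto
 finally show "cmod (fic q*(f (pr q + T)*kern nu z (%i. Z i (pr q + T)))*J (pr q + T) -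
  f p*(fic q*kern nu z (%i. Z i (pr q + T))*J (pr q + T))) <=
  CJ*ep'*exp (- real nu*(norm (pr (q - p))^2/4)) + CJ*(2*Cf)*exp (- real nu*(h^2/4))"
  by(simp add:algebra_simps)
 next
 show "(%q. CJ*ep'*exp (- real nu*(norm (pr (q - p))^2/4)) + CJ*(2*Cf)*exp (- real nu*(h^2/4))) integrable_on ccube r"
  by(intro integrable_ccube continuous_intros continuous_on_compose2[OF continuous_pr[of UNIV]]) auto
 qed (intro integrable_ccube continuous_intros cfi cc[OF S] cc[OF Cinf_J] ck)
 also have "... = CJ*ep'*integral (ccube r) (%q. exp (- real nu*(norm (pr (q - p))^2/4))) + CJ*(2*Cf)*exp (- real nu*(h^2/4))*Vq"
 proof -
 have c: "continuous_on (ccube r) (%q. CJ*ep'*exp (- real nu*(norm (pr (q - p))^2/4)))"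
  by(intro continuous_intros continuous_on_compose2[OF continuous_pr[of UNIV]]) auto
 have "integral (ccube r) (%q::'e. CJ*(2*Cf)*exp (- real nu*(h^2/4))) = CJ*(2*Cf)*exp (- real nu*(h^2/4))*Vq"
  unfolding Vq_def ccube_def integral_const by simp
 thus ?thesis by(subst integral_add[OF integrable_ccube[OF c] integrable_ccube[OF continuous_on_const]]) simp
 qed
 also have "... <= CJ*ep'*(4^DIM('e)*cn nu) + CJ*(2*Cf)*exp (- real nu*(h^2/4))*Vq"
 by(intro add_right_mono mult_left_mono gaussian_le_cn) (use p A r CJ(1) ep' in auto)
 finally have b3: "cmod (X - f p*Y) <= CJ*ep'*(4^DIM('e)*cn nu) + CJ*(2*Cf)*exp (- real nu*(h^2/4))*Vq" .
 have fp: "cmod (f p) <= Cf" using Cf(2) pK by simp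
 have "S0 - f p * of_real (cn nu) = (S0 - X) + (X - f p*Y) + f p*(Y - of_real (cn nu))" by(simp add:algebra_simps)
 hence "cmod (S0 - f p * of_real (cn nu)) <= cmod (S0 - X) + cmod (X - f p*Y) + cmod (f p)*cmod (Y - of_real (cn nu))"
 by(simp only: norm_mult[symmetric]) (rule order_trans[OF norm_triangle_ineq add_right_mono[OF norm_triangle_ineq]])
 also have "... <= A*E + (CJ*ep'*(4^DIM('e)*cn nu) + CJ*(2*Cf)*exp (- real nu*(h^2/4))*Vq) + Cf*(A*E)"
 by(intro add_mono b1 b3 mult_mono fp b2) (use Cf in auto)
 also have "... = (B nu + CJ*ep'*4^DIM('e))*cn nu"
 using cn_pos[of nu] by(simp add:B_def E_def field_simps)
 also have "... < ep*cn nu"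
 proof(rule mult_strict_right_mono[OF _ cn_pos])
 have "CJ*ep'*4^DIM('e) = (CJ/(CJ + 1))*(ep/2)" using CJ(1) by(simp add:ep'_def)
 also have "... <= 1*(ep/2)" using CJ(1) ep by(intro mult_right_mono) auto
 finally show "B nu + CJ*ep'*4^DIM('e) < ep" using B by linarith
 qed
 finally have fin: "cmod (S0 - f p * of_real (cn nu)) < ep*cn nu" .
 have "approx nu f (%i. Z i p) - f p = (S0 - f p * of_real (cn nu))/of_real (cn nu)"
 using cn_pos[of nu] by(simp add:approx_def S0_def z_def diff_divide_distrib)
 hence "cmod (approx nu f (%i. Z i p) - f p) = cmod (S0 - f p * of_real (cn nu))/cn nu"
 using cn_pos[of nu] by(simp add:norm_divide)
 thus "cmod (approx nu f (%i. Z i p) - f p) < ep" using fin cn_pos[of nu] by(simp add:pos_divide_less_eq)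
qed
qed

end

section \<open>Derivatives of the approximants\<close>

context slice_coordinates
begin

interpretation pr: bounded_linear pr by(rule bounded_linear_pr)

lemma pr_cube: "q:cube (2*r) ==> pr q:cube (2*r)"
using shift_cube[of 0 q 0] r by simp

lemma Cinf_pr_comp: "Cinf_on (cube (2*r)) g ==> Cinf_on (cube (2*r)) (%q. g (pr q))"
by(rule Cinf_compose[OF open_cube open_cube _ Cinf_linear[OF bounded_linear_pr]]) (auto intro: pr_cube)

lemma dd_pr_comp: "g differentiable (at (pr q)) ==> dd v (%q. g (pr q)) q = dd (pr v) g (pr q)"
by(rule dd_chain[OF pr.has_derivative[OF has_derivative_ident]]) simp

lemma kint_derivative:
fixes Zm :: "'e => 'a::euclidean_space => complex"
assumes V: "open V" "!!i. i:I ==> Cinf_on V (Zm i)" and u: "continuous_on (ccube r) u" and x: "x:V"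
shows "((%x. kint nu u (%i. Zm i x)) has_derivative (%v. SUM i:I. dd v (Zm i) x *
 kint nu (%q. u q*(- (2 * of_nat nu)*(Zm i x - Z i (pr q)))) (%i. Zm i x))) (at x)"
proof -
have cZ: "continuous_on (ccube r) (%q. Z i (pr q))" if "i:I" for i
 by(rule continuous_pr_comp[OF Cinf_cont[OF Z[OF that]]])
have ck: "continuous_on (ccube r) (%q. kern nu z (%i. Z i (pr q)))" for z
 unfolding kern_def by(intro continuous_intros cZ)
have cZm: "continuous_on (V \<times> ccube r) (%p. Zm i (fst p))" "continuous_on (V \<times> ccube r) (%p. dd v (Zm i) (fst p))"
 "continuous_on (V \<times> ccube r) (%p. Z i (pr (snd p)))" if "i:I" for i v
 by(rule continuous_on_compose2[OF Cinf_cont[OF V(2)[OF that]]]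
  continuous_on_compose2[OF Cinf_cont[OF Cinf_dd[OF V(2)[OF that]]]]
  continuous_on_compose2[OF cZ[OF that]]; auto intro!: continuous_intros)+
have cu: "continuous_on (V \<times> ccube r) (%p. u (snd p))"
 by(rule continuous_on_compose2[OF u]) (auto intro!: continuous_intros)
have "((%x. integral (ccube r) (%q. u q*kern nu (%i. Zm i x) (%i. Z i (pr q)))) has_derivative
 (%v. integral (ccube r) (%q. u q*(kern nu (%i. Zm i x) (%i. Z i (pr q)) *
 (SUM i:I. - (2 * of_nat nu)*(Zm i x - Z i (pr q))*dd v (Zm i) x))))) (at x)"
 unfolding ccube_def
proof(rule integral_has_derivative[OF V(1) x])
 fix y q assume y: "y:V"
 show "((%x. u q*kern nu (%i. Zm i x) (%i. Z i (pr q))) has_derivative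
 (%v. u q*(kern nu (%i. Zm i y) (%i. Z i (pr q)) *
 (SUM i:I. - (2 * of_nat nu)*(Zm i y - Z i (pr q))*dd v (Zm i) y)))) (at y)"
 proof(rule has_derivative_mult_right, rule has_derivative_kern[where w = "%i x. Z i (pr q)"])
 show "((%x. Zm i x - Z i (pr q)) has_derivative (%v. dd v (Zm i) y)) (at y)" if "i:I" for i
  using has_derivative_diff[OF Cinf_deriv[OF V(2)[OF that] y] has_derivative_const[of "Z i (pr q)"]] by simp
 qed
next
 show "continuous_on (V \<times> cbox (- r *R One) (r *R One)) (%(y,q). u q*(kern nu (%i. Zm i y) (%i. Z i (pr q)) *
 (SUM i:I. - (2 * of_nat nu)*(Zm i y - Z i (pr q))*dd v (Zm i) y)))" for v
 unfolding case_prod_beta ccube_def[symmetric] kern_def by(intro continuous_intros cu cZm)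
 show "continuous_on (cbox (- r *R One) (r *R One)) (%q. u q*kern nu (%i. Zm i y) (%i. Z i (pr q)))" for y
 unfolding ccube_def[symmetric] by(intro continuous_intros u ck)
qed
moreover have "integral (ccube r) (%q. u q*(kern nu (%i. Zm i x) (%i. Z i (pr q)) *
 (SUM i:I. - (2 * of_nat nu)*(Zm i x - Z i (pr q))*dd v (Zm i) x))) = (SUM i:I. dd v (Zm i) x *
 kint nu (%q. u q*(- (2 * of_nat nu)*(Zm i x - Z i (pr q)))) (%i. Zm i x))" for v
proof -
 have "integral (ccube r) (%q. u q*(kern nu (%i. Zm i x) (%i. Z i (pr q)) *
 (SUM i:I. - (2 * of_nat nu)*(Zm i x - Z i (pr q))*dd v (Zm i) x))) =
 integral (ccube r) (%q. SUM i:I. dd v (Zm i) x*(u q*(- (2 * of_nat nu)*(Zm i x - Z i (pr q)))*kern nu (%i. Zm i x) (%i. Z i (pr q))))"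
 by(rule integral_cong) (simp add:sum_distrib_left mult_ac)
 also have "... = (SUM i:I. integral (ccube r) (%q. dd v (Zm i) x*(u q*(- (2 * of_nat nu)*(Zm i x - Z i (pr q)))*kern nu (%i. Zm i x) (%i. Z i (pr q)))))"
 by(rule integral_sum[OF finI]) (intro integrable_ccube continuous_intros u ck cZ)
 finally show ?thesis by(simp add:kint_def)
qed
ultimately show ?thesis unfolding kint_def by simp
qed

text \<open>The derivative is again built from such integrals, with the weight multiplied by
  \<open>Z i (pr q)\<close>; the induction therefore runs over all continuous weights.\<close>

lemma kint_smooth:
fixes Zm :: "'e => 'a::euclidean_space => complex"
assumes V: "open V" "!!i. i:I ==> Cinf_on V (Zm i)" and u: "continuous_on (ccube r) u"
shows "Cinf_on V (%x. kint nu u (%i. Zm i x))"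
unfolding Cinf_on_def
proof
fix k
show "Ck_on k V (%x. kint nu u (%i. Zm i x))"
 using u
proof(induction k arbitrary: u)
 case 0
 have "continuous_on V (%x. kint nu u (%i. Zm i x))"
 using kint_derivative[OF V 0] by(auto intro!: continuous_at_imp_continuous_on has_derivative_continuous)
 thus ?case by simp
next
 case (Suc k)
 have cZ: "continuous_on (ccube r) (%q. Z i (pr q))" if "i:I" for i
 by(rule continuous_pr_comp[OF Cinf_cont[OF Z[OF that]]])
 have ck: "continuous_on (ccube r) (%q. kern nu z (%i. Z i (pr q)))" for z
 unfolding kern_def by(intro continuous_intros cZ)
 have cu: "continuous_on (ccube r) (%q. u q*Z i (pr q))" if "i:I" for i
 by(intro continuous_intros Suc.prems cZ that)
 show ?case
 proof(rule Ck_on_SucI[OF V(1) kint_derivative[OF V Suc.prems]])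
 fix v
 have "Ck_on k V (%x. SUM i:I. dd v (Zm i) x*(- (2 * of_nat nu)*(Zm i x*kint nu u (%i. Zm i x)) + 2 * of_nat nu*kint nu (%q. u q*Z i (pr q)) (%i. Zm i x)))"
  using V(2) Cinf_dd[OF V(2)]
  by(intro Ck_on_sum Ck_on_mult Ck_on_add Ck_on_const Suc.IH Suc.prems cu V(1)) (auto simp:Cinf_on_def)
 moreover have "kint nu (%q. u q*(- (2 * of_nat nu)*(Zm i x - Z i (pr q)))) (%i. Zm i x) =
  - (2 * of_nat nu)*(Zm i x*kint nu u (%i. Zm i x)) + 2 * of_nat nu*kint nu (%q. u q*Z i (pr q)) (%i. Zm i x)" if "i:I" for i x
 proof -
  let ?k = "%q. kern nu (%i. Zm i x) (%i. Z i (pr q))"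
  have "kint nu (%q. u q*(- (2 * of_nat nu)*(Zm i x - Z i (pr q)))) (%i. Zm i x) =
  integral (ccube r) (%q. - (2 * of_nat nu)*(Zm i x*(u q*?k q)) + 2 * of_nat nu*(u q*Z i (pr q)*?k q))"
  unfolding kint_def by(rule integral_cong) (simp add:algebra_simps)
  also have "... = integral (ccube r) (%q. - (2 * of_nat nu)*(Zm i x*(u q*?k q))) + integral (ccube r) (%q. 2 * of_nat nu*(u q*Z i (pr q)*?k q))"
  by(rule integral_add; intro integrable_ccube continuous_on_mult continuous_on_const Suc.prems ck cZ that)
  finally show ?thesis by(simp only: integral_mult_right kint_def)
 qed
 ultimately show "Ck_on k V (%x. SUM i:I. dd v (Zm i) x*kint nu (%q. u q*(- (2 * of_nat nu)*(Zm i x - Z i (pr q)))) (%i. Zm i x))"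
  by(simp cong: sum.cong)
 qed
qed
qed

text \<open>The terms of an integration by parts in which the derivative falls on the
  cutoff.\<close>

definition tau :: "'e => ('e => complex) => 'e => complex" where
"tau i f q = f (pr q)*(SUM k:Basis. cof (tmat I Z (pr q)) i k*dd k fic q)"

lemma continuous_u:
assumes "Cinf_on (cube (2*r)) f"
shows "continuous_on (ccube r) (%q. fic q*(f (pr q)*J (pr q)))" "continuous_on (ccube r) (tau i f)"
proof -
have c: "continuous_on (ccube r) (%q. g (pr q))" if "Cinf_on (cube (2*r)) g" for g :: "'e => complex"
 by(rule continuous_pr_comp[OF Cinf_cont[OF that]])
show "continuous_on (ccube r) (%q. fic q*(f (pr q)*J (pr q)))"
 by(intro continuous_intros continuous_fi c[OF assms] c[OF Cinf_J])
show "continuous_on (ccube r) (tau i f)" unfolding tau_def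
 by(intro continuous_intros c[OF assms] c[OF Cinf_cof[OF open_cube Cinf_tmat]]
 continuous_on_subset[OF Cinf_cont[OF Cinf_dd[OF Cinf_fic]]] subset_UNIV)
qed

text \<open>Differentiating the kernel in \<open>z i\<close> amounts to minus differentiating it
  along the slice in the direction dual to \<open>Z i\<close>, that is, by the \<open>i\<close>-th
  row of cofactors. By Piola's identity this row is divergence free, so that the derivative moves to
  \<open>f\<close>, giving \<open>grad i f\<close>, and to the cutoff, giving
  \<open>tau\<close>.\<close>

lemma kint_by_parts:
assumes f: "sol f" and i: "i:I"
shows "kint nu (%q. fic q*(f (pr q)*J (pr q))*(- (2 * of_nat nu)*(z i - Z i (pr q)))) z =
 kint nu (%q. fic q*(grad i f (pr q)*J (pr q))) z + kint nu (tau i f) z"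
proof -
let ?S = "cube (2*r) :: 'e set"
have S: "Cinf_on ?S f" and df: "!!q v. q:?S ==> dd v f q = (SUM i:I. grad i f q*dd v (Z i) q)"
 using f by(auto simp:sol_def)
have iB: "i:Basis" using i I by auto
define g where "g q = f q*kern nu z (%i. Z i q)" for q
define gi where "gi i q = grad i f q*kern nu z (%i. Z i q) + f q*(kern nu z (%i. Z i q)*(2 * of_nat nu*(z i - Z i q)))" for i q
define E where "E k q = fic q*(g (pr q)*cof (tmat I Z (pr q)) i k)" for k q
have kS: "Cinf_on ?S (%q. kern nu z (%i. Z i q))" by(intro Cinf_kern open_cube Z Cinf_const)
have g: "Cinf_on ?S g" unfolding g_def by(intro Cinf_mult S open_cube kS)
have gi: "Cinf_on ?S (gi i)" unfolding gi_def
 by(intro Cinf_add Cinf_mult S open_cube kS Z Cinf_const Cinf_grad Cinf_diff i)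
have dg: "dd v g q = (SUM i:I. gi i q*dd v (Z i) q)" if q: "q:?S" for v q
proof -
 have "dd v g q = f q*dd v (%q. kern nu z (%i. Z i q)) q + dd v f q*kern nu z (%i. Z i q)"
 unfolding g_def by(rule dd_eq) (intro has_derivative_mult Cinf_deriv[OF S q] Cinf_deriv[OF kS q])
 also have "dd v (%q. kern nu z (%i. Z i q)) q = (SUM i:I. kern nu z (%i. Z i q)*(2 * of_nat nu*(z i - Z i q))*dd v (Z i) q)"
 by(rule dd_kern[where w = Z]) (rule Cinf_differentiable[OF Z q])
 also have "f q*... + dd v f q*kern nu z (%i. Z i q) = (SUM i:I. gi i q*dd v (Z i) q)"
 unfolding df[OF q] gi_def sum_distrib_left sum_distrib_right sum.distrib[symmetric]
 by(rule sum.cong[OF refl]) (simp add:algebra_simps)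
 finally show ?thesis .
qed
have cofS: "Cinf_on ?S (%q. cof (tmat I Z q) i k)" for k by(intro Cinf_cof open_cube Cinf_tmat)
have ES: "Cinf_on ?S (E k)" for k unfolding E_def
 by(intro Cinf_mult open_cube Cinf_subset[OF Cinf_fic] Cinf_pr_comp[OF g] Cinf_pr_comp[OF cofS] subset_UNIV)
have zero: "integral (ccube r) (dd k (E k)) = 0" for k
 unfolding ccube_def
proof(rule integral_dd_zero_compact[OF open_cube ES, of "ccube (3*r/4)"])
 show "ccube (3*r/4) <= cbox (- r *R One) (r *R One :: 'e)"
 unfolding ccube_def[symmetric] using r by(intro ccube_mono) auto
 show "closed (ccube (3*r/4) :: 'e set)" by(rule compact_imp_closed[OF compact_ccube])
 show "ccube (3*r/4) <= ?S" using r by(intro ccube_subset_cube) auto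
qed (simp add:E_def fi_0)
have sumE: "(SUM k:Basis. dd k (E k) q) = tau i f q*kern nu z (%i. Z i (pr q)) + fic q*(gi i (pr q)*J (pr q))"
 if q: "q:ccube r" for q
proof -
 have qS: "q:?S" "pr q:?S" using q ccube_cube pr_cube by auto
 have tm: "tmat I Z (pr q) l j = (if l:I then dd (pr j) (Z l) (pr q) else if j = l then 1 else 0)" if "j:Basis" for l j q
 by(rule tmat_alt[OF that])
 obtain C' where C': "!!k. ((%q. cof (tmat I Z (pr q)) i k) has_derivative C' k) (at q)" "(SUM k:Basis. C' k k) = 0"
 proof(rule Piola[where tt = "%q. tmat I Z (pr q)" and x = q and i = i])
 show "((%q. tmat I Z (pr q) l j) has_derivative (%h. dd h (%q. tmat I Z (pr q) l j) q)) (at q)" for l j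
  by(rule Cinf_deriv[OF Cinf_pr_comp[OF Cinf_tmat] qS(1)])
 show "dd k (%q. tmat I Z (pr q) l j) q = dd j (%q. tmat I Z (pr q) l k) q" if "j:Basis" "k:Basis" for l j k
 proof(cases "l:I")
  case True
  have "dd k (%q. tmat I Z (pr q) l j) q = dd (pr k) (dd (pr j) (Z l)) (pr q)" if "j:Basis" for k j
  using True that by(simp add:tm dd_pr_comp[OF Cinf_differentiable[OF Cinf_dd[OF Z[OF True]] qS(2)]])
  moreover have "dd (pr k) (dd (pr j) (Z l)) (pr q) = dd (pr j) (dd (pr k) (Z l)) (pr q)"
  by(rule dd_commute[OF open_cube qS(2)]) (use Z[OF True] in "simp add: Cinf_on_def")
  ultimately show ?thesis using that by simp
 next
  case False
  have "dd k (%q. c :: complex) q = 0" for c k by(rule dd_eq) simp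
  thus ?thesis using False that by(simp add:tm)
 qed
 qed (use iB in blast)+
 have "dd k (E k) q = dd k fic q*(g (pr q)*cof (tmat I Z (pr q)) i k) +
  fic q*(g (pr q)*C' k k + (SUM l:I. gi l (pr q)*tmat I Z (pr q) l k)*cof (tmat I Z (pr q)) i k)" if k: "k:Basis" for k
 proof -
 have "((%q. g (pr q)) has_derivative (%h. dd h (%q. g (pr q)) q)) (at q)"
  by(rule Cinf_deriv[OF Cinf_pr_comp[OF g] qS(1)])
 moreover have dk: "dd k (%q. g (pr q)) q = (SUM l:I. gi l (pr q)*tmat I Z (pr q) l k)"
  using dd_pr_comp[OF Cinf_differentiable[OF g qS(2)], of k] dg[OF qS(2)] by(simp add:tm[OF k])
 moreover have "(fic has_derivative (%h. dd h fic q)) (at q)" using Cinf_deriv[OF Cinf_fic] by simp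
 ultimately have D: "(E k has_derivative (%h. fic q*(g (pr q)*C' k h + dd h (%q. g (pr q)) q*cof (tmat I Z (pr q)) i k) +
  dd h fic q*(g (pr q)*cof (tmat I Z (pr q)) i k))) (at q)"
  unfolding E_def by(intro has_derivative_mult C'(1))
 show ?thesis unfolding dd_eq[OF D] dk by simp
 qed
 hence "(SUM k:Basis. dd k (E k) q) = g (pr q)*(SUM k:Basis. cof (tmat I Z (pr q)) i k*dd k fic q) +
  fic q*g (pr q)*(SUM k:Basis. C' k k) + fic q*(SUM k:Basis. SUM l:I. gi l (pr q)*(cof (tmat I Z (pr q)) i k*tmat I Z (pr q) l k))"
 by(simp add:sum.distrib sum_distrib_left sum_distrib_right algebra_simps)
 also have "(SUM k:Basis. SUM l:I. gi l (pr q)*(cof (tmat I Z (pr q)) i k*tmat I Z (pr q) l k)) =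
 (SUM l:I. gi l (pr q)*(SUM k:Basis. cof (tmat I Z (pr q)) i k*tmat I Z (pr q) l k))"
 by(subst sum.swap) (simp add:sum_distrib_left)
 also have "... = (SUM l:I. gi l (pr q)*(if l = i then J (pr q) else 0))"
 by(rule sum.cong[OF refl]) (use cof_row[OF iB] I in auto)
 also have "... = gi i (pr q)*J (pr q)" using i finI by(simp add:if_distrib[of "%x. _*x"] cong: if_cong)
 finally show ?thesis using C'(2) by(simp add:tau_def g_def)
qed
have cc: "continuous_on (ccube r) (%q. h (pr q))" if "Cinf_on ?S h" for h :: "'e => complex"
 by(rule continuous_pr_comp[OF Cinf_cont[OF that]])
have "integral (ccube r) (%q. tau i f q*kern nu z (%i. Z i (pr q)) + fic q*(gi i (pr q)*J (pr q))) =
 integral (ccube r) (%q. SUM k:Basis. dd k (E k) q)"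
 by(rule integral_cong) (simp add:sumE)
also have "... = (SUM k:Basis. integral (ccube r) (dd k (E k)))"
 by(rule integral_sum) (auto intro!: integrable_ccube continuous_on_subset[OF Cinf_cont[OF Cinf_dd[OF ES]]] ccube_cube)
finally have 0: "integral (ccube r) (%q. tau i f q*kern nu z (%i. Z i (pr q)) + fic q*(gi i (pr q)*J (pr q))) = 0"
 by(simp add:zero)
define P1 where "P1 = (%q. fic q*(grad i f (pr q)*J (pr q))*kern nu z (%i. Z i (pr q)))"
define P2 where "P2 = (%q. fic q*(f (pr q)*J (pr q))*(- (2 * of_nat nu)*(z i - Z i (pr q)))*kern nu z (%i. Z i (pr q)))"
define P3 where "P3 = (%q. tau i f q*kern nu z (%i. Z i (pr q)))"
have int: "P1 integrable_on ccube r" "P2 integrable_on ccube r" "P3 integrable_on ccube r"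
 unfolding P1_def P2_def P3_def
 by(intro integrable_ccube continuous_on_mult continuous_on_diff continuous_on_minus continuous_on_const
  continuous_on_of_real continuous_fi cc[OF S] cc[OF Cinf_J] cc[OF kS] cc[OF Z[OF i]] cc[OF Cinf_grad[OF S]] continuous_u(2)[OF S])+
have e: "tau i f q*kern nu z (%i. Z i (pr q)) + fic q*(gi i (pr q)*J (pr q)) = P3 q + (P1 q - P2 q)" for q
 unfolding P1_def P2_def P3_def gi_def by(simp add:algebra_simps)
have "integral (ccube r) P3 + (integral (ccube r) P1 - integral (ccube r) P2) = 0"
 using 0 int unfolding e by(simp add:integral_add integral_diff integrable_diff)
thus ?thesis unfolding kint_def P1_def P2_def P3_def by(simp add:algebra_simps)
qed

definition rest :: "nat => 'e => ('e => complex) => ('e => complex) => complex" where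
"rest nu i f z = kint nu (tau i f) z/of_real (cn nu)"

lemma approx_smooth:
fixes Zm :: "'e => 'a::euclidean_space => complex"
assumes "sol f" "open V" "!!i. i:I ==> Cinf_on V (Zm i)"
shows "Cinf_on V (%x. approx nu f (%i. Zm i x))"
proof -
have "Cinf_on V (%x. kint nu (%q. fic q*(f (pr q)*J (pr q))) (%i. Zm i x))"
 by(rule kint_smooth[OF assms(2,3) continuous_u(1)]) (use assms(1) in "auto simp: sol_def")
thus ?thesis unfolding approx_def divide_inverse by(intro Cinf_mult Cinf_const assms(2))
qed

text \<open>Differentiation commutes with the approximation up to \<open>rest\<close>, so that
  convergence of all derivatives reduces to convergence for the iterated
  \<open>grad\<close>s.\<close>

lemma approx_has_derivative:
fixes Zm :: "'e => 'a::euclidean_space => complex"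
assumes f: "sol f" and V: "open V" "!!i. i:I ==> Cinf_on V (Zm i)" and x: "x:V"
shows "((%x. approx nu f (%i. Zm i x)) has_derivative
 (%v. SUM i:I. dd v (Zm i) x*(approx nu (grad i f) (%i. Zm i x) + rest nu i f (%i. Zm i x)))) (at x)"
proof -
have S: "Cinf_on (cube (2*r)) f" using f by(simp add:sol_def)
have "((%x. kint nu (%q. fic q*(f (pr q)*J (pr q))) (%i. Zm i x)*inverse (of_real (cn nu))) has_derivative
 (%v. (SUM i:I. dd v (Zm i) x*(kint nu (%q. fic q*(grad i f (pr q)*J (pr q))) (%i. Zm i x) + kint nu (tau i f) (%i. Zm i x))) *
 inverse (of_real (cn nu)))) (at x)"
proof -
 have "((%x. kint nu (%q. fic q*(f (pr q)*J (pr q))) (%i. Zm i x)) has_derivative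
 (%v. SUM i:I. dd v (Zm i) x*(kint nu (%q. fic q*(grad i f (pr q)*J (pr q))) (%i. Zm i x) + kint nu (tau i f) (%i. Zm i x)))) (at x)"
 proof -
 have "((%x. kint nu (%q. fic q*(f (pr q)*J (pr q))) (%i. Zm i x)) has_derivative (%v. SUM i:I. dd v (Zm i) x *
  kint nu (%q. fic q*(f (pr q)*J (pr q))*(- (2 * of_nat nu)*(Zm i x - Z i (pr q)))) (%i. Zm i x))) (at x)"
  by(rule kint_derivative[OF V(1) V(2) continuous_u(1)[OF S] x])
 moreover have "kint nu (%q. fic q*(f (pr q)*J (pr q))*(- (2 * of_nat nu)*(Zm i x - Z i (pr q)))) (%i. Zm i x) =
  kint nu (%q. fic q*(grad i f (pr q)*J (pr q))) (%i. Zm i x) + kint nu (tau i f) (%i. Zm i x)" if "i:I" for i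
  by(rule kint_by_parts[OF f that, of nu "%i. Zm i x"])
 ultimately show ?thesis by(simp only: cong: sum.cong)
 qed
 thus ?thesis by(rule has_derivative_mult_left)
qed
thus ?thesis unfolding approx_def rest_def divide_inverse sum_distrib_right mult.assoc distrib_right .
qed

text \<open>In \<open>tau\<close> only derivatives of the cutoff along \<open>I\<close> survive, by
  \<open>cof_I\<close>, and these vanish where \<open>norm (pr q) < r/2\<close>; elsewhere the
  kernel is at most \<open>tail nu\<close>, which is small against \<open>cn nu\<close>.\<close>

lemma rest_converges:
assumes f: "sol f" and rad: "radius de" and i: "i:I" and ep: "(0::real) < ep"
shows "\<forall>\<^sub>F nu in sequentially. ALL z. (ALL j:I. cmod (z j - Z j 0) < de) --> cmod (rest nu i f z) < ep"
proof -
have S: "Cinf_on (cube (2*r)) f" using f by(simp add:sol_def)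
obtain de0 where de0: "0 < de" "de <= de0/2" "0 < de0"
 and far: "!!nu z T q. norm T < de0 ==> pr T = 0 ==> (ALL i:I. cmod (z i - Z i 0) < de0) ==>
 q:ccube r ==> r/2 <= norm (pr q) ==> cmod (kern nu z (%i. Z i (pr q + T))) <= tail nu"
 using rad unfolding radius_def by(elim conjE exE) blast
 obtain C where C: "0 <= C" "ALL j:{0::nat}. ALL q:ccube r. cmod (tau i f q) <= C"
 by(rule finite_family_bound[of "{0::nat}", OF _ compact_ccube continuous_u(2)[OF S]]) auto
 have "(%nu. (C*measure lborel (ccube r :: 'e set))*(tail nu/cn nu)) \<longlonglongrightarrow> (C*measure lborel (ccube r :: 'e set))*0"
 by(intro tendsto_mult_left exp_over_cn) (use r in simp)
 hence "\<forall>\<^sub>F nu in sequentially. (C*measure lborel (ccube r :: 'e set))*(tail nu/cn nu) < ep"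
 using ep by(intro order_tendstoD(2)[of _ 0]) auto
 thus "\<forall>\<^sub>F nu in sequentially. ALL z. (ALL j:I. cmod (z j - Z j 0) < de) --> cmod (rest nu i f z) < ep"
 proof(rule eventually_mono, intro allI impI)
 fix nu z assume lt: "(C*measure lborel (ccube r :: 'e set))*(tail nu/cn nu) < ep"
  and z': "ALL j:I. cmod (z j - Z j 0) < de"
 hence z: "ALL j:I. cmod (z j - Z j 0) < de0" using de0 by force
 let ?E = "tail nu"
 have "cmod (kint nu (tau i f) z) <= C*?E*measure lborel (ccube r :: 'e set)"
  unfolding kint_def ccube_def
 proof(rule integrable_bound)
  show "0 <= C*?E" using C by simp
  have "continuous_on (ccube r) (%q. kern nu z (%i. Z i (pr q)))"
  by(rule continuous_pr_comp, rule Cinf_cont) (intro Cinf_kern open_cube Z Cinf_const)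
  thus "(%q. tau i f q*kern nu z (%i. Z i (pr q))) integrable_on cbox (- r *R One) (r *R One)"
  unfolding ccube_def[symmetric] by(intro integrable_ccube continuous_intros continuous_u(2)[OF S])
  fix q :: 'e assume "q:cbox (- r *R One) (r *R One)"
  hence q: "q:ccube r" by(simp add:ccube_def)
  show "norm (tau i f q*kern nu z (%i. Z i (pr q))) <= C*?E"
  proof(cases "r/2 <= norm (pr q)")
  case True
  show ?thesis unfolding norm_mult
   using C q far[of 0 z q nu] de0 z True by(intro mult_mono) (auto simp:pr.zero)
  next
  case False
  have "cof (tmat I Z (pr q)) i k*dd k fic q = 0" if "k:Basis" for k
   using cof_I[OF i that] dd_fi_0[of k q] False by(cases "k:I") auto
  hence "(SUM k:Basis. cof (tmat I Z (pr q)) i k*dd k fic q) = 0" by(rule sum.neutral[OF ballI])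
  thus ?thesis using C(1) by(simp add:tau_def)
  qed
 qed
 hence "cmod (rest nu i f z) <= C*?E*measure lborel (ccube r :: 'e set)/cn nu"
  using cn_pos[of nu] by(simp add:rest_def norm_divide divide_right_mono)
 thus "cmod (rest nu i f z) < ep" using lt by(simp add:mult_ac)
 qed
qed

end

section \<open>Seeley's extension across a hyperplane\<close>

text \<open>The interpolation polynomial of the \<open>m\<close>-th power minus that power has
  degree at most \<open>n\<close> and vanishes at \<open>n + 1\<close> nodes.\<close>

lemma Lagrange_power:
fixes t :: "nat => real"
assumes inj: "inj_on t {..n}" and m: "m <= n"
shows "(SUM k<=n. (PROD j:{..n} - {k}. (x - t j)/(t k - t j))*t k^m) = x^m"
proof -
define L where "L k = (PROD j:{..n} - {k}. smult (inverse (t k - t j)) [:- t j, 1:])" for k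
define p where "p = (SUM k<=n. smult (t k^m) (L k)) - monom 1 m"
have pL: "poly (L k) y = (PROD j:{..n} - {k}. (y - t j)/(t k - t j))" for k y
 unfolding L_def poly_prod by(rule prod.cong[OF refl]) (simp add:divide_inverse algebra_simps)
have deg: "degree p <= n" unfolding p_def
proof(intro degree_diff_le degree_sum_le)
 fix k assume k: "k:{..n}"
 have "degree (L k) <= (SUM j:{..n} - {k}. degree (smult (inverse (t k - t j)) [:- t j, 1:]))"
 unfolding L_def by(rule degree_prod_sum_le[unfolded o_def]) simp
 also have "... <= (SUM j:{..n} - {k}. 1)" by(rule sum_mono) (simp add:degree_smult_le[THEN order_trans])
 also have "... <= n" using k by simp
 finally show "degree (smult (t k^m) (L k)) <= n" using degree_smult_le order_trans by blast
qed (use m in "simp_all add: degree_monom_eq")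
have "poly p (t l) = 0" if l: "l <= n" for l
proof -
 have "poly (L k) (t l) = (if k = l then 1 else 0)" if "k <= n" for k
 proof(cases "k = l")
 case True
 have "t l ~= t j" if "j:{..n} - {l}" for j using inj l that unfolding inj_on_def by auto
 hence "poly (L k) (t l) = 1" unfolding pL True by(intro prod.neutral) auto
 thus ?thesis using True by simp
 next
 case False thus ?thesis unfolding pL using l by(auto intro!: prod_zero)
 qed
 hence "(SUM k<=n. t k^m*poly (L k) (t l)) = (SUM k<=n. if k = l then t k^m else 0)"
 by(intro sum.cong) auto
 thus ?thesis using l by(simp add:p_def poly_sum poly_monom)
qed
hence sub: "t ` {..n} <= {x. poly p x = 0}" by auto
have "p = 0"
proof(rule ccontr)
 assume "p ~= 0"
 hence "card (t ` {..n}) <= degree p"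
 using card_poly_roots_bound[of p] card_mono[OF poly_roots_finite[of p] sub] by linarith
 thus False using deg inj by(simp add:card_image)
qed
hence "poly p x = 0" by simp
thus ?thesis by(simp add:p_def poly_sum pL poly_monom mult.commute)
qed

text \<open>Moment conditions. The extension sums \<open>c k\<close> times the value at a point
  whose distance from the hyperplane is scaled by \<open>- (2^k)\<close>; derivatives of all orders
  match across the hyperplane if all moments are 1, and summability makes the differentiated series
  converge.\<close>

definition reflection_coeffs :: "(nat => real) => bool" where
"reflection_coeffs c \<longleftrightarrow> (ALL m. summable (%k. \<bar>c k\<bar>*2^(k*m)) & (\<Sum>k. c k*(- (2^k))^m) = 1)"

text \<open>For the nodes \<open>- (2^k)\<close>, \<open>k <= n\<close>, Lagrange interpolation
  evaluated at 1 solves the conditions for \<open>m <= n\<close> exactly. Its coefficients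
  \<open>s k * w k n\<close> converge as \<open>n\<close> grows, and Tannery's theorem passes to the
  limit in every condition.\<close>

lemma reflection_coeffs_exist: "EX c. reflection_coeffs c"
proof -
\<comment> \<open>The Lagrange coefficient of node \<open>k\<close> is split at
  \<open>j = k\<close>: the product over smaller \<open>j\<close> is independent of \<open>n\<close>
  and bounded by \<open>P k\<close>, which decays faster than every \<open>2^(- k*m)\<close>; the
  product over larger \<open>j\<close> increases with \<open>n\<close> and stays below
  \<open>exp 4\<close>.\<close>
define s where "s k = (PROD j<k. (1 + 2^j)/(2^j - 2^k) :: real)" for k :: nat
define w where "w k n = (PROD j:{k<..n}. (1 + 2^j)/(2^j - 2^k) :: real)" for k n :: nat
define P where "P k = (PROD j<k. 4*2^j/2^k :: real)" for k :: nat
have sP: "\<bar>s k\<bar> <= P k" for k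
 unfolding s_def P_def abs_prod
proof(rule prod_mono)
 fix j assume j: "j:{..<k}"
 have a: "(2::real)^k >= 2*2^j" using j power_increasing[of "Suc j" k "2::real"] by simp
 have b: "(1::real) <= 2^j" by simp
 have "\<bar>(1 + 2^j)/(2^j - 2^k) :: real\<bar> = (1 + 2^j)/(2^k - 2^j)" 
 proof -
 have "(2::real)^j - 2^k < 0" "0 < (1::real) + 2^j" using a b by linarith+
 thus ?thesis by simp
 qed
 also have "... <= (2*2^j)/(2^k/2)" using a b by(intro frac_le) auto
 finally show "0 <= \<bar>(1 + 2^j)/(2^j - 2^k) :: real\<bar> & \<bar>(1 + 2^j)/(2^j - 2^k) :: real\<bar> <= 4*2^j/2^k" by simp
qed
have fac: "1 <= (1 + 2^j)/(2^j - 2^k :: real)" "(1 + 2^j)/(2^j - 2^k :: real) <= exp (4*2^k/2^j)" if "k < j" for j k :: nat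
proof -
 have a: "(2::real)^j >= 2*2^k" using that power_increasing[of "Suc k" j "2::real"] by simp
 have b: "(1::real) <= 2^k" by simp
 have p: "(0::real) < 2^j - 2^k" using a b by linarith
 have "2^j - 2^k <= (1::real) + 2^j" using b by linarith
 thus "1 <= (1 + 2^j)/(2^j - 2^k :: real)" using p by simp
 have "(1 + 2^j)/(2^j - 2^k :: real) = 1 + (1 + 2^k)/(2^j - 2^k)" using p by(simp add:field_simps)
 also have "(1 + 2^k)/(2^j - 2^k :: real) <= (2*2^k)/(2^j/2)" using a b by(intro frac_le) auto
 also have "1 + (2*2^k)/(2^j/2) = 1 + 4*2^k/(2^j :: real)" by simp
 also have "... <= exp (4*2^k/2^j)" by(rule exp_ge_add_one_self)
 finally show "(1 + 2^j)/(2^j - 2^k :: real) <= exp (4*2^k/2^j)" by simp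
qed
have w_le: "w k n <= exp 4" for k n
proof -
 have "w k n <= (PROD j:{k<..n}. exp (4*2^k/2^j))"
 unfolding w_def by(rule prod_mono) (use fac order_trans[OF zero_le_one fac(1)] in auto)
 also have "... = exp (SUM j:{k<..n}. 4*2^k/2^j)" by(simp add:exp_sum)
 also have "(SUM j:{k<..n}. 4*2^k/2^j :: real) <= 4"
 proof -
 have le: "(SUM j:{k<..n}. 4*2^k/2^j :: real) <= 4 - 4*2^k/2^n" if "k <= n" for n
  using that
 proof(induction n rule: dec_induct)
  case (step n)
  hence "{k<..Suc n} = insert (Suc n) {k<..n}" by auto
  thus ?case using step by simp
 qed simp
 show ?thesis
 proof(cases "k <= n")
  case True show ?thesis by(rule order_trans[OF le[OF True]]) simp
 qed simp
 qed
 finally show ?thesis by simp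
qed
have w_Suc: "w k n <= w k (Suc n)" for k n
proof(cases "k < Suc n")
 case True
 hence "{k<..Suc n} = insert (Suc n) {k<..n}" by auto
 moreover have "0 <= w k n" unfolding w_def by(rule prod_nonneg) (use order_trans[OF zero_le_one fac(1)] in auto)
 ultimately show ?thesis using mult_right_mono[OF fac(1)[OF True], of "w k n"] by(simp add:w_def)
qed (simp add:w_def)
have w_ge: "1 <= w k n" for k n unfolding w_def by(rule prod_ge_1) (use fac in auto)
have "convergent (w k)" for k
proof(rule Bseq_mono_convergent)
 show "Bseq (w k)" by(rule BseqI'[of _ "exp 4"]) (use w_le[of k] order_trans[OF zero_le_one w_ge[of k]] in simp)
 show "ALL m n. m <= n --> w k m <= w k n" using lift_Suc_mono_le[of "w k", OF w_Suc] by blast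
qed
then obtain W where W: "!!k. w k \<longlonglongrightarrow> W k" unfolding convergent_def by metis
define c where "c k = s k*W k" for k
define a where "a m k n = (if k <= n then s k*w k n*(- (2^k))^m else 0)" for m k n :: nat
define M where "M m k = P k*exp 4*2^(k*m)" for m k :: nat
have sumM: "summable (M m)" for m
proof(rule summable_ratio_test[where c = "1/2" and N = "m + 2"])
 fix k assume k: "m + 2 <= k"
 have "P (Suc k) = (PROD j<k. (4*2^j/2^k)*(1/2))*(4*2^k/2^Suc k)"
 unfolding P_def prod.lessThan_Suc by simp
 also have "... = P k*(1/2)^k*2" unfolding prod.distrib by(simp add:P_def)
 finally have "M m (Suc k) = M m k*((1/2)^k*2*2^m)" by(simp add:M_def power_add)
 moreover have "(1/2)^k*2*2^m <= (1/2 :: real)"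
 using power_increasing[OF k, of "2::real"] by(simp add:power_divide divide_simps)
 moreover have "0 <= M m k" unfolding M_def P_def by(simp add:prod_nonneg)
 ultimately show "norm (M m (Suc k)) <= 1/2*norm (M m k)"
 using mult_left_mono[of "(1/2)^k*2*2^m" "1/2" "M m k"] by simp
qed simp
have bnd: "norm (a m k n) <= M m k" for m k n
proof(cases "k <= n")
 case True
 have "norm (a m k n) = \<bar>s k\<bar>*w k n*2^(k*m)"
 using True w_ge[of k n] by(simp add:a_def abs_mult power_abs power_mult)
 also have "... <= P k*exp 4*2^(k*m)"
 using w_ge[of k n] by(intro mult_mono sP w_le) (auto simp:P_def prod_nonneg intro!: mult_nonneg_nonneg)
 finally show ?thesis by(simp add:M_def)
qed (simp add:a_def M_def P_def prod_nonneg)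
have lim: "a m k \<longlonglongrightarrow> c k*(- (2^k))^m" for m k
proof -
 have "(%n. s k*w k n*(- (2^k))^m) \<longlonglongrightarrow> s k*W k*(- (2^k))^m" by(intro tendsto_intros W)
 moreover have "\<forall>\<^sub>F n in sequentially. s k*w k n*(- (2^k))^m = a m k n"
 using eventually_ge_at_top[of k] by eventually_elim (simp add:a_def)
 ultimately show ?thesis unfolding c_def by(rule Lim_transform_eventually)
qed
have T: "summable (%k. norm (c k*(- (2^k))^m)) & (%n. \<Sum>k. a m k n) \<longlonglongrightarrow> (\<Sum>k. c k*(- (2^k))^m)" for m
 using tannerys_theorem[where a = "a m" and F = sequentially and M = "M m", OF lim _ sumM] bnd
 by(simp add:always_eventually)
have one: "(\<Sum>k. a m k n) = 1" if "m <= n" for m n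
proof -
 have "(\<Sum>k. a m k n) = (SUM k<=n. a m k n)" by(rule suminf_finite) (auto simp:a_def)
 also have "... = (SUM k<=n. (PROD j:{..n} - {k}. (1 - (- (2^j)))/(- (2^k) - (- (2^j)) :: real))*(- (2^k))^m)"
 proof(rule sum.cong[OF refl])
 fix k assume "k:{..n}"
 hence "{..n} - {k} = {..<k} Un {k<..n}" by auto
 hence "(PROD j:{..n} - {k}. (1 + 2^j)/(2^j - 2^k) :: real) = s k*w k n"
  unfolding s_def w_def by(simp add:prod.union_disjoint disjoint_iff)
 thus "a m k n = (PROD j:{..n} - {k}. (1 - (- (2^j)))/(- (2^k) - (- (2^j)) :: real))*(- (2^k))^m"
  using `k : {..n}` by(simp add:a_def)
 qed
 also have "... = 1^m" by(rule Lagrange_power[OF _ that]) (auto simp:inj_on_def)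
 finally show ?thesis by simp
qed
have "(\<Sum>k. c k*(- (2^k))^m) = 1" for m
proof(rule LIMSEQ_unique[OF conjunct2[OF T]])
 show "(%n. \<Sum>k. a m k n) \<longlonglongrightarrow> 1"
 by(rule tendsto_eventually[OF eventually_mono[OF eventually_ge_at_top[of m] one]])
qed
moreover have "summable (%k. \<bar>c k\<bar>*2^(k*m))" for m
proof -
 have "norm (c k*(- (2^k))^m) = \<bar>c k\<bar>*2^(k*m)" for k
 by(simp add:abs_mult power_abs power_mult)
 thus ?thesis using conjunct1[OF T[of m]] by simp
qed
ultimately have "reflection_coeffs c" by(simp add:reflection_coeffs_def)
thus ?thesis by(rule exI[of _ c])
qed

text \<open>Differentiation along \<open>b\<close> multiplies the \<open>k\<close>-th term by
  \<open>- (2^k)\<close>, that is, shifts the moments by one.\<close>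

lemma reflection_coeffs_shift:
assumes "reflection_coeffs c" shows "reflection_coeffs (%k. c k*- (2^k))"
proof -
have A: "\<bar>c k*- (2^k)\<bar>*2^(k*m) = \<bar>c k\<bar>*2^(k*Suc m)" for k m by(simp add:abs_mult power_add mult_ac)
have B: "c k*- (2^k)*(- (2^k))^m = c k*(- (2^k))^Suc m" for k m by simp
show ?thesis unfolding reflection_coeffs_def
proof
 fix m
 show "summable (%k. \<bar>c k*- (2^k)\<bar>*2^(k*m)) & (\<Sum>k. c k*- (2^k)*(- (2^k))^m) = 1"
 using spec[OF assms[unfolded reflection_coeffs_def], of "Suc m"] by(simp only: A B)
qed
qed

text \<open>The mean value theorem for \<open>u\<close> minus the linear part on the segment from
  \<open>q\<close> to \<open>y\<close>. A segment transversal to the hyperplane meets it at most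
  once, and the two pieces are treated separately; the other segments follow by continuity.\<close>

lemma has_derivative_across_hyperplane:
fixes u :: "'e::euclidean_space => complex"
assumes b: "b:Basis" and cu: "continuous_on UNIV u" and cU: "!!i. i:Basis ==> continuous_on UNIV (U i)"
 and D: "!!q. q <.> b ~= 0 ==> (u has_derivative (%v. SUM i:Basis. (v <.> i) *R U i q)) (at q)"
shows "(u has_derivative (%v. SUM i:Basis. (v <.> i) *R U i q)) (at q)"
unfolding has_derivative_at_alt
proof(intro conjI allI impI)
show bl: "bounded_linear (%v. SUM i:Basis. (v <.> i) *R U i q)"
 by(intro bounded_linear_sum bounded_linear_compose[OF bounded_linear_scaleR_left bounded_linear_inner_left])
fix e :: real assume e: "0 < e"
define e' where "e' = e/real DIM('e)"
have e': "0 < e'" using e by(simp add:e'_def)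
have "EX d>0. ALL y. dist y q < d --> dist (U i y) (U i q) < e'" if "i:Basis" for i
 using cU[OF that] e' by(simp add:continuous_on_eq_continuous_at continuous_at_eps_delta)
then obtain d where d: "!!i. i:Basis ==> 0 < d i" "!!i y. i:Basis ==> dist y q < d i ==> dist (U i y) (U i q) < e'" by metis
define de where "de = Min (d ` Basis)"
have de: "0 < de" "!!i. i:Basis ==> de <= d i" using d(1) by(auto simp:de_def)
define L where "L v = (SUM i:Basis. (v <.> i) *R U i q)" for v
have L: "bounded_linear L" using bl unfolding L_def .
have lin: "(SUM i:Basis. ((k *R d) <.> i) *R X i) - k *R (SUM i:Basis. (d <.> i) *R Y i) =
 k *R (SUM i:Basis. (d <.> i) *R (X i - Y i))" for k and d :: 'e and X Y :: "'e => complex"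
 by(simp add:scaleR_sum_right scaleR_diff_right sum_subtractf)
have near: "norm (u y - u q - L (y - q)) <= e*norm (y - q)" if y: "norm (y - q) < de" "(y - q) <.> b ~= 0" for y
proof -
 define h where "h t = u (q + t *R (y - q)) - t *R L (y - q)" for t
 have ch: "continuous_on {0..1} h" unfolding h_def
 by(intro continuous_intros continuous_on_compose2[OF cu]) auto
 \<comment> \<open>The parameter at which the line meets the hyperplane, clipped to the unit
   interval so that it always splits the segment.\<close>
 obtain t0 where t0: "t0:{0..1}" "!!t. t:{0<..<1} ==> t ~= t0 ==> (q + t *R (y - q)) <.> b ~= 0"
 proof -
 define C where "C = (y - q) <.> b"
 have C: "C ~= 0" unfolding C_def by(rule y(2))
 have "(q + t *R (y - q)) <.> b = q <.> b + t*C" for t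
  by(simp only: C_def inner_add_left inner_scaleR_left)
 hence eq: "(q + t *R (y - q)) <.> b = 0 \<longleftrightarrow> t = - (q <.> b)/C" for t
  using C by(simp only: eq_divide_eq add_eq_0_iff not_False_eq_True if_True)
 show ?thesis
 proof(rule that)
  show "min 1 (max 0 (- (q <.> b)/C)):{0..1}" by auto
  fix t :: real assume t: "t:{0<..<1}" "t ~= min 1 (max 0 (- (q <.> b)/C))"
  hence "t ~= - (q <.> b)/C" by auto
  thus "(q + t *R (y - q)) <.> b ~= 0" unfolding eq .
 qed
 qed
 have seg: "norm (h t2 - h t1) <= e*norm (y - q)*(t2 - t1)" if t: "0 <= t1" "t1 <= t2" "t2 <= 1" "!!t. t:{t1<..<t2} ==> t ~= t0" for t1 t2
 proof(cases "t1 = t2")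
 case False
 hence "t1 < t2" using t by simp
 then obtain xi where xi: "xi:{t1<..<t2}" and le: "norm (h t2 - h t1) <= norm ((t2 - t1) *R (SUM i:Basis. ((y - q) <.> i) *R (U i (q + xi *R (y - q)) - U i q)))"
 proof(rule mvt_general[of t1 t2 h "%t s. s *R (SUM i:Basis. ((y - q) <.> i) *R (U i (q + t *R (y - q)) - U i q))", THEN bexE])
  show "continuous_on {t1..t2} h" by(rule continuous_on_subset[OF ch]) (use t in auto)
  fix s assume s: "t1 < s" "s < t2"
  have nz: "(q + s *R (y - q)) <.> b ~= 0" using t0(2)[of s] t s by auto
  have "((%t. q + t *R (y - q)) has_derivative (%h. h *R (y - q))) (at s)" by(auto intro!: derivative_eq_intros)
  from diff_chain_at[OF this D[OF nz]]
  have "((%t. u (q + t *R (y - q)) - t *R L (y - q)) has_derivative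
  (%h. (SUM i:Basis. ((h *R (y - q)) <.> i) *R U i (q + s *R (y - q))) - h *R L (y - q))) (at s)"
  unfolding o_def by(rule has_derivative_diff) (auto intro!: derivative_eq_intros)
  thus "(h has_derivative (%k. k *R (SUM i:Basis. ((y - q) <.> i) *R (U i (q + s *R (y - q)) - U i q)))) (at s)"
  unfolding h_def L_def lin .
 qed auto
 have "norm (SUM i:Basis. ((y - q) <.> i) *R (U i (q + xi *R (y - q)) - U i q)) <= (SUM i:(Basis :: 'e set). norm (y - q)*e')"
 proof(rule sum_norm_le)
  fix i :: 'e assume i: "i:Basis"
  have "norm (xi *R (y - q)) <= 1*norm (y - q)" unfolding norm_scaleR using xi t by(intro mult_right_mono) auto
  hence "dist (q + xi *R (y - q)) q < d i" using y de(2)[OF i] by(simp add:dist_norm)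
  from d(2)[OF i this] show "norm (((y - q) <.> i) *R (U i (q + xi *R (y - q)) - U i q)) <= norm (y - q)*e'"
  unfolding norm_scaleR by(intro mult_mono) (use Basis_le_norm[OF i, of "y - q"] in "auto simp: dist_norm")
 qed
 hence "norm (SUM i:Basis. ((y - q) <.> i) *R (U i (q + xi *R (y - q)) - U i q)) <= e*norm (y - q)" by(simp add:e'_def mult.commute)
 hence "(t2 - t1)*norm (SUM i:Basis. ((y - q) <.> i) *R (U i (q + xi *R (y - q)) - U i q)) <= (t2 - t1)*(e*norm (y - q))"
  using t by(intro mult_left_mono) auto
 thus ?thesis using le t(2) unfolding norm_scaleR by(simp only: real_norm_def abs_of_nonneg diff_ge_0_iff_ge mult.commute[of "t2 - t1"])
 qed simp
 have "norm (h 1 - h 0) <= norm (h 1 - h t0) + norm (h t0 - h 0)" by(rule norm_diff_triangle_le) auto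
 also have "... <= e*norm (y - q)*(1 - t0) + e*norm (y - q)*(t0 - 0)"
 using t0(1) by(intro add_mono seg) auto
 finally show ?thesis by(simp add:h_def algebra_simps)
qed
show "EX d>0. ALL y. norm (y - q) < d --> norm (u y - u q - L (y - q)) <= e*norm (y - q)"
proof(intro exI conjI allI impI)
 show "0 < de" by fact
 fix y assume y: "norm (y - q) < de"
 show "norm (u y - u q - L (y - q)) <= e*norm (y - q)"
 proof(cases "(y - q) <.> b = 0")
 case True
 \<comment> \<open>Makes the segment from \<open>q\<close> transversal by a push along
   \<open>b\<close> that uses less than the room left in the ball of radius
   \<open>de\<close>.\<close>
 define z where "z = (%n. y + (de - norm (y - q)) *R (inverse (real (Suc n))/2) *R b)"
 have z: "z \<longlonglongrightarrow> y"
 proof -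
  have "(%n. y + (de - norm (y - q)) *R (inverse (real (Suc n))/2) *R b) \<longlonglongrightarrow> y + (de - norm (y - q)) *R (0/2) *R b"
  by(intro tendsto_intros LIMSEQ_inverse_real_of_nat) simp
  thus ?thesis unfolding z_def by(simp only: div_0 scaleR_zero_left scaleR_zero_right add_0_right)
 qed
 have bd: "norm (u (z n) - u q - L (z n - q)) <= e*norm (z n - q)" for n
 proof(rule near)
  have "(z n - q) <.> b = (de - norm (y - q))*(inverse (real (Suc n))/2)"
  using True b by(simp add:z_def inner_diff_left inner_add_left)
  moreover have "0 < (de - norm (y - q))*(inverse (real (Suc n))/2)" using y by(intro mult_pos_pos) auto
  ultimately show "(z n - q) <.> b ~= 0" by linarith
  have "norm (z n - q) <= norm (y - q) + (de - norm (y - q))*(inverse (real (Suc n))/2)"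
  proof -
  have "z n - q = (y - q) + (de - norm (y - q)) *R (inverse (real (Suc n))/2) *R b" by(simp add:z_def)
  also have "norm ... <= norm (y - q) + norm ((de - norm (y - q)) *R (inverse (real (Suc n))/2) *R b)"
   by(rule norm_triangle_ineq)
  also have "norm ((de - norm (y - q)) *R (inverse (real (Suc n))/2) *R b) = (de - norm (y - q))*(inverse (real (Suc n))/2)"
   using b y by simp
  finally show ?thesis .
  qed
  also have "(de - norm (y - q))*(inverse (real (Suc n))/2) < (de - norm (y - q))*1"
  using y by(intro mult_strict_left_mono) (auto simp:field_simps)
  finally show "norm (z n - q) < de" by simp
 qed
 have cu': "(%n. u (z n)) \<longlonglongrightarrow> u y" 
  by(rule continuous_on_tendsto_compose[OF cu z]) auto
 have "(%n. norm (u (z n) - u q - L (z n - q))) \<longlonglongrightarrow> norm (u y - u q - L (y - q))"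
  by(intro tendsto_intros cu' bounded_linear.tendsto[OF L] z)
 moreover have "(%n. e*norm (z n - q)) \<longlonglongrightarrow> e*norm (y - q)" by(intro tendsto_intros z)
 ultimately show ?thesis by(rule LIMSEQ_le) (use bd in auto)
 qed (use near y in auto)
qed
qed

section \<open>Functions smooth up to a hyperplane and their extension\<close>

definition reflect :: "'e => nat => 'e => 'e::euclidean_space" where
"reflect b k q = q - ((1 + 2^k)*(q <.> b)) *R b"

text \<open>Seeley's extension operator. For \<open>g\<close> vanishing outside a ball the series is
  a finite sum near every point with \<open>q <.> b > 0\<close>, since \<open>reflect b k q\<close>
  leaves the ball for large \<open>k\<close>.\<close>

definition sext :: "'e => (nat => real) => ('e => complex) => 'e::euclidean_space => complex" where
"sext b c g q = (if q <.> b <= 0 then g q else (\<Sum>k. c k *R g (reflect b k q)))"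

definition half_C0 :: "'e => real => ('e::euclidean_space => complex) => bool" where
"half_C0 b R g \<longleftrightarrow> continuous_on {q. q <.> b <= 0} g & (ALL q. R <= norm q --> g q = 0)"

text \<open>Smoothness up to the hyperplane without one-sided derivatives: \<open>g' v\<close> is
  tied to the derivative only in the open half space, and continuity carries it to the closed
  one.\<close>

primrec half_Ck :: "nat => 'e => real => ('e::euclidean_space => complex) => bool" where
"half_Ck 0 b R g \<longleftrightarrow> half_C0 b R g"
| "half_Ck (Suc k) b R g \<longleftrightarrow> half_C0 b R g &
 (EX g'. (ALL v. half_Ck k b R (g' v)) & (ALL q. q <.> b < 0 --> (g has_derivative (%v. g' v q)) (at q)))"

lemma half_Ck_0: "half_Ck k b R g ==> half_C0 b R g" by(cases k) auto

lemma reflect_inner: "b:Basis ==> reflect b k q <.> b = - (2^k)*(q <.> b)"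
by(simp add:reflect_def inner_diff_left algebra_simps)

lemma bounded_linear_reflect: "bounded_linear (reflect b k)"
unfolding reflect_def
by(intro bounded_linear_sub bounded_linear_ident bounded_linear_compose[OF bounded_linear_scaleR_left]
 bounded_linear_compose[OF bounded_linear_mult_right] bounded_linear_inner_left)

lemma half_Ck_bound:
assumes "half_C0 b R g"
obtains B where "0 <= B" "!!q. q <.> b <= 0 ==> cmod (g q) <= B"
proof -
have "closed {q. q <.> b <= 0}" by(rule closed_Collect_le) (auto intro!: continuous_intros)
hence "compact (cball 0 R Int {q. q <.> b <= 0})" by(rule compact_Int_closed[OF compact_cball])
moreover have "continuous_on (cball 0 R Int {q. q <.> b <= 0}) g" using assms by(auto simp:half_C0_def intro: continuous_on_subset)
ultimately have "bounded (g ` (cball 0 R Int {q. q <.> b <= 0}))" by(intro compact_imp_bounded compact_continuous_image)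
then obtain B where "ALL x:g ` (cball 0 R Int {q. q <.> b <= 0}). cmod x <= B" unfolding bounded_iff by blast
hence B: "!!q. norm q <= R ==> q <.> b <= 0 ==> cmod (g q) <= B" by auto
have "cmod (g q) <= max 0 B" if "q <.> b <= 0" for q
 using B[OF _ that] assms by(cases "norm q <= R") (auto simp:half_C0_def)
thus ?thesis by(intro that[of "max 0 B"]) auto
qed

lemma continuous_sext:
assumes b: "b:Basis" and c: "reflection_coeffs c" and g: "half_C0 b R g"
shows "continuous_on UNIV (sext b c g)"
proof -
obtain B where B: "0 <= B" "!!q. q <.> b <= 0 ==> cmod (g q) <= B" using half_Ck_bound[OF g] by blast
have sc: "summable (%k. \<bar>c k\<bar>)" "(\<Sum>k. c k) = 1"
 using c[unfolded reflection_coeffs_def, rule_format, of 0] by simp_all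
have sc': "summable c" by(rule summable_rabs_cancel[OF sc(1)])
have cl: "closed {q. q <.> b <= 0}" "closed {q. 0 <= q <.> b}" by(intro closed_Collect_le continuous_intros)+
have cont: "continuous_on {q. 0 <= q <.> b} (%q. \<Sum>k. c k *R g (reflect b k q))"
proof(rule uniform_limit_theorem)
 show "uniform_limit {q. 0 <= q <.> b} (%n q. SUM k<n. c k *R g (reflect b k q)) (%q. \<Sum>k. c k *R g (reflect b k q)) sequentially"
 proof(rule Weierstrass_m_test[where M = "%k. \<bar>c k\<bar>*B"])
 show "norm (c k *R g (reflect b k q)) <= \<bar>c k\<bar>*B" if "q:{q. 0 <= q <.> b}" for k q
  unfolding norm_scaleR using that by(intro mult_mono B(2)) (simp_all add:reflect_inner[OF b])
 show "summable (%k. \<bar>c k\<bar>*B)" by(rule summable_mult2[OF sc(1)])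
 qed
 have "continuous_on {q. 0 <= q <.> b} (%q. g (reflect b k q))" for k
 proof(rule continuous_on_compose2[of "{q. q <.> b <= 0}" g])
 show "continuous_on {q. q <.> b <= 0} g" using g by(simp add:half_C0_def)
 show "continuous_on {q. 0 <= q <.> b} (reflect b k)"
  by(rule linear_continuous_on[OF bounded_linear_reflect])
 qed (use reflect_inner[OF b] in auto)
 thus "\<forall>\<^sub>F n in sequentially. continuous_on {q. 0 <= q <.> b} (%q. SUM k<n. c k *R g (reflect b k q))"
 by(intro always_eventually allI continuous_on_sum continuous_on_scaleR continuous_on_const)
qed simp
have "continuous_on ({q. q <.> b <= 0} Un {q. 0 <= q <.> b}) (%q. if q <.> b <= 0 then g q else (\<Sum>k. c k *R g (reflect b k q)))"
proof(rule continuous_on_cases[OF cl _ cont], goal_cases)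
 case 1 show ?case using g by(simp add:half_C0_def)
next
 case 2
 have "g q = (\<Sum>k. c k *R g (reflect b k q))" if "q <.> b = 0" for q
 using suminf_scaleR_left[OF sc', of "g q"] sc(2) that by(simp add:reflect_def)
 thus ?case by auto
qed
moreover have "{q. q <.> b <= 0} Un {q. 0 <= q <.> b} = UNIV" by auto
ultimately show ?thesis by(simp add:sext_def[abs_def])
qed

text \<open>The derivative of an extension along \<open>i\<close> is the extension of
  \<open>g' i\<close> with the same coefficients, or with the shifted ones if \<open>i = b\<close>;
  hence the induction runs over all admissible \<open>c\<close>.\<close>

lemma Ck_on_sext:
assumes b: "b:Basis"
shows "reflection_coeffs c ==> half_Ck k b R g ==> Ck_on k UNIV (sext b c g)"
proof(induction k arbitrary: c g)
case 0
thus ?case using continuous_sext[OF b] by auto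
next
case (Suc k)
note c = Suc.prems(1)
have g0: "half_C0 b R g" by(rule half_Ck_0[OF Suc.prems(2)])
obtain g' where g': "!!v. half_Ck k b R (g' v)" and D: "!!q. q <.> b < 0 ==> (g has_derivative (%v. g' v q)) (at q)"
 using Suc.prems(2) by auto
define ci where "ci i = (if i = b then (%k. c k*- (2^k)) else c)" for i
have ci: "reflection_coeffs (ci i)" for i using c reflection_coeffs_shift[OF c] by(simp add:ci_def)
define U where "U i = sext b (ci i) (g' i)" for i
have lin: "g' v q = (SUM i:Basis. (v <.> i) *R g' i q)" if "q <.> b < 0" for v q
proof -
 interpret l: bounded_linear "%v. g' v q" by(rule has_derivative_bounded_linear[OF D[OF that]])
 have "g' v q = g' (SUM i:Basis. (v <.> i) *R i) q" by(simp only: euclidean_representation)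
 thus ?thesis by(simp only: l.sum l.scaleR)
qed
have "(sext b c g has_derivative (%v. SUM i:Basis. (v <.> i) *R U i q)) (at q)" for q
proof(rule has_derivative_across_hyperplane[OF b continuous_sext[OF b c g0]])
 show "continuous_on UNIV (U i)" for i unfolding U_def by(rule continuous_sext[OF b ci half_Ck_0[OF g']])
 fix q :: 'a assume "q <.> b ~= 0"
 then consider "q <.> b < 0" | "q <.> b > 0" by linarith
 thus "(sext b c g has_derivative (%v. SUM i:Basis. (v <.> i) *R U i q)) (at q)"
 proof cases
 case 1
 have "open {q. q <.> b < 0}" by(intro open_Collect_less continuous_intros)
 moreover have "(%v. SUM i:Basis. (v <.> i) *R U i q) = (%v. g' v q)"
 proof
  fix v
  have "U i q = g' i q" for i using 1 by(simp add:U_def sext_def)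
  thus "(SUM i:Basis. (v <.> i) *R U i q) = g' v q" by(simp only: lin[OF 1, of v])
 qed
 ultimately show ?thesis
  using has_derivative_transform_within_open[OF D[OF 1], of "{q. q <.> b < 0}" "sext b c g"] 1 by(simp add:sext_def)
 next
 case 2
 define V where "V = {p. q <.> b/2 < p <.> b}"
 have V: "open V" "q:V" unfolding V_def using 2 by(auto intro!: open_Collect_less continuous_intros)
 \<comment> \<open>From the index \<open>m\<close> on, the reflected points of \<open>V\<close> lie
   outside the ball of radius \<open>R\<close>, so that the series is a finite sum on
   \<open>V\<close> and can be differentiated termwise.\<close>
 obtain m where m: "R < (q <.> b/2)*2^m"
 proof -
  obtain m where "R/(q <.> b/2) < 2^m" using real_arch_pow[of 2] by auto
  thus ?thesis using 2 by(intro that[of m]) (simp add:field_simps)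
 qed
 have zero: "h (reflect b k p) = 0" if "p:V" "m <= k" "half_C0 b R h" for p k and h :: "'a => complex"
 proof -
  have "(q <.> b/2)*2^m <= (p <.> b)*2^k" using that(1,2) 2 by(intro mult_mono) (auto simp:V_def)
  also have "... = \<bar>reflect b k p <.> b\<bar>" using that(1) 2 by(simp add:reflect_inner[OF b] V_def abs_mult)
  also have "... <= norm (reflect b k p)" by(rule Basis_le_norm[OF b])
  finally show ?thesis using m that(3) by(simp add:half_C0_def)
 qed
 have fin: "(\<Sum>k. d k *R h (reflect b k p)) = (SUM k<m. d k *R h (reflect b k p))"
  if "p:V" "half_C0 b R h" for p and d :: "nat => real" and h :: "'a => complex"
  by(rule suminf_finite) (use zero[OF that(1) _ that(2)] in auto)
 have pos: "~ p <.> b <= 0" if "p:V" for p using that 2 by(auto simp:V_def)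
 have "((%p. SUM k<m. c k *R g (reflect b k p)) has_derivative (%v. SUM k<m. c k *R g' (reflect b k v) (reflect b k q))) (at q)"
 proof(rule has_derivative_sum, rule has_derivative_scaleR_right)
  fix k
  have "reflect b k q <.> b < 0" using 2 by(simp add:reflect_inner[OF b])
  from diff_chain_at[OF bounded_linear_imp_has_derivative[OF bounded_linear_reflect] D[OF this]]
  show "((%p. g (reflect b k p)) has_derivative (%v. g' (reflect b k v) (reflect b k q))) (at q)" by(simp add:o_def)
 qed
 moreover have "(SUM k<m. c k *R g' (reflect b k v) (reflect b k q)) = (SUM i:Basis. (v <.> i) *R U i q)" for v
 proof -
  have "c k *R g' (reflect b k v) (reflect b k q) = (SUM i:Basis. (v <.> i) *R (ci i k *R g' i (reflect b k q)))" for k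
  proof -
  have "reflect b k q <.> b < 0" using 2 by(simp add:reflect_inner[OF b])
  hence "c k *R g' (reflect b k v) (reflect b k q) = (SUM i:Basis. (c k*(reflect b k v <.> i)) *R g' i (reflect b k q))"
   by(subst lin) (simp_all add:scaleR_sum_right)
  also have "... = (SUM i:Basis. (v <.> i) *R (ci i k *R g' i (reflect b k q)))"
  proof(rule sum.cong[OF refl])
   fix i :: 'a assume i: "i:Basis"
   have "c k*(reflect b k v <.> i) = (v <.> i)*ci i k"
   proof(cases "i = b")
   case True thus ?thesis by(simp add:reflect_inner[OF b] ci_def)
   next
   case False thus ?thesis using i b by(simp add:reflect_def inner_diff_left inner_Basis ci_def)
   qed
   thus "(c k*(reflect b k v <.> i)) *R g' i (reflect b k q) = (v <.> i) *R (ci i k *R g' i (reflect b k q))"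
   by(simp only: scaleR_scaleR)
  qed
  finally show ?thesis .
  qed
  hence "(SUM k<m. c k *R g' (reflect b k v) (reflect b k q)) = (SUM i:Basis. (v <.> i) *R (SUM k<m. ci i k *R g' i (reflect b k q)))"
  unfolding scaleR_sum_right by(subst sum.swap) simp
  thus ?thesis using pos[OF V(2)] by(simp add:U_def sext_def fin[OF V(2) half_Ck_0[OF g']])
 qed
 ultimately have "((%p. SUM k<m. c k *R g (reflect b k p)) has_derivative (%v. SUM i:Basis. (v <.> i) *R U i q)) (at q)" by simp
 thus ?thesis
  by(rule has_derivative_transform_within_open[OF _ V]) (simp add:sext_def pos fin[OF _ g0])
 qed
qed
thus ?case
proof(rule Ck_on_SucI[OF open_UNIV])
 have "Ck_on k UNIV (U i)" for i unfolding U_def by(rule Suc.IH[OF ci g'])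
 thus "Ck_on k UNIV (%x. SUM i:Basis. (v <.> i) *R U i x)" for v
 by(intro Ck_on_sum Ck_on_scaleR open_UNIV Ck_on_const)
qed
qed

primrec half_smooth :: "nat => 'e set => 'e => ('e::euclidean_space => complex) => bool" where
"half_smooth 0 D b g \<longleftrightarrow> continuous_on (D Int {q. q <.> b <= 0}) g"
| "half_smooth (Suc k) D b g \<longleftrightarrow> continuous_on (D Int {q. q <.> b <= 0}) g &
 (EX g'. (ALL v. half_smooth k D b (g' v)) & (ALL q:D. q <.> b < 0 --> (g has_derivative (%v. g' v q)) (at q)))"

lemma half_smooth_0: "half_smooth k D b g ==> continuous_on (D Int {q. q <.> b <= 0}) g" by(cases k) auto

lemma half_smooth_Suc: "half_smooth (Suc k) D b g ==> half_smooth k D b g"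
proof(induction k arbitrary: g)
case (Suc k)
from Suc.prems obtain g' where g': "ALL v. half_smooth (Suc k) D b (g' v)" "ALL q:D. q <.> b < 0 --> (g has_derivative (%v. g' v q)) (at q)"
 unfolding half_smooth.simps(2)[of "Suc k"] by blast
hence "ALL v. half_smooth k D b (g' v)" using Suc.IH by blast
thus ?case using g'(2) half_smooth_0[OF Suc.prems] by auto
qed simp

lemma half_smooth_add: "half_smooth k D b f ==> half_smooth k D b g ==> half_smooth k D b (%q. f q + g q)"
proof(induction k arbitrary: f g)
case (Suc k)
from Suc.prems obtain f' g' where d: "ALL v. half_smooth k D b (f' v)" "ALL q:D. q <.> b < 0 --> (f has_derivative (%v. f' v q)) (at q)"
 "ALL v. half_smooth k D b (g' v)" "ALL q:D. q <.> b < 0 --> (g has_derivative (%v. g' v q)) (at q)" by auto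
have "continuous_on (D Int {q. q <.> b <= 0}) (%q. f q + g q)"
 by(intro continuous_on_add half_smooth_0[OF Suc.prems(1)] half_smooth_0[OF Suc.prems(2)])
moreover have "ALL v. half_smooth k D b (%q. f' v q + g' v q)" using Suc.IH d by blast
moreover have "ALL q:D. q <.> b < 0 --> ((%q. f q + g q) has_derivative (%v. f' v q + g' v q)) (at q)"
 using d by(auto intro: has_derivative_add)
ultimately show ?case unfolding half_smooth.simps by(intro conjI exI[of _ "%v q. f' v q + g' v q"])
qed (auto intro: continuous_on_add)

lemma half_Ck_add: "half_Ck k b R f ==> half_Ck k b R g ==> half_Ck k b R (%q. f q + g q)"
proof(induction k arbitrary: f g)
case (Suc k)
from Suc.prems obtain f' g' where d: "ALL v. half_Ck k b R (f' v)" "ALL q. q <.> b < 0 --> (f has_derivative (%v. f' v q)) (at q)"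
 "ALL v. half_Ck k b R (g' v)" "ALL q. q <.> b < 0 --> (g has_derivative (%v. g' v q)) (at q)" by auto
have "half_C0 b R (%q. f q + g q)"
 using half_Ck_0[OF Suc.prems(1)] half_Ck_0[OF Suc.prems(2)] by(auto simp:half_C0_def intro: continuous_on_add)
moreover have "ALL v. half_Ck k b R (%q. f' v q + g' v q)" using Suc.IH d by blast
moreover have "ALL q. q <.> b < 0 --> ((%q. f q + g q) has_derivative (%v. f' v q + g' v q)) (at q)"
 using d by(auto intro: has_derivative_add)
ultimately show ?case unfolding half_Ck.simps by(intro conjI exI[of _ "%v q. f' v q + g' v q"])
qed (auto simp:half_C0_def intro: continuous_on_add)

lemma half_C0_cutoff:
assumes D: "open D" "compact K" "K <= D" "K <= ball 0 R"
 and g: "continuous_on (D Int {q. q <.> b <= 0}) g" and e1: "Cinf_on UNIV ey" and e2: "!!q. q~:K ==> ey q = 0"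
shows "half_C0 b R (%q. if q:D then ey q*g q else 0)"
proof -
let ?S = "{q. q <.> b <= 0}"
have e: "(?S Int D) Un (?S - K) = ?S" using D(3) by auto
have "continuous_on ((?S Int D) Un (?S - K)) (%q. if q:D then ey q*g q else 0)"
proof(rule continuous_on_cases_local_open)
 show "openin (top_of_set (?S Int D Un (?S - K))) (?S Int D)" unfolding e using D(1) by(simp add:openin_open_Int)
 have "openin (top_of_set ?S) (?S Int - K)" using compact_imp_closed[OF D(2)] by(intro openin_open_Int) auto
 thus "openin (top_of_set (?S Int D Un (?S - K))) (?S - K)" unfolding e by(simp add:Diff_eq)
 have "continuous_on (?S Int D) g" using g by(simp add:Int_commute)
 thus "continuous_on (?S Int D) (%q. ey q*g q)"
 by(intro continuous_on_mult continuous_on_subset[OF Cinf_cont[OF e1] subset_UNIV])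
qed (use e2 in auto)
moreover have "q~:K" if "R <= norm q" for q using that D(4) by auto
ultimately show ?thesis using e2 by(auto simp:e half_C0_def)
qed

lemma half_Ck_cutoff:
assumes D: "open D" "compact K" "K <= D" "K <= ball 0 R"
shows "half_smooth k D b g ==> Cinf_on UNIV ey ==> (!!q. q~:K ==> ey q = 0) ==> half_Ck k b R (%q. if q:D then ey q*g q else 0)"
proof(induction k arbitrary: g ey)
case (0 g ey)
thus ?case using half_C0_cutoff[OF D] by simp
next
case (Suc k g ey)
obtain g' where g': "ALL v. half_smooth k D b (g' v)" "ALL q:D. q <.> b < 0 --> (g has_derivative (%v. g' v q)) (at q)"
 using Suc.prems(1) by auto
define E where "E f g q = (if q:D then f q*g q else 0)" for f g :: "'a => complex" and q
have z: "dd v ey q = 0" if "q~:K" for v q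
proof -
 have "dd v ey q = dd v (%_. 0) q"
 by(rule dd_cong[of "- K"]) (use compact_imp_closed[OF D(2)] that Suc.prems(3) in auto)
 moreover have "dd v (%_. 0 :: complex) q = 0" by(rule dd_eq) simp
 ultimately show ?thesis by simp
qed
have IH: "half_Ck k b R (E f h)" if "half_smooth k D b h" "Cinf_on UNIV f" "!!q. q~:K ==> f q = 0" for f h
 unfolding E_def using Suc.IH[OF that] .
have "ALL v. half_Ck k b R (%q. E (dd v ey) g q + E ey (g' v) q)"
 by(intro allI half_Ck_add IH half_smooth_Suc[OF Suc.prems(1)] Cinf_dd Suc.prems(2,3) z g'(1)[rule_format])
moreover have "(E ey g has_derivative (%v. E (dd v ey) g q + E ey (g' v) q)) (at q)" if q: "q <.> b < 0" for q
proof(cases "q:D")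
 case True
 have "((%q. ey q*g q) has_derivative (%v. ey q*g' v q + dd v ey q*g q)) (at q)"
 by(rule has_derivative_mult[OF Cinf_deriv[OF Suc.prems(2)]]) (use g'(2) True q in auto)
 from has_derivative_transform_within_open[OF this D(1) True, of "E ey g"]
 show ?thesis using True by(simp add:E_def add.commute)
next
 case False
 have "((%_. 0) has_derivative (%v. 0 :: complex)) (at q)" by simp
 hence "(E ey g has_derivative (%v. 0)) (at q)"
 by(rule has_derivative_transform_within_open[of _ _ _ _ "- K"])
  (use False D(3) compact_imp_closed[OF D(2)] Suc.prems(3) in "auto simp: E_def")
 moreover have "E f h q = 0" for f h using False by(simp add:E_def)
 ultimately show ?thesis by(simp only: add_0)
qed
moreover have "half_C0 b R (E ey g)" unfolding E_def
 by(rule half_C0_cutoff[OF D half_smooth_0[OF Suc.prems(1)] Suc.prems(2,3)])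
ultimately have "half_Ck (Suc k) b R (E ey g)"
 unfolding half_Ck.simps by(intro conjI exI[of _ "%v q. E (dd v ey) g q + E ey (g' v) q"]) auto
thus ?case by(simp only: E_def[abs_def])
qed

lemma Seeley_extension:
fixes g :: "'e::euclidean_space => complex"
assumes b: "b:Basis" and D: "open D" "x0:D" and g: "!!k. half_smooth k D b g"
obtains W G where "open W" "x0:W" "W <= D" "Cinf_on UNIV G" "!!q. q:W ==> q <.> b <= 0 ==> G q = g q"
proof -
obtain e where e: "0 < e" "cball x0 e <= D" using D open_contains_cball by blast
have "- (e^2) < - ((e/2)^2)" using e by(simp add:power2_eq_square)
then obtain tt :: "real => real" where tt: "Cinf_on UNIV tt" "!!x. x <= - (e^2) ==> tt x = 0" "!!x. - ((e/2)^2) <= x ==> tt x = 1"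
 "!!x. 0 <= tt x" "!!x. tt x <= 1"
 by(rule smooth_cutoff) blast
define ey where "ey q = cor (tt (- (SUM i:Basis. ((q - x0) <.> i)*((q - x0) <.> i))))" for q :: 'e
have ey: "ey q = cor (tt (- (norm (q - x0)^2)))" for q
 unfolding ey_def power2_norm_eq_inner euclidean_inner[of "q - x0" "q - x0"] ..
have e1: "Cinf_on UNIV ey" unfolding ey_def
 by(intro Cinf_of_real open_UNIV Cinf_compose[OF open_UNIV open_UNIV _ _ tt(1)] Cinf_minus Cinf_sum Cinf_mult
 Cinf_compose_linear[OF bounded_linear_inner_left] Cinf_diff Cinf_id Cinf_const) auto
have e2: "ey q = 0" if "q~:cball x0 e" for q
 using that e by(simp add:ey tt(2) power_mono dist_norm norm_minus_commute)
have h: "half_Ck k b (norm x0 + e + 1) (%q. if q:D then ey q*g q else 0)" for k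
proof(rule half_Ck_cutoff[OF D(1) compact_cball e(2) _ g e1 e2])
 show "cball x0 e <= ball 0 (norm x0 + e + 1)"
 proof
 fix x assume "x:cball x0 e"
 thus "x:ball 0 (norm x0 + e + 1)" using norm_triangle_ineq2[of x x0] by(simp add:dist_norm norm_minus_commute)
 qed
qed
obtain c where c: "reflection_coeffs c" using reflection_coeffs_exist ..
show ?thesis
proof(rule that[of "ball x0 (e/2)" "sext b c (%q. if q:D then ey q*g q else 0)"])
 show "ball x0 (e/2) <= D" using e by auto
 show "Cinf_on UNIV (sext b c (%q. if q:D then ey q*g q else 0))"
 unfolding Cinf_on_def using Ck_on_sext[OF b c h] by blast
 fix q assume q: "q:ball x0 (e/2)" "q <.> b <= 0"
 hence "ey q = 1" using power_mono[of "norm (q - x0)" "e/2" 2] by(simp add:ey tt(3) dist_norm norm_minus_commute)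
 moreover have "q:D" using q e by auto
 ultimately show "sext b c (%q. if q:D then ey q*g q else 0) q = g q" using q by(simp add:sext_def)
qed (use e in auto)
qed

section \<open>Adapted coordinates at a boundary point\<close>

text \<open>\<open>cof_row\<close> exhibits a right inverse of the matrix; for square matrices it is
  also a left inverse.\<close>

lemma cof_col:
fixes tt :: "'e::euclidean_space => 'e => complex"
assumes "jac tt ~= 0" "k:Basis" "l:Basis"
shows "(SUM i:Basis. cof tt i k*tt i l) = (if k = l then jac tt else 0)"
proof -
define B where "B = (\<chi> k i. cof tt (Rep_bix i) (Rep_bix k)/jac tt :: complex^('e bix)^('e bix))"
have "jmat tt ** B = mat 1"
proof -
 have "(SUM k:UNIV. tt (Rep_bix l) (Rep_bix k)*(cof tt (Rep_bix i) (Rep_bix k)/jac tt)) = (if l = i then 1 else 0)" for l i :: "'e bix"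
 proof -
 have "(SUM k:UNIV. tt (Rep_bix l) (Rep_bix k)*(cof tt (Rep_bix i) (Rep_bix k)/jac tt)) =
  (SUM k:Basis. tt (Rep_bix l) k*(cof tt (Rep_bix i) k/jac tt))" by(rule sum_bix)
 also have "... = (SUM k:Basis. cof tt (Rep_bix i) k*tt (Rep_bix l) k)/jac tt" by(simp add:sum_divide_distrib mult_ac)
 also have "... = (if l = i then 1 else 0)" using assms(1) by(simp add:cof_row[OF Rep_bix Rep_bix] Rep_bix_inject)
 finally show ?thesis .
 qed
 thus ?thesis by(simp add:matrix_matrix_mult_def jmat_def B_def mat_def vec_eq_iff)
qed
hence "B ** jmat tt = mat 1" by(simp add:matrix_left_right_inverse)
hence "(B ** jmat tt) $ Abs_bix k $ Abs_bix l = mat 1 $ Abs_bix k $ Abs_bix l" by simp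
hence "(SUM i:UNIV. cof tt (Rep_bix i) k/jac tt*tt (Rep_bix i) l) = (if k = l then 1 else 0)"
 using assms(2,3) by(simp add:matrix_matrix_mult_def jmat_def B_def mat_def Rep_Abs_bix Abs_bix_inject)
hence "(SUM i:Basis. cof tt i k/jac tt*tt i l) = (if k = l then 1 else 0)"
 by(simp only: sum_bix[of "%i. cof tt i k/jac tt*tt i l"])
hence "(SUM i:Basis. cof tt i k*tt i l)/jac tt = (if k = l then 1 else 0)" by(simp add:sum_divide_distrib)
thus ?thesis using assms(1) by(auto simp:field_simps split: if_splits)
qed

text \<open>At an index where the modulus of \<open>w\<close> is maximal, the deviation from the
  identity contributes at most half of the maximum.\<close>

lemma near_identity:
fixes A :: "'c => 'c => complex"
assumes C: "finite C" "real (card C) <= n" "0 < n"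
 and A: "!!c d. c:C ==> d:C ==> cmod (A c d - (if c = d then 1 else 0)) <= 1/(2*n)"
 and w: "!!c. c:C ==> (SUM d:C. A c d*w d) = 0" and c: "c:C"
shows "w c = 0"
proof -
define M where "M = Max ((%c. cmod (w c)) ` C)"
have le: "cmod (w d) <= M" if "d:C" for d unfolding M_def using C that by(intro Max_ge) auto
have "M:(%c. cmod (w c)) ` C" unfolding M_def using C c by(intro Max_in) auto
then obtain e where e: "e:C" "M = cmod (w e)" by auto
have M0: "0 <= M" using e by simp
have "(SUM d:C. (if e = d then 1 else 0)*w d) = (SUM d:C. if d = e then w d else 0)" by(rule sum.cong) auto
hence "w e = (SUM d:C. (if e = d then 1 else 0)*w d)" using C e by simp
hence "w e = - (SUM d:C. (A e d - (if e = d then 1 else 0))*w d)"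
 using w[OF e(1)] unfolding left_diff_distrib sum_subtractf by simp
hence "M = cmod (SUM d:C. (A e d - (if e = d then 1 else 0))*w d)" using e(2) by(metis norm_minus_cancel)
also have "... <= (SUM d:C. 1/(2*n)*M)"
 by(rule sum_norm_le) (unfold norm_mult, intro mult_mono A e le, use C in auto)
also have "... = real (card C)*(1/(2*n)*M)" by simp
also have "... <= n*(1/(2*n)*M)" using C M0 by(intro mult_right_mono) auto
also have "... = M/2" using C by simp
finally show ?thesis using le[OF c] M0 by simp
qed

text \<open>Gaussian elimination by induction on the number of rows: the new row is reduced by the
  present pivots, and if the remainder \<open>R\<close> is not 0, a column where it is nonzero
  becomes a pivot and is cleared from the other combinations. For the differentials of CR
  coordinates this picks the directions \<open>I\<close>.\<close>

lemma echelon: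
fixes l :: "nat => 'c => complex"
assumes B: "finite B"
shows "EX I a. I <= B & (ALL j:I. ALL k:I. (SUM i<m. a j i*l i k) = (if k = j then 1 else 0)) &
 (ALL i<m. ALL k:B. l i k = (SUM j:I. l i j*(SUM i'<m. a j i'*l i' k)))"
proof(induction m)
case 0 show ?case by(rule exI[of _ "{}"]) simp
next
case (Suc m)
then obtain I a where I: "I <= B" "ALL j:I. ALL k:I. (SUM i<m. a j i*l i k) = (if k = j then 1 else 0)"
 "ALL i<m. ALL k:B. l i k = (SUM j:I. l i j*(SUM i'<m. a j i'*l i' k))" by blast
have fI: "finite I" using I(1) B finite_subset by blast
define L where "L j k = (SUM i<m. a j i*l i k)" for j k
have L: "!!j k. j:I ==> k:I ==> L j k = (if k = j then 1 else 0)" "!!i k. i < m ==> k:B ==> l i k = (SUM j:I. l i j*L j k)"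
 using I by(auto simp:L_def)
define R where "R k = l m k - (SUM j:I. l m j*L j k)" for k
show ?case
proof(cases "ALL k:B. R k = 0")
 case True
 have e: "(SUM i<Suc m. (if i < m then a j i else 0)*l i k) = L j k" for j k by(simp add:L_def)
 have "l i k = (SUM j:I. l i j*L j k)" if "i < Suc m" "k:B" for i k
 using that L(2)[of i k] True by(cases "i = m") (auto simp:R_def)
 thus ?thesis
 by(intro exI[of _ I] exI[of _ "%j i. if i < m then a j i else 0"], unfold e)
  (intro conjI ballI allI impI I(1) L(1); assumption)
next
 case False
 then obtain k0 where k0: "k0:B" "R k0 ~= 0" by blast
 have RI: "R k = 0" if "k:I" for k
 proof -
 have "(SUM j:I. l m j*L j k) = (SUM j:I. if j = k then l m j else 0)" by(rule sum.cong) (use L(1) that in auto)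
 thus ?thesis using fI that by(simp add:R_def)
 qed
 hence k0I: "k0~:I" using k0 by auto
 \<comment> \<open>The coefficients of the new pivot row: the reduced row, normalised to 1 at
   \<open>k0\<close>.\<close>
 define be where "be i = (if i < m then - (SUM j:I. l m j*a j i) else 1)/R k0" for i
 define a' where "a' j i = (if j = k0 then be i else (if i < m then a j i else 0) - L j k0*be i)" for j i
 define Q where "Q k = R k/R k0" for k
 have Q: "(SUM i<Suc m. be i*l i k) = Q k" for k
 proof -
 have "(SUM i<m. be i*l i k) = - (SUM j:I. l m j*L j k)/R k0"
  unfolding be_def L_def sum_distrib_left
  by(subst sum.swap) (simp add:sum_distrib_left sum_distrib_right sum_divide_distrib sum_negf mult_ac)
 thus ?thesis by(simp add:be_def Q_def R_def diff_divide_distrib)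
 qed
 have L': "(SUM i<Suc m. a' j i*l i k) = (if j = k0 then Q k else L j k - L j k0*Q k)" for j k
 proof(cases "j = k0")
 case False
 have "(SUM i<Suc m. a' j i*l i k) = (SUM i<Suc m. (if i < m then a j i else 0)*l i k) - L j k0*(SUM i<Suc m. be i*l i k)"
  using False by(simp only: a'_def if_False left_diff_distrib sum_subtractf sum_distrib_left mult.assoc)
 thus ?thesis using False unfolding Q by(simp add:L_def)
 qed (simp add:a'_def Q[symmetric])
 have Q1: "Q k0 = 1" "!!k. k:I ==> Q k = 0" using k0 RI by(auto simp:Q_def)
 have span: "l i k = (SUM j:insert k0 I. l i j*(if j = k0 then Q k else L j k - L j k0*Q k))" if i: "i < Suc m" and k: "k:B" for i k
 proof -
 have "(SUM j:I. l i j*(if j = k0 then Q k else L j k - L j k0*Q k)) = (SUM j:I. l i j*L j k) - Q k*(SUM j:I. l i j*L j k0)"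
  unfolding sum_distrib_left sum_subtractf[symmetric] by(rule sum.cong[OF refl]) (use k0I in "auto simp: algebra_simps")
 hence e: "(SUM j:insert k0 I. l i j*(if j = k0 then Q k else L j k - L j k0*Q k)) =
  Q k*(l i k0 - (SUM j:I. l i j*L j k0)) + (SUM j:I. l i j*L j k)"
  using fI k0I by(simp add:algebra_simps)
 show ?thesis
 proof(cases "i = m")
  case True
  have "Q k * R k0 = R k" using k0 by(simp add:Q_def)
  thus ?thesis unfolding e using True by(simp add:R_def)
 next
  case False
  thus ?thesis unfolding e using i L(2)[of i k] L(2)[of i k0] k k0 by simp
 qed
 qed
 show ?thesis
 proof(rule exI[of _ "insert k0 I"], rule exI[of _ a'], unfold L', intro conjI ballI allI impI span)
 show "insert k0 I <= B" using I(1) k0(1) by simp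
 fix j k assume "j:insert k0 I" "k:insert k0 I"
 thus "(if j = k0 then Q k else L j k - L j k0*Q k) = (if k = j then 1 else 0)"
  by(elim insertE) (use k0I Q1 L(1) in auto)
 qed
qed
qed

lemma half_smooth_mult:
assumes D: "open D"
shows "half_smooth k D b g ==> Cinf_on D a ==> half_smooth k D b (%q. a q*g q)"
proof(induction k arbitrary: g a)
case 0
thus ?case by(auto intro!: continuous_on_mult continuous_on_subset[OF Cinf_cont[OF 0(2)]])
next
case (Suc k)
obtain g' where g': "ALL v. half_smooth k D b (g' v)" "ALL q:D. q <.> b < 0 --> (g has_derivative (%v. g' v q)) (at q)"
 using Suc.prems(1) by auto
have "half_smooth k D b (%q. a q*g' v q + dd v a q*g q)" for v
 by(intro half_smooth_add Suc.IH g'(1)[rule_format] Suc.prems Cinf_dd half_smooth_Suc)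
moreover have "ALL q:D. q <.> b < 0 --> ((%q. a q*g q) has_derivative (%v. a q*g' v q + dd v a q*g q)) (at q)"
 by(intro ballI impI has_derivative_mult Cinf_deriv[OF Suc.prems(2)] g'(2)[rule_format])
moreover have "continuous_on (D Int {q. q <.> b <= 0}) (%q. a q*g q)"
 by(intro continuous_on_mult half_smooth_0[OF Suc.prems(1)] continuous_on_subset[OF Cinf_cont[OF Suc.prems(2)]]) auto
ultimately show ?case unfolding half_smooth.simps by(intro conjI exI[of _ "%v q. a q*g' v q + dd v a q*g q"]) auto
qed

lemma half_smooth_sum:
assumes "finite J"
shows "(!!i. i:J ==> half_smooth k D b (g i)) ==> half_smooth k D b (%q. SUM i:J. g i q)"
using assms
proof(induction J rule: finite_induct)
case empty
have "half_smooth k D b (%q. 0)" for k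
proof(induction k)
 case (Suc k) thus ?case by(auto intro!: exI[of _ "%v q. 0"])
qed simp
thus ?case by simp
qed (simp add:half_smooth_add)

context cr_manifold begin

text \<open>Three kinds of directions: \<open>b\<close> is transversal to the hypersurface, in the
  directions \<open>I\<close> the CR functions \<open>Zm\<close> serve as coordinates, and each
  remaining direction \<open>c\<close> carries a (0,1) field \<open>Y c\<close> tangent to the level
  sets of the coordinate \<open>b\<close>.\<close>

definition adapted ::
"'p => 'e => 'e set => 'p set => ('p => 'e) => ('e => 'p) => ('e => 'p => complex) => ('e => 'p => 'p cvec) => bool" where
"adapted p b I V ka ka' Zm Y \<longleftrightarrow> lchart V ka ka' & p:V & ka p = 0 & b:Basis & I <= Basis - {b} &
 (ALL i:I. smooth V (Zm i) & (ALL q:V. ALL Z:T01 q. Z (Zm i) = 0)) &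
 (ALL i:I. ALL j:I. pd ka ka' j (Zm i) p = (if j = i then 1 else 0)) &
 (ALL c:Basis - {b} - I. smooth_field V (Y c) & (ALL q:V. Y c q:T01 q & Y c q (xc ka b) = 0) &
  (ALL d:Basis - {b} - I. Y c p (xc ka d) = (if c = d then 1 else 0)))"

text \<open>The echelon form is applied to the differentials of the \<open>z i\<close> at
  \<open>p\<close> in the directions other than \<open>b\<close>. For \<open>c\<close> outside the
  pivots the coordinate vector minus its pivot part annihilates all \<open>z i\<close>, hence is of
  type (0,1); it is the vector \<open>Lc c\<close>.\<close>

lemma adapted_coordinates:
assumes cc: "CR_coords U m z" "p:U" and V0: "open V0" "p:V0" "smooth V0 (%q. cor (rh q))" "rh p = 0"
 and Y0: "Y0:T01 p" "Y0 (%q. cor (rh q)) ~= 0"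
obtains b I V ka ka' Zm Y where "adapted p b I V ka ka' Zm Y" "V <= U Int V0" "ALL q:V. ka q <.> b = rh q"
proof -
have oU: "open U" by(rule CR_coords_open[OF cc(1)])
have snrh: "smooth_near p (%q. cor (rh q))" by(rule smooth_nearI[OF V0(1-3)])
obtain V1' ka1 ka1' where l0: "lchart V1' ka1 ka1'" "p:V1'" using lchart_exists by blast
have l1: "lchart (V1' Int (U Int V0)) ka1 ka1'" "p:V1' Int (U Int V0)"
 by(rule lchart_subset[OF l0(1)]) (use l0(2) cc(2) V0(1,2) oU lchart_open[OF l0(1)] in auto)
have "EX b:Basis. pd ka1 ka1' b (%q. cor (rh q)) p ~= 0"
proof(rule ccontr)
 assume "~ ?thesis"
 hence "Y0 (%q. cor (rh q)) = 0" by(simp add:CT_pd[OF l1 T01_CT[OF Y0(1)] snrh])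
 thus False using Y0(2) by simp
qed
then obtain b where b: "b:Basis" "dd b (%x. cor (rh (ka1' x))) (ka1 p) ~= 0" by(auto simp:pd_def)
obtain V3 ka2 ka2' where V3: "lchart V3 ka2 ka2'" "p:V3" "V3 <= V1' Int (U Int V0)"
 and ka2: "!!q. q:V3 ==> ka2 q = ka1 q + (rh q - ka1 q <.> b) *R b"
 by(rule lchart_replace[OF l1 b(1) snrh b(2)]) blast
define ka ka' where "ka q = ka2 q - ka2 p" and "ka' x = ka2' (x + ka2 p)" for q x
have l: "lchart V3 ka ka'" unfolding ka_def[abs_def] ka'_def[abs_def] by(rule lchart_translate[OF V3(1)])
note lp = l V3(2)
have kab: "ka q <.> b = rh q" if "q:V3" for q
 using ka2[OF that] ka2[OF V3(2)] b(1) V0(4) by(simp add:ka_def inner_diff_left inner_add_left)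
define B where "B = Basis - {b}"
define lz where "lz i k = pd ka ka' k (z i) p" for i k
obtain I a where I: "I <= B" "ALL j:I. ALL k:I. (SUM i<m. a j i*lz i k) = (if k = j then 1 else 0)"
 "ALL i<m. ALL k:B. lz i k = (SUM j:I. lz i j*(SUM i'<m. a j i'*lz i' k))"
 using echelon[where B = B and m = m and l = lz] by(auto simp:B_def)
have fI: "finite I" by(rule finite_subset[OF I(1)]) (simp add:B_def)
define Zm where "Zm j q = (SUM i<m. a j i*z i q)" for j q
have sz: "smooth_near q (z i)" if "i < m" "q:U" for i q by(rule smooth_nearI[OF oU that(2) CR_coords_smooth[OF cc(1) that(1)]])
have vZm: "v (Zm j) = (SUM i<m. a j i * v (z i))" if "v:CT q" "q:U" for v q j
 unfolding Zm_def[abs_def] by(subst CT_sum[OF that(1)]) (auto intro!: smooth_near_mult sz that(2) simp:CT_cmult[OF that(1) sz[OF _ that(2)]])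
have sZm: "smooth V3 (Zm j)" for j
 unfolding Zm_def[abs_def] using V3(3) CR_coords_smooth[OF cc(1)]
 by(intro smooth_sum smooth_mult smooth_const lchart_open[OF l]) (auto intro: smooth_subset)
have pdZm: "pd ka ka' k (Zm j) p = (SUM i<m. a j i*lz i k)" if "k:Basis" for k j
 using vZm[OF pdv_CT[OF lp, of k] cc(2), of j] pdv_eq[OF that smooth_nearI[OF lchart_open[OF l] V3(2) sZm[of j]]]
 by(simp add:lz_def pdv_eq[OF that sz[OF _ cc(2)]])
define Lc where "Lc c = pdv ka ka' c p + (SUM j:I. cscale (- pd ka ka' c (Zm j) p) (pdv ka ka' j p))" for c
have Lc_CT: "Lc c:CT p" for c unfolding Lc_def
 by(intro CT_plus pdv_CT[OF lp] cvec.subspace_sum[OF CT_subspace] CT_cscale)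
have Lc_apply: "Lc c f = pd ka ka' c f p - (SUM j:I. pd ka ka' c (Zm j) p*pd ka ka' j f p)" if "c:B" "smooth_near p f" for c f
 using that I(1) by(simp add:Lc_def sum_fun_apply cscale_def pdv_eq B_def subset_iff sum_negf cong: sum.cong)
have Lc_T: "Lc c:T01 p" if c: "c:B" for c
proof -
 have "Lc c (z i) = 0" if i: "i < m" for i
 using I(3) i c by(simp add:Lc_apply[OF c sz[OF i cc(2)]] lz_def[symmetric] pdZm B_def mult.commute cong: sum.cong)
 thus ?thesis using CR_coords_T01[OF cc] Lc_CT by simp
qed
have Lc_xc: "Lc c (xc ka d) = (if c = d then 1 else 0)" if "c:B" "d:Basis" "d~:I" for c d
proof -
 have pdx: "pd ka ka' k (xc ka d) p = of_real (k <.> d)" for k unfolding pd_def by(rule dd_xc[OF lp])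
 have "j <.> d = 0" if "j:I" for j
 proof(rule inner_not_same_Basis)
 show "j:Basis" "j ~= d" using that I(1) `d ~: I` by(auto simp:B_def)
 qed fact
 hence "(SUM j:I. pd ka ka' c (Zm j) p * of_real (j <.> d)) = 0"
 by(intro sum.neutral ballI) simp
 thus ?thesis using that by(simp add:Lc_apply[OF that(1) smooth_near_xc[OF lp]] pdx inner_Basis B_def)
qed
obtain U4 where U4: "open U4" "p:U4" "ALL W:T01 p. EX Z:sections U4. Z p = W" by(rule T01_extend)
obtain Z0 where Z0: "Z0:sections U4" "Z0 p = Y0" using U4(3) Y0(1) by blast
have "ALL c:B. EX Z:sections U4. Z p = Lc c" using U4(3) Lc_T by blast
then obtain Zc where Zc: "!!c. c:B ==> Zc c:sections U4" "!!c. c:B ==> Zc c p = Lc c" by metis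
define O4 where "O4 = V3 Int U4"
have O4: "open O4" "p:O4" "O4 <= V3" "O4 <= U4" using lchart_open[OF l] U4 V3(2) by(auto simp:O4_def)
have sx: "smooth O4 (xc ka b)" by(rule smooth_xc[OF l O4(1,3)])
have s0: "smooth O4 (%q. Z q (xc ka b))" if "Z:sections U4" for Z
 by(rule smooth_field_smooth[OF sections_smooth_field[OF that] O4(1,4) sx])
define V where "V = {q:O4. Z0 q (xc ka b) ~= 0}"
have oV: "open V"
proof -
 have "open (O4 Int (%q. Z0 q (xc ka b)) -` (- {0}))"
 by(rule continuous_open_preimage[OF smooth_imp_continuous[OF O4(1) s0[OF Z0(1)]] O4(1)]) auto
 moreover have "V = O4 Int (%q. Z0 q (xc ka b)) -` (- {0})" by(auto simp:V_def)
 ultimately show ?thesis by simp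
qed
have V: "V <= O4" "V <= V3" "V <= U4" using O4 by(auto simp:V_def)
have "Y0 (xc ka b) = Y0 (%q. cor (rh q))"
 by(rule CT_cong_open[OF T01_CT[OF Y0(1)] smooth_near_xc[OF lp] lchart_open[OF l] V3(2)]) (simp add:xc_def kab)
hence pV: "p:V" using O4(2) Y0(2) Z0(2) by(simp add:V_def)
\<comment> \<open>The transversal section \<open>Z0\<close> removes the component along
  \<open>b\<close>. For \<open>c\<close> outside \<open>I\<close> nothing is removed at
  \<open>p\<close>, so that the values of \<open>Lc c\<close> survive there.\<close>
define Y where "Y c q = Zc c q + cscale (- (Zc c q (xc ka b)/Z0 q (xc ka b))) (Z0 q)" for c q
have "adapted p b I V ka ka' Zm Y"
 unfolding adapted_def
proof(intro conjI ballI)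
 show "lchart V ka ka'" by(rule lchart_subset[OF l oV V(2)])
 show "ka p = 0" by(simp add:ka_def)
 show "I <= Basis - {b}" using I(1) by(simp add:B_def)
 show "smooth V (Zm i)" for i by(rule smooth_subset[OF sZm V(2)])
 show "Z (Zm i) = 0" if "q:V" "Z:T01 q" for i q Z
 proof -
 have q: "q:U" using that V(2) V3(3) by auto
 have "Z (z i) = 0" if "i < m" for i using CR_coords_T01[OF cc(1) q] `Z : T01 q` that by simp
 thus ?thesis by(simp add:vZm[OF T01_CT[OF that(2)] q])
 qed
 show "pd ka ka' j (Zm i) p = (if j = i then 1 else 0)" if "i:I" "j:I" for i j
 using I(1,2) that by(simp add:pdZm B_def subset_iff)
 fix c assume "c:Basis - {b} - I"
 hence c: "c:B" "c~:I" by(auto simp:B_def)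
 show "smooth_field V (Y c)" unfolding Y_def[abs_def]
 by(intro smooth_field_add smooth_field_scale smooth_minus smooth_divide oV smooth_field_subset[OF sections_smooth_field V(3)]
  Zc(1) Z0(1) c smooth_subset[OF s0 V(1)]) (simp add:V_def)
 show "Y c q:T01 q" if "q:V" for q
 unfolding Y_def using that V(3) by(intro T01_add T01_cscale sections_T01[OF Zc(1)[OF c(1)]] sections_T01[OF Z0(1)]) auto
 show "Y c q (xc ka b) = 0" if "q:V" for q
 using that by(simp add:Y_def cscale_def V_def)
 have "b~:I" using I(1) by(auto simp:B_def)
 hence "Zc c p (xc ka b) = 0" using Lc_xc[OF c(1) b(1)] c by(auto simp:Zc(2) B_def)
 hence "Y c p = Lc c" by(simp add:Y_def Zc(2)[OF c(1)] cscale_def fun_eq_iff)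
 thus "Y c p (xc ka d) = (if c = d then 1 else 0)" if "d:Basis - {b} - I" for d
 using Lc_xc[OF c(1)] that by auto
qed (rule pV b(1))+
thus ?thesis by(rule that) (use V(2) V3(3) kab in auto)
qed

end

section \<open>Local extension\<close>

context cr_manifold begin

lemma CR_functions_diff:
assumes W: "open W" and f: "f:CR_functions W" and g: "g:CR_functions W"
shows "(%q. f q - g q):CR_functions W"
proof -
have s: "smooth W f" "smooth W g" using f g by(auto simp:CR_functions_def)
have "Z q (%q. f q - g q) = 0" if "open V" "V <= W" "Z:sections V" "q:V" for V Z q
proof -
 have q: "q:W" and T: "Z q:T01 q" using that sections_T01 by auto
 show ?thesis
 using CT_diff[OF T01_CT[OF T] smooth_nearI[OF W q s(1)] smooth_nearI[OF W q s(2)]]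
  CR_functions_T01[OF f W q T] CR_functions_T01[OF g W q T] by simp
qed
thus ?thesis using smooth_diff[OF W s] by(simp add:CR_functions_def)
qed

end

text \<open>The data at a point of \<open>N\<close> that are fixed before the boundary function is
  given, so that one \<open>G\<close> serves all boundary functions.\<close>

locale boundary_chart = cr_manifold A T01 n
for A :: "('p::{t2_space, second_countable_topology} set \<times> ('p => 'e::euclidean_space)) set" and T01 n +
fixes Om N :: "'p set" and p b I V ka ka' Zm Y r ey G de
assumes ad: "adapted p b I V ka ka' Zm Y" and Om: "open Om"
 and side: "q:V ==> q:Om \<longleftrightarrow> ka q <.> b < 0" and closed_side: "q:V ==> q:closure Om \<longleftrightarrow> ka q <.> b <= 0"
 and N: "q:V ==> q:N \<longleftrightarrow> ka q <.> b = 0"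
 and cube: "cube (2*r) <= ka ` V"
 and SC: "slice_coordinates I r (%i x. Zm i (ka' (x - (x <.> b) *R b))) ey"
 and Yd: "x:cube (2*r) ==> c:Basis - {b} - I ==> d:Basis - {b} - I ==>
 cmod (Y c (ka' x) (xc ka d) - (if c = d then 1 else 0)) <= 1/(2*real DIM('e))"
 and G: "open G" "G <= V" "q:G ==> norm (ka q) < de" "q:G ==> i:I ==> cmod (Zm i q - Zm i p) < de"
 and mp: "MP Om G"
 and rad: "slice_coordinates.radius I r (%i x. Zm i (ka' (x - (x <.> b) *R b))) de"
begin

definition pj :: "'e => 'e" where "pj x = x - (x <.> b) *R b"

text \<open>The restrictions of the \<open>Zm i\<close> to \<open>N\<close>, continued constantly
  along \<open>b\<close>. The approximants are integrals over \<open>N\<close> in terms of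
  \<open>Zs\<close>, evaluated at the values of \<open>Zm\<close> itself, whose chart expression is
  \<open>Zc\<close>.\<close>

definition Zs :: "'e => 'e => complex" where "Zs i x = Zm i (ka' (pj x))"

definition Zc :: "'e => 'e => complex" where "Zc i x = Zm i (ka' x)"

lemma Zs_eq: "Zs = (%i x. Zm i (ka' (x - (x <.> b) *R b)))" by(simp add:fun_eq_iff Zs_def pj_def)

sublocale S: slice_coordinates I r Zs ey unfolding Zs_eq by(rule SC)

lemma radS: "S.radius de" unfolding Zs_eq by(rule rad)

lemma l: "lchart V ka ka'" and pV: "p:V" and b: "b:Basis" and bI: "I <= Basis - {b}" and kap: "ka p = 0"
and sZm: "i:I ==> smooth V (Zm i)" and TZm: "i:I ==> q:V ==> Z:T01 q ==> Z (Zm i) = 0"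
and YT: "c:Basis - {b} - I ==> q:V ==> Y c q:T01 q" and Yb: "c:Basis - {b} - I ==> q:V ==> Y c q (xc ka b) = 0"
using ad unfolding adapted_def by blast+

lemma oV: "open V" by(rule lchart_open[OF l])

lemma ka'p: "ka' 0 = p" using lchart_inv[OF l pV] by(simp add:kap)

lemma Zs0: "Zs i 0 = Zm i p" by(simp add:Zs_def pj_def ka'p)

lemma CZc: "i:I ==> Cinf_on (ka ` V) (Zc i)"
unfolding Zc_def[abs_def] by(rule lchart_smoothD[OF l sZm oV]) auto

lemma oD: "open (ka ` V)" by(rule lchart_image[OF l oV order_refl])

lemma bounded_linear_pj: "bounded_linear pj"
unfolding pj_def[abs_def]
by(intro bounded_linear_sub bounded_linear_ident bounded_linear_compose[OF bounded_linear_scaleR_left] bounded_linear_inner_left)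

lemma pj_inner: "c:Basis ==> pj x <.> c = (if c = b then 0 else x <.> c)"
using b by(auto simp:pj_def inner_diff_left inner_Basis)

lemma pj_cube: "x:cube (2*r) ==> pj x:cube (2*r)"
using S.r by(auto simp:cube_def pj_inner)

lemma pj_id: "x <.> b = 0 ==> pj x = x" by(simp add:pj_def)

lemma pj_pj: "pj (pj x) = pj x" by(rule pj_id) (simp add:pj_inner b)

lemma pj_Basis: "c:Basis ==> pj c = (if c = b then 0 else c)"
by(rule euclidean_eqI) (auto simp:pj_inner inner_Basis)

lemma dd_pj: "g differentiable (at (pj x)) ==> dd v (%x. g (pj x)) x = dd (pj v) g (pj x)"
by(rule dd_chain[OF bounded_linear_imp_has_derivative[OF bounded_linear_pj]])

lemma dd_0: "g differentiable (at x) ==> dd 0 g x = (0 :: complex)"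
using linear_0[OF has_derivative_linear[OF has_derivative_dd]] by blast

lemma Zs_on_N: "q:V ==> ka q <.> b = 0 ==> Zs i (ka q) = Zm i q"
by(simp add:Zs_def pj_id lchart_inv[OF l])

lemma dd_Zs:
assumes "i:I" "x:cube (2*r)"
shows "dd v (Zs i) x = dd (pj v) (Zc i) (pj x)"
proof -
have "Zc i differentiable (at (pj x))"
 by(rule Cinf_differentiable[OF CZc[OF assms(1)]]) (use pj_cube[OF assms(2)] cube in auto)
from dd_pj[OF this, of v] show ?thesis by(simp only: Zs_def[abs_def] Zc_def[abs_def])
qed

text \<open>On the slice \<open>x <.> b = 0\<close>, which represents \<open>N\<close>, the tangential Cauchy-Riemann equations say that
the differential of the boundary value is a combination of the differentials of the \<open>Zs i\<close>.\<close>

lemma sol_boundary: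
assumes f0: "f0:CR_functions_sub N"
shows "S.sol (%x. f0 (ka' (pj x)))"
proof -
define f where "f x = f0 (ka' (pj x))" for x
let ?Q = "cube (2*r) :: 'e set"
have inN: "ka' (pj x):N Int V" "ka (ka' (pj x)) = pj x" if "x:?Q" for x
proof -
 have x: "pj x:ka ` V" using pj_cube[OF that] cube by auto
 show e: "ka (ka' (pj x)) = pj x" by(rule lchart_inv'[OF l x])
 have v: "ka' (pj x):V" using x lchart_inv[OF l] by auto
 thus "ka' (pj x):N Int V" using N[OF v] by(simp add:e pj_inner b)
qed
have Cf: "Cinf_on ?Q f"
proof(rule Cinf_local)
 fix x assume x: "x:?Q"
 have "smooth_on_subset N f0" using f0 by(simp add:CR_functions_sub_def)
 then obtain U F where U: "open U" "ka' (pj x):U" "smooth U F" "ALL q:U Int N. F q = f0 q"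
 using inN(1)[OF x] unfolding smooth_on_subset_def by blast
 let ?T = "ka ` (U Int V)"
 have oT: "open ?T" by(rule lchart_image[OF l]) (use U(1) oV in auto)
 define S where "S = ?Q Int pj -` ?T"
 have cpj: "continuous_on UNIV pj" by(rule linear_continuous_on[OF bounded_linear_pj])
 have oS: "open S" unfolding S_def by(intro open_Int open_cube open_vimage[OF oT cpj])
 have "pj x = ka (ka' (pj x))" using inN(2)[OF x] by simp
 hence "x:S" using x U(2) inN(1)[OF x] unfolding S_def by blast
 have CF: "Cinf_on ?T (%x. F (ka' x))" by(rule lchart_smoothD[OF l U(3)]) (use U(1) oV in auto)
 have "Cinf_on S (%x. F (ka' (pj x)))"
 by(rule Cinf_compose[OF oS oT _ Cinf_linear[OF bounded_linear_pj] CF]) (auto simp:S_def)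
 moreover have "F (ka' (pj y)) = f y" if "y:S" for y
 proof -
 have "ka' (pj y):U" using that lchart_inv[OF l] by(auto simp:S_def)
 thus ?thesis using U(4) inN(1)[of y] that by(simp add:S_def f_def)
 qed
 ultimately have "Cinf_on S f" by(subst Cinf_cong[OF oS, symmetric]) auto
 thus "EX T. open T & x:T & Cinf_on T f" using oS `x : S` by blast
qed
have df: "f differentiable (at x)" if "x:?Q" for x by(rule Cinf_differentiable[OF Cf that])
have f_pj: "f (pj x) = f x" for x by(simp add:f_def pj_pj)
have dd_f: "dd v f x = dd (pj v) f (pj x)" if "x:?Q" for v x
 using dd_pj[OF df[OF pj_cube[OF that]], of v] by(simp add:f_pj)
have dd_Z: "dd v (Zs i) x = dd (pj v) (Zs i) (pj x)" if "x:?Q" "i:I" for v x i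
 using dd_Zs[OF that(2,1)] dd_Zs[OF that(2) pj_cube[OF that(1)]] by(simp add:pj_pj)
\<comment> \<open>The defect of the equation for \<open>f\<close>. It vanishes along
  \<open>b\<close>, as \<open>f\<close> and the \<open>Zs i\<close> are constant there; along
  \<open>I\<close> by Cramer's rule; and in the other directions, on the slice, because the
  \<open>Y c\<close> annihilate \<open>f\<close> and the \<open>Zs i\<close> and their coefficient
  matrix is close to the identity.\<close>
define w where "w v x = dd v f x - (SUM i:I. S.grad i f x*dd v (Zs i) x)" for v x
have dZs: "Zs i differentiable (at x)" if "i:I" "x:?Q" for i x by(rule Cinf_differentiable[OF S.Z[OF that(1)] that(2)])
have w_basis: "w v x = (SUM c:Basis. of_real (v <.> c)*w c x)" if x: "x:?Q" for v x
 unfolding w_def S.dd_combination[OF df[OF x], of v]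
 by(simp add:S.dd_combination[OF dZs[OF _ x], of _ v] right_diff_distrib sum_subtractf sum_distrib_left cong: sum.cong)
 (subst sum.swap, simp add:mult_ac)
have wI: "w j x = 0" if x: "x:?Q" and j: "j:I" for x j
proof -
 have jB: "j:Basis" using j S.I by auto
 have "(SUM i:I. S.grad i f x*dd j (Zs i) x) = (SUM i:Basis. S.grad i f x*tmat I Zs x i j)"
 by(rule sum.mono_neutral_cong_left) (use S.I j in "auto simp: tmat_def")
 also have "... = (SUM k:Basis. dd (if k:I then k else 0) f x*(SUM i:Basis. cof (tmat I Zs x) i k*tmat I Zs x i j))/S.J x"
 unfolding S.grad_def sum_divide_distrib sum_distrib_left sum_distrib_right
 by(subst sum.swap) (simp add:mult_ac)
 also have "... = (SUM k:Basis. if k = j then dd (if k:I then k else 0) f x*S.J x else 0)/S.J x"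
 by(rule arg_cong[where f = "%t. t/S.J x"], rule sum.cong[OF refl]) (simp add:cof_col[OF S.jac0[OF x] _ jB])
 also have "... = dd j f x" using jB j S.jac0[OF x] by simp
 finally show ?thesis by(simp add:w_def)
qed
have wb: "w b x = 0" if x: "x:?Q" for x
 unfolding w_def using dd_f[OF x, of b] dd_Z[OF x, of _ b] b
 by(simp add:pj_Basis dd_0[OF df[OF pj_cube[OF x]]] dd_0[OF dZs[OF _ pj_cube[OF x]]])
have wc: "w c x = 0" if x: "x:?Q" "x <.> b = 0" and c: "c:Basis - {b} - I" for c x
proof(rule near_identity[where C = "Basis - {b} - I" and n = "real DIM('e)" and A = "%c d. Y c (ka' x) (xc ka d)" and w = "%d. w d x"])
 let ?q = "ka' x"
 have px: "pj x = x" by(rule pj_id[OF x(2)])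
 have q: "?q:N" "?q:V" "ka ?q = x" using inN[OF x(1)] by(auto simp:px)
 show "real (card (Basis - {b} - I)) <= real DIM('e)" using card_mono[OF finite_Basis, of "Basis - {b} - I :: 'e set"] by auto
 fix c assume c: "c:Basis - {b} - I"
 let ?Y = "Y c ?q"
 note T = YT[OF c q(2)] and CTY = T01_CT[OF YT[OF c q(2)]]
 have oQ: "open (V Int ka -` ?Q)" "ka ` (V Int ka -` ?Q) = ?Q" by(rule lchart_vimage[OF l open_cube cube])+
 have sf: "smooth (V Int ka -` ?Q) (%q. f (ka q))" by(rule smooth_pullback[OF l oQ(1)]) (use Cf oQ(2) in auto)
 have qQ: "?q:V Int ka -` ?Q" using q x by simp
 have fn: "smooth_near ?q (%q. f (ka q))" by(rule smooth_nearI[OF oQ(1) qQ sf])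
 have pdf: "pd ka ka' d (%q. f (ka q)) ?q = dd d f x" for d
 unfolding pd_def q(3) by(rule dd_cong[OF oD]) (use subsetD[OF cube x(1)] in "auto simp: lchart_inv[OF l]")
 have Yf: "?Y (%q. f (ka q)) = (SUM d:Basis. ?Y (xc ka d)*dd d f x)"
 using CT_pd[OF l q(2) CTY fn] by(simp only: pdf)
 have "?Y:CT_sub N ?q" unfolding CT_sub_def
 proof(intro CollectI conjI allI impI CTY)
 fix h assume h: "smooth_near ?q h" and h0: "\<forall>\<^sub>F q in nhds ?q. q:N --> h q = 0"
 obtain U where U: "open U" "?q:U" "!!q. q:U ==> q:N ==> h q = 0" using h0 by(auto simp:eventually_nhds)
 let ?T = "ka ` (U Int V)"
 have oT: "open ?T" by(rule lchart_image[OF l]) (use U(1) oV in auto)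
 have xT: "x:?T" using q U(2) by(metis IntI imageI)
 have "pd ka ka' d h ?q = 0" if d: "d:Basis" "d ~= b" for d
 proof -
  have dh: "(%x. h (ka' x)) differentiable (at x)" using smooth_near_differentiable[OF l q(2) h] q(3) by simp
  have dp: "pj d = d" using d by(simp add:pj_Basis)
  have "dd d (%x. h (ka' x)) x = dd d (%x. h (ka' (pj x))) x"
  using dd_pj[of "%x. h (ka' x)" x d] dh by(simp add:px dp)
  also have "... = dd d (%_. 0) x"
  proof(rule dd_cong[of "pj -` ?T"])
  show "open (pj -` ?T)" by(rule open_vimage[OF oT linear_continuous_on[OF bounded_linear_pj]])
  show "x:pj -` ?T" using xT px by simp
  fix y assume "y:pj -` ?T"
  then obtain q' where q': "q':U" "q':V" "pj y = ka q'" by auto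
  have "q':N" using N[OF q'(2)] by(simp add:q'(3)[symmetric] pj_inner b)
  thus "h (ka' (pj y)) = 0" using U(3) q' by(simp add:lchart_inv[OF l])
  qed
  also have "... = 0" by(rule dd_eq) simp
  finally show ?thesis by(simp add:pd_def q(3))
 qed
 thus "?Y h = 0"
  unfolding CT_pd[OF l q(2) CTY h] using Yb[OF c q(2)] by(intro sum.neutral) (metis mult_eq_0_iff)
 qed
 moreover have "\<forall>\<^sub>F q in nhds ?q. q:N --> f (ka q) = f0 q"
 unfolding eventually_nhds
 by(rule exI[of _ V]) (use oV q(2) N in "auto simp: f_def pj_id lchart_inv[OF l]")
 ultimately have Yf0: "?Y (%q. f (ka q)) = 0"
 using f0 T fn q(1) unfolding CR_functions_sub_def by blast
 have YZ: "(SUM d:Basis. ?Y (xc ka d)*dd d (Zs i) x) = 0" if i: "i:I" for i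
 proof -
 have "?Y (xc ka d)*dd d (Zs i) x = ?Y (xc ka d)*pd ka ka' d (Zm i) ?q" if d: "d:Basis" for d
  using Yb[OF c q(2)] dd_Zs[OF i x(1), of d] d
  by(cases "d = b") (simp_all add:pj_Basis px pd_def q(3) Zc_def[abs_def])
 hence "(SUM d:Basis. ?Y (xc ka d)*dd d (Zs i) x) = (SUM d:Basis. ?Y (xc ka d)*pd ka ka' d (Zm i) ?q)"
  by(rule sum.cong[OF refl])
 thus ?thesis
  using CT_pd[OF l q(2) CTY smooth_nearI[OF oV q(2) sZm[OF i]]] TZm[OF i q(2) T] by simp
 qed
 have "(SUM d:Basis. ?Y (xc ka d)*w d x) = ?Y (%q. f (ka q)) - (SUM i:I. S.grad i f x*(SUM d:Basis. ?Y (xc ka d)*dd d (Zs i) x))"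
 unfolding w_def Yf right_diff_distrib sum_subtractf sum_distrib_left by(subst (2) sum.swap) (simp add:mult_ac)
 also have "... = 0" using Yf0 YZ by(simp cong: sum.cong)
 finally have "(SUM d:Basis. ?Y (xc ka d)*w d x) = 0" .
 moreover have "(SUM d:Basis. ?Y (xc ka d)*w d x) = (SUM d:Basis - {b} - I. ?Y (xc ka d)*w d x)"
 by(rule sum.mono_neutral_right) (use wI[OF x(1)] wb[OF x(1)] in auto)
 ultimately show "(SUM d:Basis - {b} - I. ?Y (xc ka d)*w d x) = 0" by simp
qed (use c Yd x S.d1 in auto)
\<comment> \<open>All terms are invariant under \<open>pj\<close>, which carries the equation from
  the slice to the whole cube.\<close>
have "w v x = 0" if x: "x:?Q" for v x
proof -
 have px: "pj x:?Q" "pj x <.> b = 0" using pj_cube[OF x] by(auto simp:pj_inner b)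
 have "S.grad i f x = S.grad i f (pj x)" if "i:I" for i
 proof -
 have k: "dd (if k:I then k else 0) g x = dd (if k:I then k else 0) g (pj x)"
  if "!!v. dd v g x = dd (pj v) g (pj x)" "k:Basis" for k and g :: "'e => complex"
  using that(1)[of "if k:I then k else 0"] pj_Basis[OF that(2)] bI by(auto simp:pj_def split: if_splits)
 have "tmat I Zs x i k = tmat I Zs (pj x) i k" if "k:Basis" for i k
  using k[of "Zs i" k] dd_Z[OF x] that by(auto simp:tmat_def)
 hence "jac (tmat I Zs x) = jac (tmat I Zs (pj x))" "cof (tmat I Zs x) i k = cof (tmat I Zs (pj x)) i k" for k
  by(auto intro!: jac_cong cof_cong)
 thus ?thesis unfolding S.grad_def using k[OF dd_f[OF x]] by(simp cong: sum.cong)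
 qed
 hence "w v x = w (pj v) (pj x)" unfolding w_def dd_f[OF x, of v] using dd_Z[OF x] by(simp cong: sum.cong)
 also have "... = (SUM c:Basis. of_real (pj v <.> c)*w c (pj x))" by(rule w_basis[OF px(1)])
 also have "... = 0" using wI[OF px(1)] wb[OF px(1)] wc[OF px] by(intro sum.neutral) auto
 finally show ?thesis .
qed
hence "S.sol f" unfolding S.sol_def using Cf by(simp add:w_def)
thus ?thesis by(simp only: f_def[abs_def])
qed

end

section \<open>The limit of the approximants and its regularity up to \<open>N\<close>\<close>

context boundary_chart begin

definition apx :: "nat => ('e => complex) => 'p => complex" where
"apx nu f q = S.approx nu f (%i. Zm i q)"

text \<open>Meaningful on \<open>G Int closure Om\<close>, where \<open>apx_limit\<close> provides
  convergence.\<close>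

definition ext :: "('e => complex) => 'p => complex" where
"ext f q = lim (%nu. apx nu f q)"

lemma apx_chart: "Cinf_on (ka ` V) (%x. apx nu f (ka' x))" if "S.sol f"
using S.approx_smooth[OF that oD CZc] by(simp add:apx_def Zc_def)

lemma apx_derivative:
assumes f: "S.sol f" and x: "x:ka ` V"
shows "((%x. apx nu f (ka' x)) has_derivative
 (%v. SUM i:I. dd v (Zc i) x*(apx nu (S.grad i f) (ka' x) + S.rest nu i f (%i. Zc i x)))) (at x)"
using S.approx_has_derivative[where nu = nu, OF f oD CZc x] by(simp add:apx_def Zc_def)

lemma apx_CR: assumes f: "S.sol f" shows "apx nu f:CR_functions V"
proof -
have s: "smooth V (apx nu f)" unfolding lchart_smooth_iff[OF l oV order_refl] by(rule apx_chart[OF f])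
have "Z q (apx nu f) = 0" if "open U" "U <= V" "Z:sections U" "q:U" for U Z q
proof -
 have q: "q:V" and T: "Z q:T01 q" using that sections_T01 by auto
 have x: "ka q:ka ` V" using q by simp
 define B where "B i = apx nu (S.grad i f) q + S.rest nu i f (%i. Zc i (ka q))" for i
 have "Z q (apx nu f) = (SUM c:Basis. Z q (xc ka c)*(SUM i:I. pd ka ka' c (Zm i) q*B i))"
 unfolding CT_pd[OF l q T01_CT[OF T] smooth_nearI[OF oV q s]] pd_def dd_eq[OF apx_derivative[OF f x]]
 by(simp add:B_def lchart_inv[OF l q] Zc_def[abs_def])
 also have "... = (SUM i:I. (SUM c:Basis. Z q (xc ka c)*pd ka ka' c (Zm i) q)*B i)"
 unfolding sum_distrib_left sum_distrib_right by(subst sum.swap) (simp add:mult_ac)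
 also have "... = (SUM i:I. Z q (Zm i)*B i)"
 by(rule sum.cong[OF refl]) (simp only: CT_pd[OF l q T01_CT[OF T] smooth_nearI[OF oV q sZm]])
 also have "... = 0" using TZm[OF _ q T] by simp
 finally show ?thesis .
qed
thus ?thesis using s by(simp add:CR_functions_def)
qed

lemma GV: "q:G ==> q:V" using G(2) by auto

lemma apx_boundary:
assumes f: "S.sol f" and e: "0 < e"
shows "\<forall>\<^sub>F nu in sequentially. ALL q:G Int N. cmod (apx nu f q - f (ka q)) < e"
using S.approx_converges[OF f radS e]
proof(rule eventually_mono, intro ballI)
fix nu q assume a: "ALL p. norm p < de --> cmod (S.approx nu f (%i. Zs i p) - f p) < e" and q: "q:G Int N"
hence "Zs i (ka q) = Zm i q" for i using Zs_on_N N GV by auto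
thus "cmod (apx nu f q - f (ka q)) < e" using a[rule_format, of "ka q"] G(3) q by(simp add:apx_def)
qed

lemma apx_limit:
assumes f: "S.sol f"
shows "uniform_limit (G Int closure Om) (%nu. apx nu f) (ext f) sequentially"
proof -
have "uniformly_Cauchy_on (G Int closure Om) (%nu. apx nu f)"
proof(rule uniformly_Cauchy_onI)
 fix e :: real assume e: "0 < e"
 obtain M where M: "!!nu q. M <= nu ==> q:G Int N ==> cmod (apx nu f q - f (ka q)) < e/4"
 using apx_boundary[OF f, of "e/4"] e by(auto simp:eventually_sequentially)
 show "EX M. ALL q:G Int closure Om. ALL m>=M. ALL k>=M. dist (apx m f q) (apx k f q) < e"
 proof(intro exI[of _ M] ballI allI impI)
 fix q m k assume q: "q:G Int closure Om" and m: "M <= m" and k: "M <= k"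
 define h where "h q = apx m f q - apx k f q" for q
 have h: "h:CR_functions V" unfolding h_def[abs_def] by(intro CR_functions_diff oV apx_CR f)
 have bd: "cmod (h q) <= e/2" if "q:G Int N" for q
  using M[OF m that] M[OF k that] norm_triangle_ineq4[of "apx m f q - f (ka q)" "apx k f q - f (ka q)"] by(simp add:h_def)
 have fr: "q:N" if "q:G" "q:closure Om" "q~:Om" for q
  using that N[OF GV] side[OF GV] closed_side[OF GV] by force
 have "ALL q:G Int Om. norm (h q) <= e/2"
 proof(rule mp[unfolded MP_def, rule_format, THEN ballI])
  show "h:CR_functions (G Int Om)" by(rule CR_functions_subset[OF h]) (use G(2) in auto)
  have "continuous_on V h" by(rule smooth_imp_continuous[OF oV]) (use h in "simp add: CR_functions_def")
  thus "continuous_on (G Int closure Om) h" by(rule continuous_on_subset) (use G(2) in auto)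
  show "norm (h q) <= e/2" if "q:G Int frontier Om" for q
  by(rule bd) (use that fr Om in "auto simp: frontier_def interior_open")
 qed (use e in auto)
 hence "cmod (h q) <= e/2" using q bd fr by(cases "q:Om") auto
 thus "dist (apx m f q) (apx k f q) < e" using e by(simp add:dist_norm h_def)
 qed
qed
thus ?thesis
 using Cauchy_uniformly_convergent uniformly_convergent_uniform_limit_iff unfolding ext_def[abs_def] by blast
qed

lemma ext_boundary:
assumes f: "S.sol f" and q: "q:G Int N"
shows "ext f q = f (ka q)"
proof -
have "(%nu. apx nu f q) \<longlonglongrightarrow> f (ka q)"
 unfolding tendsto_iff dist_norm
proof(intro allI impI)
 fix e :: real assume "0 < e"
 from apx_boundary[OF f this] show "\<forall>\<^sub>F nu in sequentially. norm (apx nu f q - f (ka q)) < e"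
 by(rule eventually_mono) (use q in blast)
qed
thus ?thesis unfolding ext_def by(rule limI)
qed

abbreviation "D \<equiv> ka ` G"
abbreviation "Dm \<equiv> ka ` G Int {x. x <.> b < 0}"

lemma oG: "open D" by(rule lchart_image[OF l G(1,2)])

lemma oDm: "open Dm" by(intro open_Int oG open_Collect_less continuous_intros)

lemma Dm_G: "x:D ==> x <.> b <= 0 ==> ka' x:G Int closure Om"
using closed_side GV lchart_inv[OF l] by auto

lemma DV: "D <= ka ` V" using G(2) by auto

text \<open>Termwise differentiation: the derivatives of the approximants are combinations of
  approximants of the \<open>S.grad i f\<close>, which converge uniformly as these are solutions
  too, and of the terms \<open>S.rest\<close>, which tend to 0 uniformly.\<close>

lemma ext_derivative:
assumes f: "S.sol f" and x: "x:Dm"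
shows "((%x. ext f (ka' x)) has_derivative (%v. SUM i:I. dd v (Zc i) x*ext (S.grad i f) (ka' x))) (at x)"
proof -
obtain ep where ep: "0 < ep" "cball x ep <= Dm" using oDm x open_contains_cball by blast
let ?S = "ball x ep"
have SD: "?S <= Dm" using ep ball_subset_cball by blast
have "continuous_on (cball x ep) (dd (snd ib) (Zc (fst ib)))" if "ib:I \<times> Basis" for ib
 by(rule continuous_on_subset[OF Cinf_cont[OF Cinf_dd[OF CZc]]]) (use that ep(2) DV in auto)
then obtain C where C: "0 <= C" "ALL ib:I \<times> Basis. ALL y:cball x ep. cmod (dd (snd ib) (Zc (fst ib)) y) <= C"
 using finite_family_bound[of "I \<times> Basis" "cball x ep" "%ib. dd (snd ib) (Zc (fst ib))"] S.finI by auto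
have ddC: "cmod (dd h (Zc i) y) <= norm h*(real DIM('e)*C)" if i: "i:I" and y: "y:?S" for h i y
proof -
 have "y:ka ` V" using SD DV y by blast
 hence d: "Zc i differentiable (at y)" by(rule Cinf_differentiable[OF CZc[OF i]])
 have "cmod (dd h (Zc i) y) <= (SUM c:(Basis::'e set). norm h*C)"
 unfolding S.dd_combination[OF d, of h]
 proof(rule sum_norm_le)
 fix c :: 'e assume c: "c:Basis"
 show "cmod (of_real (h <.> c)*dd c (Zc i) y) <= norm h*C"
  unfolding norm_mult norm_of_real using C i c y by(intro mult_mono Basis_le_norm) auto
 qed
 thus ?thesis by(simp add:mult_ac)
qed
define F' where "F' nu y v = (SUM i:I. dd v (Zc i) y*(apx nu (S.grad i f) (ka' y) + S.rest nu i f (%i. Zc i y)))" for nu y v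
define g' where "g' y v = (SUM i:I. dd v (Zc i) y*ext (S.grad i f) (ka' y))" for y v
have inG: "ka' y:G Int closure Om" if "y:?S" for y
proof -
 have "y:Dm" using SD that by blast
 hence "y:D" "y <.> b <= 0" by(blast, simp)
 thus ?thesis by(rule Dm_G)
qed
have "EX g. ALL y:?S. (%nu. apx nu f (ka' y)) \<longlonglongrightarrow> g y & (g has_derivative g' y) (at y within ?S)"
proof(rule has_derivative_sequence[where f' = F'])
 show "((%y. apx nu f (ka' y)) has_derivative F' nu y) (at y within ?S)" if "y:?S" for nu y
 unfolding F'_def[abs_def] by(rule has_derivative_at_withinI[OF apx_derivative[OF f]]) (use that SD DV in blast)
 show "\<forall>\<^sub>F nu in sequentially. ALL y:?S. ALL h. norm (F' nu y h - g' y h) <= e*norm h" if e: "0 < e" for e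
 proof -
 define e1 where "e1 = e/(2*((real DIM('e)*C + 1)*(real DIM('e) + 1)))"
 have K: "0 < (real DIM('e)*C + 1)*(real DIM('e) + 1)" using C(1) by(intro mult_pos_pos add_nonneg_pos) auto
 hence e1: "0 < e1" using e by(simp add:e1_def)
 have cancel: "0 < k ==> 2*(x/(2*k))*k = x" for x k :: real by simp
 have "\<forall>\<^sub>F nu in sequentially. ALL i:I. (ALL q:G Int closure Om. dist (apx nu (S.grad i f) q) (ext (S.grad i f) q) < e1) &
  (ALL z. (ALL j:I. cmod (z j - Zs j 0) < de) --> cmod (S.rest nu i f z) < e1)"
  by(intro eventually_ball_finite S.finI ballI eventually_conj uniform_limitD[OF apx_limit[OF S.sol_grad[OF f]] e1]
  S.rest_converges[OF f radS _ e1])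
 thus ?thesis
 proof(rule eventually_mono, intro ballI allI)
  fix nu y h assume a: "ALL i:I. (ALL q:G Int closure Om. dist (apx nu (S.grad i f) q) (ext (S.grad i f) q) < e1) &
  (ALL z. (ALL j:I. cmod (z j - Zs j 0) < de) --> cmod (S.rest nu i f z) < e1)" and y: "y:?S"
  have z: "ALL j:I. cmod (Zc j y - Zs j 0) < de" using G(4) inG[OF y] by(auto simp:Zs0 Zc_def)
  have "norm (F' nu y h - g' y h) = norm (SUM i:I. dd h (Zc i) y*((apx nu (S.grad i f) (ka' y) - ext (S.grad i f) (ka' y)) + S.rest nu i f (%i. Zc i y)))"
  unfolding F'_def g'_def sum_subtractf[symmetric] by(simp add:algebra_simps)
  also have "... <= (SUM i:I. norm h*(real DIM('e)*C)*(2*e1))"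
  proof(rule sum_norm_le)
  fix i assume i: "i:I"
  have "cmod (apx nu (S.grad i f) (ka' y) - ext (S.grad i f) (ka' y)) < e1" using a i inG[OF y] by(auto simp:dist_norm)
  moreover have "cmod (S.rest nu i f (%i. Zc i y)) < e1" using bspec[OF a i, THEN conjunct2, THEN spec, of "%i. Zc i y"] z by argo
  ultimately have "cmod ((apx nu (S.grad i f) (ka' y) - ext (S.grad i f) (ka' y)) + S.rest nu i f (%i. Zc i y)) <= 2*e1"
   using norm_triangle_ineq[of "apx nu (S.grad i f) (ka' y) - ext (S.grad i f) (ka' y)" "S.rest nu i f (%i. Zc i y)"] by linarith
  thus "norm (dd h (Zc i) y*((apx nu (S.grad i f) (ka' y) - ext (S.grad i f) (ka' y)) + S.rest nu i f (%i. Zc i y)))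
   <= norm h*(real DIM('e)*C)*(2*e1)"
   unfolding norm_mult by(intro mult_mono ddC[OF i y]) (use C(1) in auto)
  qed
  also have "... = real (card I)*(norm h*(real DIM('e)*C)*(2*e1))" by simp
  also have "... <= (real DIM('e) + 1)*(norm h*(real DIM('e)*C + 1)*(2*e1))"
  using S.cardI C(1) e1 by(intro mult_mono mult_nonneg_nonneg) auto
  also have "... = 2*e1*((real DIM('e)*C + 1)*(real DIM('e) + 1))*norm h" by(simp only: mult_ac)
  also have "2*e1*((real DIM('e)*C + 1)*(real DIM('e) + 1)) = e" by(rule cancel[OF K, of e, folded e1_def])
  finally show "norm (F' nu y h - g' y h) <= e*norm h" .
 qed
 qed
 show "x:?S" using ep by simp
 show "(%nu. apx nu f (ka' x)) \<longlonglongrightarrow> ext f (ka' x)"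
 by(rule tendsto_uniform_limitI[OF apx_limit[OF f] inG]) (use ep in simp)
qed (rule convex_ball)
then obtain g where g: "!!y. y:?S ==> (%nu. apx nu f (ka' y)) \<longlonglongrightarrow> g y" "!!y. y:?S ==> (g has_derivative g' y) (at y within ?S)"
 by blast
have d: "(g has_derivative g' x) (at x)" using g(2)[of x] ep at_within_open[OF _ open_ball] by(metis centre_in_ball)
have eq: "g y = ext f (ka' y)" if "y:?S" for y using limI[OF g(1)[OF that]] by(simp add:ext_def)
have "((%y. ext f (ka' y)) has_derivative g' x) (at x)"
 by(rule has_derivative_transform_within_open[OF d open_ball _ eq]) (use ep in auto)
thus ?thesis by(simp add:g'_def[abs_def])
qed

lemma ext_continuous:
assumes f: "S.sol f" shows "continuous_on (D Int {x. x <.> b <= 0}) (%x. ext f (ka' x))"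
proof -
have "continuous_on (G Int closure Om) (ext f)"
proof(rule uniform_limit_theorem[OF _ apx_limit[OF f]])
 have "continuous_on (G Int closure Om) (apx nu f)" for nu
 by(rule continuous_on_subset[OF smooth_imp_continuous[OF oV]]) (use apx_CR[OF f] G(2) in "auto simp: CR_functions_def")
 thus "\<forall>\<^sub>F nu in sequentially. continuous_on (G Int closure Om) (apx nu f)" by simp
qed simp
thus ?thesis
 by(rule continuous_on_compose2) (use Dm_G in "auto intro: continuous_on_subset[OF lchart_continuous'[OF l]] DV[THEN subsetD]")
qed

text \<open>By induction for all solutions at once, because the coefficients of the derivative are
  the \<open>ext (S.grad i f)\<close>.\<close>

lemma ext_half_smooth: "S.sol f ==> half_smooth k D b (%x. ext f (ka' x))"
proof(induction k arbitrary: f)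
case 0 thus ?case using ext_continuous by simp
next
case (Suc k)
have "half_smooth k D b (%x. SUM i:I. dd v (Zc i) x*ext (S.grad i f) (ka' x))" for v
 by(intro half_smooth_sum[OF S.finI] half_smooth_mult oG Suc.IH S.sol_grad[OF Suc.prems] Cinf_dd Cinf_subset[OF CZc DV])
moreover have "ALL x:D. x <.> b < 0 --> ((%x. ext f (ka' x)) has_derivative (%v. SUM i:I. dd v (Zc i) x*ext (S.grad i f) (ka' x))) (at x)"
 using ext_derivative[OF Suc.prems] by simp
ultimately show ?case using ext_continuous[OF Suc.prems] unfolding half_smooth.simps
 by(intro conjI exI[of _ "%v x. SUM i:I. dd v (Zc i) x*ext (S.grad i f) (ka' x)"]) auto
qed

lemma ext_smooth_interior: "S.sol f ==> Ck_on k Dm (%x. ext f (ka' x))"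
proof(induction k arbitrary: f)
case 0
have "Dm <= D Int {x. x <.> b <= 0}" by auto
thus ?case using continuous_on_subset[OF ext_continuous[OF 0]] by simp
next
case (Suc k)
have "Ck_on k Dm (dd v (Zc i))" if "i:I" for v i
 using Cinf_subset[OF Cinf_dd[OF CZc[OF that]], of Dm] DV by(auto simp:Cinf_on_def)
thus ?case
 by(intro Ck_on_SucI[OF oDm ext_derivative[OF Suc.prems]] Ck_on_sum Ck_on_mult oDm Suc.IH S.sol_grad[OF Suc.prems])
qed

lemma ext_CR: assumes f: "S.sol f" shows "ext f:CR_functions (G Int Om)"
proof -
have o: "open (G Int Om)" "G Int Om <= V" using G(1,2) Om by auto
have e: "ka ` (G Int Om) = Dm" using side GV by auto
have s: "smooth (G Int Om) (ext f)"
 unfolding lchart_smooth_iff[OF l o] e Cinf_on_def using ext_smooth_interior[OF f] by blast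
have "Z q (ext f) = 0" if "open U" "U <= G Int Om" "Z:sections U" "q:U" for U Z q
proof -
 have q: "q:V" "q:G Int Om" and T: "Z q:T01 q" using that sections_T01 G(2) by auto
 have x: "ka q:Dm" using q e by auto
 have "Z q (ext f) = (SUM c:Basis. Z q (xc ka c)*(SUM i:I. pd ka ka' c (Zm i) q*ext (S.grad i f) q))"
 unfolding CT_pd[OF l q(1) T01_CT[OF T] smooth_nearI[OF o(1) q(2) s]] pd_def dd_eq[OF ext_derivative[OF f x]]
 by(simp add:lchart_inv[OF l q(1)] Zc_def[abs_def])
 also have "... = (SUM i:I. (SUM c:Basis. Z q (xc ka c)*pd ka ka' c (Zm i) q)*ext (S.grad i f) q)"
 unfolding sum_distrib_left sum_distrib_right by(subst sum.swap) (simp add:mult_ac)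
 also have "... = (SUM i:I. Z q (Zm i)*ext (S.grad i f) q)"
 by(rule sum.cong[OF refl]) (simp only: CT_pd[OF l q(1) T01_CT[OF T] smooth_nearI[OF oV q(1) sZm]])
 also have "... = 0" using TZm[OF _ q(1) T] by simp
 finally show ?thesis .
qed
thus ?thesis using s by(simp add:CR_functions_def)
qed

lemma ext_smooth: assumes f: "S.sol f" shows "smooth_on_subset (G Int closure Om) (ext f)"
unfolding smooth_on_subset_def
proof
fix q assume q: "q:G Int closure Om"
hence "ka q:D" by auto
obtain W g where W: "open W" "ka q:W" "W <= D" "Cinf_on UNIV g" "!!x. x:W ==> x <.> b <= 0 ==> g x = ext f (ka' x)"
 by(rule Seeley_extension[OF b oG `ka q : D` ext_half_smooth[OF f]]) blast
have WV: "W <= ka ` V" using W(3) DV by auto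
have U: "open (V Int ka -` W)" by(rule lchart_vimage(1)[OF l W(1) WV])
show "EX U F. open U & q:U & smooth U F & (ALL q:U Int (G Int closure Om). F q = ext f q)"
proof(intro exI conjI ballI)
 show "open (V Int ka -` W)" by(rule U)
 show "q:V Int ka -` W" using q W(2) GV by auto
 show "smooth (V Int ka -` W) (%q. g (ka q))" by(rule smooth_pullback[OF l U _ Cinf_subset[OF W(4) subset_UNIV]]) auto
 fix q' assume q': "q':V Int ka -` W Int (G Int closure Om)"
 thus "g (ka q') = ext f q'" using W(5)[of "ka q'"] closed_side[of q'] lchart_inv[OF l, of q'] by simp
qed
qed

lemma boundary_chart_extension:
assumes "f0:CR_functions_sub N"
shows "EX F:CR_functions (G Int Om). smooth_on_subset (G Int closure Om) F & (ALL q:G Int N. F q = f0 q)"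
proof -
note sol = sol_boundary[OF assms]
have "ext (%x. f0 (ka' (pj x))) q = f0 q" if "q:G Int N" for q
 using ext_boundary[OF sol that] that N[of q] GV[of q] by(simp add:pj_id lchart_inv[OF l])
thus ?thesis using ext_CR[OF sol] ext_smooth[OF sol] by blast
qed

end

section \<open>Choice of coordinates and neighbourhoods at a boundary point\<close>

lemma cube_nhds:
fixes S :: "'e::euclidean_space set"
assumes "open S" "0:S" obtains s where "0 < s" "cube s <= S"
proof -
obtain e where e: "0 < e" "ball 0 e <= S" using assms openE by blast
have "x:ball 0 e" if x: "x:cube (e/real DIM('e))" for x :: 'e
proof -
 have "norm x <= (SUM b:Basis. \<bar>x <.> b\<bar>)" by(rule norm_le_l1)
 also have "... < (SUM b:(Basis :: 'e set). e/real DIM('e))" by(rule sum_strict_mono) (use x in "auto simp: cube_def")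
 finally show ?thesis by simp
qed
thus ?thesis using e by(intro that[of "e/real DIM('e)"]) auto
qed

lemma Cinf_near_value:
fixes g :: "'e::euclidean_space => complex"
assumes "Cinf_on (cube s) g" "0 < s" "g 0 = c" "0 < e"
shows "\<forall>\<^sub>F x in nhds 0. cmod (g x - c) <= e"
proof -
have "0:cube s" using assms(2) by(simp add:cube_def)
hence "isCont g 0"
 using Cinf_cont[OF assms(1)] continuous_on_eq_continuous_at[OF open_cube] by blast
then obtain d where "0 < d" "!!x. dist x 0 < d ==> dist (g x) (g 0) < e"
 using assms(4) unfolding continuous_at_eps_delta by blast
hence "\<forall>\<^sub>F x in nhds 0. dist (g x) (g 0) < e" unfolding eventually_nhds_metric by blast
thus ?thesis by(rule eventually_mono) (simp add:assms(3) dist_norm)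
qed

context cr_manifold begin

definition extends_from :: "'p set => 'p set => 'p set => bool" where
"extends_from Om N G \<longleftrightarrow> (ALL f0:CR_functions_sub N. EX F:CR_functions (G Int Om).
 smooth_on_subset (G Int closure Om) F & (ALL q:G Int N. F q = f0 q))"

text \<open>The order of choices matters: the chart fixes the cube and \<open>r\<close>, the
  coordinates on it fix the radius \<open>de\<close>, and only then the neighbourhood
  \<open>G\<close> of the maximum principle is taken inside the set \<open>W0\<close> where
  \<open>de\<close> applies.\<close>

lemma local_extension:
assumes psi: "Psi_we 2" and Om: "open Om" and N: "openin (top_of_set (frontier Om)) N" and pN: "p:N"
 and sc: "strongly_1_convex Om p" and nc: "Theta_noncharacteristic N p" and emb: "locally_CR_embeddable TYPE('x) p"
 and W00: "open W00" "p:W00"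
obtains G where "open G" "p:G" "G <= W00" "MP Om G" "G Int frontier Om <= N" "extends_from Om N G"
proof -
obtain U m z where cc: "CR_coords U m z" "p:U" by(rule embeddable_CR_coords[OF emb])
obtain T where T: "open T" "N = frontier Om Int T" using N by(auto simp:openin_open)
have NF: "N <= frontier Om" using T by auto
obtain rh where "defining_function Om p rh" using sc unfolding strongly_1_convex_def by blast
then obtain V0 v where V0: "open V0" "p:V0" "smooth V0 (%q. cor (rh q))" "Om Int V0 = {q:V0. rh q < 0}"
 and v: "v:TM p" "v (%q. cor (rh q)) ~= 0" unfolding defining_function_def by blast
note fr = defining_function_frontier[OF V0(1,3) Om V0(4)]
obtain Y0 where Y0: "Y0:T01 p" "Y0 (%q. cor (rh q)) ~= 0"
 by(rule Theta_noncharacteristic_T01[OF nc V0(1-3) _ v]) (use fr NF in auto)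
have V0T: "open (V0 Int T)" "p:V0 Int T" "smooth (V0 Int T) (%q. cor (rh q))" "rh p = 0"
 using V0 T pN smooth_subset[OF V0(3)] fr(2) by auto
obtain b I V ka ka' Zm Y where ad: "adapted p b I V ka ka' Zm Y" and VU: "V <= U Int (V0 Int T)" and kab: "ALL q:V. ka q <.> b = rh q"
 by(rule adapted_coordinates[OF cc V0T Y0])
have l: "lchart V ka ka'" and pV: "p:V" and b: "b:Basis" and bI: "I <= Basis - {b}" and kap: "ka p = 0"
 and sZm: "!!i. i:I ==> smooth V (Zm i)" and pdZ: "!!i j. i:I ==> j:I ==> pd ka ka' j (Zm i) p = (if j = i then 1 else 0)"
 and Yf: "!!c. c:Basis - {b} - I ==> smooth_field V (Y c)"
 and Yp: "!!c d. c:Basis - {b} - I ==> d:Basis - {b} - I ==> Y c p (xc ka d) = (if c = d then 1 else 0)"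
 using ad unfolding adapted_def by blast+
have oV: "open V" by(rule lchart_open[OF l])
have oD: "open (ka ` V)" by(rule lchart_image[OF l oV order_refl])
have fI: "finite I" by(rule finite_subset[OF bI]) simp
have ka'p: "ka' 0 = p" using lchart_inv[OF l pV] kap by simp
have side: "q:Om \<longleftrightarrow> ka q <.> b < 0" if "q:V" for q
 using V0(4) kab VU that by(auto simp:set_eq_iff)
have closed_side: "q:closure Om \<longleftrightarrow> ka q <.> b <= 0" if q: "q:V" for q
proof
 show "ka q <.> b <= 0" if "q:closure Om" using fr(1)[of q] kab VU q that by auto
 assume le: "ka q <.> b <= 0"
 show "q:closure Om"
 unfolding closure_iff_nhds_not_empty
 proof(intro allI impI)
 fix B S assume S: "S <= B" "open S" "q:S"
 have "open (ka ` (S Int V))" by(rule lchart_image[OF l]) (use S oV in auto)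
 moreover have "ka q:ka ` (S Int V)" using S q by auto
 ultimately obtain e where e: "0 < e" "ball (ka q) e <= ka ` (S Int V)" by(metis openE)
 have "ka q - (e/2) *R b:ball (ka q) e" using e b by(simp add:dist_norm)
 then obtain q' where q': "q':S" "q':V" "ka q - (e/2) *R b = ka q'" using e(2) by blast
 have "ka q' <.> b < 0" using le e(1) b by(simp add:q'(3)[symmetric] inner_diff_left)
 thus "Om Int B ~= {}" using side[OF q'(2)] q'(1) S(1) by auto
 qed
qed
have NV: "q:N \<longleftrightarrow> ka q <.> b = 0" if q: "q:V" for q
 using side[OF q] closed_side[OF q] Om T(2) VU q by(auto simp:frontier_def interior_open)
define Zs where "Zs = (%i x. Zm i (ka' (x - (x <.> b) *R b)))"
have blp: "bounded_linear (%x::'e. x - (x <.> b) *R b)"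
 by(intro bounded_linear_sub bounded_linear_ident bounded_linear_compose[OF bounded_linear_scaleR_left] bounded_linear_inner_left)
have "0:ka ` V" using pV kap by(metis imageI)
then obtain s0 where s0: "0 < s0" "cube s0 <= ka ` V" by(rule cube_nhds[OF oD])
have pc: "x - (x <.> b) *R b:cube s0" if "x:cube s0" for x
proof -
 have "\<bar>(x - (x <.> b) *R b) <.> c\<bar> < s0" if c: "c:Basis" for c
 using `x : cube s0` c b s0(1) by(cases "c = b") (auto simp:cube_def inner_diff_left inner_Basis)
 thus ?thesis by(simp add:cube_def)
qed
have CZm: "Cinf_on (cube s0) (%x. Zm i (ka' x))" if "i:I" for i
 by(rule Cinf_subset[OF lchart_smoothD[OF l sZm[OF that] oV] s0(2)]) auto
have CZ: "Cinf_on (cube s0) (Zs i)" if "i:I" for i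
 unfolding Zs_def by(rule Cinf_compose[OF open_cube open_cube _ Cinf_linear[OF blp] CZm[OF that]]) (use pc in auto)
have 00: "0:cube s0" using s0(1) by(simp add:cube_def)
have Z0: "dd j (Zs i) 0 = (if j = i then 1 else 0)" if ij: "i:I" "j:I" for i j
proof -
 have "(%x. Zm i (ka' x)) differentiable (at (0 - (0 <.> b) *R b))" using Cinf_differentiable[OF CZm[OF ij(1)] 00] by simp
 from dd_chain[OF bounded_linear_imp_has_derivative[OF blp] this, of j]
 have "dd j (Zs i) 0 = dd (j - (j <.> b) *R b) (%x. Zm i (ka' x)) 0" by(simp add:Zs_def)
 also have "j <.> b = 0" using ij bI b by(intro inner_not_same_Basis) auto
 finally show ?thesis using pdZ[OF ij] by(simp add:pd_def kap)
qed
have tm0: "tmat I Zs 0 i k = (if k = i then 1 else 0)" if "i:Basis" "k:Basis" for i k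
proof -
 have "dd 0 (Zs i) 0 = 0" if "i:I"
 using linear_0[OF has_derivative_linear[OF has_derivative_dd[OF Cinf_differentiable[OF CZ[OF that] 00]]]] .
 thus ?thesis using Z0 by(auto simp:tmat_def)
qed
have Ctm: "Cinf_on (cube s0) (%x. tmat I Zs x i k)" for i k
 by(cases "i:I") (auto simp:tmat_def intro!: Cinf_dd CZ)
have CY: "Cinf_on (cube s0) (%x. Y c (ka' x) (xc ka d))" if "c:Basis - {b} - I" for c d
 by(rule Cinf_subset[OF lchart_smoothD[OF l smooth_field_smooth[OF Yf[OF that] oV order_refl smooth_xc[OF l oV order_refl]] oV] s0(2)]) auto
have "\<forall>\<^sub>F x in nhds 0. (ALL i:I. ALL j:I. cmod (dd j (Zs i) x - (if j = i then 1 else 0)) <= 1/(8*real DIM('e)^2)) &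
 cmod (jac (tmat I Zs x) - 1) <= 1/2 &
 (ALL c:Basis - {b} - I. ALL d:Basis - {b} - I. cmod (Y c (ka' x) (xc ka d) - (if c = d then 1 else 0)) <= 1/(2*real DIM('e)))"
 using Z0 Yp jac_unit[OF tm0]
 by(intro eventually_conj eventually_ball_finite fI ballI finite_Diff finite_Basis Cinf_near_value[OF _ s0(1)]
 Cinf_dd CZ CY Cinf_jac open_cube Ctm) (auto simp:ka'p)
then obtain S where S: "open S" "0:S"
 "!!x i j. x:S ==> i:I ==> j:I ==> cmod (dd j (Zs i) x - (if j = i then 1 else 0)) <= 1/(8*real DIM('e)^2)"
 "!!x. x:S ==> cmod (jac (tmat I Zs x) - 1) <= 1/2"
 "!!x c d. x:S ==> c:Basis - {b} - I ==> d:Basis - {b} - I ==> cmod (Y c (ka' x) (xc ka d) - (if c = d then 1 else 0)) <= 1/(2*real DIM('e))"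
 unfolding eventually_nhds by blast
have "open (S Int cube s0)" "0:S Int cube s0" using S(1,2) open_cube 00 by auto
then obtain s1 where s1: "0 < s1" "cube s1 <= S Int cube s0" by(rule cube_nhds)
define r where "r = s1/2"
have r: "0 < r" "cube (2*r) <= S" "cube (2*r) <= (cube s0 :: 'e set)" using s1 by(auto simp:r_def)
have "- ((3*r/4)^2) < - ((r/2)^2)" using r(1) by(simp add:power2_eq_square)
then obtain tt :: "real => real" where tt: "Cinf_on UNIV tt" "!!x. x <= - ((3*r/4)^2) ==> tt x = 0"
 "!!x. - ((r/2)^2) <= x ==> tt x = 1" "!!x. 0 <= tt x" "!!x. tt x <= 1"
 by(rule smooth_cutoff) blast
\<comment> \<open>An even cutoff: \<open>tt\<close> is 0 far to the left and 1 further right, so it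
  is applied to the negative square, with the thresholds at \<open>3*r/4\<close> and
  \<open>r/2\<close>.\<close>
define ey where "ey t = tt (- (t*t))" for t
have SC: "slice_coordinates I r Zs ey"
proof
 show "I <= Basis" using bI by auto
 show "0 < r" by(rule r(1))
 show "Cinf_on (cube (2*r)) (Zs i)" if "i:I" for i by(rule Cinf_subset[OF CZ[OF that] r(3)])
 show "cmod (dd j (Zs i) q - (if j = i then 1 else 0)) <= 1/(8*real DIM('e)^2)" if "i:I" "j:I" "q:cube (2*r)" for i j q
 by(rule S(3)) (use that r(2) in auto)
 show "jac (tmat I Zs q) ~= 0" if "q:cube (2*r)" for q
 using S(4)[of q] r(2) that by auto
 show "Cinf_on UNIV ey" unfolding ey_def[abs_def]
 by(rule Cinf_compose[OF open_UNIV open_UNIV _ _ tt(1)]) (auto intro!: Cinf_minus Cinf_mult Cinf_id)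
 show "0 <= ey t" "ey t <= 1" for t using tt(4,5) by(auto simp:ey_def)
 show "ey t = 1" if "\<bar>t\<bar> <= r/2" for t
 unfolding ey_def by(rule tt(3)) (use power_mono[OF that, of 2] in "simp add: power2_eq_square")
 show "ey t = 0" if "3*r/4 <= \<bar>t\<bar>" for t
 unfolding ey_def by(rule tt(2)) (use power_mono[OF that, of 2] r(1) in "simp add: power2_eq_square")
qed
obtain de where de: "slice_coordinates.radius I r Zs de" using slice_coordinates.radius_exists[OF SC] by blast
have de0: "0 < de" using de unfolding slice_coordinates.radius_def[OF SC] by blast
define W0 where "W0 = (W00 Int (V Int ka -` ball 0 de)) Int (INT i:I. V Int Zm i -` ball (Zm i p) de)"
have "open W0" unfolding W0_def
 by(intro open_Int W00(1) open_INT fI ballI continuous_open_preimage[OF lchart_continuous[OF l] oV]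
 continuous_open_preimage[OF smooth_imp_continuous[OF oV sZm] oV] open_ball)
moreover have "p:W0" using W00(2) pV kap de0 by(auto simp:W0_def)
ultimately obtain G where G: "open G" "p:G" "G <= W0" "MP Om G"
 by(rule local_maximum_principle[OF psi Om sc nc NF pN cc])
have GV: "G <= V" using G(3) by(auto simp:W0_def)
have "boundary_chart A T01 n Om N p b I V ka ka' Zm Y r ey G de"
proof(intro boundary_chart.intro cr_manifold_axioms boundary_chart_axioms.intro)
 show "cube (2*r) <= ka ` V" using r(3) s0(2) by auto
 show "slice_coordinates I r (%i x. Zm i (ka' (x - (x <.> b) *R b))) ey" using SC by(simp add:Zs_def)
 show "slice_coordinates.radius I r (%i x. Zm i (ka' (x - (x <.> b) *R b))) de" using de by(simp add:Zs_def)
 show "cmod (Y c (ka' x) (xc ka d) - (if c = d then 1 else 0)) <= 1/(2*real DIM('e))"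
 if "x:cube (2*r)" "c:Basis - {b} - I" "d:Basis - {b} - I" for x c d by(rule S(5)) (use that r(2) in auto)
 show "norm (ka q) < de" if "q:G" for q using G(3) that by(auto simp:W0_def)
 show "cmod (Zm i q - Zm i p) < de" if "q:G" "i:I" for q i
 proof -
 have "q:(INT i:I. V Int Zm i -` ball (Zm i p) de)" using G(3) that unfolding W0_def by blast
 hence "Zm i q:ball (Zm i p) de" using that(2) by blast
 thus ?thesis by(simp add:dist_norm norm_minus_commute)
 qed
qed (fact ad Om side closed_side NV G(1) GV G(4))+
from boundary_chart.boundary_chart_extension[OF this] have "extends_from Om N G" by(simp add:extends_from_def)
moreover have "G Int frontier Om <= N" using GV VU T(2) by auto
moreover have "G <= W00" using G(3) by(auto simp:W0_def)
ultimately show ?thesis using that G by blast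
qed

end

section \<open>Gluing\<close>

context cr_manifold begin

lemma smooth_on_subset_subset: "smooth_on_subset S f ==> S' <= S ==> smooth_on_subset S' f"
unfolding smooth_on_subset_def by(meson IntD1 IntD2 IntI subsetD)

lemma smooth_on_subset_continuous:
assumes f: "smooth_on_subset S f" shows "continuous_on S f"
unfolding continuous_on_eq_continuous_within
proof
fix p assume p: "p:S"
obtain V F where V: "open V" "p:V" "smooth V F" "ALL q:V Int S. F q = f q"
 using f p unfolding smooth_on_subset_def by blast
have "continuous (at p) F"
 using smooth_imp_continuous[OF V(1,3)] V(1,2) by(simp add:continuous_on_eq_continuous_at)
hence t: "(F \<longlongrightarrow> F p) (at p within S)"
 using continuous_at_imp_continuous_at_within continuous_within by blast
have ev: "\<forall>\<^sub>F q in at p within S. F q = f q"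
 unfolding eventually_at_topological using V(1,2,4) by blast
have "F p = f p" using V p by blast
thus "continuous (at p within S) f"
 unfolding continuous_within using Lim_transform_eventually[OF t ev] by simp
qed

text \<open>The maximum principle with \<open>M = 0\<close> for the difference.\<close>

lemma MP_unique:
assumes G: "open G" "open Om" and mp: "MP Om G" and h: "h1:CR_functions (G Int Om)" "h2:CR_functions (G Int Om)"
 and s: "smooth_on_subset (G Int closure Om) h1" "smooth_on_subset (G Int closure Om) h2"
 and eq: "!!q. q:G Int frontier Om ==> h1 q = h2 q" and x: "x:G Int closure Om"
shows "h1 x = h2 x"
proof(cases "x:Om")
case True
have "(%q. h1 q - h2 q):CR_functions (G Int Om)" by(rule CR_functions_diff[OF _ h]) (use G in auto)
moreover have "continuous_on (G Int closure Om) (%q. h1 q - h2 q)"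
 by(intro continuous_on_diff smooth_on_subset_continuous s)
moreover have "ALL q:G Int frontier Om. norm (h1 q - h2 q) <= 0" using eq by simp
ultimately have "ALL q:G Int Om. norm (h1 q - h2 q) <= 0"
 using mp unfolding MP_def by(meson order_refl)
thus ?thesis using x True by simp
next
case False
thus ?thesis using x G(2) by(intro eq) (simp add:frontier_def interior_open)
qed

lemma CR_functions_local:
assumes W: "open W" and loc: "!!x. x:W ==> EX G h. open G & x:G & h:CR_functions G & (ALL y:G. h y = f y)"
shows "f:CR_functions W"
proof -
have "smooth W f"
proof(rule smooth_local)
 fix x assume "x:W"
 then obtain G h where G: "open G" "x:G" "h:CR_functions G" "ALL y:G. h y = f y" using loc by blast
 have "smooth G f" by(rule smooth_cong[OF G(1), of h]) (use G in "auto simp: CR_functions_def")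
 thus "EX G. open G & x:G & smooth G f" using G by blast
qed
moreover have "Z x f = 0" if V: "open V" "V <= W" "Z:sections V" "x:V" for V Z x
proof -
 have "x:W" using V by blast
 then obtain G h where G: "open G" "x:G" "h:CR_functions G" "ALL y:G. h y = f y" using loc by blast
 have T: "Z x:T01 x" by(rule sections_T01[OF V(3,4)])
 have "smooth_near x h" by(rule smooth_nearI[OF G(1,2)]) (use G(3) in "simp add: CR_functions_def")
 hence "Z x h = Z x f" by(rule CT_cong_open[OF T01_CT[OF T] _ G(1,2)]) (use G(4) in blast)
 thus ?thesis using CR_functions_T01[OF G(3,1,2) T] by simp
qed
ultimately show ?thesis by(simp add:CR_functions_def)
qed

lemma shrink_nhd:
fixes p :: 'p assumes "open B" "p:B" obtains C where "open C" "p:C" "closure C <= B"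
proof -
obtain V ka ka' where l: "lchart V ka ka'" and pV: "p:V" using lchart_exists by blast
have "open (ka ` (V Int B))" by(rule lchart_image[OF l]) (use lchart_open[OF l] assms in auto)
then obtain e where e: "0 < e" "cball (ka p) e <= ka ` (V Int B)"
 by(metis open_contains_cball pV assms(2) IntI imageI)
have bs: "ball (ka p) e <= ka ` V" "cball (ka p) e <= ka ` V" using e(2) ball_subset_cball by blast+
let ?K = "ka' ` cball (ka p) e"
have "closed ?K"
 by(intro compact_imp_closed compact_continuous_image compact_cball continuous_on_subset[OF lchart_continuous'[OF l] bs(2)])
moreover have "ka' ` ball (ka p) e <= ?K" using ball_subset_cball by blast
ultimately have "closure (ka' ` ball (ka p) e) <= ?K" by(rule closure_minimal[rotated])
moreover have "?K <= B"
proof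
 fix y assume "y:?K"
 then obtain q where "q:V Int B" "y = ka' (ka q)" using e(2) by blast
 thus "y:B" using lchart_inv[OF l] by simp
qed
moreover note lchart_vimage[OF l open_ball bs(1)]
ultimately show ?thesis using pV e(1) by(intro that[of "V Int ka -` ball (ka p) e"]) auto
qed

text \<open>
The solutions on two sets of a cover need not agree on the overlap, which may contain components
not reaching \<open>N\<close>. The sets \<open>Gf q\<close> are therefore chosen, relative to an enumeration \<open>ix\<close> of a
shrunken cover, so that two of them meet only if one lies where both solutions are defined.
\<close>

lemma gluing:
assumes Om: "open Om" and NF: "N <= frontier Om"
 and loc: "!!q W. q:N ==> open W ==> q:W ==>
 EX G. open G & q:G & G <= W & MP Om G & G Int frontier Om <= N & extends_from Om N G"
shows "EX U. open U & N <= U & (ALL f0:CR_functions_sub N. EX! f. f:extensional (U Int closure (U Int Om)) &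
 f:CR_functions (U Int Om) & smooth_on_subset (U Int closure (U Int Om)) f & (ALL p:N. f p = f0 p))"
proof -
define CC where "CC = {C. open C & (EX B. open B & closure C <= B & B Int frontier Om <= N & extends_from Om N B)}"
have "!!C. C:CC ==> open C" by(simp add:CC_def)
then obtain DD where DD: "DD <= CC" "countable DD" "\<Union>DD = \<Union>CC" by(rule Lindelof)
have cov: "EX C:DD. q:C" if q: "q:N" for q
proof -
 obtain B where B: "open B" "q:B" "B Int frontier Om <= N" "extends_from Om N B" using loc[OF q open_UNIV] by blast
 obtain C where "open C" "q:C" "closure C <= B" by(rule shrink_nhd[OF B(1,2)])
 hence "q:\<Union>CC" using B by(auto simp:CC_def)
 thus ?thesis using DD(3) by blast
qed
define ix where "ix = to_nat_on DD"
have ix: "inj_on ix DD" using DD(2) by(simp add:ix_def inj_on_to_nat_on)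
have "ALL C:DD. EX B. open B & closure C <= B & B Int frontier Om <= N & extends_from Om N B"
 using DD(1) by(auto simp:CC_def)
then obtain Bf where Bf: "!!C. C:DD ==> open (Bf C)" "!!C. C:DD ==> closure C <= Bf C"
 "!!C. C:DD ==> Bf C Int frontier Om <= N" "!!C. C:DD ==> extends_from Om N (Bf C)" by metis
have oDD: "open C" if "C:DD" for C using DD(1) that by(auto simp:CC_def)
from cov obtain Cf where Cf: "!!q. q:N ==> Cf q:DD" "!!q. q:N ==> q:Cf q" by metis
\<comment> \<open>Each earlier set \<open>C\<close> is decided: if its closure contains
  \<open>q\<close>, then \<open>H q\<close> stays where the solution for \<open>C\<close> is
  defined, otherwise \<open>H q\<close> avoids that closure. Only finitely many \<open>C\<close>
  precede \<open>Cf q\<close>, which keeps \<open>H q\<close> open.\<close>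
define H where "H q = Cf q Int (INT C:{C:DD. ix C < ix (Cf q)}. if q:closure C then Bf C else - closure C)" for q
have "EX G. open G & q:G & G <= H q & MP Om G & G Int frontier Om <= N" if q: "q:N" for q
proof -
 have "finite {C:DD. ix C < ix (Cf q)}"
 proof(rule inj_on_finite)
 show "inj_on ix {C:DD. ix C < ix (Cf q)}" by(rule inj_on_subset[OF ix]) auto
 show "ix ` {C:DD. ix C < ix (Cf q)} <= {..<ix (Cf q)}" by auto
 qed simp
 hence "open (H q)" unfolding H_def by(intro open_Int open_INT oDD[OF Cf(1)[OF q]] ballI) (auto simp:Bf)
 moreover have "q:H q" using Cf(2)[OF q] Bf(2) by(auto simp:H_def)
 ultimately show ?thesis using loc[OF q] by metis
qed
then obtain Gf where Gf: "!!q. q:N ==> open (Gf q)" "!!q. q:N ==> q:Gf q" "!!q. q:N ==> Gf q <= H q"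
 "!!q. q:N ==> MP Om (Gf q)" "!!q. q:N ==> Gf q Int frontier Om <= N" by metis
define U where "U = (UN q:N. Gf q)"
have oU: "open U" unfolding U_def using Gf(1) by blast
have GU: "Gf q <= U" if "q:N" for q using that by(auto simp:U_def)
have NU: "N <= U" using Gf(2) by(auto simp:U_def)
\<comment> \<open>Replaces the set in the statement by one that localises to each
  \<open>Gf q\<close>.\<close>
have Ucl: "U Int closure (U Int Om) = U Int closure Om"
 using open_Int_closure_subset[OF oU, of Om] closure_mono[of "U Int Om" Om] by blast
have GB: "Gf q <= Bf (Cf q)" if q: "q:N" for q
proof -
 have "Gf q <= Cf q" using Gf(3)[OF q] by(auto simp:H_def)
 thus ?thesis using Bf(2)[OF Cf(1)[OF q]] closure_subset by blast
qed
have "EX! f. f:extensional (U Int closure Om) & f:CR_functions (U Int Om) & smooth_on_subset (U Int closure Om) f & (ALL p:N. f p = f0 p)"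
 if f0: "f0:CR_functions_sub N" for f0
proof -
 have "ALL C:DD. EX F. F:CR_functions (Bf C Int Om) & smooth_on_subset (Bf C Int closure Om) F & (ALL q:Bf C Int N. F q = f0 q)"
 using Bf(4) f0 unfolding extends_from_def by blast
 then obtain F where F: "!!C. C:DD ==> F C:CR_functions (Bf C Int Om)" "!!C. C:DD ==> smooth_on_subset (Bf C Int closure Om) (F C)"
 "!!C q. C:DD ==> q:Bf C Int N ==> F C q = f0 q" by metis
 \<comment> \<open>\<open>Gf q\<close> lies in \<open>Cf q\<close>, so a common point rules out that
   \<open>H q'\<close> avoids \<open>closure (Cf q)\<close>. Hence \<open>Gf q'\<close> lies in
   \<open>Bf (Cf q)\<close>, and the two solutions are compared on all of \<open>Gf q'\<close>,
   where the maximum principle applies.\<close>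
 have le: "F (Cf q) x = F (Cf q') x"
 if q: "q:N" "q':N" and x: "x:Gf q" "x:Gf q'" "x:closure Om" and lt: "ix (Cf q) < ix (Cf q')" for q q' x
 proof -
 have "Cf q:{C:DD. ix C < ix (Cf q')}" using lt Cf(1)[OF q(1)] by simp
 hence Hq: "H q' <= (if q':closure (Cf q) then Bf (Cf q) else - closure (Cf q))" unfolding H_def by(intro le_infI2 INT_lower)
 have "x:closure (Cf q)" using Gf(3)[OF q(1)] x(1) closure_subset by(auto simp:H_def)
 moreover have "x:H q'" using Gf(3)[OF q(2)] x(2) by blast
 ultimately have B1: "Gf q' <= Bf (Cf q)" using Hq Gf(3)[OF q(2)] by(auto split: if_splits)
 note B2 = GB[OF q(2)]
 show ?thesis
 proof(rule MP_unique[OF Gf(1)[OF q(2)] Om Gf(4)[OF q(2)]])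
  show "F (Cf q):CR_functions (Gf q' Int Om)" by(rule CR_functions_subset[OF F(1)[OF Cf(1)[OF q(1)]]]) (use B1 in blast)
  show "F (Cf q'):CR_functions (Gf q' Int Om)" by(rule CR_functions_subset[OF F(1)[OF Cf(1)[OF q(2)]]]) (use B2 in blast)
  show "smooth_on_subset (Gf q' Int closure Om) (F (Cf q))" by(rule smooth_on_subset_subset[OF F(2)[OF Cf(1)[OF q(1)]]]) (use B1 in blast)
  show "smooth_on_subset (Gf q' Int closure Om) (F (Cf q'))" by(rule smooth_on_subset_subset[OF F(2)[OF Cf(1)[OF q(2)]]]) (use B2 in blast)
  show "F (Cf q) y = F (Cf q') y" if "y:Gf q' Int frontier Om" for y
  proof -
  have "y:Bf (Cf q) Int N" "y:Bf (Cf q') Int N" using that Gf(5)[OF q(2)] B1 B2 by blast+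
  thus ?thesis using F(3)[OF Cf(1)[OF q(1)]] F(3)[OF Cf(1)[OF q(2)]] by simp
  qed
  show "x:Gf q' Int closure Om" using x by blast
 qed
 qed
 have consistent: "F (Cf q) x = F (Cf q') x"
 if q: "q:N" "q':N" and x: "x:Gf q" "x:Gf q'" "x:closure Om" for q q' x
 proof(cases "ix (Cf q)" "ix (Cf q')" rule: linorder_cases)
 case less
 thus ?thesis by(rule le[OF q x])
 next
 case equal
 hence "Cf q = Cf q'" by(rule inj_onD[OF ix]) (use Cf q in auto)
 thus ?thesis by simp
 next
 case greater
 thus ?thesis by(rule le[OF q(2,1) x(2,1,3), symmetric])
 qed
 \<comment> \<open>By \<open>consistent\<close> the choice of \<open>q\<close> is immaterial;
   \<open>undefined\<close> elsewhere is the value that \<open>extensional\<close> demands.\<close>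
 define f where "f x = (if x:U Int closure Om then F (Cf (SOME q. q:N & x:Gf q)) x else undefined)" for x
 have f: "f x = F (Cf q) x" if q: "q:N" and x: "x:Gf q" "x:closure Om" for q x
 proof -
 have "q:N & x:Gf q" using q x by blast
 from someI[of "%q. q:N & x:Gf q", OF this]
 have "F (Cf (SOME q. q:N & x:Gf q)) x = F (Cf q) x" using consistent[OF _ q _ x] by blast
 moreover have "x:U" using GU[OF q] x by blast
 ultimately show ?thesis using x by(simp add:f_def)
 qed
 show ?thesis
 proof(rule ex1I[of _ f], intro conjI ballI)
 show "f:extensional (U Int closure Om)" unfolding extensional_def by(simp add:f_def)
 show "f:CR_functions (U Int Om)"
 proof(rule CR_functions_local)
  show "open (U Int Om)" using oU Om by blast
  fix x assume x: "x:U Int Om"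
  then obtain q where q: "q:N" "x:Gf q" unfolding U_def by blast
  have "F (Cf q):CR_functions (Gf q Int Om)" by(rule CR_functions_subset[OF F(1)[OF Cf(1)[OF q(1)]]]) (use GB[OF q(1)] in blast)
  moreover have "ALL y:Gf q Int Om. F (Cf q) y = f y" using f[OF q(1)] closure_subset[of Om] by auto
  moreover have "open (Gf q Int Om)" "x:Gf q Int Om" using Gf(1)[OF q(1)] Om q x by auto
  ultimately show "EX G h. open G & x:G & h:CR_functions G & (ALL y:G. h y = f y)" by blast
 qed
 show "smooth_on_subset (U Int closure Om) f"
  unfolding smooth_on_subset_def
 proof
  fix x assume x: "x:U Int closure Om"
  then obtain q where q: "q:N" "x:Gf q" unfolding U_def by blast
  have "x:Bf (Cf q) Int closure Om" using GB[OF q(1)] q x by blast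
  then obtain V E where V: "open V" "x:V" "smooth V E" "ALL y:V Int (Bf (Cf q) Int closure Om). E y = F (Cf q) y"
  using F(2)[OF Cf(1)[OF q(1)]] unfolding smooth_on_subset_def by blast
  have "E y = f y" if "y:(V Int Gf q) Int (U Int closure Om)" for y
  using V(4) f[OF q(1), of y] GB[OF q(1)] that by auto
  moreover have "open (V Int Gf q)" "x:V Int Gf q" using V(1,2) Gf(1)[OF q(1)] q(2) by auto
  moreover have "smooth (V Int Gf q) E" by(rule smooth_subset[OF V(3)]) simp
  ultimately show "EX V E. open V & x:V & smooth V E & (ALL y:V Int (U Int closure Om). E y = f y)" by blast
 qed
 show "f p = f0 p" if p: "p:N" for p
 proof -
  have "p:closure Om" using NF p by(auto simp:frontier_def)
  hence "f p = F (Cf p) p" by(rule f[OF p Gf(2)[OF p]])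
  also have "... = f0 p" by(rule F(3)[OF Cf(1)[OF p]]) (use GB[OF p] Gf(2)[OF p] p in blast)
  finally show ?thesis .
 qed
 note fCR = `f : CR_functions (U Int Om)` and fs = `smooth_on_subset (U Int closure Om) f` and fe = `f : extensional (U Int closure Om)`
  and f0 = `!!p. p : N ==> f p = f0 p`
 fix g assume g: "g:extensional (U Int closure Om) & g:CR_functions (U Int Om) & smooth_on_subset (U Int closure Om) g & (ALL p:N. g p = f0 p)"
 show "g = f"
 proof(rule extensionalityI[OF conjunct1[OF g] fe])
  fix x assume x: "x:U Int closure Om"
  then obtain q where q: "q:N" "x:Gf q" unfolding U_def by blast
  have sub: "Gf q Int Om <= U Int Om" "Gf q Int closure Om <= U Int closure Om" using GU[OF q(1)] by blast+
  show "g x = f x"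
  proof(rule MP_unique[OF Gf(1)[OF q(1)] Om Gf(4)[OF q(1)] _ CR_functions_subset[OF fCR sub(1)] _ smooth_on_subset_subset[OF fs sub(2)]])
  show "g:CR_functions (Gf q Int Om)" using g CR_functions_subset[OF _ sub(1)] by blast
  show "smooth_on_subset (Gf q Int closure Om) g" using g smooth_on_subset_subset[OF _ sub(2)] by blast
  show "g y = f y" if "y:Gf q Int frontier Om" for y
  proof -
   have "y:N" using that Gf(5)[OF q(1)] by blast
   thus ?thesis using g f0 by simp
  qed
  show "x:Gf q Int closure Om" using q x by blast
  qed
 qed
 qed
qed
thus ?thesis by(intro exI[of _ U] conjI oU NU ballI) (simp only: Ucl)
qed

end

theorem theorem9p2:
  fixes A :: "('p::{t2_space, second_countable_topology} set \<times> ('p \<Rightarrow> 'e::euclidean_space)) set"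
    and T01 :: "'p \<Rightarrow> 'p cvec set" and n :: nat
    and \<Omega> N :: "'p set"
  assumes "cr_manifold A T01 n"
    and "cr_manifold.Psi_we A T01 n 2"
    and "open \<Omega>"
    and "openin (top_of_set (frontier \<Omega>)) N"
    and "\<And>p. p \<in> N \<Longrightarrow> smooth_manifold.smooth_boundary_point A \<Omega> p"
    and "\<And>p. p \<in> N \<Longrightarrow> cr_manifold.strongly_1_convex A T01 \<Omega> p"
    and "\<And>p. p \<in> N \<Longrightarrow> cr_manifold.Theta_noncharacteristic A T01 N p"
    and "\<And>p. p \<in> N \<Longrightarrow> cr_manifold.locally_CR_embeddable A T01 TYPE('x) p"
  shows "\<exists>U. open U \<and> N \<subseteq> U \<and>
    (\<forall>f0 \<in> cr_manifold.CR_functions_sub A T01 N.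
       \<exists>!f. f \<in> extensional (U \<inter> closure (U \<inter> \<Omega>)) \<and>
            f \<in> cr_manifold.CR_functions A T01 (U \<inter> \<Omega>) \<and>
            smooth_manifold.smooth_on_subset A (U \<inter> closure (U \<inter> \<Omega>)) f \<and>
            (\<forall>p\<in>N. f p = f0 p))"
proof -
interpret cr_manifold A T01 n by(rule assms(1))
show ?thesis
proof(rule gluing[OF assms(3)])
 show "N <= frontier \<Omega>" using openin_subset[OF assms(4)] by simp
 fix q W assume q: "q:N" and W: "open W" "q:W"
 obtain G where "open G" "q:G" "G <= W" "MP \<Omega> G" "G Int frontier \<Omega> <= N" "extends_from \<Omega> N G"
 by(rule local_extension[OF assms(2-4) q assms(6-8)[OF q] W])
 thus "EX G. open G & q:G & G <= W & MP \<Omega> G & G Int frontier \<Omega> <= N & extends_from \<Omega> N G" by blast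
qed
qed

end
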